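(* For every positive absolute constant $\mu\in(0,1)$ there exist a deterministic algorithm $\mathcal{T}_{\text{disagreement}}$ and an absolute constant $C$ with the following properties. The algorithm is given a dataset $S$ of points in $\mathbb{R}^d$ of size $N\ge\left(\frac{Cd}{\epsilon\delta}\right)^C$, a unit vector $\mathbf{v}\in\mathbb{R}^d$, and parameters $\epsilon,\delta,\mu\in(0,1)$. It runs in time $\mathrm{poly}\left(\frac{dN}{\epsilon\delta}\right)$ and outputs $\mathsf{Accept}$ or $\mathsf{Reject}$, subject to the following for all $\epsilon,\delta\in(0,1)$: (Completeness) If $S$ consists of $N\ge\left(\frac{Cd}{\epsilon\delta}\right)^C$ i.i.d. samples from the standard Gaussian distribution on $\mathbb{R}^d$, then with probability at least $1-O(\delta)$ the set $S$ is such that for all unit vectors $\mathbf{v}$ the algorithm accepts when given $(S,\mathbf{v},\epsilon,\delta,\mu)$ as input. (Soundness) For any dataset $S$ and unit vector $\mathbf{v}$, if the algorithm accepts, then for every unit vector $\mathbf{v}'\in\mathbb{R}^d$ $$\Pr_{\mathbf{x}\sim S}\left[\mathrm{sign}(\mathbf{x}\cdot\mathbf{v})\ne\mathrm{sign}(\mathbf{x}\cdot\mathbf{v}')\right]=(1\pm\mu)\frac{\measuredangle(\mathbf{v},\mathbf{v}')}{\pi}\pm O(\epsilon).$$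
   Context: $\mathbf{x}\sim S$ means $\mathbf{x}$ is uniform over the finite dataset $S$. $\measuredangle(\mathbf{v},\mathbf{v}')\in[0,\pi]$ is the angle between the vectors. $\mathrm{sign}(t)=1$ if $t\ge0$ and $-1$ otherwise. The notation $a=(1\pm\mu)b\pm c$ means $(1-\mu)b-c\le a\le(1+\mu)b+c$. The degree of the polynomial in the running time and the constants hidden in $O(\cdot)$ may depend on the constant $\mu$. *)

theory Defs
  imports "HOL-Probability.Probability" "HOL-Computational_Algebra.Polynomial"
begin

section \<open>A real RAM\<close>

text \<open>
  Algorithms are programs of a deterministic random access machine over the reals. The machine
  has natural-number registers and two-dimensional real arrays (all initially zero outside the
  input). Real cells support exact addition, subtraction, multiplication, division and comparison
  at unit cost. There is no rounding from reals to naturals, indices can only be added and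
  subtracted (not multiplied), and the only constants are rational; these restrictions keep
  unit-cost arithmetic from hiding superpolynomial work or non-uniform advice.
  One fixed program serves all dimensions and all dataset sizes.
\<close>

datatype iexp =
    IConst nat
  | IReg nat
  | IAdd iexp iexp
  | ISub iexp iexp

datatype rexp =
    RConst rat
  | RIdx iexp
  | RCell nat iexp iexp
  | RAdd rexp rexp
  | RSub rexp rexp
  | RMul rexp rexp
  | RDiv rexp rexp

datatype bexp =
    ILess iexp iexp
  | RLess rexp rexp
  | BNot bexp
  | BAnd bexp bexp

datatype prog =
    Skip
  | ISet nat iexp
  | RSet nat iexp iexp rexp
  | Seq prog prog
  | Cond bexp prog prog
  | While bexp prog

record memory =
  reg :: "nat \<Rightarrow> nat"
  cell :: "nat \<Rightarrow> nat \<Rightarrow> nat \<Rightarrow> real"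

text \<open>Subtraction of naturals is truncated, and division of reals by zero yields zero.\<close>

primrec ival :: "memory \<Rightarrow> iexp \<Rightarrow> nat" where
  "ival s (IConst n) = n"
| "ival s (IReg r) = reg s r"
| "ival s (IAdd a b) = ival s a + ival s b"
| "ival s (ISub a b) = ival s a - ival s b"

primrec rval :: "memory \<Rightarrow> rexp \<Rightarrow> real" where
  "rval s (RConst q) = of_rat q"
| "rval s (RIdx a) = real (ival s a)"
| "rval s (RCell A i j) = cell s A (ival s i) (ival s j)"
| "rval s (RAdd a b) = rval s a + rval s b"
| "rval s (RSub a b) = rval s a - rval s b"
| "rval s (RMul a b) = rval s a * rval s b"
| "rval s (RDiv a b) = rval s a / rval s b"

primrec bval :: "memory \<Rightarrow> bexp \<Rightarrow> bool" where
  "bval s (ILess a b) \<longleftrightarrow> ival s a < ival s b"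
| "bval s (RLess a b) \<longleftrightarrow> rval s a < rval s b"
| "bval s (BNot b) \<longleftrightarrow> \<not> bval s b"
| "bval s (BAnd b c) \<longleftrightarrow> bval s b \<and> bval s c"

text \<open>Evaluating an expression costs one step per node.\<close>

primrec icost :: "iexp \<Rightarrow> nat" where
  "icost (IConst n) = 1"
| "icost (IReg r) = 1"
| "icost (IAdd a b) = 1 + icost a + icost b"
| "icost (ISub a b) = 1 + icost a + icost b"

primrec rcost :: "rexp \<Rightarrow> nat" where
  "rcost (RConst q) = 1"
| "rcost (RIdx a) = 1 + icost a"
| "rcost (RCell A i j) = 1 + icost i + icost j"
| "rcost (RAdd a b) = 1 + rcost a + rcost b"
| "rcost (RSub a b) = 1 + rcost a + rcost b"
| "rcost (RMul a b) = 1 + rcost a + rcost b"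
| "rcost (RDiv a b) = 1 + rcost a + rcost b"

primrec bcost :: "bexp \<Rightarrow> nat" where
  "bcost (ILess a b) = 1 + icost a + icost b"
| "bcost (RLess a b) = 1 + rcost a + rcost b"
| "bcost (BNot b) = 1 + bcost b"
| "bcost (BAnd b c) = 1 + bcost b + bcost c"

definition set_reg :: "nat \<Rightarrow> nat \<Rightarrow> memory \<Rightarrow> memory" where
  "set_reg r n s = s\<lparr>reg := (reg s)(r := n)\<rparr>"

definition set_cell :: "nat \<Rightarrow> nat \<Rightarrow> nat \<Rightarrow> real \<Rightarrow> memory \<Rightarrow> memory" where
  "set_cell A i j x s = s\<lparr>cell := (cell s)(A := (cell s A)(i := (cell s A i)(j := x)))\<rparr>"

text \<open>\<open>exec P s t s'\<close>: started in \<open>s\<close>, the program halts in \<open>s'\<close> after \<open>t\<close> steps.\<close>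

inductive exec :: "prog \<Rightarrow> memory \<Rightarrow> nat \<Rightarrow> memory \<Rightarrow> bool" where
  Skip: "exec Skip s 1 s"
| ISet: "exec (ISet r a) s (1 + icost a) (set_reg r (ival s a) s)"
| RSet: "exec (RSet A i j a) s (1 + icost i + icost j + rcost a)
           (set_cell A (ival s i) (ival s j) (rval s a) s)"
| Seq: "exec P s t s' \<Longrightarrow> exec Q s' u s'' \<Longrightarrow> exec (Seq P Q) s (t + u) s''"
| CondTrue: "bval s b \<Longrightarrow> exec P s t s' \<Longrightarrow> exec (Cond b P Q) s (1 + bcost b + t) s'"
| CondFalse: "\<not> bval s b \<Longrightarrow> exec Q s t s' \<Longrightarrow> exec (Cond b P Q) s (1 + bcost b + t) s'"
| WhileFalse: "\<not> bval s b \<Longrightarrow> exec (While b P) s (1 + bcost b) s"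
| WhileTrue: "bval s b \<Longrightarrow> exec P s t s' \<Longrightarrow> exec (While b P) s' u s'' \<Longrightarrow>
     exec (While b P) s (1 + bcost b + t + u) s''"

inductive_cases SkipE: "exec Skip s t s'"
inductive_cases ISetE: "exec (ISet r a) s t s'"
inductive_cases RSetE: "exec (RSet A i j a) s t s'"
inductive_cases SeqE: "exec (Seq P Q) s t s'"
inductive_cases CondE: "exec (Cond b P Q) s t s'"
inductive_cases WhileE: "exec (While b P) s t s'"

lemma exec_deterministic:
  assumes "exec P s t s'" and "exec P s u s''"
  shows "t = u \<and> s' = s''"
  using assms
proof (induction arbitrary: u s'' rule: exec.induct)
  case (Skip s)
  then show ?case by (auto elim: SkipE)
next
  case (ISet r a s)
  then show ?case by (auto elim: ISetE)
next
  case (RSet A i j a s)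
  then show ?case by (auto elim: RSetE)
next
  case (Seq P s t s' Q v s3)
  from Seq.prems obtain t1 t2 s1 where "u = t1 + t2" "exec P s t1 s1" "exec Q s1 t2 s''"
    by (rule SeqE)
  with Seq.IH show ?case by metis
next
  case (CondTrue s b P t s' Q)
  from CondTrue.prems CondTrue.hyps(1) obtain t1
    where "u = 1 + bcost b + t1" "exec P s t1 s''"
    by (auto elim!: CondE)
  with CondTrue.IH show ?case by metis
next
  case (CondFalse s b Q t s' P)
  from CondFalse.prems CondFalse.hyps(1) obtain t1
    where "u = 1 + bcost b + t1" "exec Q s t1 s''"
    by (auto elim!: CondE)
  with CondFalse.IH show ?case by metis
next
  case (WhileFalse s b P)
  from WhileFalse.prems show ?case
    by (rule WhileE) (use WhileFalse.hyps in simp_all)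
next
  case (WhileTrue s b P t s' v s3)
  have "\<exists>t1 t2 s1. u = 1 + bcost b + t1 + t2 \<and> exec P s t1 s1 \<and> exec (While b P) s1 t2 s''"
    using WhileTrue.prems by (rule WhileE) (use WhileTrue.hyps(1) in auto)
  then obtain t1 t2 s1 where
    "u = 1 + bcost b + t1 + t2" "exec P s t1 s1" "exec (While b P) s1 t2 s''"
    by blast
  with WhileTrue.IH show ?case by metis
qed

section \<open>Vectors and datasets\<close>

text \<open>
  The algorithm is uniform in the dimension, so the dimension has to be a number rather than a
  type. A vector of dimension \<open>d\<close> is a function on the naturals of which only the
  coordinates below \<open>d\<close> are ever used. A dataset of size \<open>N\<close> is an indexed family
  (repetitions allowed) of which only the members below \<open>N\<close> are used.
\<close>

type_synonym vect = "nat \<Rightarrow> real"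
type_synonym dataset = "nat \<Rightarrow> vect"

definition dot :: "nat \<Rightarrow> vect \<Rightarrow> vect \<Rightarrow> real" where
  "dot d x y = (\<Sum>j<d. x j * y j)"

definition unit_vector :: "nat \<Rightarrow> vect \<Rightarrow> bool" where
  "unit_vector d v \<longleftrightarrow> L2_set v {..<d} = 1"

definition angle :: "nat \<Rightarrow> vect \<Rightarrow> vect \<Rightarrow> real" where
  "angle d v w = arccos (dot d v w / (L2_set v {..<d} * L2_set w {..<d}))"

text \<open>The library function \<^const>\<open>sgn\<close> differs from this one at zero.\<close>

definition hsign :: "real \<Rightarrow> real" where
  "hsign t = (if t \<ge> 0 then 1 else -1)"

definition uniform_on_dataset :: "nat \<Rightarrow> dataset \<Rightarrow> vect pmf" where
  "uniform_on_dataset N S = map_pmf S (pmf_of_set {..<N})"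

definition disagreement :: "nat \<Rightarrow> nat \<Rightarrow> dataset \<Rightarrow> vect \<Rightarrow> vect \<Rightarrow> real" where
  "disagreement d N S v w =
     measure_pmf.prob (uniform_on_dataset N S) {x. hsign (dot d x v) \<noteq> hsign (dot d x w)}"

definition std_gaussian :: "nat \<Rightarrow> vect measure" where
  "std_gaussian d = (\<Pi>\<^sub>M j\<in>{..<d}. std_normal_distribution)"

definition gaussian_dataset :: "nat \<Rightarrow> nat \<Rightarrow> dataset measure" where
  "gaussian_dataset d N = (\<Pi>\<^sub>M i\<in>{..<N}. std_gaussian d)"

section \<open>Input and output of a tester\<close>

text \<open>
  Registers 0 and 1 hold the dimension and the size of the dataset. Array 0 holds the dataset,
  row 0 of array 1 the vector, and row 0 of array 2 the three parameters.
\<close>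

definition input_memory ::
    "nat \<Rightarrow> nat \<Rightarrow> dataset \<Rightarrow> vect \<Rightarrow> real \<Rightarrow> real \<Rightarrow> real \<Rightarrow> memory" where
  "input_memory d N S v \<epsilon> \<delta> \<mu> =
     \<lparr>reg = (\<lambda>_. 0)(0 := d, 1 := N),
      cell = (\<lambda>A i j.
        if A = 0 \<and> i < N \<and> j < d then S i j
        else if A = 1 \<and> i = 0 \<and> j < d then v j
        else if A = 2 \<and> i = 0 \<and> j = 0 then \<epsilon>
        else if A = 2 \<and> i = 0 \<and> j = 1 then \<delta>
        else if A = 2 \<and> i = 0 \<and> j = 2 then \<mu>
        else 0)\<rparr>"

datatype verdict = Accept | Reject

definition verdict_of :: "memory \<Rightarrow> verdict" where
  "verdict_of s = (if reg s 0 = 1 then Accept else Reject)"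

definition accepts ::
    "prog \<Rightarrow> nat \<Rightarrow> nat \<Rightarrow> dataset \<Rightarrow> vect \<Rightarrow> real \<Rightarrow> real \<Rightarrow> real \<Rightarrow> bool" where
  "accepts P d N S v \<epsilon> \<delta> \<mu> \<longleftrightarrow>
     (\<exists>t s. exec P (input_memory d N S v \<epsilon> \<delta> \<mu>) t s \<and> verdict_of s = Accept)"

definition halts_within ::
    "prog \<Rightarrow> real \<Rightarrow> nat \<Rightarrow> nat \<Rightarrow> dataset \<Rightarrow> vect \<Rightarrow> real \<Rightarrow> real \<Rightarrow> real \<Rightarrow> bool" where
  "halts_within P T d N S v \<epsilon> \<delta> \<mu> \<longleftrightarrow>
     (\<exists>t s. exec P (input_memory d N S v \<epsilon> \<delta> \<mu>) t s \<and> real t \<le> T)"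

text \<open>
  The set of datasets accepted for all directions is not known in advance to be measurable, so
  ``with probability at least \<open>p\<close>'' asks for a measurable subset of good outcomes of
  probability at least \<open>p\<close>. For a measurable event this is the usual meaning.
\<close>

definition with_prob_at_least :: "'a measure \<Rightarrow> real \<Rightarrow> ('a \<Rightarrow> bool) \<Rightarrow> bool" where
  "with_prob_at_least M p Q \<longleftrightarrow> (\<exists>E\<in>sets M. (\<forall>x\<in>E. Q x) \<and> p \<le> measure M E)"

definition large_enough :: "real \<Rightarrow> nat \<Rightarrow> nat \<Rightarrow> real \<Rightarrow> real \<Rightarrow> bool" where
  "large_enough C d N \<epsilon> \<delta> \<longleftrightarrow> real N \<ge> (C * real d / (\<epsilon> * \<delta>)) powr C"

end

(*
  The tester cuts the line spanned by v into strips of width proportional to epsilon, smoothed to tents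
  that add up to one, and checks that each strip carries about the Gaussian mass and that, within each
  strip, the moments up to a constant degree of the part of x orthogonal to v are nearly Gaussian.

  Soundness: a halfspace sign(x . v') is a threshold on x . u, with u orthogonal to v, and this threshold
  is nearly constant on a strip. Nearly Gaussian moments force the distribution function of x . u on a
  strip to be close to the normal one, because the normal distribution is determined by its moments.
  Comparing with the two-dimensional Gaussian strip by strip bounds the disagreement additively by the
  strip width, plus an error that has to be a small multiple of the angle. For small angles the
  thresholds grow quickly from one strip to the next, and Chebyshev's inequality makes the errors of the
  strips summable with a total proportional to the angle.

  Completeness: for Gaussian data x . v is independent of the orthogonal part, so all checked quantities
  have the right expectations. They concentrate uniformly in v by Hoeffding's inequality for truncated
  data and a union bound over a grid of directions, since they are Lipschitz in v up to a polynomial in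
  the norm of x.
*)
theory Submission
  imports Defs
begin

text \<open>The tester does not know v', so every strip must be tested against all directions u at
  once. It bounds the sum of squares of all entries of the difference of two moment tensors; by
  Cauchy-Schwarz against the tensor power of u, this controls every directional moment. The price is
  paid in completeness, where about d^(2h) entries have to be accurate at once, which polynomially
  many samples allow. The degree comes from a limit argument and has no explicit value, but it
  depends only on the accuracy \<kappa> wanted in a strip, hence only on \<mu>. Dataset and Gaussian
  are never compared directly: both are compared with one Riemann sum \<open>Q c\<close>. Accuracy
  \<kappa> in every strip gives a total error of order \<kappa>, which is useless for a small angle
  \<theta>. There the threshold in the strip at height y is about y / \<theta>, Chebyshev bounds the
  error by a multiple of (\<theta> / y)^2, and the smaller of this and \<kappa>, summed over the
  strips with weight \<eta>, is of order sqrt \<kappa> times \<theta>, up to a multiple of \<eta>.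
  So sqrt \<kappa>, not only \<kappa>, has to be small compared with \<mu>.\<close>

section \<open>The tester as a program\<close>

text \<open>Total correctness together with a running time up to a constant factor. \<open>K\<close>
  is chosen before \<open>z\<close> and \<open>s\<close>, so it depends on the program text only and
  every rule may enlarge it. The ghost parameter \<open>z\<close> carries the input and the loop
  counters.\<close>

definition triple :: "('z \<Rightarrow> memory \<Rightarrow> bool) \<Rightarrow> prog \<Rightarrow> ('z \<Rightarrow> nat) \<Rightarrow> ('z \<Rightarrow> memory \<Rightarrow> bool) \<Rightarrow> bool" where
  "triple P c X Q \<longleftrightarrow> (\<exists>K. \<forall>z s. P z s \<longrightarrow> (\<exists>t s'. exec c s t s' \<and> t \<le> K * X z \<and> Q z s'))"

lemma le_mult_pos: "1 \<le> (x::nat) \<Longrightarrow> a \<le> a * x"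
  by simp

lemma triple_mono:
  assumes "triple P c X Q" "\<And>z s. P' z s \<Longrightarrow> P z s \<and> X z \<le> Y z" "\<And>z s. Q z s \<Longrightarrow> Q' z s"
  shows "triple P' c Y Q'"
proof -
  from assms(1) obtain K where K: "\<And>z s. P z s \<Longrightarrow> (\<exists>t s'. exec c s t s' \<and> t \<le> K * X z \<and> Q z s')"
    unfolding triple_def by blast
  have "\<exists>t s'. exec c s t s' \<and> t \<le> K * Y z \<and> Q' z s'" if "P' z s" for z s
  proof -
    from K assms(2)[OF that] obtain t s' where "exec c s t s'" "t \<le> K * X z" "Q z s'" by blast
    moreover have "K * X z \<le> K * Y z" using assms(2)[OF that] by simp
    ultimately show ?thesis using assms(3) order_trans by blast
  qed
  then show ?thesis unfolding triple_def by blast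
qed

lemma triple_Seq:
  assumes "triple P c X Q" "triple Q c' X R"
  shows "triple P (Seq c c') X R"
proof -
  from assms(1) obtain K where K: "\<And>z s. P z s \<Longrightarrow> (\<exists>t s'. exec c s t s' \<and> t \<le> K * X z \<and> Q z s')"
    unfolding triple_def by blast
  from assms(2) obtain L where L: "\<And>z s. Q z s \<Longrightarrow> (\<exists>t s'. exec c' s t s' \<and> t \<le> L * X z \<and> R z s')"
    unfolding triple_def by blast
  have "\<exists>t s'. exec (Seq c c') s t s' \<and> t \<le> (K + L) * X z \<and> R z s'" if "P z s" for z s
  proof -
    from K[OF that] obtain t s' where 1: "exec c s t s'" "t \<le> K * X z" "Q z s'" by blast
    from L[OF 1(3)] obtain u s'' where 2: "exec c' s' u s''" "u \<le> L * X z" "R z s''" by blast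
    from exec.Seq[OF 1(1) 2(1)] 1(2) 2(2,3) show ?thesis
      by (intro exI[of _ "t + u"] exI[of _ s'']) (auto simp: algebra_simps)
  qed
  then show ?thesis unfolding triple_def by blast
qed

lemma triple_ISet:
  assumes "\<And>z s. P z s \<Longrightarrow> Q z (set_reg r (ival s a) s)" and "\<And>z s. P z s \<Longrightarrow> 1 \<le> X z"
  shows "triple P (ISet r a) X Q"
  unfolding triple_def
proof (rule exI[of _ "1 + icost a"], intro allI impI)
  fix z s assume "P z s"
  with assms have "1 \<le> X z" "Q z (set_reg r (ival s a) s)" by auto
  then show "\<exists>t s'. exec (ISet r a) s t s' \<and> t \<le> (1 + icost a) * X z \<and> Q z s'"
    using exec.ISet le_mult_pos by blast
qed

lemma triple_RSet:
  assumes "\<And>z s. P z s \<Longrightarrow> Q z (set_cell A (ival s i) (ival s j) (rval s a) s)"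
    and "\<And>z s. P z s \<Longrightarrow> 1 \<le> X z"
  shows "triple P (RSet A i j a) X Q"
  unfolding triple_def
proof (rule exI[of _ "1 + icost i + icost j + rcost a"], intro allI impI)
  fix z s assume "P z s"
  with assms have "1 \<le> X z" and Q: "Q z (set_cell A (ival s i) (ival s j) (rval s a) s)" by auto
  then show "\<exists>t s'. exec (RSet A i j a) s t s' \<and> t \<le> (1 + icost i + icost j + rcost a) * X z \<and> Q z s'"
    using exec.RSet Q le_mult_pos by blast
qed

lemma triple_Skip:
  assumes "\<And>z s. P z s \<Longrightarrow> Q z s" and "\<And>z s. P z s \<Longrightarrow> 1 \<le> X z"
  shows "triple P Skip X Q"
  unfolding triple_def using exec.Skip assms by (metis mult_1)

lemma triple_Cond:
  assumes "triple (\<lambda>z s. P z s \<and> bval s b) c X Q" "triple (\<lambda>z s. P z s \<and> \<not> bval s b) c' X Q"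
    and X: "\<And>z s. P z s \<Longrightarrow> 1 \<le> X z"
  shows "triple P (Cond b c c') X Q"
proof -
  from assms(1) obtain K where
    K: "\<And>z s. P z s \<Longrightarrow> bval s b \<Longrightarrow> (\<exists>t s'. exec c s t s' \<and> t \<le> K * X z \<and> Q z s')"
    unfolding triple_def by blast
  from assms(2) obtain L where
    L: "\<And>z s. P z s \<Longrightarrow> \<not> bval s b \<Longrightarrow> (\<exists>t s'. exec c' s t s' \<and> t \<le> L * X z \<and> Q z s')"
    unfolding triple_def by blast
  have "\<exists>t s'. exec (Cond b c c') s t s' \<and> t \<le> (1 + bcost b + K + L) * X z \<and> Q z s'"
    if "P z s" for z s
  proof -
    have *: "1 + bcost b \<le> (1 + bcost b) * X z" using X[OF that] by (rule le_mult_pos)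
    have **: "1 + bcost b + t \<le> (1 + bcost b + K + L) * X z" if "t \<le> K * X z \<or> t \<le> L * X z" for t
      using * that by (auto simp: distrib_right)
    show ?thesis
    proof (cases "bval s b")
      case True
      with K[OF that] obtain t s' where "exec c s t s'" "t \<le> K * X z" "Q z s'" by blast
      with exec.CondTrue[where b = b, OF True] ** show ?thesis by blast
    next
      case False
      with L[OF that] obtain t s' where "exec c' s t s'" "t \<le> L * X z" "Q z s'" by blast
      with exec.CondFalse[where b = b, OF False] ** show ?thesis by blast
    qed
  qed
  then show ?thesis unfolding triple_def by blast
qed

text \<open>The counter \<open>k\<close> is part of the ghost parameter of the body, so the constant
  of the body is the same in all rounds and the rounds add up to a multiple of \<open>n z\<close>.
  \<open>Suc (n z)\<close> also pays for the final failing test, which covers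
  \<open>n z = 0\<close>.\<close>

lemma triple_While:
  assumes body: "triple (\<lambda>(z, k) s. I k z s \<and> k < n z) c (\<lambda>(z, k). X z) (\<lambda>(z, k) s. I (Suc k) z s)"
    and test: "\<And>k z s. I k z s \<Longrightarrow> k \<le> n z \<Longrightarrow> bval s b \<longleftrightarrow> k < n z"
    and X: "\<And>z s. I 0 z s \<Longrightarrow> 1 \<le> X z"
  shows "triple (I 0) (While b c) (\<lambda>z. Suc (n z) * X z) (\<lambda>z. I (n z) z)"
proof -
  from body obtain K where
    K: "\<And>k z s. I k z s \<Longrightarrow> k < n z \<Longrightarrow> (\<exists>t s'. exec c s t s' \<and> t \<le> K * X z \<and> I (Suc k) z s')"
    unfolding triple_def by fastforce
  have *: "\<exists>t s'. exec (While b c) s t s' \<and> t \<le> j * (1 + bcost b + K * X z) + 1 + bcost b \<and> I (n z) z s'"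
    if "I k z s" "k + j = n z" for j k z s
    using that
  proof (induction j arbitrary: k s)
    case 0
    then have "\<not> bval s b" using test[of k z s] by auto
    from exec.WhileFalse[OF this] show ?case using 0 by (intro exI[of _ "1 + bcost b"] exI[of _ s]) auto
  next
    case (Suc j)
    then have b: "bval s b" using test[of k z s] by auto
    from K[of k z s] Suc.prems obtain t s' where 1: "exec c s t s'" "t \<le> K * X z" "I (Suc k) z s'" by auto
    from Suc.IH[OF 1(3)] Suc.prems obtain u s'' where
      2: "exec (While b c) s' u s''" "u \<le> j * (1 + bcost b + K * X z) + 1 + bcost b" "I (n z) z s''"
      by auto
    from exec.WhileTrue[OF b 1(1) 2(1)] 1(2) 2(2,3) show ?case
      by (intro exI[of _ "1 + bcost b + t + u"] exI[of _ s'']) auto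
  qed
  have "\<exists>t s'. exec (While b c) s t s' \<and> t \<le> (1 + bcost b + K) * (Suc (n z) * X z) \<and> I (n z) z s'"
    if I: "I 0 z s" for z s
  proof -
    from *[OF I, of "n z"] obtain t s' where
      1: "exec (While b c) s t s'" "t \<le> n z * (1 + bcost b + K * X z) + 1 + bcost b" "I (n z) z s'"
      by auto
    have "n z * (1 + bcost b + K * X z) + 1 + bcost b \<le> Suc (n z) * (1 + bcost b + K * X z)" by simp
    also have "\<dots> \<le> Suc (n z) * ((1 + bcost b) * X z + K * X z)"
      using le_mult_pos[OF X[OF I], of "1 + bcost b"] by (intro mult_le_mono2 add_right_mono)
    also have "\<dots> = (1 + bcost b + K) * (Suc (n z) * X z)" by (simp add: algebra_simps)
    finally show ?thesis using 1 by (meson order_trans)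
  qed
  then show ?thesis unfolding triple_def by blast
qed

primrec assigned :: "prog \<Rightarrow> nat set" where
  "assigned Skip = {}"
| "assigned (ISet r a) = {r}"
| "assigned (RSet A i j a) = {}"
| "assigned (Seq P Q) = assigned P \<union> assigned Q"
| "assigned (Cond b P Q) = assigned P \<union> assigned Q"
| "assigned (While b P) = assigned P"

lemma exec_unassigned: "exec P s t s' \<Longrightarrow> r \<notin> assigned P \<Longrightarrow> reg s' r = reg s r"
  by (induction rule: exec.induct) (auto simp: set_reg_def set_cell_def)

text \<open>Carries the verdict register through the subprograms whose specifications do not mention
  it.\<close>

lemma triple_frame:
  assumes "triple P c X Q" "r \<notin> assigned c"
  shows "triple (\<lambda>z s. P z s \<and> reg s r = f z) c X (\<lambda>z s. Q z s \<and> reg s r = f z)"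
  using assms(1) exec_unassigned[OF _ assms(2)] unfolding triple_def by metis

definition for_loop :: "nat \<Rightarrow> iexp \<Rightarrow> prog \<Rightarrow> prog" where
  "for_loop r e c = Seq (ISet r (IConst 0))
     (While (ILess (IReg r) e) (Seq c (ISet r (IAdd (IReg r) (IConst 1)))))"

lemma reg_set_reg [simp]: "reg (set_reg r n s) q = (if q = r then n else reg s q)"
  by (simp add: set_reg_def)

lemma cell_set_reg [simp]: "cell (set_reg r n s) = cell s"
  by (simp add: set_reg_def)

lemma reg_set_cell [simp]: "reg (set_cell A i j x s) = reg s"
  by (simp add: set_cell_def)

lemma cell_set_cell [simp]:
  "cell (set_cell A i j x s) B k l = (if B = A \<and> k = i \<and> l = j then x else cell s B k l)"
  by (simp add: set_cell_def)

text \<open>The bound \<open>e\<close> is evaluated again before each round, so the invariant has to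
  fix its value. The invariant must also tolerate any value of the counter register, because the
  increment comes after the body has established \<open>I (Suc k)\<close>.\<close>

lemma triple_for:
  assumes body: "triple (\<lambda>(z, k) s. I k z s \<and> reg s r = k \<and> k < n z) c (\<lambda>(z, k). X z)
      (\<lambda>(z, k) s. I (Suc k) z s \<and> reg s r = k)"
    and bound: "\<And>k z s. I k z s \<Longrightarrow> ival s e = n z"
    and reg: "\<And>k z s q. I k z s \<Longrightarrow> I k z (set_reg r q s)"
    and X: "\<And>z. 1 \<le> X z"
  shows "triple (I 0) (for_loop r e c) (\<lambda>z. Suc (n z) * X z) (\<lambda>z. I (n z) z)"
proof -
  have inc: "triple (\<lambda>(z, k) s. I (Suc k) z s \<and> reg s r = k) (ISet r (IAdd (IReg r) (IConst 1)))
      (\<lambda>(z, k). X z) (\<lambda>(z, k) s. I (Suc k) z s \<and> reg s r = Suc k)"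
    by (rule triple_ISet) (use reg X in auto)
  have step: "triple (\<lambda>(z, k) s. (I k z s \<and> reg s r = k) \<and> k < n z)
      (Seq c (ISet r (IAdd (IReg r) (IConst 1)))) (\<lambda>(z, k). X z)
      (\<lambda>(z, k) s. I (Suc k) z s \<and> reg s r = Suc k)"
    using triple_Seq[OF body inc] by (rule triple_mono) auto
  have w: "triple (\<lambda>z s. I 0 z s \<and> reg s r = 0) (While (ILess (IReg r) e) (Seq c (ISet r (IAdd (IReg r) (IConst 1)))))
      (\<lambda>z. Suc (n z) * X z) (\<lambda>z s. I (n z) z s \<and> reg s r = n z)"
    by (rule triple_While[where I = "\<lambda>k z s. I k z s \<and> reg s r = k", OF step])
      (use bound X in auto)
  have i: "triple (I 0) (ISet r (IConst 0)) (\<lambda>z. Suc (n z) * X z) (\<lambda>z s. I 0 z s \<and> reg s r = 0)"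
  proof (rule triple_ISet)
    fix z s
    show "1 \<le> Suc (n z) * X z" using X[of z] by simp
  qed (use reg in auto)
  show ?thesis unfolding for_loop_def
    by (rule triple_mono[OF triple_Seq[OF i w]]) auto
qed

primrec rpow :: "rexp \<Rightarrow> nat \<Rightarrow> rexp" where
  "rpow x 0 = RConst 1"
| "rpow x (Suc n) = RMul x (rpow x n)"

primrec rsum :: "(nat \<Rightarrow> rexp) \<Rightarrow> nat \<Rightarrow> rexp" where
  "rsum f 0 = RConst 0"
| "rsum f (Suc n) = RAdd (rsum f n) (f n)"

primrec rprod :: "(nat \<Rightarrow> rexp) \<Rightarrow> nat \<Rightarrow> rexp" where
  "rprod f 0 = RConst 1"
| "rprod f (Suc n) = RMul (rprod f n) (f n)"

lemma rval_rpow [simp]: "rval s (rpow x n) = rval s x ^ n"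
  by (induction n) auto

lemma rval_rsum [simp]: "rval s (rsum f n) = (\<Sum>i<n. rval s (f i))"
  by (induction n) auto

lemma rval_rprod [simp]: "rval s (rprod f n) = (\<Prod>i<n. rval s (f i))"
  by (induction n) auto

section \<open>The quantities that the tester checks\<close>

definition tent :: "real \<Rightarrow> real \<Rightarrow> real \<Rightarrow> real" where
  "tent \<eta> t x = max 0 (1 - \<bar>x - t\<bar> / \<eta>)"

text \<open>The index \<open>2 * L + 1\<close> stands for the constant weight.\<close>

definition weight :: "real \<Rightarrow> nat \<Rightarrow> nat \<Rightarrow> real \<Rightarrow> real" where
  "weight \<eta> L i x = (if i < 2 * L + 1 then tent \<eta> ((real i - real L) * \<eta>) x else 1)"

definition half_width :: "nat \<Rightarrow> real \<Rightarrow> nat" where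
  "half_width r \<eta> = nat \<lceil>real r / \<eta>\<rceil>"

text \<open>\<open>rising_two 1 m\<close> is the moment of order \<open>2 * m\<close> of the standard normal distribution, and
  \<open>rising_two n m\<close> is the one of the norm of an \<open>n\<close>-dimensional standard Gaussian.\<close>

definition rising_two :: "real \<Rightarrow> nat \<Rightarrow> real" where
  "rising_two x m = (\<Prod>l<m. x + 2 * real l)"

text \<open>The three kernels are the terms of an expanded square of a difference of moment tensors,
  summed over all degrees up to \<open>2 * h\<close>: empirical with empirical, empirical with
  Gaussian, Gaussian with Gaussian. In the last two only even degrees survive, because odd normal
  moments vanish.\<close>

definition power_kernel :: "nat \<Rightarrow> real \<Rightarrow> real" where
  "power_kernel h x = (\<Sum>q<2 * h + 1. x ^ q)"

definition cross_kernel :: "nat \<Rightarrow> real \<Rightarrow> real" where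
  "cross_kernel h x = (\<Sum>m<h + 1. rising_two 1 m * x ^ m)"

definition gauss_kernel :: "nat \<Rightarrow> real \<Rightarrow> real" where
  "gauss_kernel h x = (\<Sum>m<h + 1. rising_two 1 m * rising_two x m)"

definition mass :: "nat \<Rightarrow> dataset \<Rightarrow> (vect \<Rightarrow> real) \<Rightarrow> real" where
  "mass N S w = (\<Sum>n<N. w (S n)) / real N"

text \<open>A rational stand-in for the normal density, since the machine has no exponential function.\<close>

definition mass_target :: "rat \<Rightarrow> nat \<Rightarrow> real \<Rightarrow> real" where
  "mass_target k M t = of_rat k / (1 + t\<^sup>2 / (2 * real M)) ^ M"

text \<open>The sum, over all monomials of degree at most \<open>2 * h\<close> in the part of \<open>x\<close> orthogonal to \<open>v\<close>, of the
  squared difference between the weighted empirical moment and the Gaussian one (see \<open>moment_defect_eq\<close>).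
  The kernels bring it into a form that takes polynomial time in \<open>d\<close> with an exponent independent of \<open>h\<close>.\<close>

definition moment_defect :: "nat \<Rightarrow> nat \<Rightarrow> nat \<Rightarrow> dataset \<Rightarrow> vect \<Rightarrow> (vect \<Rightarrow> real) \<Rightarrow> real" where
  "moment_defect h d N S v w =
     (\<Sum>n<N. \<Sum>m<N. w (S n) * w (S m) * power_kernel h (dot d (S n) (S m) - dot d (S n) v * dot d (S m) v)) / (real N)\<^sup>2
     - 2 * mass N S w * ((\<Sum>n<N. w (S n) * cross_kernel h (dot d (S n) (S n) - (dot d (S n) v)\<^sup>2)) / real N)
     + (mass N S w)\<^sup>2 * gauss_kernel h (real d - 1)"

text \<open>Constants written into the program; they are chosen from \<mu> alone and are rational
  because the machine has no other constants. \<open>deg\<close> is half of the largest degree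
  tested, \<open>rad\<close> the distance that the strips cover on either side, \<open>width\<close>
  the ratio of the strip width to \<epsilon>.\<close>

record parameters =
  deg :: nat
  expo :: nat
  rad :: nat
  coef :: rat
  mass_tol :: rat
  defect_tol :: rat
  width :: rat

definition mass_ok :: "parameters \<Rightarrow> nat \<Rightarrow> nat \<Rightarrow> dataset \<Rightarrow> vect \<Rightarrow> real \<Rightarrow> nat \<Rightarrow> bool" where
  "mass_ok q d N S v \<epsilon> i \<longleftrightarrow> (let \<eta> = \<epsilon> * of_rat (width q); L = half_width (rad q) \<eta> in
     \<bar>mass N S (\<lambda>x. weight \<eta> L i (dot d x v)) - \<eta> * mass_target (coef q) (expo q) ((real i - real L) * \<eta>)\<bar>
       \<le> of_rat (mass_tol q) * \<eta>)"

text \<open>A strip has mass of order \<eta>, so its moments have to be accurate up to a small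
  multiple of \<eta>. The defect is a sum of squares of such errors, hence the tolerance quadratic
  in \<eta>.\<close>

definition defect_ok :: "parameters \<Rightarrow> nat \<Rightarrow> nat \<Rightarrow> dataset \<Rightarrow> vect \<Rightarrow> real \<Rightarrow> nat \<Rightarrow> bool" where
  "defect_ok q d N S v \<epsilon> i \<longleftrightarrow> (let \<eta> = \<epsilon> * of_rat (width q); L = half_width (rad q) \<eta> in
     moment_defect (deg q) d N S v (\<lambda>x. weight \<eta> L i (dot d x v)) \<le> of_rat (defect_tol q) * \<eta>\<^sup>2)"

text \<open>The last index carries the constant weight, so there is no mass to test. Its moment test
  bounds the second moment of the orthogonal part over the whole dataset, which is needed for the
  points beyond the last strip.\<close>

definition passes :: "parameters \<Rightarrow> nat \<Rightarrow> nat \<Rightarrow> dataset \<Rightarrow> vect \<Rightarrow> real \<Rightarrow> nat \<Rightarrow> bool" where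
  "passes q d N S v \<epsilon> i \<longleftrightarrow> defect_ok q d N S v \<epsilon> i \<and>
     (i < 2 * half_width (rad q) (\<epsilon> * of_rat (width q)) + 1 \<longrightarrow> mass_ok q d N S v \<epsilon> i)"

section \<open>The text of the program\<close>

abbreviation var :: "nat \<Rightarrow> rexp" where
  "var A \<equiv> RCell A (IConst 0) (IConst 0)"

abbreviation set_var :: "nat \<Rightarrow> rexp \<Rightarrow> prog" where
  "set_var A \<equiv> RSet A (IConst 0) (IConst 0)"

abbreviation entry :: "nat \<Rightarrow> nat \<Rightarrow> rexp" where
  "entry A r \<equiv> RCell A (IConst 0) (IReg r)"

abbreviation set_entry :: "nat \<Rightarrow> nat \<Rightarrow> rexp \<Rightarrow> prog" where
  "set_entry A r \<equiv> RSet A (IConst 0) (IReg r)"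

abbreviation strip_total :: iexp where
  "strip_total \<equiv> IAdd (IAdd (IReg 2) (IReg 2)) (IConst 1)"

text \<open>Registers: 2 holds \<open>L\<close>, 3 the strip, 4 and 5 points, 6 a coordinate, 7 the verdict. Arrays: 3 holds
  the width, 4 the centre of the strip, 5 the total weight, 6 and 7 the two sums of the defect, 8 an inner
  product, 9 the projections on \<open>v\<close>, 10 the weights.\<close>

definition prog_projections :: prog where
  "prog_projections = for_loop 4 (IReg 1) (Seq (set_entry 9 4 (RConst 0)) (for_loop 6 (IReg 0)
     (set_entry 9 4 (RAdd (entry 9 4) (RMul (RCell 0 (IReg 4) (IReg 6)) (entry 1 6))))))"

definition prog_weight :: prog where
  "prog_weight = (let u = RDiv (RSub (entry 9 4) (var 4)) (var 3) in
     Cond (ILess (IReg 3) strip_total)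
       (Seq (set_entry 10 4 (RAdd (RConst 1) u))
       (Seq (Cond (RLess (RSub (RConst 1) u) (entry 10 4)) (set_entry 10 4 (RSub (RConst 1) u)) Skip)
            (Cond (RLess (entry 10 4) (RConst 0)) (set_entry 10 4 (RConst 0)) Skip)))
       (set_entry 10 4 (RConst 1)))"

definition prog_weights :: prog where
  "prog_weights = Seq (set_var 4 (RMul (RSub (RIdx (IReg 3)) (RIdx (IReg 2))) (var 3)))
     (Seq (set_var 5 (RConst 0))
       (for_loop 4 (IReg 1) (Seq prog_weight (set_var 5 (RAdd (var 5) (entry 10 4))))))"

definition prog_inner :: prog where
  "prog_inner = Seq (set_var 8 (RSub (RConst 0) (RMul (entry 9 4) (entry 9 5))))
     (for_loop 6 (IReg 0) (set_var 8 (RAdd (var 8) (RMul (RCell 0 (IReg 4) (IReg 6)) (RCell 0 (IReg 5) (IReg 6))))))"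

definition prog_pairs :: "nat \<Rightarrow> prog" where
  "prog_pairs h = Seq (set_var 6 (RConst 0)) (for_loop 4 (IReg 1) (for_loop 5 (IReg 1) (Seq prog_inner
     (set_var 6 (RAdd (var 6) (RMul (RMul (entry 10 4) (entry 10 5)) (rsum (rpow (var 8)) (2 * h + 1))))))))"

definition rising_exp :: "rexp \<Rightarrow> nat \<Rightarrow> rexp" where
  "rising_exp x m = rprod (\<lambda>l. RAdd x (RConst (2 * of_nat l))) m"

definition prog_cross :: "nat \<Rightarrow> prog" where
  "prog_cross h = Seq (set_var 7 (RConst 0)) (for_loop 4 (IReg 1) (Seq (ISet 5 (IReg 4)) (Seq prog_inner
     (set_var 7 (RAdd (var 7) (RMul (entry 10 4)
       (rsum (\<lambda>m. RMul (rising_exp (RConst 1) m) (rpow (var 8) m)) (h + 1))))))))"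

definition mass_exp :: rexp where
  "mass_exp = RDiv (var 5) (RIdx (IReg 1))"

definition defect_exp :: "nat \<Rightarrow> rexp" where
  "defect_exp h = RAdd (RSub (RDiv (var 6) (rpow (RIdx (IReg 1)) 2))
       (RMul (RMul (RConst 2) mass_exp) (RDiv (var 7) (RIdx (IReg 1)))))
     (RMul (rpow mass_exp 2)
       (rsum (\<lambda>m. RMul (rising_exp (RConst 1) m) (rising_exp (RSub (RIdx (IReg 0)) (RConst 1)) m)) (h + 1)))"

definition target_exp :: "rat \<Rightarrow> nat \<Rightarrow> rexp" where
  "target_exp k M = RDiv (RConst k) (rpow (RAdd (RConst 1) (RDiv (rpow (var 4) 2) (RConst (2 * of_nat M)))) M)"

text \<open>Boolean expressions have neither disjunction nor absolute value, so the violation of a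
  two-sided bound is spelled out by De Morgan. A failed test clears register 7, and a passed one
  leaves it alone, so the register holds the conjunction of all tests.\<close>

definition prog_verdict :: "parameters \<Rightarrow> prog" where
  "prog_verdict q = (let z = RSub mass_exp (RMul (var 3) (target_exp (coef q) (expo q)));
       k = RMul (RConst (mass_tol q)) (var 3) in
     Seq (Cond (RLess (RMul (RConst (defect_tol q)) (rpow (var 3) 2)) (defect_exp (deg q))) (ISet 7 (IConst 0)) Skip)
         (Cond (BAnd (ILess (IReg 3) strip_total) (BNot (BAnd (BNot (RLess k z)) (BNot (RLess k (RSub (RConst 0) z))))))
           (ISet 7 (IConst 0)) Skip))"

text \<open>The machine cannot round, so the while loop finds \<open>half_width\<close> by counting:
  register 2, which is zero in the input, is raised until its product with the strip width reaches
  \<open>rad q\<close>. The projections on the given vector are computed once and serve all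
  strips.\<close>

definition tester :: "parameters \<Rightarrow> prog" where
  "tester q = Seq (Seq (set_var 3 (RMul (var 2) (RConst (width q))))
     (While (RLess (RMul (RIdx (IReg 2)) (var 3)) (RConst (of_nat (rad q)))) (ISet 2 (IAdd (IReg 2) (IConst 1)))))
     (Seq prog_projections
     (Seq (ISet 7 (IConst 1))
     (Seq (for_loop 3 (IAdd strip_total (IConst 1))
        (Seq prog_weights (Seq (prog_pairs (deg q)) (Seq (prog_cross (deg q)) (prog_verdict q)))))
     (ISet 0 (IReg 7)))))"

section \<open>Correctness and running time of the program\<close>

record input =
  dim :: nat
  num :: nat
  pts :: dataset
  dir :: vect
  eps :: real

definition input_ok :: "input \<Rightarrow> memory \<Rightarrow> bool" where
  "input_ok z s \<longleftrightarrow> reg s 0 = dim z \<and> reg s 1 = num z \<and> 0 < eps z \<and>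
     (\<forall>n<num z. \<forall>j<dim z. cell s 0 n j = pts z n j) \<and> (\<forall>j<dim z. cell s (Suc 0) 0 j = dir z j) \<and>
     cell s 2 0 0 = eps z"

abbreviation proj :: "input \<Rightarrow> nat \<Rightarrow> real" where
  "proj z n \<equiv> dot (dim z) (pts z n) (dir z)"

definition projected :: "real \<Rightarrow> nat \<Rightarrow> input \<Rightarrow> memory \<Rightarrow> bool" where
  "projected \<eta> L z s \<longleftrightarrow> input_ok z s \<and> cell s 3 0 0 = \<eta> \<and> reg s 2 = L \<and>
     (\<forall>n<num z. cell s 9 0 n = proj z n)"

lemma dot_Suc: "dot (Suc d) x y = dot d x y + x d * y d"
  by (simp add: dot_def)

text \<open>Stated for an arbitrary precondition that survives writing the two places used here, so
  that it serves both the double loop over pairs and the single loop over points. The subtracted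
  product turns the inner product into that of the orthogonal parts.\<close>

lemma triple_inner:
  fixes \<zeta> :: "'z \<Rightarrow> input"
  assumes P: "\<And>z s. P z s \<Longrightarrow> projected (\<eta> z) (L z) (\<zeta> z) s \<and> reg s 4 = a z \<and> reg s 5 = b z \<and>
      a z < num (\<zeta> z) \<and> b z < num (\<zeta> z)"
    and P1: "\<And>z s q. P z s \<Longrightarrow> P z (set_reg 6 q s)"
    and P2: "\<And>z s x. P z s \<Longrightarrow> P z (set_cell 8 0 0 x s)"
  shows "triple P prog_inner (\<lambda>z. Suc (dim (\<zeta> z)))
    (\<lambda>z s. P z s \<and> cell s 8 0 0 = dot (dim (\<zeta> z)) (pts (\<zeta> z) (a z)) (pts (\<zeta> z) (b z))
       - proj (\<zeta> z) (a z) * proj (\<zeta> z) (b z))"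
proof -
  define I where "I k z s \<longleftrightarrow> P z s \<and> cell s 8 0 0 = dot k (pts (\<zeta> z) (a z)) (pts (\<zeta> z) (b z))
       - proj (\<zeta> z) (a z) * proj (\<zeta> z) (b z)" for k z s
  have 1: "triple P (set_var 8 (RSub (RConst 0) (RMul (entry 9 4) (entry 9 5)))) (\<lambda>z. Suc (dim (\<zeta> z))) (I 0)"
    by (rule triple_RSet) (use P P2 in \<open>auto simp: I_def projected_def dot_def\<close>)
  have 2: "triple (I 0) (for_loop 6 (IReg 0) (set_var 8 (RAdd (var 8) (RMul (RCell 0 (IReg 4) (IReg 6)) (RCell 0 (IReg 5) (IReg 6))))))
     (\<lambda>z. Suc (dim (\<zeta> z)) * 1) (\<lambda>z. I (dim (\<zeta> z)) z)"
  proof (rule triple_for[where I = I])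
    show "triple (\<lambda>(z, k) s. I k z s \<and> reg s 6 = k \<and> k < dim (\<zeta> z))
       (set_var 8 (RAdd (var 8) (RMul (RCell 0 (IReg 4) (IReg 6)) (RCell 0 (IReg 5) (IReg 6)))))
       (\<lambda>(z, k). 1) (\<lambda>(z, k) s. I (Suc k) z s \<and> reg s 6 = k)"
      by (rule triple_RSet) (use P P2 in \<open>auto simp: I_def projected_def input_ok_def dot_Suc split: prod.splits\<close>)
  qed (use P P1 in \<open>auto simp: I_def projected_def input_ok_def\<close>)
  show ?thesis unfolding prog_inner_def 
    by (rule triple_mono[OF triple_Seq[OF 1 2[simplified]]]) (auto simp: I_def)
qed

lemma triple_projections:
  "triple (\<lambda>z s. input_ok z s \<and> cell s 3 0 0 = \<eta> z \<and> reg s 2 = L z) prog_projections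
     (\<lambda>z. Suc (num z) * Suc (dim z)) (\<lambda>z. projected (\<eta> z) (L z) z)"
proof -
  define B where "B z s \<longleftrightarrow> input_ok z s \<and> cell s 3 0 0 = \<eta> z \<and> reg s 2 = L z" for z s
  define I where "I n z s \<longleftrightarrow> B z s \<and> (\<forall>k<n. cell s 9 0 k = proj z k)" for n z s
  define J where "J j = (\<lambda>(z, n) s. I n z s \<and> reg s 4 = n \<and> n < num z \<and> cell s 9 0 n = dot j (pts z n) (dir z))" for j
  have "triple (I 0) prog_projections (\<lambda>z. Suc (num z) * Suc (dim z)) (\<lambda>z. I (num z) z)"
    unfolding prog_projections_def
  proof (rule triple_for[where I = I])
    have 1: "triple (\<lambda>(z, k) s. I k z s \<and> reg s 4 = k \<and> k < num z) (set_entry 9 4 (RConst 0))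
       (\<lambda>(z, k). Suc (dim z)) (J 0)"
      by (rule triple_RSet) (auto simp: J_def I_def B_def input_ok_def dot_def split: prod.splits)
    have 2: "triple (J 0) (for_loop 6 (IReg 0)
        (set_entry 9 4 (RAdd (entry 9 4) (RMul (RCell 0 (IReg 4) (IReg 6)) (entry 1 6)))))
        (\<lambda>(z, k). Suc (dim z)) (\<lambda>(z, k). J (dim z) (z, k))"
    proof (rule triple_mono[OF triple_for[where I = J and n = "\<lambda>(z, k). dim z" and X = "\<lambda>_. 1"]])
      show "triple (\<lambda>(z, k) s. J k z s \<and> reg s 6 = k \<and> k < (case z of (z, k) \<Rightarrow> dim z))
         (set_entry 9 4 (RAdd (entry 9 4) (RMul (RCell 0 (IReg 4) (IReg 6)) (entry 1 6))))
         (\<lambda>(z, k). 1) (\<lambda>(z, k) s. J (Suc k) z s \<and> reg s 6 = k)"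
        by (rule triple_RSet) (auto simp: J_def I_def B_def input_ok_def dot_Suc split: prod.splits)
    qed (auto simp: J_def I_def B_def input_ok_def split: prod.splits)
    show "triple (\<lambda>(z, k) s. I k z s \<and> reg s 4 = k \<and> k < num z)
       (Seq (set_entry 9 4 (RConst 0)) (for_loop 6 (IReg 0)
        (set_entry 9 4 (RAdd (entry 9 4) (RMul (RCell 0 (IReg 4) (IReg 6)) (entry 1 6))))))
       (\<lambda>(z, k). Suc (dim z)) (\<lambda>(z, k) s. I (Suc k) z s \<and> reg s 4 = k)"
      using triple_Seq[OF 1 2] by (rule triple_mono) (auto simp: J_def I_def less_Suc_eq split: prod.splits)
  qed (auto simp: I_def B_def input_ok_def)
  then show ?thesis by (rule triple_mono) (auto simp: I_def B_def projected_def)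
qed

definition weighted :: "real \<Rightarrow> nat \<Rightarrow> nat \<Rightarrow> input \<Rightarrow> memory \<Rightarrow> bool" where
  "weighted \<eta> L i z s \<longleftrightarrow> projected \<eta> L z s \<and> 0 < \<eta> \<and> reg s 3 = i \<and> cell s 4 0 0 = (real i - real L) * \<eta> \<and>
     (\<forall>n<num z. cell s 10 0 n = weight \<eta> L i (proj z n)) \<and>
     cell s 5 0 0 = (\<Sum>n<num z. weight \<eta> L i (proj z n))"

text \<open>The minimum and the maximum are what the two conditionals of \<open>prog_weight\<close>
  compute.\<close>

lemma tent_eq:
  "0 < \<eta> \<Longrightarrow> tent \<eta> t x = max 0 (min (1 + (x - t) / \<eta>) (1 - (x - t) / \<eta>))"
  by (auto simp: tent_def abs_if max_def min_def field_simps)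

lemma triple_weights:
  fixes \<zeta> :: "'z \<Rightarrow> input"
  shows "triple (\<lambda>z s. projected (\<eta> z) (L z) (\<zeta> z) s \<and> 0 < \<eta> z \<and> reg s 3 = i z) prog_weights
     (\<lambda>z. Suc (num (\<zeta> z))) (\<lambda>z. weighted (\<eta> z) (L z) (i z) (\<zeta> z))"
proof -
  define B where "B z s \<longleftrightarrow> projected (\<eta> z) (L z) (\<zeta> z) s \<and> 0 < \<eta> z \<and> reg s 3 = i z \<and>
     cell s 4 0 0 = (real (i z) - real (L z)) * \<eta> z" for z s
  define W where "W z n = weight (\<eta> z) (L z) (i z) (proj (\<zeta> z) n)" for z n
  define I where "I n z s \<longleftrightarrow> B z s \<and> (\<forall>k<n. cell s 10 0 k = W z k) \<and> cell s 5 0 0 = (\<Sum>k<n. W z k)" for n z s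
  define u where "u = RDiv (RSub (entry 9 4) (var 4)) (var 3)"
  define U where "U = (\<lambda>(z, n). (proj (\<zeta> z) n - (real (i z) - real (L z)) * \<eta> z) / \<eta> z)"
  define J where "J x = (\<lambda>(z, n) s. I n z s \<and> reg s 4 = n \<and> n < num (\<zeta> z) \<and> i z < 2 * L z + 1 \<and> cell s 10 0 n = x (z, n))" for x
  have u: "rval s u = U zn" if "J x zn s" for x zn s
    using that by (auto simp: u_def U_def J_def I_def B_def projected_def split: prod.splits)
  have u': "rval s u = U (z, n)" if "I n z s" "reg s 4 = n" "n < num (\<zeta> z)" for z n s
    using that by (auto simp: u_def U_def I_def B_def projected_def)
  have J: "J x zn s \<Longrightarrow> reg s 4 = snd zn \<and> cell s 10 0 (snd zn) = x zn" for x zn s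
    by (auto simp: J_def)
  have set: "J y zn (set_cell 10 0 (snd zn) (y zn) s)" if "J x zn s" for x y zn s
    using that by (auto simp: J_def I_def B_def projected_def input_ok_def split: prod.splits)
  have W: "max 0 (min (1 + U (z, n)) (1 - U (z, n))) = W z n" if "0 < \<eta> z" "i z < 2 * L z + 1" for z n
    using that by (simp add: W_def weight_def tent_eq U_def)
  have t1: "triple (\<lambda>(z, n) s. I n z s \<and> reg s 4 = n \<and> n < num (\<zeta> z) \<and> i z < 2 * L z + 1)
      (set_entry 10 4 (RAdd (RConst 1) u)) (\<lambda>_. 1) (J (\<lambda>zn. 1 + U zn))"
    by (rule triple_RSet)
      (use u' in \<open>auto simp: J_def I_def B_def projected_def input_ok_def split: prod.splits\<close>)
  have t2: "triple (J (\<lambda>zn. 1 + U zn)) (Cond (RLess (RSub (RConst 1) u) (entry 10 4)) (set_entry 10 4 (RSub (RConst 1) u)) Skip)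
      (\<lambda>_. 1) (J (\<lambda>zn. min (1 + U zn) (1 - U zn)))"
  proof (rule triple_Cond)
    show "triple (\<lambda>z s. J (\<lambda>zn. 1 + U zn) z s \<and> bval s (RLess (RSub (RConst 1) u) (entry 10 4)))
        (set_entry 10 4 (RSub (RConst 1) u)) (\<lambda>_. 1) (J (\<lambda>zn. min (1 + U zn) (1 - U zn)))"
    proof (rule triple_RSet)
      fix zn s assume A: "J (\<lambda>zn. 1 + U zn) zn s \<and> bval s (RLess (RSub (RConst 1) u) (entry 10 4))"
      then have "min (1 + U zn) (1 - U zn) = 1 - U zn" using u[of _ zn s] J[of _ zn s] by auto
      with A set[of _ zn s "\<lambda>zn. min (1 + U zn) (1 - U zn)"] u[of _ zn s] J[of _ zn s]
      show "J (\<lambda>zn. min (1 + U zn) (1 - U zn)) zn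
         (set_cell 10 (ival s (IConst 0)) (ival s (IReg 4)) (rval s (RSub (RConst 1) u)) s)" by auto
    qed auto
    show "triple (\<lambda>z s. J (\<lambda>zn. 1 + U zn) z s \<and> \<not> bval s (RLess (RSub (RConst 1) u) (entry 10 4)))
        Skip (\<lambda>_. 1) (J (\<lambda>zn. min (1 + U zn) (1 - U zn)))"
    proof (rule triple_Skip)
      fix zn s assume A: "J (\<lambda>zn. 1 + U zn) zn s \<and> \<not> bval s (RLess (RSub (RConst 1) u) (entry 10 4))"
      then have "min (1 + U zn) (1 - U zn) = 1 + U zn" using u[of _ zn s] J[of _ zn s] by auto
      with A show "J (\<lambda>zn. min (1 + U zn) (1 - U zn)) zn s" by (auto simp: J_def)
    qed auto
  qed auto
  have t3: "triple (J (\<lambda>zn. min (1 + U zn) (1 - U zn))) (Cond (RLess (entry 10 4) (RConst 0)) (set_entry 10 4 (RConst 0)) Skip)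
      (\<lambda>_. 1) (J (\<lambda>zn. max 0 (min (1 + U zn) (1 - U zn))))"
  proof (rule triple_Cond)
    show "triple (\<lambda>z s. J (\<lambda>zn. min (1 + U zn) (1 - U zn)) z s \<and> bval s (RLess (entry 10 4) (RConst 0)))
        (set_entry 10 4 (RConst 0)) (\<lambda>_. 1) (J (\<lambda>zn. max 0 (min (1 + U zn) (1 - U zn))))"
    proof (rule triple_RSet)
      fix zn s assume A: "J (\<lambda>zn. min (1 + U zn) (1 - U zn)) zn s \<and> bval s (RLess (entry 10 4) (RConst 0))"
      then have "max 0 (min (1 + U zn) (1 - U zn)) = 0" using J[of _ zn s] by auto
      with A set[of _ zn s "\<lambda>zn. max 0 (min (1 + U zn) (1 - U zn))"] J[of _ zn s]
      show "J (\<lambda>zn. max 0 (min (1 + U zn) (1 - U zn))) zn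
         (set_cell 10 (ival s (IConst 0)) (ival s (IReg 4)) (rval s (RConst 0)) s)" by auto
    qed auto
    show "triple (\<lambda>z s. J (\<lambda>zn. min (1 + U zn) (1 - U zn)) z s \<and> \<not> bval s (RLess (entry 10 4) (RConst 0)))
        Skip (\<lambda>_. 1) (J (\<lambda>zn. max 0 (min (1 + U zn) (1 - U zn))))"
    proof (rule triple_Skip)
      fix zn s assume A: "J (\<lambda>zn. min (1 + U zn) (1 - U zn)) zn s \<and> \<not> bval s (RLess (entry 10 4) (RConst 0))"
      then have "max 0 (min (1 + U zn) (1 - U zn)) = min (1 + U zn) (1 - U zn)" using J[of _ zn s] by auto
      with A show "J (\<lambda>zn. max 0 (min (1 + U zn) (1 - U zn))) zn s" by (auto simp: J_def)
    qed auto
  qed auto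
  have w: "triple (\<lambda>(z, n) s. I n z s \<and> reg s 4 = n \<and> n < num (\<zeta> z)) prog_weight (\<lambda>_. 1)
      (\<lambda>(z, n) s. I n z s \<and> reg s 4 = n \<and> n < num (\<zeta> z) \<and> cell s 10 0 n = W z n)"
    unfolding prog_weight_def Let_def u_def[symmetric]
  proof (rule triple_Cond)
    show "triple (\<lambda>zn s. (case zn of (z, n) \<Rightarrow> \<lambda>s. I n z s \<and> reg s 4 = n \<and> n < num (\<zeta> z)) s \<and> bval s (ILess (IReg 3) strip_total))
      (Seq (set_entry 10 4 (RAdd (RConst 1) u)) (Seq (Cond (RLess (RSub (RConst 1) u) (entry 10 4)) (set_entry 10 4 (RSub (RConst 1) u)) Skip)
            (Cond (RLess (entry 10 4) (RConst 0)) (set_entry 10 4 (RConst 0)) Skip))) (\<lambda>_. 1)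
      (\<lambda>(z, n) s. I n z s \<and> reg s 4 = n \<and> n < num (\<zeta> z) \<and> cell s 10 0 n = W z n)"
      by (rule triple_mono[OF triple_Seq[OF t1 triple_Seq[OF t2 t3]]])
        (auto simp: J_def I_def B_def projected_def W split: prod.splits)
    show "triple (\<lambda>zn s. (case zn of (z, n) \<Rightarrow> \<lambda>s. I n z s \<and> reg s 4 = n \<and> n < num (\<zeta> z)) s \<and> \<not> bval s (ILess (IReg 3) strip_total))
      (set_entry 10 4 (RConst 1)) (\<lambda>_. 1)
      (\<lambda>(z, n) s. I n z s \<and> reg s 4 = n \<and> n < num (\<zeta> z) \<and> cell s 10 0 n = W z n)"
      by (rule triple_RSet)
        (auto simp: I_def B_def projected_def input_ok_def W_def weight_def split: prod.splits)
  qed auto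
  have a: "triple (\<lambda>(z, n) s. I n z s \<and> reg s 4 = n \<and> n < num (\<zeta> z) \<and> cell s 10 0 n = W z n)
      (set_var 5 (RAdd (var 5) (entry 10 4))) (\<lambda>_. 1) (\<lambda>(z, n) s. I (Suc n) z s \<and> reg s 4 = n)"
    by (rule triple_RSet)
      (auto simp: I_def B_def projected_def input_ok_def less_Suc_eq split: prod.splits)
  have l: "triple (I 0) (for_loop 4 (IReg 1) (Seq prog_weight (set_var 5 (RAdd (var 5) (entry 10 4)))))
     (\<lambda>z. Suc (num (\<zeta> z)) * 1) (\<lambda>z. I (num (\<zeta> z)) z)"
    by (rule triple_for[where I = I], rule triple_mono[OF triple_Seq[OF w a]])
      (auto simp: I_def B_def projected_def input_ok_def split: prod.splits)
  have 1: "triple (\<lambda>z s. projected (\<eta> z) (L z) (\<zeta> z) s \<and> 0 < \<eta> z \<and> reg s 3 = i z)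
      (set_var 4 (RMul (RSub (RIdx (IReg 3)) (RIdx (IReg 2))) (var 3))) (\<lambda>z. Suc (num (\<zeta> z)) * 1) B"
    by (rule triple_RSet) (auto simp: B_def projected_def input_ok_def)
  have 2: "triple B (set_var 5 (RConst 0)) (\<lambda>z. Suc (num (\<zeta> z)) * 1) (I 0)"
    by (rule triple_RSet) (auto simp: I_def B_def projected_def input_ok_def)
  show ?thesis unfolding prog_weights_def
    by (rule triple_mono[OF triple_Seq[OF 1 triple_Seq[OF 2 l]]])
      (auto simp: I_def B_def weighted_def W_def)
qed

lemma triple_pairs:
  fixes \<zeta> :: "'z \<Rightarrow> input"
  shows "triple (\<lambda>z. weighted (\<eta> z) (L z) (i z) (\<zeta> z)) (prog_pairs h) (\<lambda>z. Suc (num (\<zeta> z)) * (Suc (num (\<zeta> z)) * Suc (dim (\<zeta> z))))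
     (\<lambda>z s. weighted (\<eta> z) (L z) (i z) (\<zeta> z) s \<and>
       cell s 6 0 0 = (\<Sum>n<num (\<zeta> z). \<Sum>m<num (\<zeta> z). weight (\<eta> z) (L z) (i z) (proj (\<zeta> z) n) * weight (\<eta> z) (L z) (i z) (proj (\<zeta> z) m)
         * power_kernel h (dot (dim (\<zeta> z)) (pts (\<zeta> z) n) (pts (\<zeta> z) m) - proj (\<zeta> z) n * proj (\<zeta> z) m)))"
proof -
  define G where "G z n m = weight (\<eta> z) (L z) (i z) (proj (\<zeta> z) n) * weight (\<eta> z) (L z) (i z) (proj (\<zeta> z) m)
         * power_kernel h (dot (dim (\<zeta> z)) (pts (\<zeta> z) n) (pts (\<zeta> z) m) - proj (\<zeta> z) n * proj (\<zeta> z) m)" for z n m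
  define I where "I n z s \<longleftrightarrow> weighted (\<eta> z) (L z) (i z) (\<zeta> z) s \<and> cell s 6 0 0 = (\<Sum>n<n. \<Sum>m<num (\<zeta> z). G z n m)" for n z s
  define J where "J m = (\<lambda>(z, n) s. weighted (\<eta> z) (L z) (i z) (\<zeta> z) s \<and> reg s 4 = n \<and> n < num (\<zeta> z) \<and>
      cell s 6 0 0 = (\<Sum>n<n. \<Sum>m<num (\<zeta> z). G z n m) + (\<Sum>m<m. G z n m))" for m
  define body where "body = Seq prog_inner (set_var 6 (RAdd (var 6) (RMul (RMul (entry 10 4) (entry 10 5)) (rsum (rpow (var 8)) (2 * h + 1)))))"
  have inner: "triple (\<lambda>(zn, m) s. J m zn s \<and> reg s 5 = m \<and> m < num (\<zeta> (fst zn))) prog_inner (\<lambda>(zn, m). Suc (dim (\<zeta> (fst zn))))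
     (\<lambda>(zn, m) s. J m zn s \<and> reg s 5 = m \<and> m < num (\<zeta> (fst zn)) \<and>
         cell s 8 0 0 = dot (dim (\<zeta> (fst zn))) (pts (\<zeta> (fst zn)) (snd zn)) (pts (\<zeta> (fst zn)) m) - proj (\<zeta> (fst zn)) (snd zn) * proj (\<zeta> (fst zn)) m)"
    by (rule triple_mono[OF triple_inner[where \<zeta> = "\<lambda>(zn, m). \<zeta> (fst zn)" and a = "\<lambda>(zn, m). snd zn" and b = snd
          and \<eta> = "\<lambda>(zn, m). \<eta> (fst zn)" and L = "\<lambda>(zn, m). L (fst zn)"
          and P = "\<lambda>(zn, m) s. J m zn s \<and> reg s 5 = m \<and> m < num (\<zeta> (fst zn))"]])
      (auto simp: J_def weighted_def projected_def input_ok_def split: prod.splits)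
  have add: "triple (\<lambda>(zn, m) s. J m zn s \<and> reg s 5 = m \<and> m < num (\<zeta> (fst zn)) \<and>
         cell s 8 0 0 = dot (dim (\<zeta> (fst zn))) (pts (\<zeta> (fst zn)) (snd zn)) (pts (\<zeta> (fst zn)) m) - proj (\<zeta> (fst zn)) (snd zn) * proj (\<zeta> (fst zn)) m)
       (set_var 6 (RAdd (var 6) (RMul (RMul (entry 10 4) (entry 10 5)) (rsum (rpow (var 8)) (2 * h + 1)))))
       (\<lambda>(zn, m). Suc (dim (\<zeta> (fst zn)))) (\<lambda>(zn, m) s. J (Suc m) zn s \<and> reg s 5 = m)"
    by (rule triple_RSet)
      (auto simp: J_def weighted_def projected_def input_ok_def G_def power_kernel_def simp del: sum.lessThan_Suc_shift split: prod.splits)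
  have 2: "triple (J 0) (for_loop 5 (IReg 1) body) (\<lambda>zn. Suc (num (\<zeta> (fst zn))) * Suc (dim (\<zeta> (fst zn)))) (\<lambda>zn. J (num (\<zeta> (fst zn))) zn)"
  proof (rule triple_for[where I = J])
    show "triple (\<lambda>(z, k) s. J k z s \<and> reg s 5 = k \<and> k < num (\<zeta> (fst z))) body (\<lambda>(z, k). Suc (dim (\<zeta> (fst z))))
      (\<lambda>(z, k) s. J (Suc k) z s \<and> reg s 5 = k)"
      unfolding body_def by (rule triple_Seq[OF inner add])
  qed (auto simp: J_def weighted_def projected_def input_ok_def split: prod.splits)
  have 3: "triple (I 0) (for_loop 4 (IReg 1) (for_loop 5 (IReg 1) body)) (\<lambda>z. Suc (num (\<zeta> z)) * (Suc (num (\<zeta> z)) * Suc (dim (\<zeta> z)))) (\<lambda>z. I (num (\<zeta> z)) z)"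
  proof (rule triple_for[where I = I])
    show "triple (\<lambda>(z, k) s. I k z s \<and> reg s 4 = k \<and> k < num (\<zeta> z)) (for_loop 5 (IReg 1) body)
      (\<lambda>(z, k). Suc (num (\<zeta> z)) * Suc (dim (\<zeta> z))) (\<lambda>(z, k) s. I (Suc k) z s \<and> reg s 4 = k)"
      by (rule triple_mono[OF 2]) (auto simp: J_def I_def split: prod.splits)
  qed (auto simp: I_def weighted_def projected_def input_ok_def)
  have 1: "triple (\<lambda>z. weighted (\<eta> z) (L z) (i z) (\<zeta> z)) (set_var 6 (RConst 0)) (\<lambda>z. Suc (num (\<zeta> z)) * (Suc (num (\<zeta> z)) * Suc (dim (\<zeta> z)))) (I 0)"
    by (rule triple_RSet) (auto simp: I_def weighted_def projected_def input_ok_def)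
  show ?thesis unfolding prog_pairs_def body_def[symmetric]
    by (rule triple_mono[OF triple_Seq[OF 1 3]]) (auto simp: I_def G_def)
qed

lemma rval_rising_exp [simp]: "rval s (rising_exp x m) = rising_two (rval s x) m"
  by (simp add: rising_exp_def rising_two_def of_rat_mult)

lemma triple_cross:
  fixes \<zeta> :: "'z \<Rightarrow> input"
  shows "triple (\<lambda>z s. weighted (\<eta> z) (L z) (i z) (\<zeta> z) s \<and> cell s 6 0 0 = F z) (prog_cross h) (\<lambda>z. Suc (num (\<zeta> z)) * Suc (dim (\<zeta> z)))
     (\<lambda>z s. weighted (\<eta> z) (L z) (i z) (\<zeta> z) s \<and> cell s 6 0 0 = F z \<and>
       cell s 7 0 0 = (\<Sum>n<num (\<zeta> z). weight (\<eta> z) (L z) (i z) (proj (\<zeta> z) n)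
         * cross_kernel h (dot (dim (\<zeta> z)) (pts (\<zeta> z) n) (pts (\<zeta> z) n) - (proj (\<zeta> z) n)\<^sup>2)))"
proof -
  define G where "G z n = weight (\<eta> z) (L z) (i z) (proj (\<zeta> z) n)
         * cross_kernel h (dot (dim (\<zeta> z)) (pts (\<zeta> z) n) (pts (\<zeta> z) n) - (proj (\<zeta> z) n)\<^sup>2)" for z n
  define I where "I n z s \<longleftrightarrow> weighted (\<eta> z) (L z) (i z) (\<zeta> z) s \<and> cell s 6 0 0 = F z \<and> cell s 7 0 0 = (\<Sum>n<n. G z n)" for n z s
  define J where "J = (\<lambda>(z, n) s. I n z s \<and> reg s 4 = n \<and> reg s 5 = n \<and> n < num (\<zeta> z))"
  have 1: "triple (\<lambda>(z, n) s. I n z s \<and> reg s 4 = n \<and> n < num (\<zeta> z)) (ISet 5 (IReg 4)) (\<lambda>(z, n). Suc (dim (\<zeta> z))) J"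
    by (rule triple_ISet) (auto simp: J_def I_def weighted_def projected_def input_ok_def split: prod.splits)
  have 2: "triple J prog_inner (\<lambda>(z, n). Suc (dim (\<zeta> z)))
      (\<lambda>(z, n) s. J (z, n) s \<and> cell s 8 0 0 = dot (dim (\<zeta> z)) (pts (\<zeta> z) n) (pts (\<zeta> z) n) - proj (\<zeta> z) n * proj (\<zeta> z) n)"
    by (rule triple_mono[OF triple_inner[where \<zeta> = "\<lambda>zn. \<zeta> (fst zn)" and a = snd and b = snd
          and \<eta> = "\<lambda>zn. \<eta> (fst zn)" and L = "\<lambda>zn. L (fst zn)" and P = J]])
      (auto simp: J_def I_def weighted_def projected_def input_ok_def split: prod.splits)
  have 3: "triple (\<lambda>(z, n) s. J (z, n) s \<and> cell s 8 0 0 = dot (dim (\<zeta> z)) (pts (\<zeta> z) n) (pts (\<zeta> z) n) - proj (\<zeta> z) n * proj (\<zeta> z) n)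
     (set_var 7 (RAdd (var 7) (RMul (entry 10 4)
       (rsum (\<lambda>m. RMul (rising_exp (RConst 1) m) (rpow (var 8) m)) (h + 1))))) (\<lambda>(z, n). Suc (dim (\<zeta> z)))
     (\<lambda>(z, n) s. I (Suc n) z s \<and> reg s 4 = n)"
    by (rule triple_RSet)
      (auto simp: J_def I_def weighted_def projected_def input_ok_def G_def cross_kernel_def power2_eq_square split: prod.splits)
  have 4: "triple (I 0) (for_loop 4 (IReg 1) (Seq (ISet 5 (IReg 4)) (Seq prog_inner
     (set_var 7 (RAdd (var 7) (RMul (entry 10 4)
       (rsum (\<lambda>m. RMul (rising_exp (RConst 1) m) (rpow (var 8) m)) (h + 1)))))))) (\<lambda>z. Suc (num (\<zeta> z)) * Suc (dim (\<zeta> z))) (\<lambda>z. I (num (\<zeta> z)) z)"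
    by (rule triple_for[where I = I, OF triple_Seq[OF 1 triple_Seq[OF 2 3]]])
      (auto simp: I_def weighted_def projected_def input_ok_def)
  have 5: "triple (\<lambda>z s. weighted (\<eta> z) (L z) (i z) (\<zeta> z) s \<and> cell s 6 0 0 = F z) (set_var 7 (RConst 0)) (\<lambda>z. Suc (num (\<zeta> z)) * Suc (dim (\<zeta> z))) (I 0)"
    by (rule triple_RSet) (auto simp: I_def weighted_def projected_def input_ok_def)
  show ?thesis unfolding prog_cross_def
    by (rule triple_mono[OF triple_Seq[OF 5 4]]) (auto simp: I_def G_def)
qed

definition accepted :: "parameters \<Rightarrow> input \<Rightarrow> nat \<Rightarrow> nat" where
  "accepted q z i = (if \<forall>j<i. passes q (dim z) (num z) (pts z) (dir z) (eps z) j then 1 else 0)"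

abbreviation (input) strip_width :: "parameters \<Rightarrow> input \<Rightarrow> real" where
  "strip_width q z \<equiv> eps z * of_rat (width q)"

abbreviation (input) strips :: "parameters \<Rightarrow> input \<Rightarrow> nat" where
  "strips q z \<equiv> half_width (rad q) (strip_width q z)"

lemma rval_defect_exp:
  assumes "weighted \<eta> L i z s"
    and "cell s 6 0 0 = (\<Sum>n<num z. \<Sum>m<num z. weight \<eta> L i (proj z n) * weight \<eta> L i (proj z m)
         * power_kernel h (dot (dim z) (pts z n) (pts z m) - proj z n * proj z m))"
    and "cell s 7 0 0 = (\<Sum>n<num z. weight \<eta> L i (proj z n)
         * cross_kernel h (dot (dim z) (pts z n) (pts z n) - (proj z n)\<^sup>2))"
  shows "rval s (defect_exp h) = moment_defect h (dim z) (num z) (pts z) (dir z) (\<lambda>x. weight \<eta> L i (dot (dim z) x (dir z)))"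
  using assms
  by (simp add: defect_exp_def moment_defect_def mass_exp_def mass_def weighted_def projected_def input_ok_def
    gauss_kernel_def)

lemma rval_mass_exp:
  "weighted \<eta> L i z s \<Longrightarrow> rval s mass_exp = mass (num z) (pts z) (\<lambda>x. weight \<eta> L i (dot (dim z) x (dir z)))"
  by (simp add: mass_exp_def mass_def weighted_def projected_def input_ok_def)

lemma rval_target_exp:
  "weighted \<eta> L i z s \<Longrightarrow> rval s (target_exp k M) = mass_target k M ((real i - real L) * \<eta>)"
  by (simp add: target_exp_def mass_target_def weighted_def of_rat_mult)

lemma triple_verdict:
  fixes q :: parameters
  defines "\<eta> \<equiv> strip_width q" and "L \<equiv> strips q"
  shows "triple (\<lambda>(z, i) s. (weighted (\<eta> z) (L z) i z s \<and>
       cell s 6 0 0 = (\<Sum>n<num z. \<Sum>m<num z. weight (\<eta> z) (L z) i (proj z n) * weight (\<eta> z) (L z) i (proj z m)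
         * power_kernel (deg q) (dot (dim z) (pts z n) (pts z m) - proj z n * proj z m)) \<and>
       cell s 7 0 0 = (\<Sum>n<num z. weight (\<eta> z) (L z) i (proj z n)
         * cross_kernel (deg q) (dot (dim z) (pts z n) (pts z n) - (proj z n)\<^sup>2))) \<and> reg s 7 = accepted q z i)
     (prog_verdict q) (\<lambda>_. 1)
     (\<lambda>(z, i) s. projected (\<eta> z) (L z) z s \<and> 0 < \<eta> z \<and> reg s 3 = i \<and> reg s 7 = accepted q z (Suc i))"
proof -
  define A where "A = (\<lambda>(z :: input, i) s. (weighted (\<eta> z) (L z) i z s \<and>
       cell s 6 0 0 = (\<Sum>n<num z. \<Sum>m<num z. weight (\<eta> z) (L z) i (proj z n) * weight (\<eta> z) (L z) i (proj z m)
         * power_kernel (deg q) (dot (dim z) (pts z n) (pts z m) - proj z n * proj z m)) \<and>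
       cell s 7 0 0 = (\<Sum>n<num z. weight (\<eta> z) (L z) i (proj z n)
         * cross_kernel (deg q) (dot (dim z) (pts z n) (pts z n) - (proj z n)\<^sup>2))))"
  have A1: "A zi (set_reg 7 k s)" if "A zi s" for zi s k
    using that by (auto simp: A_def weighted_def projected_def input_ok_def split: prod.splits)
  define D where "D = (\<lambda>(z :: input, i). defect_ok q (dim z) (num z) (pts z) (dir z) (eps z) i)"
  define M where "M = (\<lambda>(z :: input, i). i < 2 * L z + 1 \<longrightarrow> mass_ok q (dim z) (num z) (pts z) (dir z) (eps z) i)"
  have acc: "accepted q z (Suc i) = (if accepted q z i = 1 \<and> D (z, i) \<and> M (z, i) then 1 else 0)" for z i
    by (auto simp: accepted_def passes_def less_Suc_eq D_def M_def L_def \<eta>_def)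
  have 1: "triple (\<lambda>(z, i) s. A (z, i) s \<and> reg s 7 = accepted q z i)
     (Cond (RLess (RMul (RConst (defect_tol q)) (rpow (var 3) 2)) (defect_exp (deg q))) (ISet 7 (IConst 0)) Skip)
     (\<lambda>_. 1) (\<lambda>(z, i) s. A (z, i) s \<and> reg s 7 = (if accepted q z i = 1 \<and> D (z, i) then 1 else 0))"
  proof -
    have "bval s (RLess (RMul (RConst (defect_tol q)) (rpow (var 3) 2)) (defect_exp (deg q))) \<longleftrightarrow> \<not> D (z, i)"
      if "A (z, i) s" for z i s
    proof -
      have "rval s (defect_exp (deg q)) = moment_defect (deg q) (dim z) (num z) (pts z) (dir z) (\<lambda>x. weight (\<eta> z) (L z) i (dot (dim z) x (dir z)))"
        using that by (intro rval_defect_exp) (auto simp: A_def)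
      moreover have "cell s 3 0 0 = \<eta> z" using that by (auto simp: A_def weighted_def projected_def)
      ultimately show ?thesis by (simp add: D_def defect_ok_def Let_def L_def \<eta>_def not_le)
    qed
    then show ?thesis
      by (intro triple_Cond triple_ISet triple_Skip) (auto intro: A1 simp: accepted_def split: prod.splits)
  qed
  define b where "b = (let z = RSub mass_exp (RMul (var 3) (target_exp (coef q) (expo q))); k = RMul (RConst (mass_tol q)) (var 3) in
    (BAnd (ILess (IReg 3) strip_total) (BNot (BAnd (BNot (RLess k z)) (BNot (RLess k (RSub (RConst 0) z)))))))"
  have b: "bval s b \<longleftrightarrow> \<not> M (z, i)" if "A (z, i) s" for z i s
  proof -
    have w: "weighted (\<eta> z) (L z) i z s" using that by (auto simp: A_def)
    then have "cell s 3 0 0 = \<eta> z" "reg s 3 = i" "reg s 2 = L z" by (auto simp: weighted_def projected_def)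
    then show ?thesis
      unfolding b_def Let_def
      by (simp add: M_def mass_ok_def Let_def rval_mass_exp[OF w] rval_target_exp[OF w] L_def \<eta>_def)
        (auto simp: abs_le_iff)
  qed
  have 2: "triple (\<lambda>(z, i) s. A (z, i) s \<and> reg s 7 = (if accepted q z i = 1 \<and> D (z, i) then 1 else 0))
     (Cond b (ISet 7 (IConst 0)) Skip)
     (\<lambda>_. 1) (\<lambda>(z, i) s. A (z, i) s \<and> reg s 7 = (if accepted q z i = 1 \<and> D (z, i) \<and> M (z, i) then 1 else 0))"
    using b by (intro triple_Cond triple_ISet triple_Skip) (auto intro: A1 split: prod.splits)
  show ?thesis unfolding prog_verdict_def Let_def b_def[unfolded Let_def, symmetric]
    by (rule triple_mono[OF triple_Seq[OF 1 2]]) (auto simp: acc A_def weighted_def)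
qed

text \<open>Turns the ceiling into the comparison that the counting loop performs.\<close>

lemma less_half_width: "0 < \<eta> \<Longrightarrow> k < half_width r \<eta> \<longleftrightarrow> real k * \<eta> < real r"
  by (simp add: half_width_def zless_nat_eq_int_zless less_ceiling_iff pos_less_divide_eq)

lemma triple_find_width:
  assumes w: "0 < width q"
  shows "triple (\<lambda>z s. input_ok z s \<and> reg s 2 = 0) 
     (Seq (set_var 3 (RMul (var 2) (RConst (width q))))
       (While (RLess (RMul (RIdx (IReg 2)) (var 3)) (RConst (of_nat (rad q)))) (ISet 2 (IAdd (IReg 2) (IConst 1)))))
     (\<lambda>z. Suc (strips q z))
     (\<lambda>z s. input_ok z s \<and> cell s 3 0 0 = strip_width q z \<and> reg s 2 = strips q z)"
proof -
  define I where "I k z s \<longleftrightarrow> input_ok z s \<and> cell s 3 0 0 = strip_width q z \<and> reg s 2 = k" for k :: nat and z s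
  have 1: "triple (\<lambda>z s. input_ok z s \<and> reg s 2 = 0) (set_var 3 (RMul (var 2) (RConst (width q))))
     (\<lambda>z. Suc (strips q z) * 1) (I 0)"
    by (rule triple_RSet) (auto simp: I_def input_ok_def)
  have 2: "triple (I 0) (While (RLess (RMul (RIdx (IReg 2)) (var 3)) (RConst (of_nat (rad q)))) (ISet 2 (IAdd (IReg 2) (IConst 1))))
     (\<lambda>z. Suc (strips q z) * 1) (\<lambda>z. I (strips q z) z)"
  proof (rule triple_While)
    show "triple (\<lambda>(z, k) s. I k z s \<and> k < strips q z) (ISet 2 (IAdd (IReg 2) (IConst 1)))
       (\<lambda>(z, k). 1) (\<lambda>(z, k). I (Suc k) z)"
      by (rule triple_ISet) (auto simp: I_def input_ok_def split: prod.splits)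
  next
    fix k z s assume "I k z s"
    then show "bval s (RLess (RMul (RIdx (IReg 2)) (var 3)) (RConst (of_nat (rad q)))) \<longleftrightarrow> k < strips q z"
      using w by (subst less_half_width) (auto simp: I_def input_ok_def)
  qed auto
  show ?thesis by (rule triple_mono[OF triple_Seq[OF 1 2]]) (auto simp: I_def)
qed

lemma triple_tester:
  assumes w: "0 < width q"
  shows "triple (\<lambda>z s. input_ok z s \<and> reg s 2 = 0) (tester q)
     (\<lambda>z. Suc (2 * strips q z + 2) * (Suc (num z) * (Suc (num z) * Suc (dim z))))
     (\<lambda>z s. reg s 0 = accepted q z (2 * strips q z + 2))"
proof -
  define X where "X z = Suc (num z) * (Suc (num z) * Suc (dim z))" for z :: input
  define Y where "Y z = Suc (2 * strips q z + 2) * X z" for z :: input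
  have X1: "1 \<le> X z" "Suc (num z) \<le> X z" "Suc (num z) * Suc (dim z) \<le> X z" for z by (auto simp: X_def)
  have Y1: "X z \<le> Y z" for z by (auto simp: Y_def)
  have Y2: "Suc (strips q z) \<le> Y z" for z
  proof -
    have "Suc (strips q z) * 1 \<le> Suc (2 * strips q z + 2) * X z" using X1(1) by (intro mult_le_mono) auto
    then show ?thesis by (simp add: Y_def)
  qed
  define I where "I i z s \<longleftrightarrow> projected (strip_width q z) (strips q z) z s \<and> 0 < strip_width q z \<and>
      reg s 7 = accepted q z i" for i z s
  define W where "W = (\<lambda>(z, i). weighted (strip_width q z) (strips q z) i z)"
  define F where "F = (\<lambda>(z, i). (\<Sum>n<num z. \<Sum>m<num z. weight (strip_width q z) (strips q z) i (proj z n) * weight (strip_width q z) (strips q z) i (proj z m)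
         * power_kernel (deg q) (dot (dim z) (pts z n) (pts z m) - proj z n * proj z m)))"
  define G where "G = (\<lambda>(z, i). (\<Sum>n<num z. weight (strip_width q z) (strips q z) i (proj z n)
         * cross_kernel (deg q) (dot (dim z) (pts z n) (pts z n) - (proj z n)\<^sup>2)))"
  define V where "V = (\<lambda>(z, i). accepted q z i)"
  have f: "triple (\<lambda>z s. input_ok z s \<and> reg s 2 = 0) 
     (Seq (set_var 3 (RMul (var 2) (RConst (width q))))
       (While (RLess (RMul (RIdx (IReg 2)) (var 3)) (RConst (of_nat (rad q)))) (ISet 2 (IAdd (IReg 2) (IConst 1))))) Y
     (\<lambda>z s. input_ok z s \<and> cell s 3 0 0 = strip_width q z \<and> reg s 2 = strips q z)"
    using triple_find_width[OF w] by (rule triple_mono) (auto intro: Y2)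
  have g: "triple (\<lambda>z s. input_ok z s \<and> cell s 3 0 0 = strip_width q z \<and> reg s 2 = strips q z) prog_projections Y
     (\<lambda>z. projected (strip_width q z) (strips q z) z)"
    using triple_projections[of "strip_width q" "strips q"]
    by (rule triple_mono) (use X1(3) Y1 order_trans in blast)+
  have k: "triple (\<lambda>z. projected (strip_width q z) (strips q z) z) (ISet 7 (IConst 1)) Y (I 0)"
  proof (rule triple_ISet)
    fix z s show "1 \<le> Y z" using X1(1) Y1 order_trans by blast
  qed (use w in \<open>auto simp: I_def projected_def input_ok_def accepted_def\<close>)
  \<comment> \<open>Register 7 holds the conjunction of the earlier tests while a strip is being
    evaluated.\<close>
  have nonass: "7 \<notin> assigned prog_weights" "7 \<notin> assigned (prog_pairs (deg q))" "7 \<notin> assigned (prog_cross (deg q))"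
    by (auto simp: prog_weights_def prog_weight_def prog_pairs_def prog_cross_def prog_inner_def for_loop_def Let_def)
  have b1: "triple (\<lambda>(z, i) s. I i z s \<and> reg s 3 = i) prog_weights (\<lambda>(z, i). X z) (\<lambda>zi s. W zi s \<and> reg s 7 = V zi)"
    using triple_frame[OF triple_weights nonass(1),
        of "\<lambda>zi. strip_width q (fst zi)"  "\<lambda>zi. strips q (fst zi)" fst snd V]
    by (rule triple_mono) (use X1(2) in \<open>auto simp: W_def V_def I_def split: prod.splits\<close>)
  have b2: "triple (\<lambda>zi s. W zi s \<and> reg s 7 = V zi) (prog_pairs (deg q)) (\<lambda>(z, i). X z) (\<lambda>zi s. (W zi s \<and> cell s 6 0 0 = F zi) \<and> reg s 7 = V zi)"
    using triple_frame[OF triple_pairs nonass(2),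
        of "\<lambda>zi. strip_width q (fst zi)"  "\<lambda>zi. strips q (fst zi)" snd fst V]
    by (rule triple_mono) (auto simp: W_def F_def X_def split: prod.splits)
  have b3: "triple (\<lambda>zi s. (W zi s \<and> cell s 6 0 0 = F zi) \<and> reg s 7 = V zi) (prog_cross (deg q)) (\<lambda>(z, i). X z)
     (\<lambda>zi s. (W zi s \<and> cell s 6 0 0 = F zi \<and> cell s 7 0 0 = G zi) \<and> reg s 7 = V zi)"
    using triple_frame[OF triple_cross nonass(3),
        of "\<lambda>zi. strip_width q (fst zi)"  "\<lambda>zi. strips q (fst zi)" snd fst F V]
    by (rule triple_mono) (use X1(3) in \<open>auto simp: W_def G_def split: prod.splits\<close>)
  have b4: "triple (\<lambda>zi s. (W zi s \<and> cell s 6 0 0 = F zi \<and> cell s 7 0 0 = G zi) \<and> reg s 7 = V zi) (prog_verdict q) (\<lambda>(z, i). X z)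
     (\<lambda>(z, i) s. I (Suc i) z s \<and> reg s 3 = i)"
    using triple_verdict[of q]
    by (rule triple_mono) (use X1(1) in \<open>auto simp: W_def F_def G_def V_def I_def split: prod.splits\<close>)
  have l: "triple (I 0) (for_loop 3 (IAdd strip_total (IConst 1))
        (Seq prog_weights (Seq (prog_pairs (deg q)) (Seq (prog_cross (deg q)) (prog_verdict q)))))
     (\<lambda>z. Suc (2 * strips q z + 2) * X z) (\<lambda>z. I (2 * strips q z + 2) z)"
  proof (rule triple_for[where I = I])
    show "triple (\<lambda>(z, k) s. I k z s \<and> reg s 3 = k \<and> k < 2 * strips q z + 2)
       (Seq prog_weights (Seq (prog_pairs (deg q)) (Seq (prog_cross (deg q)) (prog_verdict q))))
       (\<lambda>(z, k). X z) (\<lambda>(z, k) s. I (Suc k) z s \<and> reg s 3 = k)"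
      using triple_Seq[OF b1 triple_Seq[OF b2 triple_Seq[OF b3 b4]]]
      by (rule triple_mono) (auto split: prod.splits)
  qed (use X1(1) in \<open>auto simp: I_def projected_def input_ok_def\<close>)
  have e: "triple (\<lambda>z. I (2 * strips q z + 2) z) (ISet 0 (IReg 7)) Y (\<lambda>z s. reg s 0 = accepted q z (2 * strips q z + 2))"
  proof (rule triple_ISet)
    fix z s show "1 \<le> Y z" using X1(1) Y1 order_trans by blast
  qed (auto simp: I_def)
  show ?thesis unfolding tester_def
    using triple_Seq[OF f triple_Seq[OF g triple_Seq[OF k triple_Seq[OF l[folded Y_def] e]]]]
    by (rule triple_mono) (simp_all only: X_def Y_def order_refl)
qed

lemma tester_run:
  assumes "0 < width q"
  shows "\<exists>K. \<forall>d N S v \<epsilon> \<delta> \<mu>. 0 < \<epsilon> \<longrightarrow> (\<exists>t s. exec (tester q) (input_memory d N S v \<epsilon> \<delta> \<mu>) t s \<and>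
     t \<le> K * (Suc (2 * half_width (rad q) (\<epsilon> * of_rat (width q)) + 2) * (Suc N * (Suc N * Suc d))) \<and>
     reg s 0 = (if \<forall>i < 2 * half_width (rad q) (\<epsilon> * of_rat (width q)) + 2. passes q d N S v \<epsilon> i then 1 else 0))"
proof -
  obtain K where K: "\<And>z s. input_ok z s \<Longrightarrow> reg s 2 = 0 \<Longrightarrow> (\<exists>t s'. exec (tester q) s t s' \<and>
     t \<le> K * (Suc (2 * strips q z + 2) * (Suc (num z) * (Suc (num z) * Suc (dim z)))) \<and>
     reg s' 0 = accepted q z (2 * strips q z + 2))"
    using triple_tester[OF assms] unfolding triple_def by blast
  have "\<exists>t s. exec (tester q) (input_memory d N S v \<epsilon> \<delta> \<mu>) t s \<and>
     t \<le> K * (Suc (2 * half_width (rad q) (\<epsilon> * of_rat (width q)) + 2) * (Suc N * (Suc N * Suc d))) \<and>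
     reg s 0 = (if \<forall>i < 2 * half_width (rad q) (\<epsilon> * of_rat (width q)) + 2. passes q d N S v \<epsilon> i then 1 else 0)"
    if "0 < \<epsilon>" for d N S v \<epsilon> \<delta> \<mu>
  proof -
    define z where "z = \<lparr>dim = d, num = N, pts = S, dir = v, eps = \<epsilon>\<rparr>"
    have "input_ok z (input_memory d N S v \<epsilon> \<delta> \<mu>)" "reg (input_memory d N S v \<epsilon> \<delta> \<mu>) 2 = 0"
      using that by (auto simp: input_ok_def input_memory_def z_def)
    from K[OF this] show ?thesis by (simp only: z_def input.simps accepted_def)
  qed
  then show ?thesis by blast
qed

text \<open>\<open>accepts\<close> only asks for some accepting run. Since execution is
  deterministic, the run provided by \<open>tester_run\<close> is the only one.\<close>

lemma accepts_tester:
  assumes "0 < width q" "0 < \<epsilon>"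
  shows "accepts (tester q) d N S v \<epsilon> \<delta> \<mu> \<longleftrightarrow>
    (\<forall>i < 2 * half_width (rad q) (\<epsilon> * of_rat (width q)) + 2. passes q d N S v \<epsilon> i)"
proof -
  obtain t s where 1: "exec (tester q) (input_memory d N S v \<epsilon> \<delta> \<mu>) t s"
    "reg s 0 = (if \<forall>i < 2 * half_width (rad q) (\<epsilon> * of_rat (width q)) + 2. passes q d N S v \<epsilon> i then 1 else 0)"
    using tester_run[OF assms(1)] assms(2) by blast
  then have "accepts (tester q) d N S v \<epsilon> \<delta> \<mu> \<longleftrightarrow> verdict_of s = Accept"
    unfolding accepts_def using exec_deterministic by blast
  with 1(2) show ?thesis by (auto simp: verdict_of_def)
qed

lemma half_width_le: "0 < \<eta> \<Longrightarrow> real (half_width r \<eta>) \<le> real r / \<eta> + 1"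
  unfolding half_width_def by (simp add: of_nat_nat)

text \<open>There are of the order of 1 / \<epsilon> strips, and each costs of the order of N^2 d
  steps. The four factors 1 / \<epsilon>, N, N and d are all at most X = d N / (\<epsilon>
  \<delta>), whence a monomial of degree 4.\<close>

lemma halts_tester:
  assumes w: "0 < width q"
  shows "\<exists>p. \<forall>d N S v \<epsilon> \<delta> \<mu>. 0 < d \<longrightarrow> 0 < N \<longrightarrow> 0 < \<epsilon> \<longrightarrow> \<epsilon> < 1 \<longrightarrow> 0 < \<delta> \<longrightarrow> \<delta> < 1 \<longrightarrow>
    halts_within (tester q) (poly p (real d * real N / (\<epsilon> * \<delta>))) d N S v \<epsilon> \<delta> \<mu>"
proof -
  obtain K where K: "\<And>d N S v \<epsilon> \<delta> \<mu>. 0 < \<epsilon> \<Longrightarrow> (\<exists>t s. exec (tester q) (input_memory d N S v \<epsilon> \<delta> \<mu>) t s \<and>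
     t \<le> K * (Suc (2 * half_width (rad q) (\<epsilon> * of_rat (width q)) + 2) * (Suc N * (Suc N * Suc d))))"
    using tester_run[OF w] by meson
  define w where "w = real_of_rat (width q)"
  have w0: "0 < w" using w by (simp add: w_def)
  \<comment> \<open>\<open>8\<close> collects three estimates of the form
    \<open>real (Suc n) \<le> 2 * X\<close>. \<open>5\<close> is the \<open>3\<close> of the number
    of rounds plus \<open>2\<close> for rounding up the half width.\<close>
  define c where "c = real K * (2 * (real (rad q) / w) + 5) * 8"
  have c0: "0 \<le> c" using w0 by (simp add: c_def)
  have "halts_within (tester q) (poly (monom c 4) (real d * real N / (\<epsilon> * \<delta>))) d N S v \<epsilon> \<delta> \<mu>"
    if *: "0 < d" "0 < N" "0 < \<epsilon>" "\<epsilon> < 1" "0 < \<delta>" "\<delta> < 1" for d N S v \<epsilon> \<delta> \<mu>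
  proof -
    define X where "X = real d * real N / (\<epsilon> * \<delta>)"
    obtain t s where t: "exec (tester q) (input_memory d N S v \<epsilon> \<delta> \<mu>) t s"
     "t \<le> K * (Suc (2 * half_width (rad q) (\<epsilon> * w) + 2) * (Suc N * (Suc N * Suc d)))"
      using K[OF *(3)] unfolding w_def by blast
    have ed: "0 < \<epsilon> * \<delta>" "\<epsilon> * \<delta> \<le> 1" "\<epsilon> * \<delta> \<le> \<epsilon>" using * by (auto simp: mult_le_one mult_left_le)
    have dN: "1 \<le> real d" "1 \<le> real N" using * by auto
    have ddN: "real d * 1 \<le> real d * real N" "1 * real N \<le> real d * real N" "1 * 1 \<le> real d * real N"
      using mult_left_mono[OF dN(2), of "real d"] mult_right_mono[OF dN(1), of "real N"] dN by linarith+
    have up: "x \<le> X" if "x \<le> real d * real N" "0 \<le> x" for x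
    proof -
      have "x * (\<epsilon> * \<delta>) \<le> x" using that ed by (simp add: mult_left_le)
      with that ed show ?thesis by (simp add: X_def pos_le_divide_eq)
    qed
    have X1: "1 \<le> X" "real d \<le> X" "real N \<le> X" using up ddN by auto
    have "1 / \<epsilon> \<le> 1 / (\<epsilon> * \<delta>)" using ed * by (simp add: frac_le)
    also have "\<dots> \<le> X" using ddN ed by (simp add: X_def divide_right_mono)
    finally have Xe: "1 / \<epsilon> \<le> X" .
    have Lh: "real (half_width (rad q) (\<epsilon> * w)) \<le> real (rad q) / (\<epsilon> * w) + 1"
      using * w0 by (intro half_width_le) auto
    have "real (rad q) / (\<epsilon> * w) = (real (rad q) / w) * (1 / \<epsilon>)" by simp
    also have "\<dots> \<le> (real (rad q) / w) * X" using Xe w0 by (intro mult_left_mono) auto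
    finally have Lr: "real (rad q) / (\<epsilon> * w) \<le> (real (rad q) / w) * X" .
    have L: "real (Suc (2 * half_width (rad q) (\<epsilon> * w) + 2)) \<le> (2 * (real (rad q) / w) + 5) * X"
    proof -
      have "real (half_width (rad q) (\<epsilon> * w)) \<le> (real (rad q) / w) * X + 1" using Lh Lr by linarith
      moreover have "(2 * (real (rad q) / w) + 5) * X = 2 * ((real (rad q) / w) * X) + 5 * X" by (simp add: algebra_simps)
      ultimately show ?thesis using X1(1) by simp
    qed
    have "real t \<le> real (K * (Suc (2 * half_width (rad q) (\<epsilon> * w) + 2) * (Suc N * (Suc N * Suc d))))"
      using t(2) by (simp only: of_nat_le_iff)
    also have "\<dots> = real K * (real (Suc (2 * half_width (rad q) (\<epsilon> * w) + 2)) * (real (Suc N) * (real (Suc N) * real (Suc d))))"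
      by (simp only: of_nat_mult)
    also have "\<dots> \<le> real K * (((2 * (real (rad q) / w) + 5) * X) * ((2 * X) * ((2 * X) * (2 * X))))"
    proof -
      have N: "real (Suc N) \<le> 2 * X" and D: "real (Suc d) \<le> 2 * X" using X1 by auto
      show ?thesis using L N D X1 w0 by (intro mult_left_mono mult_mono mult_nonneg_nonneg add_nonneg_nonneg divide_nonneg_pos) auto
    qed
    also have "\<dots> = c * X ^ 4" by (simp add: c_def power4_eq_xxxx)
    finally show ?thesis unfolding halts_within_def using t(1) by (auto simp: poly_monom X_def)
  qed
  then show ?thesis by blast
qed

section \<open>Moments determine the normal distribution\<close>

abbreviation Phi :: "real \<Rightarrow> real" where
  "Phi s \<equiv> measure std_normal_distribution {..s}"

abbreviation gauss_moment :: "nat \<Rightarrow> real" where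
  "gauss_moment q \<equiv> LINT x|std_normal_distribution. x ^ q"

lemma power_over_fact_le_exp: "0 \<le> x \<Longrightarrow> x ^ n / fact n \<le> exp (x :: real)"
  using exp_converges[of x] sum_le_suminf[OF summable_exp, of "{n}" x] unfolding exp_def
  by (simp add: divide_inverse mult.commute)

lemma sum_power_over_fact_le_exp: "0 \<le> x \<Longrightarrow> (\<Sum>k\<le>n. x ^ k / fact k) \<le> exp (x :: real)"
  using sum_le_suminf[OF summable_exp, of "{..n}" x] unfolding exp_def
  by (simp add: divide_inverse mult.commute)

text \<open>Both characteristic functions are expanded up to degree 2n. The polynomial parts differ
  by at most \<tau> e^|t|. The remainders contain the 2n-th moment divided by (2n)!; for the normal
  distribution this moment is (2n)! / (2^n n!), and what is left tends to zero for every t.\<close>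

lemma char_diff_le:
  assumes M: "real_distribution M" and int: "\<And>k. k \<le> 2 * n \<Longrightarrow> integrable M (\<lambda>x. x ^ k)"
    and mom: "\<And>k. k \<le> 2 * n \<Longrightarrow> \<bar>(LINT x|M. x ^ k) - gauss_moment k\<bar> \<le> \<tau>"
  shows "cmod (char M t - char std_normal_distribution t) \<le> 3 * \<tau> * exp \<bar>t\<bar> + 4 * ((t\<^sup>2 / 2) ^ n / fact n)"
proof -
  interpret M: real_distribution M by fact
  interpret N: real_distribution std_normal_distribution by (rule real_dist_normal_dist)
  have t0: "0 \<le> \<tau>" using mom[of 0] by auto
  define T where "T = (\<lambda>M :: real measure. \<Sum>k\<le>2 * n. ((\<i> * t)^k / fact k) * complex_of_real (LINT x|M. x ^ k))"
  have 1: "cmod (char M t - T M) \<le> (2*\<bar>t\<bar>^(2*n) / fact (2*n)) * (LINT x|M. \<bar>x\<bar>^(2*n))"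
    unfolding T_def by (rule M.char_approx1) (rule int)
  have 2: "cmod (char std_normal_distribution t - T std_normal_distribution)
     \<le> (2*\<bar>t\<bar>^(2*n) / fact (2*n)) * (LINT x|std_normal_distribution. \<bar>x\<bar>^(2*n))"
    unfolding T_def by (rule N.char_approx1) (rule integrable_std_normal_distribution_moment)
  have "T M - T std_normal_distribution = (\<Sum>k\<le>2 * n. ((\<i> * t)^k / fact k) * complex_of_real ((LINT x|M. x ^ k) - gauss_moment k))"
    unfolding T_def by (simp add: sum_subtractf[symmetric] algebra_simps)
  also have "cmod \<dots> \<le> (\<Sum>k\<le>2 * n. \<bar>t\<bar>^k / fact k * \<tau>)"
  proof (rule sum_norm_le)
    fix k assume "k \<in> {..2 * n}"
    then have "\<bar>(LINT x|M. x ^ k) - gauss_moment k\<bar> \<le> \<tau>" using mom by auto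
    then have "\<bar>t\<bar>^k / fact k * \<bar>(LINT x|M. x ^ k) - gauss_moment k\<bar> \<le> \<bar>t\<bar>^k / fact k * \<tau>"
      by (intro mult_left_mono) auto
    then show "cmod (((\<i> * t)^k / fact k) * complex_of_real ((LINT x|M. x ^ k) - gauss_moment k)) \<le> \<bar>t\<bar>^k / fact k * \<tau>"
      by (simp only: norm_mult norm_divide norm_power norm_of_real norm_ii norm_fact mult_1)
  qed
  also have "\<dots> = (\<Sum>k\<le>2 * n. \<bar>t\<bar>^k / fact k) * \<tau>" by (simp add: sum_distrib_right)
  also have "\<dots> \<le> exp \<bar>t\<bar> * \<tau>" using t0 by (intro mult_right_mono sum_power_over_fact_le_exp) auto
  finally have 3: "cmod (T M - T std_normal_distribution) \<le> exp \<bar>t\<bar> * \<tau>" .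
  have ev: "(LINT x|M. \<bar>x\<bar>^(2*n)) = (LINT x|M. x^(2*n))" for M :: "real measure" by (simp add: power_even_abs)
  have g: "\<bar>t\<bar>^(2*n) / fact (2*n) * gauss_moment (2 * n) = (t\<^sup>2 / 2) ^ n / fact n"
  proof -
    have "\<bar>t\<bar>^(2*n) = (t\<^sup>2) ^ n" by (simp add: power_mult)
    then show ?thesis by (subst std_normal_distribution_even_moments) (simp add: power_divide)
  qed
  have "(2*\<bar>t\<bar>^(2*n) / fact (2*n)) * (LINT x|M. x^(2*n)) \<le> (2*\<bar>t\<bar>^(2*n) / fact (2*n)) * (gauss_moment (2*n) + \<tau>)"
    using mom[of "2 * n"] by (intro mult_left_mono) auto
  also have "\<dots> = 2 * ((t\<^sup>2 / 2) ^ n / fact n) + 2 * (\<bar>t\<bar>^(2*n) / fact (2*n)) * \<tau>"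
    unfolding g[symmetric] by (simp add: algebra_simps add_divide_distrib)
  also have "\<dots> \<le> 2 * ((t\<^sup>2 / 2) ^ n / fact n) + 2 * exp \<bar>t\<bar> * \<tau>"
    using t0 power_over_fact_le_exp[of "\<bar>t\<bar>" "2 * n"] by (intro add_left_mono mult_right_mono mult_left_mono) auto
  finally have 4: "cmod (char M t - T M) \<le> 2 * ((t\<^sup>2 / 2) ^ n / fact n) + 2 * exp \<bar>t\<bar> * \<tau>"
    using 1 unfolding ev by simp
  have 5: "cmod (char std_normal_distribution t - T std_normal_distribution) \<le> 2 * ((t\<^sup>2 / 2) ^ n / fact n)"
    using 2 unfolding ev g[symmetric] by simp
  have tri: "cmod (a - c) \<le> cmod (a - x) + cmod (x - y) + cmod (c - y)" for a c x y
    using norm_triangle_ineq[of "a - x" "x - y"] norm_triangle_ineq4[of "a - y" "c - y"] by simp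
  from tri[of "char M t" "char std_normal_distribution t" "T M" "T std_normal_distribution"] 3 4 5 show ?thesis by (simp add: algebra_simps)
qed

lemma std_normal_density_le: "std_normal_density x \<le> 1 / 2"
proof -
  have "2 \<le> sqrt (2 * pi)" using pi_gt3 by (intro real_le_rsqrt) auto
  then have "1 / sqrt (2 * pi) * exp (- x\<^sup>2 / 2) \<le> 1 / 2 * 1" by (intro mult_mono) (auto simp: divide_simps)
  then show ?thesis by (simp add: std_normal_density_def)
qed

interpretation std_normal: real_distribution std_normal_distribution
  by (rule real_dist_normal_dist)

lemma Phi_mono: "x \<le> y \<Longrightarrow> Phi x \<le> Phi y"
  by (intro std_normal.finite_measure_mono) auto

lemma Phi_nonneg: "0 \<le> Phi x" and Phi_le_1: "Phi x \<le> 1"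
  by auto

lemma Phi_diff_le: "x \<le> y \<Longrightarrow> Phi y - Phi x \<le> y - x"
proof -
  assume xy: "x \<le> y"
  have le1: "std_normal_density z \<le> 1" for z using std_normal_density_le[of z] by linarith
  have "{..y} = {..x} \<union> {x<..y}" using xy by auto
  then have "Phi y = Phi x + measure std_normal_distribution {x<..y}"
    by (simp only: \<open>{..y} = {..x} \<union> {x<..y}\<close>) (rule std_normal.finite_measure_Union, auto)
  moreover have "emeasure std_normal_distribution {x<..y} \<le> ennreal (y - x)"
  proof -
    have "emeasure std_normal_distribution {x<..y} = (\<integral>\<^sup>+z. ennreal (std_normal_density z) * indicator {x<..y} z \<partial>lborel)"
      by (subst emeasure_density) auto
    also have "\<dots> \<le> (\<integral>\<^sup>+z. indicator {x<..y} z \<partial>lborel)"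
      using le1 by (intro nn_integral_mono) (auto simp: indicator_def)
    finally show ?thesis using xy by simp
  qed
  then have "measure std_normal_distribution {x<..y} \<le> y - x"
    using xy by (simp add: std_normal.emeasure_eq_measure)
  ultimately show ?thesis by simp
qed

lemma Phi_lipschitz: "\<bar>Phi x - Phi y\<bar> \<le> \<bar>x - y\<bar>"
  using Phi_diff_le[of x y] Phi_diff_le[of y x] Phi_mono[of x y] Phi_mono[of y x] by (cases "x \<le> y") auto

lemma isCont_Phi: "isCont Phi x"
  unfolding continuous_at_eps_delta
proof (intro allI impI)
  fix e :: real assume "0 < e"
  then show "\<exists>d>0. \<forall>y. dist y x < d \<longrightarrow> dist (Phi y) (Phi x) < e"
    by (intro exI[of _ e]) (auto simp: dist_real_def intro: le_less_trans[OF Phi_lipschitz])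
qed

text \<open>If no degree and tolerance worked, there would be a counterexample for degree 2n and
  tolerance 1 / (n + 1) for every n. By \<open>char_diff_le\<close> their characteristic functions
  converge to the normal one, and Levy's continuity theorem contradicts the fixed gap at the
  continuity point s. No explicit degree results.\<close>

lemma moments_determine_cdf_at:
  assumes "0 < e"
  shows "\<exists>h \<tau>. 0 < \<tau> \<and> (\<forall>M. real_distribution M \<longrightarrow> (\<forall>k\<le>2 * h. integrable M (\<lambda>x. x ^ k)) \<longrightarrow>
    (\<forall>k\<le>2 * h. \<bar>(LINT x|M. x ^ k) - gauss_moment k\<bar> \<le> \<tau>) \<longrightarrow> \<bar>measure M {..s} - Phi s\<bar> \<le> e)"
proof (rule ccontr)
  assume neg: "\<not> ?thesis"
  define P where "P n M \<longleftrightarrow> real_distribution M \<and> (\<forall>k\<le>2 * n. integrable M (\<lambda>x. x ^ k)) \<and>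
    (\<forall>k\<le>2 * n. \<bar>(LINT x|M. x ^ k) - gauss_moment k\<bar> \<le> 1 / real (Suc n)) \<and> \<not> \<bar>measure M {..s} - Phi s\<bar> \<le> e"
    for n :: nat and M
  have "\<exists>M. P n M" for n
  proof (rule ccontr)
    assume "\<nexists>M. P n M"
    then have "0 < 1 / real (Suc n) \<and> (\<forall>M. real_distribution M \<longrightarrow> (\<forall>k\<le>2 * n. integrable M (\<lambda>x. x ^ k)) \<longrightarrow>
      (\<forall>k\<le>2 * n. \<bar>(LINT x|M. x ^ k) - gauss_moment k\<bar> \<le> 1 / real (Suc n)) \<longrightarrow> \<bar>measure M {..s} - Phi s\<bar> \<le> e)"
      unfolding P_def by (intro conjI) (simp, blast)
    then have "\<exists>h \<tau>. 0 < \<tau> \<and> (\<forall>M. real_distribution M \<longrightarrow> (\<forall>k\<le>2 * h. integrable M (\<lambda>x. x ^ k)) \<longrightarrow>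
      (\<forall>k\<le>2 * h. \<bar>(LINT x|M. x ^ k) - gauss_moment k\<bar> \<le> \<tau>) \<longrightarrow> \<bar>measure M {..s} - Phi s\<bar> \<le> e)"
      by (intro exI)
    with neg show False by contradiction
  qed
  then have "\<exists>M. \<forall>n. P n (M n)" by (intro choice allI)
  then obtain M where PM: "P n (M n)" for n by blast
  have M: "\<And>n. real_distribution (M n)" "\<And>n k. k \<le> 2 * n \<Longrightarrow> integrable (M n) (\<lambda>x. x ^ k)"
    "\<And>n k. k \<le> 2 * n \<Longrightarrow> \<bar>(LINT x|M n. x ^ k) - gauss_moment k\<bar> \<le> 1 / real (Suc n)"
    "\<And>n. \<not> \<bar>measure (M n) {..s} - Phi s\<bar> \<le> e"
    using PM unfolding P_def by blast+
  have "weak_conv_m M std_normal_distribution"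
  proof (rule levy_continuity[OF M(1) real_dist_normal_dist])
    fix t :: real
    have "(\<lambda>n. y ^ n / fact n) \<longlonglongrightarrow> 0" for y :: real
    proof -
      have "(\<lambda>n. y ^ n / fact n) = (\<lambda>n. inverse (fact n) * y ^ n)" by (auto simp: field_simps)
      then show ?thesis using summable_LIMSEQ_zero[OF summable_exp[of y]] by simp
    qed
    then have "(\<lambda>n. 3 * (1 / real (Suc n)) * exp \<bar>t\<bar> + 4 * ((t\<^sup>2 / 2) ^ n / fact n)) \<longlonglongrightarrow> 3 * 0 * exp \<bar>t\<bar> + 4 * 0"
      using LIMSEQ_Suc[OF lim_1_over_n] by (intro tendsto_intros) auto
    then have "(\<lambda>n. 3 * (1 / real (Suc n)) * exp \<bar>t\<bar> + 4 * ((t\<^sup>2 / 2) ^ n / fact n)) \<longlonglongrightarrow> 0" by simp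
    then show "(\<lambda>n. char (M n) t) \<longlonglongrightarrow> char std_normal_distribution t"
      by (rule Lim_null[THEN iffD2, OF Lim_null_comparison[OF always_eventually, rotated]])
        (intro allI char_diff_le[OF M(1,2,3)], auto)
  qed
  then have "(\<lambda>n. measure (M n) {..s}) \<longlonglongrightarrow> Phi s"
    using isCont_Phi[of s] unfolding weak_conv_m_def weak_conv_def cdf_def by auto
  then have "\<forall>\<^sub>F n in sequentially. \<bar>measure (M n) {..s} - Phi s\<bar> < e"
    using assms by (simp add: tendsto_iff dist_real_def)
  then obtain N where "\<bar>measure (M N) {..s} - Phi s\<bar> < e" by (auto simp: eventually_sequentially)
  with M(4)[of N] show False by simp
qed

lemma moments_determine_cdf_finite:
  assumes "0 < e" "finite A"
  shows "\<exists>h \<tau>. 0 < \<tau> \<and> (\<forall>M. real_distribution M \<longrightarrow> (\<forall>k\<le>2 * h. integrable M (\<lambda>x. x ^ k)) \<longrightarrow>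
    (\<forall>k\<le>2 * h. \<bar>(LINT x|M. x ^ k) - gauss_moment k\<bar> \<le> \<tau>) \<longrightarrow> (\<forall>s\<in>A. \<bar>measure M {..s} - Phi s\<bar> \<le> e))"
  using assms(2)
proof induction
  case empty
  show ?case by (intro exI[of _ 1]) auto
next
  case (insert s A)
  from insert.IH obtain h \<tau> where 1: "0 < \<tau>" "\<And>M. real_distribution M \<Longrightarrow> (\<forall>k\<le>2 * h. integrable M (\<lambda>x. x ^ k)) \<Longrightarrow>
    (\<forall>k\<le>2 * h. \<bar>(LINT x|M. x ^ k) - gauss_moment k\<bar> \<le> \<tau>) \<Longrightarrow> (\<forall>s\<in>A. \<bar>measure M {..s} - Phi s\<bar> \<le> e)"
    by blast
  from moments_determine_cdf_at[OF assms(1), of s] obtain h' \<tau>' where 2: "0 < \<tau>'"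
    "\<And>M. real_distribution M \<Longrightarrow> (\<forall>k\<le>2 * h'. integrable M (\<lambda>x. x ^ k)) \<Longrightarrow>
    (\<forall>k\<le>2 * h'. \<bar>(LINT x|M. x ^ k) - gauss_moment k\<bar> \<le> \<tau>') \<Longrightarrow> \<bar>measure M {..s} - Phi s\<bar> \<le> e"
    by blast
  show ?case
  proof (intro exI[of _ "max h h'"] exI[of _ "min \<tau> \<tau>'"] conjI allI impI ballI)
    fix M x
    assume M: "real_distribution M" "\<forall>k\<le>2 * max h h'. integrable M (\<lambda>x. x ^ k)"
      "\<forall>k\<le>2 * max h h'. \<bar>(LINT x|M. x ^ k) - gauss_moment k\<bar> \<le> min \<tau> \<tau>'" and x: "x \<in> insert s A"
    have "\<forall>s\<in>A. \<bar>measure M {..s} - Phi s\<bar> \<le> e"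
      by (rule 1(2)[OF M(1)]) (use M(2,3) in auto)
    moreover have "\<bar>measure M {..s} - Phi s\<bar> \<le> e"
      by (rule 2(2)[OF M(1)]) (use M(2,3) in auto)
    ultimately show "\<bar>measure M {..x} - Phi x\<bar> \<le> e" using x by auto
  qed (use 1(1) 2(1) in auto)
qed

text \<open>Uniformity in s as in Polya's theorem: distribution functions are monotone and the limit
  is Lipschitz, so finitely many points suffice. An open half-line is squeezed between two closed
  ones.\<close>

lemma moments_determine_cdf:
  assumes "0 < e"
  shows "\<exists>h \<tau>. 0 < \<tau> \<and> (\<forall>M. real_distribution M \<longrightarrow> (\<forall>k\<le>2 * h. integrable M (\<lambda>x. x ^ k)) \<longrightarrow>
    (\<forall>k\<le>2 * h. \<bar>(LINT x|M. x ^ k) - gauss_moment k\<bar> \<le> \<tau>) \<longrightarrow>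
    (\<forall>s. \<bar>measure M {..s} - Phi s\<bar> \<le> e \<and> \<bar>measure M {..<s} - Phi s\<bar> \<le> e))"
proof -
  \<comment> \<open>One third is the error at the grid points, one the mesh of the grid, and one the
    shift from \<open>s\<close> to \<open>s - c\<close> for open half-lines.\<close>
  define c where "c = e / 3"
  have c: "0 < c" using assms by (simp add: c_def)
  have 1: "(Phi \<longlongrightarrow> 0) at_bot" using std_normal.cdf_lim_at_bot unfolding cdf_def .
  have 2: "(Phi \<longlongrightarrow> 1) at_top" using std_normal.cdf_lim_at_top_prob unfolding cdf_def .
  have "\<forall>\<^sub>F x in at_bot. Phi x < c" using order_tendstoD(2)[OF 1 c] .
  moreover have "\<forall>\<^sub>F x in at_top. 1 - c < Phi x" using order_tendstoD(1)[OF 2, of "1 - c"] c by simp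
  ultimately obtain x0 y0 where "Phi x0 < c" "1 - c < Phi y0" 
    unfolding eventually_at_bot_linorder eventually_at_top_linorder by blast
  define R where "R = max \<bar>x0\<bar> \<bar>y0\<bar>"
  have R: "Phi (- R) < c" "1 - c < Phi R"
  proof -
    have "- R \<le> x0" "y0 \<le> R" by (auto simp: R_def)
    from Phi_mono[OF this(1)] Phi_mono[OF this(2)] show "Phi (- R) < c" "1 - c < Phi R"
      using \<open>Phi x0 < c\<close> \<open>1 - c < Phi y0\<close> by linarith+
  qed
  have R0: "0 \<le> R" by (simp add: R_def)
  \<comment> \<open>The grid runs to index \<open>m + 1\<close>, so that the right neighbour of a
    point below \<open>R\<close> is always among the controlled points.\<close>
  define m where "m = nat \<lceil>2 * R / c\<rceil>"
  define g where "g j = - R + real j * c" for j :: nat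
  obtain h \<tau> where ht: "0 < \<tau>" "\<And>M. real_distribution M \<Longrightarrow> (\<forall>k\<le>2 * h. integrable M (\<lambda>x. x ^ k)) \<Longrightarrow>
    (\<forall>k\<le>2 * h. \<bar>(LINT x|M. x ^ k) - gauss_moment k\<bar> \<le> \<tau>) \<Longrightarrow> (\<forall>s\<in>insert R (g ` {..m+1}). \<bar>measure M {..s} - Phi s\<bar> \<le> c)"
    using moments_determine_cdf_finite[OF c, of "insert R (g ` {..m+1})"] by auto
  have "\<bar>measure M {..s} - Phi s\<bar> \<le> e \<and> \<bar>measure M {..<s} - Phi s\<bar> \<le> e"
    if M: "real_distribution M" "\<forall>k\<le>2 * h. integrable M (\<lambda>x. x ^ k)"
      "\<forall>k\<le>2 * h. \<bar>(LINT x|M. x ^ k) - gauss_moment k\<bar> \<le> \<tau>" for M s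
  proof -
    interpret M: real_distribution M by fact
    have mono: "measure M {..x} \<le> measure M {..y}" if "x \<le> y" for x y
      using that by (intro M.finite_measure_mono) auto
    have gr: "\<bar>measure M {..g j} - Phi (g j)\<bar> \<le> c" if "j \<le> m + 1" for j
      using ht(2)[OF M] that by auto
    have R': "\<bar>measure M {..R} - Phi R\<bar> \<le> c" "\<bar>measure M {..-R} - Phi (-R)\<bar> \<le> c"
      using ht(2)[OF M] gr[of 0] by (auto simp: g_def)
    have le: "\<bar>measure M {..s} - Phi s\<bar> \<le> 2 * c" for s
    proof -
      consider "s < - R" | "R \<le> s" | "- R \<le> s" "s < R" by linarith
      then show ?thesis
      proof cases
        case 1
        then show ?thesis using mono[of s "- R"] R' R Phi_mono[of s "- R"] Phi_nonneg[of s] measure_nonneg[of M "{..s}"] by linarith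
      next
        case 2
        then show ?thesis using mono[of R s] R' R Phi_mono[of R s] Phi_le_1[of s] M.prob_le_1[of "{..s}"] by linarith
      next
        case 3
        define j where "j = nat \<lfloor>(s + R) / c\<rfloor>"
        have jr: "real j = of_int \<lfloor>(s + R) / c\<rfloor>" using 3 c by (simp add: j_def)
        have "real j \<le> (s + R) / c" "(s + R) / c < real j + 1" unfolding jr by linarith+
        then have j: "real j * c \<le> s + R" "s + R \<le> (real j + 1) * c" using c by (auto simp: field_simps)
        have "real j \<le> 2 * R / c" using j 3 c by (simp add: field_simps)
        then have "j \<le> m" unfolding m_def by linarith
        then have "\<bar>measure M {..g j} - Phi (g j)\<bar> \<le> c" "\<bar>measure M {..g (Suc j)} - Phi (g (Suc j))\<bar> \<le> c"
          using gr by auto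
        moreover have "g j \<le> s" "s \<le> g (Suc j)" "g (Suc j) - g j = c" using j by (auto simp: g_def algebra_simps)
        ultimately show ?thesis
          using mono[of "g j" s] mono[of s "g (Suc j)"] Phi_diff_le[of "g j" s] Phi_diff_le[of s "g (Suc j)"]
          by auto
      qed
    qed
    have "measure M {..<s} \<le> measure M {..s}" "measure M {..s - c} \<le> measure M {..<s}"
      using c by (auto intro!: M.finite_measure_mono)
    then have "\<bar>measure M {..<s} - Phi s\<bar> \<le> 3 * c"
      using le[of s] le[of "s - c"] Phi_diff_le[of "s - c" s] c by auto
    with le[of s] c show ?thesis by (auto simp: c_def)
  qed
  with ht(1) show ?thesis by (intro exI[of _ h] exI[of _ \<tau>]) simp
qed

lemma Phi_tail: "0 < s \<Longrightarrow> Phi (- s) \<le> 1 / s\<^sup>2"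
proof -
  assume s: "0 < s"
  have "emeasure std_normal_distribution {..-s} \<le> emeasure std_normal_distribution {x \<in> space std_normal_distribution. s\<^sup>2 \<le> x\<^sup>2}"
    using s by (intro emeasure_mono) (auto simp: abs_le_square_iff[symmetric])
  then have "Phi (- s) \<le> measure std_normal_distribution {x \<in> space std_normal_distribution. s\<^sup>2 \<le> x\<^sup>2}"
    by (simp add: std_normal.emeasure_eq_measure)
  also have "\<dots> \<le> (LINT x|std_normal_distribution. x\<^sup>2) / s\<^sup>2"
    using s integrable_std_normal_distribution_moment[of 2] by (intro integral_Markov_inequality_measure[where A = "{}"]) auto
  also have "(LINT x|std_normal_distribution. x\<^sup>2) = 1"
    using std_normal_distribution_even_moments(1)[of 1] by (simp add: eval_nat_numeral)
  finally show ?thesis .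
qed

section \<open>The standard Gaussian\<close>

abbreviation lebesgue_vect :: "nat \<Rightarrow> vect measure" where
  "lebesgue_vect d \<equiv> PiM {..<d} (\<lambda>_. lborel)"

interpretation lborel_product: product_sigma_finite "\<lambda>_::nat. lborel :: real measure"
  by standard

lemma product_sigma_finite_normal: "product_sigma_finite (\<lambda>_::nat. std_normal_distribution)"
  by standard

lemma prob_space_std_gaussian: "prob_space (std_gaussian d)"
  unfolding std_gaussian_def by (intro prob_space_PiM) (auto intro: prob_space_normal_density)

lemma sets_std_gaussian [measurable_cong]: "sets (std_gaussian d) = sets (PiM {..<d} (\<lambda>_. borel :: real measure))"
  unfolding std_gaussian_def by (intro sets_PiM_cong) auto

lemma sets_lebesgue_vect: "sets (lebesgue_vect d) = sets (PiM {..<d} (\<lambda>_. borel :: real measure))"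
  by (intro sets_PiM_cong) auto

lemma measurable_std_gaussian:
  "measurable (std_gaussian d) N = measurable (PiM {..<d} (\<lambda>_. borel :: real measure)) N"
  by (intro measurable_cong_sets sets_std_gaussian refl)

lemma space_std_gaussian: "space (std_gaussian d) = PiE {..<d} (\<lambda>_. UNIV)"
  by (simp add: std_gaussian_def space_PiM)

lemma measurable_dot [measurable (raw)]:
  assumes "f \<in> measurable M (PiM {..<d} (\<lambda>_. borel :: real measure))"
  shows "(\<lambda>x. dot d (f x) v) \<in> borel_measurable M"
proof -
  have "(\<lambda>x. f x j) \<in> borel_measurable M" if "j < d" for j
    using measurable_compose[OF assms measurable_component_singleton[of j]] that by simp
  then show ?thesis unfolding dot_def by (intro borel_measurable_sum borel_measurable_times) auto
qed

lemma std_gaussian_density: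
  "std_gaussian d = density (lebesgue_vect d) (\<lambda>x. \<Prod>j<d. ennreal (std_normal_density (x j)))"
  unfolding std_gaussian_def
proof (rule product_sigma_finite.PiM_eqI[OF product_sigma_finite_normal, symmetric])
  fix A :: "nat \<Rightarrow> real set" assume A: "\<And>i. i \<in> {..<d} \<Longrightarrow> A i \<in> sets std_normal_distribution"
  have "emeasure (density (lebesgue_vect d) (\<lambda>x. \<Prod>j<d. ennreal (std_normal_density (x j)))) (Pi\<^sub>E {..<d} A)
     = (\<integral>\<^sup>+x. (\<Prod>j<d. ennreal (std_normal_density (x j))) * indicator (Pi\<^sub>E {..<d} A) x \<partial>lebesgue_vect d)"
    using A by (subst emeasure_density) (auto intro!: sets_PiM_I_finite)
  also have "\<dots> = (\<integral>\<^sup>+x. (\<Prod>j<d. ennreal (std_normal_density (x j)) * indicator (A j) (x j)) \<partial>lebesgue_vect d)"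
  proof (intro nn_integral_cong)
    fix x assume x: "x \<in> space (lebesgue_vect d)"
    show "(\<Prod>j<d. ennreal (std_normal_density (x j))) * indicator (Pi\<^sub>E {..<d} A) x =
      (\<Prod>j<d. ennreal (std_normal_density (x j)) * indicator (A j) (x j))"
    proof (cases "x \<in> Pi\<^sub>E {..<d} A")
      case True
      then show ?thesis by (auto simp: PiE_iff intro!: prod.cong)
    next
      case False
      with x obtain j where "j < d" "x j \<notin> A j" by (auto simp: space_PiM PiE_iff)
      then have "(\<Prod>j<d. ennreal (std_normal_density (x j)) * indicator (A j) (x j)) = 0" by (intro prod_zero) (auto intro!: bexI[of _ j])
      with False show ?thesis by simp
    qed
  qed
  also have "\<dots> = (\<Prod>j<d. \<integral>\<^sup>+x. ennreal (std_normal_density x) * indicator (A j) x \<partial>lborel)"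
    using A by (intro lborel_product.product_nn_integral_prod) auto
  also have "\<dots> = (\<Prod>j<d. emeasure std_normal_distribution (A j))"
    using A by (intro prod.cong refl) (auto simp: emeasure_density)
  finally show "emeasure (density (lebesgue_vect d) (\<lambda>x. \<Prod>j<d. ennreal (std_normal_density (x j)))) (Pi\<^sub>E {..<d} A)
     = (\<Prod>j<d. emeasure std_normal_distribution (A j))" .
next
  show "sets (density (lebesgue_vect d) (\<lambda>x. \<Prod>j<d. ennreal (std_normal_density (x j)))) = sets (PiM {..<d} (\<lambda>_. std_normal_distribution))"
    unfolding sets_density by (intro sets_PiM_cong) auto
qed simp

lemma translate_lebesgue_vect:
  fixes t :: vect
  shows "distr (lebesgue_vect d) (lebesgue_vect d) (\<lambda>x. \<lambda>j\<in>{..<d}. x j + t j) = lebesgue_vect d"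
proof (rule lborel_product.PiM_eqI)
  fix A :: "nat \<Rightarrow> real set" assume A: "\<And>i. i \<in> {..<d} \<Longrightarrow> A i \<in> sets lborel"
  have "emeasure (distr (lebesgue_vect d) (lebesgue_vect d) (\<lambda>x. \<lambda>j\<in>{..<d}. x j + t j)) (Pi\<^sub>E {..<d} A)
    = emeasure (lebesgue_vect d) ((\<lambda>x. \<lambda>j\<in>{..<d}. x j + t j) -` Pi\<^sub>E {..<d} A \<inter> space (lebesgue_vect d))"
    using A by (intro emeasure_distr) (auto intro!: sets_PiM_I_finite)
  also have "(\<lambda>x. \<lambda>j\<in>{..<d}. x j + t j) -` Pi\<^sub>E {..<d} A \<inter> space (lebesgue_vect d) = Pi\<^sub>E {..<d} (\<lambda>j. (\<lambda>x. x + t j) -` A j)"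
    by (auto simp: space_PiM PiE_iff)
  also have "emeasure (lebesgue_vect d) \<dots> = (\<Prod>j<d. emeasure lborel ((\<lambda>x. x + t j) -` A j))"
  proof (rule lborel_product.emeasure_PiM)
    fix j assume "j \<in> {..<d}"
    then show "(\<lambda>x. x + t j) -` A j \<in> sets lborel"
      using measurable_sets[of "\<lambda>x. x + t j" lborel lborel "A j"] A by auto
  qed simp
  also have "\<dots> = (\<Prod>j<d. emeasure lborel (A j))"
  proof (intro prod.cong refl)
    fix j assume "j \<in> {..<d}"
    then have "emeasure (distr lborel lborel ((+) (t j))) (A j) = emeasure lborel ((+) (t j) -` A j \<inter> space lborel)"
      using A by (intro emeasure_distr) auto
    moreover have "distr lborel lborel ((+) (t j)) = lborel"
      using lborel_distr_plus[of "t j"] by (metis distr_cong sets_lborel)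
    ultimately show "emeasure lborel ((\<lambda>x. x + t j) -` A j) = emeasure lborel (A j)"
      by (simp add: vimage_def add.commute)
  qed
  finally show "emeasure (distr (lebesgue_vect d) (lebesgue_vect d) (\<lambda>x. \<lambda>j\<in>{..<d}. x j + t j)) (Pi\<^sub>E {..<d} A)
    = (\<Prod>j<d. emeasure lborel (A j))" .
qed auto

lemma nn_integral_translate_vect:
  assumes "f \<in> borel_measurable (lebesgue_vect d)"
  shows "(\<integral>\<^sup>+x. f (\<lambda>j\<in>{..<d}. x j + t j) \<partial>lebesgue_vect d) = (\<integral>\<^sup>+x. f x \<partial>lebesgue_vect d)"
  using assms by (subst (2) translate_lebesgue_vect[symmetric, of _ t], subst nn_integral_distr) auto

lemma nn_integral_translate_real:
  fixes f :: "real \<Rightarrow> ennreal"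
  assumes "f \<in> borel_measurable borel"
  shows "(\<integral>\<^sup>+x. f (x - t) \<partial>lborel) = (\<integral>\<^sup>+x. f x \<partial>lborel)"
  using nn_integral_real_affine[of f 1 "- t"] assms by (simp add: add.commute)

text \<open>For a unit vector this is the orthogonal projection along it. The restriction to
  coordinates below \<open>d\<close> keeps the values inside the space of the product
  measure.\<close>

definition perp :: "nat \<Rightarrow> vect \<Rightarrow> vect \<Rightarrow> vect" where
  "perp d v x = (\<lambda>j\<in>{..<d}. x j - dot d x v * v j)"

abbreviation borel_vect :: "nat \<Rightarrow> vect measure" where
  "borel_vect d \<equiv> PiM {..<d} (\<lambda>_. borel)"

lemma measurable_lebesgue_vect [simp]: "measurable (lebesgue_vect d) N = measurable (borel_vect d) N"
  by (intro measurable_cong_sets sets_lebesgue_vect refl)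

definition shift :: "nat \<Rightarrow> vect \<Rightarrow> vect \<Rightarrow> real \<Rightarrow> vect" where
  "shift d v x s = (\<lambda>j\<in>{..<d}. x j + s * v j)"

lemma measurable_shift [measurable]:
  assumes "f \<in> measurable M (borel_vect d)" "g \<in> borel_measurable M"
  shows "(\<lambda>p. shift d v (f p) (g p)) \<in> measurable M (borel_vect d)"
proof -
  have "(\<lambda>x. f x j) \<in> borel_measurable M" if "j < d" for j
    using measurable_compose[OF assms(1) measurable_component_singleton[of j]] that by simp
  then show ?thesis unfolding shift_def using assms(2)
    by (intro measurable_restrict borel_measurable_add borel_measurable_times) auto
qed

lemma dot_shift: "dot d (shift d v x s) v = dot d x v + s * dot d v v"
  by (simp add: dot_def shift_def sum.distrib sum_distrib_left distrib_right mult.assoc)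

lemma normal_density_eq: "std_normal_density x = 1 / sqrt (2 * pi) * exp (- x\<^sup>2 / 2)"
  by (simp add: std_normal_density_def)

lemma prod_normal_density:
  "(\<Prod>j<d. ennreal (std_normal_density (x j))) = ennreal ((1 / sqrt (2 * pi)) ^ d * exp (- dot d x x / 2))"
proof -
  have "(\<Prod>j<d. std_normal_density (x j)) = (1 / sqrt (2 * pi)) ^ d * exp (- dot d x x / 2)"
    by (simp add: normal_density_eq prod.distrib dot_def sum_divide_distrib exp_sum power2_eq_square power_divide
      prod_dividef flip: sum_negf)
  then show ?thesis by (simp add: prod_ennreal)
qed

text \<open>Three shears compose to a rotation by a right angle in the plane spanned by \<open>v\<close> and an extra
  coordinate; each preserves Lebesgue measure and the composition preserves the Gaussian density.\<close>

lemma nn_integral_rotate: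
  assumes v: "dot d v v = 1" and f: "f \<in> borel_measurable (borel_vect d)"
  shows "(\<integral>\<^sup>+x. \<integral>\<^sup>+z. f (shift d v x (z - dot d x v)) \<partial>std_normal_distribution \<partial>std_gaussian d) = (\<integral>\<^sup>+x. f x \<partial>std_gaussian d)"
proof -
  define \<rho> where "\<rho> x = (\<Prod>j<d. ennreal (std_normal_density (x j)))" for x :: vect
  define \<phi> where "\<phi> z = ennreal (std_normal_density z)" for z :: real
  have \<rho>_meas: "\<rho> \<in> borel_measurable (borel_vect d)" unfolding \<rho>_def by measurable
  have \<phi>_meas: "\<phi> \<in> borel_measurable borel" unfolding \<phi>_def by measurable
  define F where "F y w = \<rho> y * (\<phi> w * f y)" for y w
  have F_meas: "(\<lambda>p. F (g p) (h p)) \<in> borel_measurable M"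
    if "g \<in> measurable M (borel_vect d)" "h \<in> borel_measurable M" for g h and M :: "'z measure"
    unfolding F_def using that
    by (intro borel_measurable_times_ennreal measurable_compose[OF _ \<rho>_meas] measurable_compose[OF _ \<phi>_meas] measurable_compose[OF _ f])
  interpret L: sigma_finite_measure "lebesgue_vect d" by (rule lborel_product.sigma_finite) simp
  interpret P: pair_sigma_finite "lebesgue_vect d" lborel by standard
  have dd: "dot d (shift d v x s) (shift d v x s) = dot d x x + 2 * s * dot d x v + s\<^sup>2" for x s
  proof -
    have "dot d (shift d v x s) (shift d v x s) = dot d x x + 2 * s * dot d x v + s\<^sup>2 * dot d v v"
      by (simp add: dot_def shift_def sum.distrib sum_distrib_left algebra_simps power2_eq_square)
    with v show ?thesis by simp
  qed
  define c b where "c = (1 / sqrt (2 * pi)) ^ d" and "b = 1 / sqrt (2 * pi)"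
  have cb: "0 \<le> c" "0 \<le> b" by (auto simp: c_def b_def)
  have rp: "\<rho> x * \<phi> z = ennreal (c * b * exp (- (dot d x x + z\<^sup>2) / 2))" for x z
  proof -
    have "exp (- (dot d x x + z\<^sup>2) / 2) = exp (- dot d x x / 2) * exp (- z\<^sup>2 / 2)"
      by (simp add: exp_add[symmetric] field_simps)
    moreover have "\<rho> x = ennreal (c * exp (- dot d x x / 2))" unfolding \<rho>_def c_def by (rule prod_normal_density)
    moreover have "\<phi> z = ennreal (b * exp (- z\<^sup>2 / 2))" unfolding \<phi>_def b_def normal_density_eq ..
    ultimately show ?thesis using cb by (simp add: ennreal_mult[symmetric] mult_ac)
  qed
  \<comment> \<open>The component \<open>dot d x v\<close> is exchanged for \<open>z\<close>, and
    the extra coordinate becomes \<open>- dot d x v\<close>. The sum of all squares is unchanged,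
    and the joint density depends on nothing else.\<close>
  have inv: "\<rho> x * \<phi> z = \<rho> (shift d v x (z - dot d x v)) * \<phi> (- dot d x v)" for x z
  proof -
    have "dot d (shift d v x (z - dot d x v)) (shift d v x (z - dot d x v)) + (- dot d x v)\<^sup>2 = dot d x x + z\<^sup>2"
      unfolding dd by (simp add: power2_eq_square algebra_simps)
    then show ?thesis by (simp only: rp)
  qed
  have fst_meas: "fst \<in> measurable (lebesgue_vect d \<Otimes>\<^sub>M lborel) (borel_vect d)"
    using measurable_fst[of "lebesgue_vect d" lborel] by (simp only: measurable_cong_sets[OF refl sets_lebesgue_vect])
  have snd_meas: "snd \<in> borel_measurable (lebesgue_vect d \<Otimes>\<^sub>M lborel)"
    using measurable_snd[of "lebesgue_vect d" lborel] by (simp only: measurable_cong_sets[OF refl sets_lborel])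
  have fz: "(\<lambda>z. f (shift d v x (z - dot d x v))) \<in> borel_measurable lborel" if "x \<in> space (borel_vect d)" for x
    using that by (intro measurable_compose[OF measurable_shift f] measurable_const borel_measurable_diff borel_measurable_const)
      simp_all
  have "(\<integral>\<^sup>+x. \<integral>\<^sup>+z. f (shift d v x (z - dot d x v)) \<partial>std_normal_distribution \<partial>std_gaussian d)
    = (\<integral>\<^sup>+x. \<rho> x * (\<integral>\<^sup>+z. \<phi> z * f (shift d v x (z - dot d x v)) \<partial>lborel) \<partial>lebesgue_vect d)"
  proof -
    have "(\<integral>\<^sup>+z. f (shift d v x (z - dot d x v)) \<partial>std_normal_distribution) = (\<integral>\<^sup>+z. \<phi> z * f (shift d v x (z - dot d x v)) \<partial>lborel)"
      if "x \<in> space (borel_vect d)" for x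
      unfolding \<phi>_def by (intro nn_integral_density fz[OF that]) simp_all
    then have "(\<integral>\<^sup>+x. \<integral>\<^sup>+z. f (shift d v x (z - dot d x v)) \<partial>std_normal_distribution \<partial>std_gaussian d)
      = (\<integral>\<^sup>+x. (\<integral>\<^sup>+z. \<phi> z * f (shift d v x (z - dot d x v)) \<partial>lborel) \<partial>std_gaussian d)"
      by (intro nn_integral_cong) (simp add: space_std_gaussian space_PiM)
    also have "\<dots> = (\<integral>\<^sup>+x. \<rho> x * (\<integral>\<^sup>+z. \<phi> z * f (shift d v x (z - dot d x v)) \<partial>lborel) \<partial>lebesgue_vect d)"
      unfolding std_gaussian_density \<rho>_def[symmetric]
    proof (rule nn_integral_density)
      have "(\<lambda>p. \<phi> (snd p) * f (shift d v (fst p) (snd p - dot d (fst p) v))) \<in> borel_measurable (lebesgue_vect d \<Otimes>\<^sub>M lborel)"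
        by (intro borel_measurable_times_ennreal measurable_compose[OF snd_meas \<phi>_meas]
          measurable_compose[OF measurable_shift f] fst_meas borel_measurable_diff snd_meas measurable_dot)
      then show "(\<lambda>x. \<integral>\<^sup>+z. \<phi> z * f (shift d v x (z - dot d x v)) \<partial>lborel) \<in> borel_measurable (lebesgue_vect d)"
        by (intro lborel.borel_measurable_nn_integral) (simp only: case_prod_beta')
    qed (use \<rho>_meas in simp)
    finally show ?thesis .
  qed
  also have "\<dots> = (\<integral>\<^sup>+x. \<integral>\<^sup>+z. F (shift d v x (z - dot d x v)) (- dot d x v) \<partial>lborel \<partial>lebesgue_vect d)"
  proof (intro nn_integral_cong)
    fix x assume "x \<in> space (lebesgue_vect d)"
    then have x: "x \<in> space (borel_vect d)" by (simp add: space_PiM)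
    have "\<rho> x * (\<integral>\<^sup>+z. \<phi> z * f (shift d v x (z - dot d x v)) \<partial>lborel) = (\<integral>\<^sup>+z. \<rho> x * (\<phi> z * f (shift d v x (z - dot d x v))) \<partial>lborel)"
      by (intro nn_integral_cmult[symmetric] borel_measurable_times_ennreal fz[OF x]) (use \<phi>_meas in simp)
    also have "\<dots> = (\<integral>\<^sup>+z. F (shift d v x (z - dot d x v)) (- dot d x v) \<partial>lborel)"
      unfolding F_def mult.assoc[symmetric] inv[of x] ..
    finally show "\<rho> x * (\<integral>\<^sup>+z. \<phi> z * f (shift d v x (z - dot d x v)) \<partial>lborel) = (\<integral>\<^sup>+z. F (shift d v x (z - dot d x v)) (- dot d x v) \<partial>lborel)" .
  qed
  \<comment> \<open>The three shears from here on: \<open>z = s + dot d x v\<close> for fixed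
    \<open>x\<close>, then \<open>y = shift d v x s\<close> for fixed \<open>s\<close>, then a
    translation of \<open>s\<close> by \<open>dot d y v\<close> for fixed \<open>y\<close>. Fubini's
    theorem changes the order in between.\<close>
  also have "\<dots> = (\<integral>\<^sup>+x. \<integral>\<^sup>+s. F (shift d v x s) (s - dot d (shift d v x s) v) \<partial>lborel \<partial>lebesgue_vect d)"
  proof (rule nn_integral_cong)
    fix x assume "x \<in> space (lebesgue_vect d)"
    then have x: "x \<in> space (borel_vect d)" by (simp add: space_PiM)
    have "(\<integral>\<^sup>+z. F (shift d v x (z - dot d x v)) (- dot d x v) \<partial>lborel) = (\<integral>\<^sup>+s. F (shift d v x s) (- dot d x v) \<partial>lborel)"
      using x by (intro nn_integral_translate_real[of "\<lambda>s. F (shift d v x s) (- dot d x v)"] F_meas measurable_shift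
        measurable_const borel_measurable_const measurable_ident_sets refl)
    then show "(\<integral>\<^sup>+z. F (shift d v x (z - dot d x v)) (- dot d x v) \<partial>lborel) = (\<integral>\<^sup>+s. F (shift d v x s) (s - dot d (shift d v x s) v) \<partial>lborel)"
      by (simp add: dot_shift v)
  qed
  also have "\<dots> = (\<integral>\<^sup>+s. \<integral>\<^sup>+x. F (shift d v x s) (s - dot d (shift d v x s) v) \<partial>lebesgue_vect d \<partial>lborel)"
    using F_meas[OF measurable_shift[OF fst_meas snd_meas]
        borel_measurable_diff[OF snd_meas measurable_dot[OF measurable_shift[OF fst_meas snd_meas]]]]
    by (intro P.Fubini'[symmetric]) (simp only: case_prod_beta')
  also have "\<dots> = (\<integral>\<^sup>+s. \<integral>\<^sup>+y. F y (s - dot d y v) \<partial>lebesgue_vect d \<partial>lborel)"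
    
  proof (rule nn_integral_cong)
    fix s
    have "(\<lambda>y. F y (s - dot d y v)) \<in> borel_measurable (borel_vect d)"
      by (intro F_meas borel_measurable_diff borel_measurable_const measurable_dot measurable_ident_sets refl)
    then show "(\<integral>\<^sup>+x. F (shift d v x s) (s - dot d (shift d v x s) v) \<partial>lebesgue_vect d) = (\<integral>\<^sup>+y. F y (s - dot d y v) \<partial>lebesgue_vect d)"
      unfolding shift_def by (intro nn_integral_translate_vect) simp
  qed
  also have "\<dots> = (\<integral>\<^sup>+y. \<integral>\<^sup>+s. F y (s - dot d y v) \<partial>lborel \<partial>lebesgue_vect d)"
    using F_meas[OF fst_meas borel_measurable_diff[OF snd_meas measurable_dot[OF fst_meas]]]
    by (intro P.Fubini') (simp only: case_prod_beta')
  also have "\<dots> = (\<integral>\<^sup>+y. \<integral>\<^sup>+s. F y s \<partial>lborel \<partial>lebesgue_vect d)"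
  proof (rule nn_integral_cong)
    fix y
    have "F y \<in> borel_measurable borel"
      unfolding F_def by (intro borel_measurable_times_ennreal measurable_const \<phi>_meas) auto
    then show "(\<integral>\<^sup>+s. F y (s - dot d y v) \<partial>lborel) = (\<integral>\<^sup>+s. F y s \<partial>lborel)"
      by (rule nn_integral_translate_real)
  qed
  also have "\<dots> = (\<integral>\<^sup>+y. \<rho> y * f y \<partial>lebesgue_vect d)"
  proof (intro nn_integral_cong)
    fix y
    have "(\<integral>\<^sup>+s. F y s \<partial>lborel) = (\<integral>\<^sup>+s. (\<rho> y * f y) * \<phi> s \<partial>lborel)"
      by (intro nn_integral_cong) (simp add: F_def mult_ac)
    also have "\<dots> = (\<rho> y * f y) * (\<integral>\<^sup>+s. \<phi> s \<partial>lborel)" by (intro nn_integral_cmult) (use \<phi>_meas in simp)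
    also have "(\<integral>\<^sup>+s. \<phi> s \<partial>lborel) = 1"
      using prob_space.emeasure_space_1[OF prob_space_normal_density[of 1 0]] by (simp add: \<phi>_def emeasure_density)
    finally show "(\<integral>\<^sup>+s. F y s \<partial>lborel) = \<rho> y * f y" by simp
  qed
  also have "\<dots> = (\<integral>\<^sup>+x. f x \<partial>std_gaussian d)"
    unfolding std_gaussian_density \<rho>_def[symmetric]
    by (rule nn_integral_density[symmetric]) (use \<rho>_meas f in simp_all)
  finally show ?thesis .
qed

lemma measurable_perp [measurable]: "perp d v \<in> measurable (borel_vect d) (borel_vect d)"
proof -
  have "(\<lambda>x. shift d v x (- dot d x v)) \<in> measurable (borel_vect d) (borel_vect d)" by measurable
  then show ?thesis by (simp add: shift_def perp_def[abs_def])
qed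

lemma perp_shift: "dot d v v = 1 \<Longrightarrow> perp d v (shift d v x (z - dot d x v)) = perp d v x"
proof -
  assume "dot d v v = 1"
  then have "dot d (shift d v x (z - dot d x v)) v = z" by (simp add: dot_shift)
  then show ?thesis unfolding perp_def by (simp only:) (auto simp: shift_def algebra_simps)
qed

lemma measurable_fst_gaussian: "fst \<in> measurable (std_gaussian d \<Otimes>\<^sub>M N) (borel_vect d)"
  using measurable_fst[of "std_gaussian d" N] by (simp only: measurable_cong_sets[OF refl sets_std_gaussian])

lemma measurable_snd_normal: "snd \<in> borel_measurable (M \<Otimes>\<^sub>M std_normal_distribution)"
  using measurable_snd[of M std_normal_distribution] by (simp only: measurable_cong_sets[OF refl sets_density] measurable_lborel1 measurable_cong_sets[OF refl sets_lborel])

lemma measurable_rotate: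
  "(\<lambda>(x, z). shift d v x (z - dot d x v)) \<in> measurable (std_gaussian d \<Otimes>\<^sub>M std_normal_distribution) (std_gaussian d)"
  unfolding case_prod_beta' measurable_cong_sets[OF refl sets_std_gaussian]
  by (intro measurable_shift measurable_fst_gaussian borel_measurable_diff measurable_snd_normal measurable_dot)

text \<open>The component along v may be replaced by a fresh normal variable without changing the
  law. In this form the independence of \<open>dot d x v\<close> and \<open>perp d v x\<close> is
  used.\<close>

lemma distr_rotate:
  assumes "dot d v v = 1"
  shows "distr (std_gaussian d \<Otimes>\<^sub>M std_normal_distribution) (std_gaussian d)
    (\<lambda>(x, z). shift d v x (z - dot d x v)) = std_gaussian d" (is "distr ?M _ ?T = _")
proof (rule measure_eqI)
  have T: "?T \<in> measurable ?M (std_gaussian d)"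
    by (rule measurable_rotate)
  fix A assume "A \<in> sets (distr ?M (std_gaussian d) ?T)"
  then have A: "A \<in> sets (std_gaussian d)" by simp
  then have A': "A \<in> sets (borel_vect d)" by (simp add: sets_std_gaussian)
  have "emeasure (distr ?M (std_gaussian d) ?T) A = (\<integral>\<^sup>+x. indicator A x \<partial>distr ?M (std_gaussian d) ?T)"
    using A by simp
  also have "\<dots> = (\<integral>\<^sup>+p. indicator A (?T p) \<partial>?M)"
    by (intro nn_integral_distr T borel_measurable_indicator) (simp add: A)
  also have "\<dots> = (\<integral>\<^sup>+x. \<integral>\<^sup>+z. indicator A (?T (x, z)) \<partial>std_normal_distribution \<partial>std_gaussian d)"
    by (rule std_normal.nn_integral_fst[OF measurable_compose[OF T borel_measurable_indicator[OF A]], symmetric])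
  also have "\<dots> = (\<integral>\<^sup>+x. indicator A x \<partial>std_gaussian d)"
    using nn_integral_rotate[OF assms borel_measurable_indicator[OF A']] by (simp only: prod.case)
  finally show "emeasure (distr ?M (std_gaussian d) ?T) A = emeasure (std_gaussian d) A" using A by simp
qed (rule sets_distr)

text \<open>After the replacement of \<open>distr_rotate\<close>, the component along v is the fresh
  variable and \<open>perp d v x\<close> is unchanged, so the integrand is a product of functions of
  independent arguments and Fubini's theorem applies.\<close>

lemma integral_rotate:
  fixes f g
  assumes v: "dot d v v = 1" and g: "integrable std_normal_distribution g"
    and f: "f \<in> borel_measurable (borel_vect d)" "integrable (std_gaussian d) (\<lambda>x. f (perp d v x))"
  shows "integrable (std_gaussian d) (\<lambda>x. g (dot d x v) * f (perp d v x) :: real)"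
    and "(LINT x|std_gaussian d. g (dot d x v) * f (perp d v x)) =
      (LINT z|std_normal_distribution. g z) * (LINT x|std_gaussian d. f (perp d v x))"
proof -
  let ?M = "std_gaussian d \<Otimes>\<^sub>M std_normal_distribution"
  let ?T = "\<lambda>(x, z). shift d v x (z - dot d x v)"
  let ?h = "\<lambda>x. g (dot d x v) * f (perp d v x)"
  have P: "pair_sigma_finite (std_gaussian d) std_normal_distribution"
    by (intro pair_sigma_finite.intro prob_space_imp_sigma_finite prob_space_std_gaussian prob_space_normal_density) simp
  have gm: "g \<in> borel_measurable borel" using borel_measurable_integrable[OF g] by simp
  have T: "?T \<in> measurable ?M (std_gaussian d)"
    by (rule measurable_rotate)
  have fp: "(\<lambda>x. f (perp d v x)) \<in> borel_measurable (borel_vect d)"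
    using measurable_compose[OF measurable_perp f(1)] .
  have "(\<lambda>x. g (dot d x v)) \<in> borel_measurable (borel_vect d)"
    by (intro measurable_compose[OF measurable_dot gm] measurable_ident_sets refl)
  with fp have h: "?h \<in> borel_measurable (std_gaussian d)"
    unfolding measurable_std_gaussian by (intro borel_measurable_times)
  have eq: "?h (?T p) = f (perp d v (fst p)) * g (snd p)" for p
    by (simp add: case_prod_beta' perp_shift v dot_shift mult.commute)
  have int: "integrable ?M (\<lambda>p. f (perp d v (fst p)) * g (snd p))"
  proof (rule pair_sigma_finite.Fubini_integrable[OF P])
    show "integrable (std_gaussian d) (\<lambda>x. LINT z|std_normal_distribution. norm (f (perp d v (fst (x, z))) * g (snd (x, z))))"
      using f(2) by (simp add: abs_mult)
    show "AE x in std_gaussian d. integrable std_normal_distribution (\<lambda>z. f (perp d v (fst (x, z))) * g (snd (x, z)))"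
      using g by simp
    show "(\<lambda>p. f (perp d v (fst p)) * g (snd p)) \<in> borel_measurable ?M"
      by (intro borel_measurable_times measurable_compose[OF measurable_fst_gaussian fp] measurable_compose[OF measurable_snd_normal gm])
  qed
  have "integrable (distr ?M (std_gaussian d) ?T) ?h \<longleftrightarrow> integrable ?M (\<lambda>p. ?h (?T p))"
    using h by (intro integrable_distr_eq T) 
  then show "integrable (std_gaussian d) ?h" using int unfolding eq distr_rotate[OF v] by simp
  have "(LINT x|distr ?M (std_gaussian d) ?T. ?h x) = (LINT p|?M. ?h (?T p))"
    using h by (intro integral_distr T)
  also have "\<dots> = (LINT p|?M. f (perp d v (fst p)) * g (snd p))" unfolding eq ..
  also have "\<dots> = (LINT x|std_gaussian d. LINT z|std_normal_distribution. f (perp d v x) * g z)"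
    using pair_sigma_finite.integral_fst'[OF P int] by simp
  also have "\<dots> = (LINT z|std_normal_distribution. g z) * (LINT x|std_gaussian d. f (perp d v x))"
    using g f(2) by (simp add: mult.commute)
  finally show "(LINT x|std_gaussian d. ?h x) =
      (LINT z|std_normal_distribution. g z) * (LINT x|std_gaussian d. f (perp d v x))"
    unfolding distr_rotate[OF v] .
qed

lemma
  assumes v: "dot d v v = 1" and g: "integrable std_normal_distribution g"
  shows integrable_dot: "integrable (std_gaussian d) (\<lambda>x. g (dot d x v) :: real)"
    and integral_dot: "(LINT x|std_gaussian d. g (dot d x v)) = (LINT z|std_normal_distribution. g z)"
proof -
  interpret prob_space "std_gaussian d" by (rule prob_space_std_gaussian)
  show "integrable (std_gaussian d) (\<lambda>x. g (dot d x v))"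
    "(LINT x|std_gaussian d. g (dot d x v)) = (LINT z|std_normal_distribution. g z)"
    using integral_rotate[OF v g borel_measurable_const[of 1] integrable_const] by (simp_all add: prob_space)
qed

section \<open>Moments of the standard Gaussian\<close>

definition axis :: "nat \<Rightarrow> vect" where
  "axis i = (\<lambda>j. if j = i then 1 else 0)"

lemma dot_axis: "i < d \<Longrightarrow> dot d x (axis i) = x i" and dot_axis_axis: "i < d \<Longrightarrow> dot d (axis i) (axis i) = 1"
  by (simp_all add: dot_def axis_def if_distrib[of "(*) _"] cong: if_cong)

lemma integrable_coordinate_power: "i < d \<Longrightarrow> integrable (std_gaussian d) (\<lambda>x. x i ^ k)"
  using integrable_dot[OF dot_axis_axis integrable_std_normal_distribution_moment[of k]] by (simp add: dot_axis)

lemma integral_coordinate_power: "i < d \<Longrightarrow> (LINT x|std_gaussian d. x i ^ k) = gauss_moment k"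
  using integral_dot[OF dot_axis_axis integrable_std_normal_distribution_moment[of k]] by (simp add: dot_axis)

lemma dot_self_nonneg [simp]: "0 \<le> dot d x x"
  by (simp add: dot_def sum_nonneg)

lemma dot_commute: "dot d x y = dot d y x"
  by (simp add: dot_def mult.commute)

text \<open>One family of dominating functions for all polynomials in x that occur. It is at least
  one and increasing in the exponent, so lower degrees are absorbed, and it depends on x through its
  norm only.\<close>

definition growth :: "nat \<Rightarrow> nat \<Rightarrow> vect \<Rightarrow> real" where
  "growth d k x = (1 + dot d x x) ^ k"

lemma growth_ge_1: "1 \<le> growth d k x"
  by (simp add: growth_def one_le_power)

lemma growth_mono: "k \<le> l \<Longrightarrow> growth d k x \<le> growth d l x"
  unfolding growth_def by (intro power_increasing) auto

lemma measurable_dot_self [measurable (raw)]: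
  assumes "f \<in> measurable M (borel_vect d)"
  shows "(\<lambda>x. dot d (f x) (f x)) \<in> borel_measurable M"
proof -
  have "(\<lambda>x. f x j) \<in> borel_measurable M" if "j < d" for j
    using measurable_compose[OF assms measurable_component_singleton[of j]] that by simp
  then show ?thesis unfolding dot_def by (intro borel_measurable_sum borel_measurable_times) auto
qed

lemma measurable_growth [measurable]: "growth d k \<in> borel_measurable (borel_vect d)"
  unfolding growth_def by measurable

lemma power_sum_le:
  fixes f :: "'a \<Rightarrow> real"
  assumes "finite A" "A \<noteq> {}" "\<And>i. i \<in> A \<Longrightarrow> 0 \<le> f i"
  shows "(\<Sum>i\<in>A. f i) ^ k \<le> real (card A) ^ k * (\<Sum>i\<in>A. f i ^ k)"
proof -
  obtain i where i: "i \<in> A" "\<And>j. j \<in> A \<Longrightarrow> f j \<le> f i"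
    using Max_in[of "f ` A"] Max_ge[of "f ` A"] assms(1,2) by fastforce
  have "(\<Sum>i\<in>A. f i) \<le> real (card A) * f i" using sum_bounded_above[of A f "f i"] i by simp
  then have "(\<Sum>i\<in>A. f i) ^ k \<le> (real (card A) * f i) ^ k" using assms(3) by (intro power_mono sum_nonneg)
  also have "\<dots> = real (card A) ^ k * f i ^ k" by (simp add: power_mult_distrib)
  also have "f i ^ k \<le> (\<Sum>i\<in>A. f i ^ k)" using assms i by (intro member_le_sum) auto
  finally show ?thesis by (simp add: mult_left_mono)
qed

lemma growth_le: "growth d k x \<le> (real d + 1) ^ k * (1 + (\<Sum>j<d. x j ^ (2 * k)))"
proof -
  \<comment> \<open>The summand one of \<open>growth\<close> is treated as an additional coordinate
    with index \<open>d\<close>.\<close>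
  define f where "f j = (if j < d then (x j)\<^sup>2 else 1)" for j
  have s: "(\<Sum>j<Suc d. f j) = 1 + dot d x x" by (simp add: f_def dot_def power2_eq_square)
  have t: "(\<Sum>j<Suc d. f j ^ k) = 1 + (\<Sum>j<d. x j ^ (2 * k))" by (simp add: f_def power_mult)
  have "(\<Sum>j<Suc d. f j) ^ k \<le> real (card {..<Suc d}) ^ k * (\<Sum>j<Suc d. f j ^ k)"
    by (rule power_sum_le) (auto simp: f_def)
  then show ?thesis unfolding s t growth_def by (simp add: add.commute)
qed

lemma integrable_growth: "integrable (std_gaussian d) (growth d k)"
proof -
  interpret prob_space "std_gaussian d" by (rule prob_space_std_gaussian)
  have "integrable (std_gaussian d) (\<lambda>x. (real d + 1) ^ k * (1 + (\<Sum>j<d. x j ^ (2 * k))))"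
    by (intro integrable_mult_right Bochner_Integration.integrable_add integrable_const
      Bochner_Integration.integrable_sum integrable_coordinate_power) auto
  then show ?thesis
  proof (rule Bochner_Integration.integrable_bound)
    show "AE x in std_gaussian d. norm (growth d k x) \<le> norm ((real d + 1) ^ k * (1 + (\<Sum>j<d. x j ^ (2 * k))))"
    proof (rule AE_I2)
      fix x
      show "norm (growth d k x) \<le> norm ((real d + 1) ^ k * (1 + (\<Sum>j<d. x j ^ (2 * k))))"
        unfolding real_norm_def using growth_le[of d k x] growth_ge_1[of d k x] by linarith
    qed
  qed simp
qed

lemma integral_growth_le:
  "(LINT x|std_gaussian d. growth d k x) \<le> (real d + 1) ^ k * (1 + real d * gauss_moment (2 * k))"
proof -
  interpret prob_space "std_gaussian d" by (rule prob_space_std_gaussian)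
  have i: "integrable (std_gaussian d) (\<lambda>x. \<Sum>j<d. x j ^ (2 * k))"
    by (intro Bochner_Integration.integrable_sum integrable_coordinate_power) auto
  have "(LINT x|std_gaussian d. growth d k x) \<le> (LINT x|std_gaussian d. (real d + 1) ^ k * (1 + (\<Sum>j<d. x j ^ (2 * k))))"
    using i by (intro integral_mono integrable_growth growth_le integrable_mult_right Bochner_Integration.integrable_add integrable_const)
  also have "\<dots> = (real d + 1) ^ k * (1 + (LINT x|std_gaussian d. (\<Sum>j<d. x j ^ (2 * k))))"
    using i by (simp add: prob_space)
  also have "(LINT x|std_gaussian d. (\<Sum>j<d. x j ^ (2 * k))) = (\<Sum>j<d. gauss_moment (2 * k))"
    by (subst Bochner_Integration.integral_sum) (auto simp: integral_coordinate_power intro!: integrable_coordinate_power)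
  finally show ?thesis by simp
qed

lemma integrable_growth_bound:
  assumes "f \<in> borel_measurable (borel_vect d)" "\<And>x. \<bar>f x\<bar> \<le> c * growth d k x"
  shows "integrable (std_gaussian d) f"
proof (rule Bochner_Integration.integrable_bound)
  show "integrable (std_gaussian d) (\<lambda>x. c * growth d k x)" by (intro integrable_mult_right integrable_growth)
  show "AE x in std_gaussian d. norm (f x) \<le> norm (c * growth d k x)"
    using assms(2) by (intro AE_I2) (metis abs_ge_self order_trans real_norm_def)
qed (use assms in simp)

text \<open>An entry of the q-th tensor power of x. A monomial occurs once for each ordering of its
  factors, which is what keeps multinomial coefficients out of
  \<open>dot_power_eq_tensor\<close>.\<close>

definition tensor :: "nat \<Rightarrow> (nat \<Rightarrow> nat) \<Rightarrow> vect \<Rightarrow> real" where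
  "tensor q J x = (\<Prod>l<q. x (J l))"

abbreviation indices :: "nat \<Rightarrow> nat \<Rightarrow> (nat \<Rightarrow> nat) set" where
  "indices d q \<equiv> PiE {..<q} (\<lambda>_. {..<d})"

text \<open>Expanding the power of the sum gives the inner product of two tensor powers. Through
  this identity sums over d^q tensors are computed from a single inner product of vectors.\<close>

lemma dot_power_eq_tensor: "dot d x y ^ q = (\<Sum>J\<in>indices d q. tensor q J x * tensor q J y)"
proof -
  have "dot d x y ^ q = (\<Prod>l<q. \<Sum>j<d. x j * y j)" by (simp add: dot_def)
  also have "\<dots> = (\<Sum>J\<in>indices d q. \<Prod>l<q. x (J l) * y (J l))" by (rule prod_sum_PiE) auto
  finally show ?thesis by (simp add: tensor_def prod.distrib)
qed

lemma abs_coordinate_le: "j < d \<Longrightarrow> \<bar>x j\<bar> \<le> 1 + dot d x x"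
proof -
  assume j: "j < d"
  have "(x j)\<^sup>2 \<le> dot d x x" using j member_le_sum[of j "{..<d}" "\<lambda>j. (x j)\<^sup>2"] by (simp add: dot_def power2_eq_square)
  moreover have "\<bar>x j\<bar> \<le> 1 + (x j)\<^sup>2"
    using sum_squares_ge_zero[of "\<bar>x j\<bar> - 1" 0] by (simp add: power2_eq_square algebra_simps)
  ultimately show ?thesis by simp
qed

lemma abs_tensor_le: "J \<in> indices d q \<Longrightarrow> \<bar>tensor q J x\<bar> \<le> growth d q x"
proof -
  assume J: "J \<in> indices d q"
  have "\<bar>tensor q J x\<bar> = (\<Prod>l<q. \<bar>x (J l)\<bar>)" by (simp add: tensor_def abs_prod)
  also have "\<dots> \<le> (\<Prod>l<q. 1 + dot d x x)" using J by (intro prod_mono) (auto intro!: abs_coordinate_le)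
  finally show ?thesis by (simp add: growth_def)
qed

lemma measurable_tensor: "J \<in> indices d q \<Longrightarrow> tensor q J \<in> borel_measurable (borel_vect d)"
  unfolding tensor_def by (intro borel_measurable_prod measurable_component_singleton) auto

lemma dot_perp_left: "dot d (perp d v x) y = dot d x y - dot d x v * dot d v y"
  by (simp add: perp_def dot_def sum_subtractf sum_distrib_left algebra_simps)

lemma dot_perp_perp:
  assumes "dot d v v = 1"
  shows "dot d (perp d v x) (perp d v y) = dot d x y - dot d x v * dot d y v"
proof -
  have "dot d v (perp d v y) = 0"
    by (subst dot_commute) (simp add: dot_perp_left assms)
  moreover have "dot d x (perp d v y) = dot d x y - dot d x v * dot d y v"
    by (subst dot_commute) (simp add: dot_perp_left dot_commute[of d y x] dot_commute[of d v x])
  ultimately show ?thesis by (simp add: dot_perp_left)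
qed

lemma growth_perp_le: "dot d v v = 1 \<Longrightarrow> growth d k (perp d v x) \<le> growth d k x"
  using dot_self_nonneg[of d "perp d v x"] unfolding growth_def by (intro power_mono) (simp_all add: dot_perp_perp)

lemma integral_dot_power:
  "integrable (std_gaussian d) (\<lambda>x. dot d x w ^ q)"
  "(LINT x|std_gaussian d. dot d x w ^ q) = sqrt (dot d w w) ^ q * gauss_moment q"
proof -
  interpret prob_space "std_gaussian d" by (rule prob_space_std_gaussian)
  define c where "c = sqrt (dot d w w)"
  define v where "v j = w j / c" for j
  have "integrable (std_gaussian d) (\<lambda>x. dot d x w ^ q) \<and>
    (LINT x|std_gaussian d. dot d x w ^ q) = c ^ q * gauss_moment q"
  proof (cases "c = 0")
    case True
    then have "dot d w w = 0" by (simp add: c_def)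
    then have "w j = 0" if "j < d" for j using that by (simp add: dot_def sum_nonneg_eq_0_iff)
    then have "dot d x w = 0" for x by (simp add: dot_def)
    \<comment> \<open>At \<open>q = 0\<close> both sides are one, since
      \<open>0 ^ 0 = 1\<close>.\<close>
    then show ?thesis using True std_normal.prob_space by (cases "q = 0") (auto simp: prob_space)
  next
    case False
    have "c\<^sup>2 = dot d w w" by (simp add: c_def)
    moreover have "dot d v v = dot d w w / c\<^sup>2"
      by (simp add: dot_def v_def sum_divide_distrib power2_eq_square)
    ultimately have v: "dot d v v = 1" using False by auto
    have w: "dot d x w = c * dot d x v" for x using False by (simp add: dot_def v_def sum_distrib_left)
    show ?thesis unfolding w power_mult_distrib
      using integrable_dot[OF v integrable_std_normal_distribution_moment[of q]]
        integral_dot[OF v integrable_std_normal_distribution_moment[of q]] by simp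
  qed
  then show "integrable (std_gaussian d) (\<lambda>x. dot d x w ^ q)"
    "(LINT x|std_gaussian d. dot d x w ^ q) = sqrt (dot d w w) ^ q * gauss_moment q" by (auto simp: c_def)
qed

lemma rising_two_eq_pochhammer: "rising_two x m = 2 ^ m * pochhammer (x / 2) m"
  by (induction m) (simp_all add: rising_two_def pochhammer_Suc field_simps)

text \<open>Vandermonde's identity for rising factorials. It mirrors the binomial expansion of the
  squared norm of two independent orthogonal blocks of a Gaussian vector.\<close>

lemma rising_two_add: "rising_two (x + y) m = (\<Sum>i\<le>m. real (m choose i) * rising_two x i * rising_two y (m - i))"
proof -
  have "pochhammer (x / 2 + y / 2) m = (\<Sum>i\<le>m. real (m choose i) * pochhammer (x / 2) i * pochhammer (y / 2) (m - i))"
    by (rule pochhammer_binomial_sum)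
  moreover have "(2::real) ^ m = 2 ^ i * 2 ^ (m - i)" if "i \<le> m" for i using that by (simp flip: power_add)
  ultimately show ?thesis
    by (simp add: rising_two_eq_pochhammer add_divide_distrib sum_distrib_left) (intro sum.cong, auto)
qed

lemma gauss_moment_even: "gauss_moment (2 * m) = rising_two 1 m"
proof -
  have "fact (2 * m) = 2 ^ m * fact m * rising_two 1 m"
    by (induction m) (simp_all add: rising_two_def algebra_simps)
  then show ?thesis by (subst std_normal_distribution_even_moments) simp
qed

text \<open>Binomial theorem and independence of the two summands. \<open>D'\<close> is left general
  because the lemma is used for partial sums of squared coordinates and for the norm of
  \<open>perp d v x\<close>.\<close>

lemma integral_norm_power_split:
  assumes v: "dot d v v = 1" and A: "\<And>x. D x = D' (perp d v x) + (dot d x v)\<^sup>2"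
    and m: "D' \<in> borel_measurable (borel_vect d)" "\<And>i x. \<bar>D' x ^ i\<bar> \<le> growth d i x"
  shows "(LINT x|std_gaussian d. D x ^ m) =
    (\<Sum>i\<le>m. real (m choose i) * (LINT x|std_gaussian d. D' (perp d v x) ^ i) * rising_two 1 (m - i))"
proof -
  have int: "integrable (std_gaussian d) (\<lambda>x. D' (perp d v x) ^ i)" for i
  proof (rule integrable_growth_bound)
    show "(\<lambda>x. D' (perp d v x) ^ i) \<in> borel_measurable (borel_vect d)"
      by (intro borel_measurable_power measurable_compose[OF measurable_perp m(1)])
    show "\<bar>D' (perp d v x) ^ i\<bar> \<le> 1 * growth d i x" for x
      using order_trans[OF m(2) growth_perp_le[OF v]] by simp
  qed
  note rot = integral_rotate[OF v integrable_std_normal_distribution_moment borel_measurable_power[OF m(1)] int]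
  have "(LINT x|std_gaussian d. D x ^ m) = (LINT x|std_gaussian d. (\<Sum>i\<le>m. real (m choose i) * (dot d x v ^ (2 * (m - i)) * D' (perp d v x) ^ i)))"
    unfolding A binomial_ring power_mult[symmetric] by (simp add: mult_ac)
  also have "\<dots> = (\<Sum>i\<le>m. real (m choose i) * (gauss_moment (2 * (m - i)) * (LINT x|std_gaussian d. D' (perp d v x) ^ i)))"
    using rot by (subst Bochner_Integration.integral_sum) auto
  finally show ?thesis unfolding gauss_moment_even by (simp only: mult_ac)
qed

text \<open>Moments of a chi-squared variable: one coordinate is split off at a time, and
  \<open>rising_two_add\<close> adds up the degrees of freedom.\<close>

lemma integral_partial_norm_power:
  "k \<le> d \<Longrightarrow> (LINT x|std_gaussian d. (\<Sum>j<k. (x j)\<^sup>2) ^ m) = rising_two (real k) m"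
proof (induction k arbitrary: m)
  case 0
  interpret prob_space "std_gaussian d" by (rule prob_space_std_gaussian)
  show ?case by (cases m) (simp_all add: rising_two_def prob_space prod.lessThan_Suc_shift del: prod.lessThan_Suc)
next
  case (Suc k)
  then have k: "k < d" by simp
  have p: "perp d (axis k) x j = x j" if "j < k" for x j
    using that k by (simp add: perp_def axis_def)
  have le: "(\<Sum>j<k. (x j)\<^sup>2) \<le> 1 + dot d x x" for x
    using sum_mono2[of "{..<d}" "{..<k}" "\<lambda>j. (x j)\<^sup>2"] k by (auto simp: dot_def power2_eq_square)
  have "(LINT x|std_gaussian d. (\<Sum>j<Suc k. (x j)\<^sup>2) ^ m) =
    (\<Sum>i\<le>m. real (m choose i) * (LINT x|std_gaussian d. (\<Sum>j<k. (perp d (axis k) x j)\<^sup>2) ^ i) * rising_two 1 (m - i))"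
  proof (rule integral_norm_power_split[OF dot_axis_axis[OF k]])
    show "(\<Sum>j<Suc k. (x j)\<^sup>2) = (\<Sum>j<k. (perp d (axis k) x j)\<^sup>2) + (dot d x (axis k))\<^sup>2" for x
      using k by (simp add: p dot_axis)
    show "\<bar>(\<Sum>j<k. (x j)\<^sup>2) ^ i\<bar> \<le> growth d i x" for i x
      unfolding growth_def using le[of x] by (simp add: power_abs power_mono sum_nonneg)
    show "(\<lambda>x. \<Sum>j<k. (x j)\<^sup>2) \<in> borel_measurable (borel_vect d)"
      using k by (intro borel_measurable_sum borel_measurable_power measurable_component_singleton) auto
  qed
  also have "\<dots> = (\<Sum>i\<le>m. real (m choose i) * rising_two (real k) i * rising_two 1 (m - i))"
    using Suc.IH k by (simp add: p)
  also have "\<dots> = rising_two (real (Suc k)) m" using rising_two_add[of "real k" 1 m] by (simp add: add.commute)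
  finally show ?case .
qed

text \<open>No basis of the orthogonal complement is chosen. Splitting the squared norm of x into
  its parts across and along v expresses the known moments of the whole by those of
  \<open>perp d v x\<close>; this system is triangular with ones on the diagonal, so strong
  induction on m solves it.\<close>

lemma integral_perp_norm_power:
  assumes v: "dot d v v = 1"
  shows "(LINT x|std_gaussian d. dot d (perp d v x) (perp d v x) ^ m) = rising_two (real d - 1) m"
proof (induction m rule: less_induct)
  case (less m)
  define B where "B i = (LINT x|std_gaussian d. dot d (perp d v x) (perp d v x) ^ i)" for i
  define R where "R f = (\<Sum>i\<le>m. real (m choose i) * f i * rising_two 1 (m - i))" for f
  have "rising_two (real d) m = (LINT x|std_gaussian d. dot d x x ^ m)"
    using integral_partial_norm_power[of d d m] by (simp add: dot_def power2_eq_square)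
  also have "\<dots> = R B" unfolding R_def B_def
  proof (rule integral_norm_power_split[OF v])
    show "dot d x x = dot d (perp d v x) (perp d v x) + (dot d x v)\<^sup>2" for x
      using v by (simp add: dot_perp_perp power2_eq_square)
    show "\<bar>dot d x x ^ i\<bar> \<le> growth d i x" for i x
      unfolding growth_def by (simp add: power_abs power_mono)
  qed measurable
  finally have "R B = rising_two (real d) m" ..
  also have "\<dots> = R (rising_two (real d - 1))" using rising_two_add[of "real d - 1" 1 m] by (simp add: R_def)
  finally have "R B = R (rising_two (real d - 1))" .
  moreover have "R f = f m + (\<Sum>i<m. real (m choose i) * f i * rising_two 1 (m - i))" for f
    unfolding R_def lessThan_Suc_atMost[symmetric] by (simp add: rising_two_def)
  ultimately have "B m = rising_two (real d - 1) m" using less.IH by (simp add: B_def)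
  then show ?case by (simp add: B_def)
qed

section \<open>Tents and the disagreement region\<close>

lemma tent_nonneg: "0 \<le> tent \<eta> t x"
  by (simp add: tent_def)

lemma tent_le_1: "0 < \<eta> \<Longrightarrow> tent \<eta> t x \<le> 1"
  by (simp add: tent_def)

lemma tent_eq_0: "0 < \<eta> \<Longrightarrow> \<eta> \<le> \<bar>x - t\<bar> \<Longrightarrow> tent \<eta> t x = 0"
  by (simp add: tent_def)

lemma tent_neg: "tent \<eta> (- t) (- x) = tent \<eta> t x"
  by (simp add: tent_def abs_minus_commute)

lemma tent_scale: "0 < \<eta> \<Longrightarrow> tent \<eta> (k * \<eta>) x = max 0 (1 - \<bar>x / \<eta> - k\<bar>)"
proof -
  assume "0 < \<eta>"
  moreover have "x - k * \<eta> = (x / \<eta> - k) * \<eta>" using \<open>0 < \<eta>\<close> by (simp add: field_simps)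
  ultimately show ?thesis by (simp add: tent_def abs_mult)
qed

lemma borel_measurable_tent [measurable (raw)]:
  "f \<in> borel_measurable M \<Longrightarrow> (\<lambda>x. tent \<eta> t (f x)) \<in> borel_measurable M"
  unfolding tent_def by (intro borel_measurable_max borel_measurable_const borel_measurable_diff
    borel_measurable_divide borel_measurable_abs)

text \<open>Only the tents at the two multiples of \<eta> that enclose x can be nonzero, and they
  take complementary values.\<close>

lemma sum_tents:
  fixes I :: "int set" and x :: real
  assumes \<eta>: "0 < \<eta>" and I: "finite I"
  defines "j \<equiv> \<lfloor>x / \<eta>\<rfloor>"
  shows "(\<Sum>k\<in>I. tent \<eta> (of_int k * \<eta>) x) =
    (if j \<in> I then 1 - frac (x / \<eta>) else 0) + (if j + 1 \<in> I then frac (x / \<eta>) else 0)"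
proof -
  define s where "s = frac (x / \<eta>)"
  have s: "0 \<le> s" "s < 1" unfolding s_def by (rule frac_ge_0, rule frac_lt_1)
  have xs: "x / \<eta> = of_int j + s" by (simp add: s_def j_def frac_def)
  have t: "tent \<eta> (of_int k * \<eta>) x = (if k = j then 1 - s else 0) + (if k = j + 1 then s else 0)" for k
  proof -
    consider "k \<le> j - 1" | "k = j" | "k = j + 1" | "j + 2 \<le> k" by linarith
    then show ?thesis
    proof cases
      case 1
      then have "real_of_int k \<le> of_int j - 1" by linarith
      then show ?thesis unfolding tent_scale[OF \<eta>] xs using s 1 by auto
    next
      case 4
      then have "real_of_int k \<ge> of_int j + 2" by linarith
      then show ?thesis unfolding tent_scale[OF \<eta>] xs using s 4 by auto
    qed (use s in \<open>auto simp: tent_scale[OF \<eta>] xs\<close>)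
  qed
  show ?thesis unfolding t sum.distrib s_def[symmetric] using I by (simp add: sum.delta)
qed

lemma sum_tents_le_1: "0 < \<eta> \<Longrightarrow> finite I \<Longrightarrow> (\<Sum>k\<in>I. tent \<eta> (of_int k * \<eta>) x) \<le> 1"
  using frac_ge_0[of "x / \<eta>"] frac_lt_1[of "x / \<eta>"] by (simp add: sum_tents)

lemma sum_tents_eq_1:
  assumes \<eta>: "0 < \<eta>" and x: "of_int p * \<eta> \<le> x" "x \<le> of_int q * \<eta>"
  shows "(\<Sum>k\<in>{p..q}. tent \<eta> (of_int k * \<eta>) x) = 1"
proof -
  define j where "j = \<lfloor>x / \<eta>\<rfloor>"
  have y: "of_int p \<le> x / \<eta>" "x / \<eta> \<le> of_int q" using \<eta> x by (auto simp: field_simps)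
  then have "p \<le> j" "j \<le> q" unfolding j_def by (auto simp: le_floor_iff floor_le_iff)
  \<comment> \<open>If the right neighbour lies outside the range, then x is the last centre and the
    missing tent vanishes there.\<close>
  moreover have "frac (x / \<eta>) = 0" if "\<not> j + 1 \<le> q"
  proof -
    have "j = q" using that \<open>j \<le> q\<close> by simp
    then have "of_int q \<le> x / \<eta>" unfolding j_def by (metis of_int_floor_le)
    with y have "x / \<eta> = of_int q" by simp
    then show ?thesis by simp
  qed
  ultimately show ?thesis using sum_tents[OF \<eta>, of "{p..q}" x] by (auto simp: j_def)
qed

text \<open>A single formula above the minimum of \<open>\<kappa>\<close> and
  \<open>1 / y\<^sup>2\<close>; the two agree at \<open>y = 1 / sqrt \<kappa>\<close>, where the
  formula attains their value. Its sum over equally spaced points is bounded by a telescoping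
  one.\<close>

definition tail_bound :: "real \<Rightarrow> real \<Rightarrow> real" where
  "tail_bound \<kappa> y = 4 * \<kappa> / (1 + sqrt \<kappa> * y)\<^sup>2"

lemma tail_bound_ge:
  assumes \<kappa>: "0 < \<kappa>" and y: "0 \<le> y" and z: "z \<le> \<kappa>" "0 < y \<Longrightarrow> z \<le> 1 / y\<^sup>2"
  shows "z \<le> tail_bound \<kappa> y"
proof (cases "sqrt \<kappa> * y \<le> 1")
  case True
  then have "(1 + sqrt \<kappa> * y)\<^sup>2 \<le> 2\<^sup>2" using \<kappa> y by (intro power_mono) auto
  moreover have "0 < 1 + sqrt \<kappa> * y" using \<kappa> y by (simp add: add_pos_nonneg)
  ultimately have "\<kappa> \<le> tail_bound \<kappa> y" unfolding tail_bound_def using \<kappa>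
    by (subst pos_le_divide_eq) auto
  with z show ?thesis by simp
next
  case False
  then have y0: "0 < y" using y by (cases "y = 0") auto
  have "(1 + sqrt \<kappa> * y)\<^sup>2 \<le> (2 * (sqrt \<kappa> * y))\<^sup>2"
  proof (rule power_mono)
    show "1 + sqrt \<kappa> * y \<le> 2 * (sqrt \<kappa> * y)" using False by linarith
  qed (use \<kappa> y in simp)
  also have "\<dots> = 4 * \<kappa> * y\<^sup>2" using \<kappa> by (simp add: power_mult_distrib)
  finally have sq: "(1 + sqrt \<kappa> * y)\<^sup>2 \<le> 4 * \<kappa> * y\<^sup>2" .
  have pos: "0 < 1 + sqrt \<kappa> * y" using \<kappa> y0 by (simp add: add_pos_nonneg)
  from sq have "1 / y\<^sup>2 \<le> tail_bound \<kappa> y" unfolding tail_bound_def using \<kappa> y0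
    using pos by (simp add: divide_simps)
  with z y0 show ?thesis by simp
qed

text \<open>The square in the denominator is replaced by a product of neighbouring terms, and the
  sum telescopes. The bound does not grow with the number of strips; its main term is sqrt \<kappa>
  / c, and 1 / c will be comparable to the angle.\<close>

lemma sum_tail_bound_le:
  assumes \<kappa>: "0 < \<kappa>" and c: "0 < c" and \<eta>: "0 < \<eta>"
  shows "(\<Sum>j<n. \<eta> * tail_bound \<kappa> (c * (real j * \<eta>))) \<le> 4 * \<kappa> * \<eta> + 4 * sqrt \<kappa> / c"
proof (cases n)
  case 0
  then show ?thesis using assms by simp
next
  case (Suc m)
  define B where "B = sqrt \<kappa> * c"
  have B: "0 < B" using \<kappa> c by (simp add: B_def)
  define u where "u j = 1 + B * (real j * \<eta>)" for j
  have u: "0 < u j" for j using B \<eta> by (simp add: u_def add_pos_nonneg)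
  have t: "tail_bound \<kappa> (c * (real j * \<eta>)) = 4 * \<kappa> / (u j)\<^sup>2" for j
    by (simp add: tail_bound_def u_def B_def mult.assoc)
  have step: "\<eta> / (u (Suc j))\<^sup>2 \<le> (1 / B) * (1 / u j - 1 / u (Suc j))" for j
  proof -
    have "u (Suc j) - u j = B * \<eta>" by (simp add: u_def algebra_simps)
    then have "1 / u j - 1 / u (Suc j) = B * \<eta> / (u j * u (Suc j))"
      using u[of j] u[of "Suc j"] by (simp add: divide_simps)
    moreover have "u j * u (Suc j) \<le> (u (Suc j))\<^sup>2" unfolding power2_eq_square
      using u[of "Suc j"] B \<eta> by (intro mult_right_mono) (auto simp: u_def)
    then have "\<eta> / (u (Suc j))\<^sup>2 \<le> \<eta> / (u j * u (Suc j))" using \<eta> u[of j] u[of "Suc j"] by (intro divide_left_mono mult_pos_pos zero_less_power) auto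
    ultimately show ?thesis using B by simp
  qed
  have "(\<Sum>j<n. \<eta> / (u j)\<^sup>2) = \<eta> / (u 0)\<^sup>2 + (\<Sum>j<m. \<eta> / (u (Suc j))\<^sup>2)"
    unfolding Suc by (rule sum.lessThan_Suc_shift)
  also have "\<eta> / (u 0)\<^sup>2 = \<eta>" by (simp add: u_def)
  also have "(\<Sum>j<m. \<eta> / (u (Suc j))\<^sup>2) \<le> (\<Sum>j<m. (1 / B) * (1 / u j - 1 / u (Suc j)))"
    by (intro sum_mono step)
  also have "\<dots> = (1 / B) * (1 / u 0 - 1 / u m)"
    unfolding sum_distrib_left[symmetric] sum_lessThan_telescope'[of "\<lambda>j. 1 / u j"] ..
  also have "\<dots> \<le> (1 / B) * 1" using B u[of m] by (intro mult_left_mono) (auto simp: u_def)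
  finally have *: "(\<Sum>j<n. \<eta> / (u j)\<^sup>2) \<le> \<eta> + 1 / B" by simp
  have "(\<Sum>j<n. \<eta> * tail_bound \<kappa> (c * (real j * \<eta>))) = 4 * \<kappa> * (\<Sum>j<n. \<eta> / (u j)\<^sup>2)"
    unfolding t sum_distrib_left by (intro sum.cong) auto
  also have "\<dots> \<le> 4 * \<kappa> * (\<eta> + 1 / B)" using * \<kappa> by (intro mult_left_mono) auto
  also have "4 * \<kappa> * (1 / B) = 4 * sqrt \<kappa> / c"
    using \<kappa> c real_sqrt_mult_self[of \<kappa>] unfolding B_def by (simp add: field_simps)
  then have "4 * \<kappa> * (\<eta> + 1 / B) = 4 * \<kappa> * \<eta> + 4 * sqrt \<kappa> / c" by (simp add: distrib_left)
  finally show ?thesis .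
qed

lemma sum_abs_diff_monotone:
  fixes \<Psi> :: "nat \<Rightarrow> real"
  assumes "mono \<Psi> \<or> antimono \<Psi>" and "\<And>n. 0 \<le> \<Psi> n \<and> \<Psi> n \<le> 1"
  shows "(\<Sum>k<n. \<bar>\<Psi> k - \<Psi> (Suc k)\<bar>) \<le> 1"
proof -
  have "(\<Sum>k<n. \<bar>\<Psi> k - \<Psi> (Suc k)\<bar>) = \<bar>\<Psi> 0 - \<Psi> n\<bar>"
    using assms(1)
  proof
    assume m: "mono \<Psi>"
    have "(\<Sum>k<n. \<bar>\<Psi> k - \<Psi> (Suc k)\<bar>) = (\<Sum>k<n. \<Psi> (Suc k) - \<Psi> k)"
    proof (intro sum.cong refl)
      fix k show "\<bar>\<Psi> k - \<Psi> (Suc k)\<bar> = \<Psi> (Suc k) - \<Psi> k" using monoD[OF m, of k "Suc k"] by simp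
    qed
    also have "\<dots> = \<Psi> n - \<Psi> 0" by (rule sum_lessThan_telescope)
    finally show ?thesis using monoD[OF m, of 0 n] by simp
  next
    assume m: "antimono \<Psi>"
    have "(\<Sum>k<n. \<bar>\<Psi> k - \<Psi> (Suc k)\<bar>) = (\<Sum>k<n. \<Psi> k - \<Psi> (Suc k))"
    proof (intro sum.cong refl)
      fix k show "\<bar>\<Psi> k - \<Psi> (Suc k)\<bar> = \<Psi> k - \<Psi> (Suc k)" using antimonoD[OF m, of k "Suc k"] by simp
    qed
    also have "\<dots> = \<Psi> 0 - \<Psi> n" by (rule sum_lessThan_telescope')
    finally show ?thesis using antimonoD[OF m, of 0 n] by simp
  qed
  also have "\<dots> \<le> 1" using assms(2)[of 0] assms(2)[of n] by (auto simp: abs_le_iff)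
  finally show ?thesis .
qed

text \<open>\<open>a\<close> stands for the component along \<open>v\<close> and \<open>b\<close> for the component in an orthogonal direction.\<close>

locale strip_model = prob_space M for M :: "'a measure" +
  fixes a b :: "'a \<Rightarrow> real" and \<eta> :: real and L :: nat and g :: "real \<Rightarrow> real" and \<kappa> \<omega> :: real
  assumes a [measurable]: "a \<in> borel_measurable M" and b [measurable]: "b \<in> borel_measurable M"
    and \<eta>: "0 < \<eta>" and \<kappa>: "0 < \<kappa>" "\<kappa> \<le> 1"
    and g: "\<And>k. k \<le> L \<Longrightarrow> 0 \<le> g (real k * \<eta>)" "\<And>k. k \<le> L \<Longrightarrow> g (real k * \<eta>) \<le> 1"
    and mass: "\<And>k. k \<le> L \<Longrightarrow> \<bar>expectation (\<lambda>x. tent \<eta> (real k * \<eta>) (a x)) - \<eta> * g (real k * \<eta>)\<bar> \<le> \<kappa> * \<eta>"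
    and cdf_lt: "\<And>k s. k \<le> L \<Longrightarrow> \<bar>expectation (\<lambda>x. tent \<eta> (real k * \<eta>) (a x) * indicator {..<s} (b x))
       - expectation (\<lambda>x. tent \<eta> (real k * \<eta>) (a x)) * Phi s\<bar> \<le> \<kappa> * expectation (\<lambda>x. tent \<eta> (real k * \<eta>) (a x))"
    and cdf_le: "\<And>k s. k \<le> L \<Longrightarrow> \<bar>expectation (\<lambda>x. tent \<eta> (real k * \<eta>) (a x) * indicator {..s} (b x))
       - expectation (\<lambda>x. tent \<eta> (real k * \<eta>) (a x)) * Phi s\<bar> \<le> \<kappa> * expectation (\<lambda>x. tent \<eta> (real k * \<eta>) (a x))"
    and second: "\<And>k. k \<le> L \<Longrightarrow> integrable M (\<lambda>x. tent \<eta> (real k * \<eta>) (a x) * (b x)\<^sup>2)"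
      "\<And>k. k \<le> L \<Longrightarrow> expectation (\<lambda>x. tent \<eta> (real k * \<eta>) (a x) * (b x)\<^sup>2) \<le> 2 * expectation (\<lambda>x. tent \<eta> (real k * \<eta>) (a x))"
    and square: "integrable M (\<lambda>x. (b x)\<^sup>2)" "expectation (\<lambda>x. (b x)\<^sup>2) \<le> 2"
    and tail: "prob {x \<in> space M. real L * \<eta> < a x} \<le> \<omega>"
begin

definition "W k x = tent \<eta> (real k * \<eta>) (a x)"

definition "p k = expectation (W k)"

lemma W_meas [measurable]: "W k \<in> borel_measurable M"
  unfolding W_def by measurable

lemma W_bounds: "0 \<le> W k x" "W k x \<le> 1"
  using \<eta> by (auto simp: W_def tent_nonneg tent_le_1)

lemma integrable_W [simp]: "integrable M (W k)"
  by (intro integrable_const_bound[where B = 1]) (use W_bounds in auto)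

lemma integrable_W_mult:
  "f \<in> borel_measurable M \<Longrightarrow> (\<And>x. \<bar>f x\<bar> \<le> 1) \<Longrightarrow> integrable M (\<lambda>x. W k x * f x)"
  by (intro integrable_const_bound[where B = 1]) (use W_bounds in \<open>auto simp: abs_mult intro!: mult_le_one\<close>)

lemma p_bounds: "0 \<le> p k" "k \<le> L \<Longrightarrow> p k \<le> 2 * \<eta>"
proof -
  show "0 \<le> p k" unfolding p_def using W_bounds by (intro integral_nonneg_AE) auto
  assume k: "k \<le> L"
  have "p k \<le> \<eta> * g (real k * \<eta>) + \<kappa> * \<eta>" using mass[OF k] unfolding p_def W_def by linarith
  also have "\<dots> \<le> \<eta> * 1 + 1 * \<eta>" using g[OF k] \<kappa> \<eta> by (intro add_mono mult_left_mono mult_right_mono) auto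
  finally show "p k \<le> 2 * \<eta>" by simp
qed

text \<open>Upper estimates use closed half-lines and lower ones open half-lines, since events are
  known only up to the boundary. The error is relative to the mass of the strip.\<close>

definition cdf_error :: "nat \<Rightarrow> real \<Rightarrow> real \<Rightarrow> bool" where
  "cdf_error k s e \<longleftrightarrow> \<bar>expectation (\<lambda>x. W k x * indicator {..<s} (b x)) - p k * Phi s\<bar> \<le> e * p k \<and>
    \<bar>expectation (\<lambda>x. W k x * indicator {..s} (b x)) - p k * Phi s\<bar> \<le> e * p k"

lemma cdf_error_const: "k \<le> L \<Longrightarrow> cdf_error k s \<kappa>"
  using cdf_lt[of k s] cdf_le[of k s] by (simp add: cdf_error_def W_def[abs_def] p_def)

text \<open>Far out, both quantities are small by themselves: Chebyshev's inequality with the second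
  moment in the strip, at most twice its mass, and for the normal distribution
  \<open>Phi_tail\<close>.\<close>

lemma cdf_error_tail:
  assumes k: "k \<le> L" and s: "0 < s"
  shows "cdf_error k (- s) (2 / s\<^sup>2)"
proof -
  have le: "expectation (\<lambda>x. W k x * indicator A (b x)) \<le> 2 / s\<^sup>2 * p k \<and> 0 \<le> expectation (\<lambda>x. W k x * indicator A (b x))"
    if A: "A \<in> sets borel" "A \<subseteq> {..-s}" for A
  proof
    have "expectation (\<lambda>x. W k x * indicator A (b x)) \<le> expectation (\<lambda>x. W k x * (b x)\<^sup>2 / s\<^sup>2)"
    proof (rule integral_mono)
      show "integrable M (\<lambda>x. W k x * indicator A (b x))" using A
        by (intro integrable_W_mult) (auto simp: indicator_def)
      show "integrable M (\<lambda>x. W k x * (b x)\<^sup>2 / s\<^sup>2)" using second(1)[OF k] by (simp add: W_def)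
      show "W k x * indicator A (b x) \<le> W k x * (b x)\<^sup>2 / s\<^sup>2" for x
      proof (cases "b x \<in> A")
        case True
        then have "s \<le> \<bar>b x\<bar>" using A by auto
        then have "s\<^sup>2 \<le> (b x)\<^sup>2" using s by (simp add: abs_le_square_iff[symmetric])
        then have "W k x * 1 \<le> W k x * ((b x)\<^sup>2 / s\<^sup>2)" using s W_bounds by (intro mult_left_mono) (auto simp: divide_simps)
        with True show ?thesis by simp
      qed (use W_bounds in auto)
    qed
    also have "\<dots> = expectation (\<lambda>x. W k x * (b x)\<^sup>2) / s\<^sup>2" by simp
    also have "\<dots> \<le> 2 * p k / s\<^sup>2" using second(2)[OF k] s by (intro divide_right_mono) (auto simp: W_def[abs_def] p_def)
    finally show "expectation (\<lambda>x. W k x * indicator A (b x)) \<le> 2 / s\<^sup>2 * p k" by simp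
    show "0 \<le> expectation (\<lambda>x. W k x * indicator A (b x))" using W_bounds by (intro integral_nonneg_AE) auto
  qed
  have "p k * Phi (- s) \<le> p k * (1 / s\<^sup>2)" using Phi_tail[OF s] p_bounds(1) by (intro mult_left_mono)
  also have "\<dots> \<le> 2 / s\<^sup>2 * p k" using p_bounds(1)[of k] by (simp add: divide_right_mono)
  finally have "p k * Phi (- s) \<le> 2 / s\<^sup>2 * p k" .
  moreover have "0 \<le> p k * Phi (- s)" using p_bounds(1)[of k] by simp
  moreover have "expectation (\<lambda>x. W k x * indicator {..<-s} (b x)) \<le> 2 / s\<^sup>2 * p k \<and> 0 \<le> expectation (\<lambda>x. W k x * indicator {..<-s} (b x))"
    by (rule le) auto
  moreover have "expectation (\<lambda>x. W k x * indicator {..-s} (b x)) \<le> 2 / s\<^sup>2 * p k \<and> 0 \<le> expectation (\<lambda>x. W k x * indicator {..-s} (b x))"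
    by (rule le) auto
  ultimately show ?thesis unfolding cdf_error_def by (intro conjI; linarith)
qed

definition "\<Psi> c k = Phi (- (c * (real k * \<eta>)))"

text \<open>\<open>D\<close> is pinned down only where \<open>a\<close> is positive, and the line
  \<open>b x = - (c * a x)\<close> is left free. So the notion fits the disagreement region, which
  is open on one side and closed on the other because of the convention at zero, its reflection
  through the origin, and the closed Gaussian wedge.\<close>

definition "half_event c D \<longleftrightarrow> D \<in> events \<and>
  (\<forall>x\<in>space M. 0 < a x \<longrightarrow> (b x < - (c * a x) \<longrightarrow> x \<in> D) \<and> (x \<in> D \<longrightarrow> b x \<le> - (c * a x)))"

text \<open>In the strip around \<open>k * \<eta>\<close> the threshold \<open>- c * a\<close> lies between the thresholds at the centres
  of the two neighbouring strips.\<close>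

lemma strip_error:
  assumes D: "half_event c D" and k: "1 \<le> k" "k \<le> L"
    and e: "cdf_error k (- (c * (real (k - 1) * \<eta>))) e" "cdf_error k (- (c * (real (Suc k) * \<eta>))) e"
  shows "\<bar>expectation (\<lambda>x. W k x * indicator D x) - p k * \<Psi> c k\<bar>
    \<le> p k * (\<bar>\<Psi> c (k - 1) - \<Psi> c k\<bar> + \<bar>\<Psi> c k - \<Psi> c (Suc k)\<bar> + e)"
proof -
  define u where "u = - (c * (real (k - 1) * \<eta>))"
  define w where "w = - (c * (real (Suc k) * \<eta>))"
  define A where "A = expectation (\<lambda>x. W k x * indicator D x)"
  have Dm: "D \<in> events" using D by (simp add: half_event_def)
  \<comment> \<open>For negative \<open>c\<close> the two thresholds change order, hence
    \<open>min\<close> and \<open>max\<close>. Since \<open>k\<close> is at least one, the strip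
    lies in the half-plane where \<open>D\<close> is known.\<close>
  have between: "min u w \<le> - (c * a x) \<and> - (c * a x) \<le> max u w \<and> 0 < a x" if "W k x \<noteq> 0" for x
  proof -
    have "\<bar>a x - real k * \<eta>\<bar> < \<eta>" using that tent_eq_0[OF \<eta>] unfolding W_def by (meson not_le)
    then have "real (k - 1) * \<eta> < a x" "a x < real (Suc k) * \<eta>" using k by (auto simp: of_nat_diff algebra_simps abs_less_iff)
    moreover have "0 \<le> real (k - 1) * \<eta>" using \<eta> by simp
    ultimately have 1: "0 < a x" and 2: "real (k - 1) * \<eta> \<le> a x" "a x \<le> real (Suc k) * \<eta>" by linarith+
    show ?thesis
    proof (cases "0 \<le> c")
      case True
      then have "c * (real (k - 1) * \<eta>) \<le> c * a x" "c * a x \<le> c * (real (Suc k) * \<eta>)" using 2 by (auto intro: mult_left_mono)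
      with 1 show ?thesis unfolding u_def w_def by auto
    next
      case False
      then have "c * a x \<le> c * (real (k - 1) * \<eta>)" "c * (real (Suc k) * \<eta>) \<le> c * a x" using 2 by (auto intro: mult_left_mono_neg)
      with 1 show ?thesis unfolding u_def w_def by auto
    qed
  qed
  have iD: "integrable M (\<lambda>x. W k x * indicator D x)" using Dm by (intro integrable_W_mult) (auto simp: indicator_def)
  have ib: "integrable M (\<lambda>x. W k x * indicator B (b x))" if "B \<in> sets borel" for B
    using that by (intro integrable_W_mult) (auto simp: indicator_def)
  have up: "A \<le> expectation (\<lambda>x. W k x * indicator {..max u w} (b x))"
    unfolding A_def
  proof (rule integral_mono[OF iD ib])
    fix x assume "x \<in> space M"
    then show "W k x * indicator D x \<le> W k x * indicator {..max u w} (b x)"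
      using between[of x] D W_bounds[of k x] unfolding half_event_def by (cases "W k x = 0") (auto simp: indicator_def)
  qed simp
  have lo: "expectation (\<lambda>x. W k x * indicator {..<min u w} (b x)) \<le> A"
    unfolding A_def
  proof (rule integral_mono[OF ib iD])
    fix x assume "x \<in> space M"
    then show "W k x * indicator {..<min u w} (b x) \<le> W k x * indicator D x"
      using between[of x] D W_bounds[of k x] unfolding half_event_def by (cases "W k x = 0") (auto simp: indicator_def)
  qed simp
  have Pu: "Phi u = \<Psi> c (k - 1)" and Pw: "Phi w = \<Psi> c (Suc k)" by (simp_all only: \<Psi>_def u_def w_def)
  define d where "d = \<bar>\<Psi> c (k - 1) - \<Psi> c k\<bar> + \<bar>\<Psi> c k - \<Psi> c (Suc k)\<bar>"
  have near: "\<bar>Phi u - \<Psi> c k\<bar> \<le> d" "\<bar>Phi w - \<Psi> c k\<bar> \<le> d" unfolding Pu Pw d_def by linarith+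
  have s: "expectation (\<lambda>x. W k x * indicator {..t} (b x)) \<le> p k * (\<Psi> c k + d + e) \<and>
     p k * (\<Psi> c k - d - e) \<le> expectation (\<lambda>x. W k x * indicator {..<t} (b x))" if "t = u \<or> t = w" for t
  proof -
    have 1: "cdf_error k t e" using e that unfolding u_def w_def by blast
    have "\<bar>Phi t - \<Psi> c k\<bar> \<le> d" using near that by auto
    then have "p k * Phi t \<le> p k * (\<Psi> c k + d)" "p k * (\<Psi> c k - d) \<le> p k * Phi t"
      using p_bounds(1) by (auto intro!: mult_left_mono)
    moreover have "p k * (\<Psi> c k + d + e) = p k * (\<Psi> c k + d) + e * p k" "p k * (\<Psi> c k - d - e) = p k * (\<Psi> c k - d) - e * p k"
      by (simp_all add: algebra_simps)
    ultimately show ?thesis using 1 unfolding cdf_error_def by linarith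
  qed
  have "A \<le> p k * (\<Psi> c k + d + e)" using up s[of "max u w"] by (auto simp: max_def split: if_splits)
  moreover have "p k * (\<Psi> c k - d - e) \<le> A" using lo s[of "min u w"] by (auto simp: min_def split: if_splits)
  ultimately show ?thesis unfolding A_def[symmetric] d_def[symmetric] abs_le_iff by (simp add: algebra_simps)
qed

text \<open>A Riemann sum for the probability of the wedge. It depends on the widths, the targets
  and \<open>c\<close> only, so the dataset, its reflection and the Gaussian share it, and its value
  is never computed.\<close>

definition "Q c = (\<Sum>k\<in>{1..L}. \<eta> * g (real k * \<eta>) * \<Psi> c k)"

text \<open>The tents with index from 1 to \<open>L\<close> vanish for \<open>a x \<le> 0\<close>.
  What they miss of the half-plane lies under the tent at zero, of mass at most
  \<open>2 * \<eta>\<close>, or beyond the last centre.\<close>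

lemma half_split:
  assumes D: "half_event c D"
  shows "\<bar>prob (D \<inter> {x \<in> space M. 0 < a x}) - (\<Sum>k\<in>{1..L}. expectation (\<lambda>x. W k x * indicator D x))\<bar>
    \<le> 2 * \<eta> + prob (D \<inter> {x \<in> space M. real L * \<eta> < a x})"
proof -
  have Dm: "D \<in> events" using D by (simp add: half_event_def)
  define P where "P = D \<inter> {x \<in> space M. 0 < a x}"
  define T where "T = D \<inter> {x \<in> space M. real L * \<eta> < a x}"
  have Pm [measurable]: "P \<in> events" "T \<in> events" using Dm unfolding P_def T_def by auto
  define S where "S x = (\<Sum>k\<in>{1..L}. W k x * indicator D x)" for x
  have iS: "integrable M S" unfolding S_def using Dm
    by (intro Bochner_Integration.integrable_sum integrable_W_mult) (auto simp: indicator_def)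
  have eS: "expectation S = (\<Sum>k\<in>{1..L}. expectation (\<lambda>x. W k x * indicator D x))" unfolding S_def using Dm
    by (intro Bochner_Integration.integral_sum integrable_W_mult) (auto simp: indicator_def)
  have W0: "W k x = 0" if "a x \<le> 0" "1 \<le> k" for k x
  proof -
    have "\<eta> \<le> real k * \<eta>" using \<eta> that by simp
    then have "\<eta> \<le> \<bar>a x - real k * \<eta>\<bar>" using that(1) by linarith
    then show ?thesis unfolding W_def by (rule tent_eq_0[OF \<eta>])
  qed
  have re: "(\<Sum>k\<in>{i..L}. W k x) = (\<Sum>k\<in>{int i..int L}. tent \<eta> (of_int k * \<eta>) (a x))" for i x
  proof -
    have "{int i..int L} = int ` {i..L}" by (auto simp: image_int_atLeastAtMost)
    then show ?thesis by (simp add: sum.reindex W_def)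
  qed
  have lo: "S x \<le> indicator P x" if "x \<in> space M" for x
  proof (cases "0 < a x \<and> x \<in> D")
    case True
    then have "S x \<le> 1" using sum_tents_le_1[OF \<eta>, of "{int 1..int L}" "a x"] re[of x 1] by (simp add: S_def)
    with True that show ?thesis by (simp add: P_def)
  next
    case False
    then have "S x = 0" using W0[of x] by (auto simp: S_def intro!: sum.neutral)
    then show ?thesis by simp
  qed
  have up: "indicator P x \<le> S x + (W 0 x + indicator T x)" if "x \<in> space M" for x
  proof (cases "x \<in> P")
    case True
    then have x: "0 < a x" "x \<in> D" by (auto simp: P_def)
    have S0: "0 \<le> S x" using W_bounds by (auto simp: S_def intro!: sum_nonneg)
    show ?thesis
    proof (cases "real L * \<eta> < a x")
      case True
      with x that have "x \<in> T" by (auto simp: T_def)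
      then show ?thesis using \<open>x \<in> P\<close> S0 W_bounds[of 0 x] by simp
    next
      case False
      then have "(\<Sum>k\<in>{0..L}. W k x) = 1"
        using sum_tents_eq_1[OF \<eta>, of "int 0" "a x" "int L"] x re[of x 0] by simp
      moreover have "(\<Sum>k\<in>{0..L}. W k x) = W 0 x + (\<Sum>k\<in>{1..L}. W k x)"
        by (simp add: sum.atLeast_Suc_atMost)
      ultimately show ?thesis using x by (simp add: S_def indicator_def)
    qed
  next
    case False
    then show ?thesis using W_bounds[of 0 x] W_bounds by (auto simp: S_def intro!: add_nonneg_nonneg sum_nonneg)
  qed
  have "expectation S \<le> prob P"
    using integral_mono[OF iS integrable_real_indicator[OF Pm(1)] lo] by (simp add: emeasure_eq_measure)
  moreover have "prob P \<le> expectation (\<lambda>x. S x + (W 0 x + indicator T x))"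
    using iS integral_mono[OF integrable_real_indicator[OF Pm(1)] _ up] by (simp add: emeasure_eq_measure)
  moreover have "expectation (\<lambda>x. S x + (W 0 x + indicator T x)) = expectation S + (p 0 + prob T)"
    using iS by (simp add: p_def emeasure_eq_measure)
  moreover have "p 0 \<le> 2 * \<eta>" by (intro p_bounds) simp
  moreover have "0 \<le> prob T" by simp
  ultimately show ?thesis using \<eta> unfolding eS P_def T_def by linarith
qed

lemma \<Psi>_bounds: "0 \<le> \<Psi> c k" "\<Psi> c k \<le> 1"
  by (auto simp: \<Psi>_def)

text \<open>The threshold is not constant on a strip, but the values at the centres are monotone
  with total variation at most one. With strip masses at most \<open>2 * \<eta>\<close> and two
  neighbours each, this costs \<open>4 * \<eta>\<close> in total, however steep the threshold
  is.\<close>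

lemma sum_strips:
  assumes D: "half_event c D"
    and e: "\<And>k. 1 \<le> k \<Longrightarrow> k \<le> L \<Longrightarrow> cdf_error k (- (c * (real (k - 1) * \<eta>))) (e k)"
      "\<And>k. 1 \<le> k \<Longrightarrow> k \<le> L \<Longrightarrow> cdf_error k (- (c * (real (Suc k) * \<eta>))) (e k)"
    and e0: "\<And>k. 1 \<le> k \<Longrightarrow> k \<le> L \<Longrightarrow> 0 \<le> e k"
  shows "\<bar>(\<Sum>k\<in>{1..L}. expectation (\<lambda>x. W k x * indicator D x)) - Q c\<bar>
    \<le> 4 * \<eta> + (\<Sum>k\<in>{1..L}. \<eta> * (\<kappa> * \<Psi> c k + 2 * e k))"
proof -
  define \<Delta> where "\<Delta> k = \<bar>\<Psi> c k - \<Psi> c (Suc k)\<bar>" for k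
  have one: "\<bar>expectation (\<lambda>x. W k x * indicator D x) - \<eta> * g (real k * \<eta>) * \<Psi> c k\<bar>
    \<le> 2 * \<eta> * \<Delta> (k - 1) + 2 * \<eta> * \<Delta> k + \<eta> * (\<kappa> * \<Psi> c k + 2 * e k)" if k: "k \<in> {1..L}" for k
  proof -
    from k have k': "1 \<le> k" "k \<le> L" "Suc (k - 1) = k" by auto
    have "\<bar>expectation (\<lambda>x. W k x * indicator D x) - p k * \<Psi> c k\<bar> \<le> p k * (\<Delta> (k - 1) + \<Delta> k + e k)"
      using strip_error[OF D k'(1,2) e(1)[OF k'(1,2)] e(2)[OF k'(1,2)]] unfolding \<Delta>_def k'(3) .
    also have "\<dots> \<le> 2 * \<eta> * (\<Delta> (k - 1) + \<Delta> k + e k)"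
      using p_bounds(2)[OF k'(2)] e0[OF k'(1,2)] by (intro mult_right_mono) (auto simp: \<Delta>_def)
    finally have 1: "\<bar>expectation (\<lambda>x. W k x * indicator D x) - p k * \<Psi> c k\<bar> \<le> 2 * \<eta> * (\<Delta> (k - 1) + \<Delta> k + e k)" .
    have "\<bar>p k * \<Psi> c k - \<eta> * g (real k * \<eta>) * \<Psi> c k\<bar> = \<bar>p k - \<eta> * g (real k * \<eta>)\<bar> * \<Psi> c k"
      using \<Psi>_bounds(1)[of c k] by (simp add: left_diff_distrib[symmetric] abs_mult)
    also have "\<dots> \<le> \<kappa> * \<eta> * \<Psi> c k"
      using mass[OF k'(2)] \<Psi>_bounds(1)[of c k] unfolding p_def W_def[abs_def] by (intro mult_right_mono)
    finally have 2: "\<bar>p k * \<Psi> c k - \<eta> * g (real k * \<eta>) * \<Psi> c k\<bar> \<le> \<kappa> * \<eta> * \<Psi> c k" .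
    from 1 2 show ?thesis by (simp add: algebra_simps abs_le_iff)
  qed
  have mono: "mono (\<Psi> c) \<or> antimono (\<Psi> c)"
  proof (cases "0 \<le> c")
    case True
    have "antimono (\<Psi> c)" unfolding \<Psi>_def
      by (intro antimonoI Phi_mono) (use True \<eta> in \<open>auto intro!: mult_left_mono mult_right_mono\<close>)
    then show ?thesis ..
  next
    case False
    have "mono (\<Psi> c)" unfolding \<Psi>_def
      by (intro monoI Phi_mono) (use False \<eta> in \<open>auto intro!: mult_left_mono_neg mult_right_mono\<close>)
    then show ?thesis ..
  qed
  have S1: "(\<Sum>k\<in>{1..L}. \<Delta> (k - 1)) \<le> 1"
  proof -
    have "(\<Sum>k\<in>{1..L}. \<Delta> (k - 1)) = (\<Sum>k<L. \<Delta> k)"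
      by (rule sum.reindex_bij_witness[of _ Suc "\<lambda>k. k - 1"]) auto
    also have "\<dots> \<le> 1" unfolding \<Delta>_def by (rule sum_abs_diff_monotone[OF mono]) (use \<Psi>_bounds in auto)
    finally show ?thesis .
  qed
  have S2: "(\<Sum>k\<in>{1..L}. \<Delta> k) \<le> 1"
  proof -
    have "(\<Sum>k\<in>{1..L}. \<Delta> k) \<le> (\<Sum>k<Suc L. \<Delta> k)" by (rule sum_mono2) (auto simp: \<Delta>_def)
    also have "\<dots> \<le> 1" unfolding \<Delta>_def by (rule sum_abs_diff_monotone[OF mono]) (use \<Psi>_bounds in auto)
    finally show ?thesis .
  qed
  have "\<bar>(\<Sum>k\<in>{1..L}. expectation (\<lambda>x. W k x * indicator D x)) - Q c\<bar>
    \<le> (\<Sum>k\<in>{1..L}. \<bar>expectation (\<lambda>x. W k x * indicator D x) - \<eta> * g (real k * \<eta>) * \<Psi> c k\<bar>)"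
    unfolding Q_def sum_subtractf[symmetric] by (rule sum_abs)
  also have "\<dots> \<le> (\<Sum>k\<in>{1..L}. 2 * \<eta> * \<Delta> (k - 1) + 2 * \<eta> * \<Delta> k + \<eta> * (\<kappa> * \<Psi> c k + 2 * e k))"
    by (intro sum_mono one)
  also have "\<dots> = 2 * \<eta> * (\<Sum>k\<in>{1..L}. \<Delta> (k - 1)) + 2 * \<eta> * (\<Sum>k\<in>{1..L}. \<Delta> k) + (\<Sum>k\<in>{1..L}. \<eta> * (\<kappa> * \<Psi> c k + 2 * e k))"
    by (simp only: sum.distrib sum_distrib_left)
  also have "\<dots> \<le> 2 * \<eta> * 1 + 2 * \<eta> * 1 + (\<Sum>k\<in>{1..L}. \<eta> * (\<kappa> * \<Psi> c k + 2 * e k))"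
    using S1 S2 \<eta> by (intro add_right_mono add_mono mult_left_mono) auto
  finally show ?thesis by simp
qed

text \<open>The estimate with the same error in every strip. It does not improve for small angles
  and is applied to angles bounded below.\<close>

lemma half_error:
  assumes D: "half_event c D"
  shows "\<bar>prob (D \<inter> {x \<in> space M. 0 < a x}) - Q c\<bar> \<le> 6 * \<eta> + 3 * \<kappa> * (real L * \<eta>) + \<omega>"
proof -
  have "prob (D \<inter> {x \<in> space M. real L * \<eta> < a x}) \<le> prob {x \<in> space M. real L * \<eta> < a x}"
    by (intro finite_measure_mono) auto
  moreover have "(\<Sum>k\<in>{1..L}. \<eta> * (\<kappa> * \<Psi> c k + 2 * \<kappa>)) \<le> (\<Sum>k\<in>{1..L}. \<eta> * (\<kappa> * 1 + 2 * \<kappa>))"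
    using \<eta> \<kappa> \<Psi>_bounds by (intro sum_mono mult_left_mono add_right_mono) auto
  moreover have "(\<Sum>k\<in>{1..L}. \<eta> * (\<kappa> * 1 + 2 * \<kappa>)) = 3 * \<kappa> * (real L * \<eta>)" by (simp add: algebra_simps)
  moreover have "\<bar>(\<Sum>k\<in>{1..L}. expectation (\<lambda>x. W k x * indicator D x)) - Q c\<bar>
    \<le> 4 * \<eta> + (\<Sum>k\<in>{1..L}. \<eta> * (\<kappa> * \<Psi> c k + 2 * \<kappa>))"
    by (rule sum_strips[OF D]) (use cdf_error_const \<kappa> in auto)
  ultimately show ?thesis using half_split[OF D] tail by linarith
qed

text \<open>The better one of \<open>cdf_error_const\<close> and \<open>cdf_error_tail\<close>.
  Allowing a threshold \<open>s\<close> beyond \<open>y\<close> lets the left neighbour's threshold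
  serve for both neighbours of a strip.\<close>

lemma cdf_error_tail_bound:
  assumes k: "k \<le> L" and y: "0 \<le> y" "y \<le> s"
  shows "cdf_error k (- s) (2 * tail_bound \<kappa> y)"
proof -
  have ex: "\<exists>z. cdf_error k (- s) z \<and> z / 2 \<le> \<kappa> \<and> (0 < y \<longrightarrow> z / 2 \<le> 1 / y\<^sup>2)"
  proof (cases "0 < s \<and> 2 / s\<^sup>2 \<le> \<kappa>")
    case True
    then have "0 < y \<longrightarrow> 1 / s\<^sup>2 \<le> 1 / y\<^sup>2" using y by (auto intro!: divide_left_mono power_mono)
    moreover have "2 / s\<^sup>2 / 2 \<le> \<kappa>" using True \<kappa> by auto
    ultimately show ?thesis using cdf_error_tail[OF k, of s] True by (intro exI[of _ "2 / s\<^sup>2"]) auto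
  next
    case False
    have "\<kappa> / 2 \<le> 1 / y\<^sup>2" if "0 < y"
    proof -
      have "\<kappa> \<le> 2 / s\<^sup>2" using False that y by auto
      also have "\<dots> \<le> 2 / y\<^sup>2" using that y by (intro divide_left_mono power_mono) auto
      finally show ?thesis by simp
    qed
    then show ?thesis using cdf_error_const[OF k, of "- s"] \<kappa> by (intro exI[of _ \<kappa>]) auto
  qed
  then obtain z where z: "cdf_error k (- s) z" "z / 2 \<le> \<kappa>" "0 < y \<Longrightarrow> z / 2 \<le> 1 / y\<^sup>2" by blast
  have "z / 2 \<le> tail_bound \<kappa> y" using tail_bound_ge[OF \<kappa>(1) y(1) z(2,3)] .
  then have "z * p k \<le> 2 * tail_bound \<kappa> y * p k" using p_bounds(1) by (intro mult_right_mono) auto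
  with z(1) show ?thesis unfolding cdf_error_def by linarith
qed

text \<open>Every error has to decay with \<open>c\<close>. In the strips this is the sum of
  \<open>tail_bound\<close>. Beyond the last centre the points of \<open>D\<close> satisfy
  \<open>c * (real L * \<eta>) \<le> \<bar>b x\<bar>\<close>, and the second moment over all points
  bounds their share.\<close>

lemma half_error_steep:
  assumes D: "half_event c D" and c: "0 < c" and L: "0 < L"
  shows "\<bar>prob (D \<inter> {x \<in> space M. 0 < a x}) - Q c\<bar> \<le> 26 * \<eta> + 20 * sqrt \<kappa> / c + 2 / (c * (real L * \<eta>))\<^sup>2"
proof -
  define y where "y k = c * (real (k - 1) * \<eta>)" for k
  have y0: "0 \<le> y k" for k using c \<eta> by (simp add: y_def)
  have tb0: "0 \<le> tail_bound \<kappa> (y k)" for k using \<kappa> by (simp add: tail_bound_def)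
  have 1: "\<bar>(\<Sum>k\<in>{1..L}. expectation (\<lambda>x. W k x * indicator D x)) - Q c\<bar>
    \<le> 4 * \<eta> + (\<Sum>k\<in>{1..L}. \<eta> * (\<kappa> * \<Psi> c k + 2 * (2 * tail_bound \<kappa> (y k))))"
  proof (rule sum_strips[OF D])
    fix k assume k: "1 \<le> k" "k \<le> L"
    show "cdf_error k (- (c * (real (k - 1) * \<eta>))) (2 * tail_bound \<kappa> (y k))"
      using k y0[of k] by (intro cdf_error_tail_bound) (auto simp: y_def)
    show "cdf_error k (- (c * (real (Suc k) * \<eta>))) (2 * tail_bound \<kappa> (y k))"
    proof (rule cdf_error_tail_bound[OF k(2) y0])
      show "y k \<le> c * (real (Suc k) * \<eta>)" unfolding y_def using c \<eta> by (intro mult_left_mono mult_right_mono) auto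
    qed
    show "0 \<le> 2 * tail_bound \<kappa> (y k)" using tb0 by simp
  qed
  have kp: "\<kappa> * \<Psi> c k \<le> tail_bound \<kappa> (y k)" if "k \<in> {1..L}" for k
  proof (rule tail_bound_ge[OF \<kappa>(1) y0])
    show "\<kappa> * \<Psi> c k \<le> \<kappa>" using \<kappa> \<Psi>_bounds by (simp add: mult_left_le)
    assume y: "0 < y k"
    have yk: "y k \<le> c * (real k * \<eta>)" unfolding y_def using c \<eta> by (intro mult_left_mono mult_right_mono) auto
    have "\<kappa> * \<Psi> c k \<le> \<Psi> c k" using \<kappa> \<Psi>_bounds by (simp add: mult_left_le_one_le)
    also have "\<Psi> c k \<le> 1 / (c * (real k * \<eta>))\<^sup>2" unfolding \<Psi>_def using y yk by (intro Phi_tail) auto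
    also have "\<dots> \<le> 1 / (y k)\<^sup>2" using y yk by (intro frac_le power_mono zero_less_power) auto
    finally show "\<kappa> * \<Psi> c k \<le> 1 / (y k)\<^sup>2" .
  qed
  \<comment> \<open>\<open>5\<close> is one for the error \<open>\<kappa> * \<Psi> c k\<close> of
    the strip mass, which decays as well by \<open>kp\<close>, plus \<open>2 * 2\<close> for the
    distribution function.\<close>
  have "(\<Sum>k\<in>{1..L}. \<eta> * (\<kappa> * \<Psi> c k + 2 * (2 * tail_bound \<kappa> (y k)))) \<le> (\<Sum>k\<in>{1..L}. 5 * (\<eta> * tail_bound \<kappa> (y k)))"
  proof (rule sum_mono)
    fix k assume "k \<in> {1..L}"
    then have "\<kappa> * \<Psi> c k + 2 * (2 * tail_bound \<kappa> (y k)) \<le> 5 * tail_bound \<kappa> (y k)" using kp by fastforce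
    then have "\<eta> * (\<kappa> * \<Psi> c k + 2 * (2 * tail_bound \<kappa> (y k))) \<le> \<eta> * (5 * tail_bound \<kappa> (y k))" using \<eta> by (intro mult_left_mono) auto
    then show "\<eta> * (\<kappa> * \<Psi> c k + 2 * (2 * tail_bound \<kappa> (y k))) \<le> 5 * (\<eta> * tail_bound \<kappa> (y k))" by (simp only: mult.left_commute)
  qed
  also have "\<dots> = 5 * (\<Sum>j<L. \<eta> * tail_bound \<kappa> (c * (real j * \<eta>)))"
    unfolding sum_distrib_left by (rule sum.reindex_bij_witness[of _ Suc "\<lambda>k. k - 1"]) (auto simp: y_def)
  also have "\<dots> \<le> 5 * (4 * \<kappa> * \<eta> + 4 * sqrt \<kappa> / c)"
    using sum_tail_bound_le[OF \<kappa>(1) c \<eta>, of L] by (intro mult_left_mono) auto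
  also have "\<dots> \<le> 20 * \<eta> + 20 * sqrt \<kappa> / c" using \<kappa> \<eta> by (simp add: mult_left_le_one_le)
  finally have 2: "(\<Sum>k\<in>{1..L}. \<eta> * (\<kappa> * \<Psi> c k + 2 * (2 * tail_bound \<kappa> (y k)))) \<le> 20 * \<eta> + 20 * sqrt \<kappa> / c" .
  define t where "t = c * (real L * \<eta>)"
  have t: "0 < t" using c L \<eta> by (simp add: t_def)
  have "prob (D \<inter> {x \<in> space M. real L * \<eta> < a x}) \<le> prob {x \<in> space M. t\<^sup>2 \<le> (b x)\<^sup>2}"
  proof (rule finite_measure_mono)
    show "D \<inter> {x \<in> space M. real L * \<eta> < a x} \<subseteq> {x \<in> space M. t\<^sup>2 \<le> (b x)\<^sup>2}"
    proof safe
      fix x assume x: "x \<in> D" "x \<in> space M" "real L * \<eta> < a x"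
      have "0 < a x" using x(3) L \<eta> by (meson le_less_trans less_imp_le mult_pos_pos of_nat_0_less_iff)
      then have "b x \<le> - (c * a x)" using D x by (auto simp: half_event_def)
      moreover have "t \<le> c * a x" unfolding t_def using x c by (intro mult_left_mono) auto
      ultimately have "t \<le> \<bar>b x\<bar>" by linarith
      then show "t\<^sup>2 \<le> (b x)\<^sup>2" using t by (simp add: abs_le_square_iff[symmetric])
    qed
  qed measurable
  also have "\<dots> \<le> expectation (\<lambda>x. (b x)\<^sup>2) / t\<^sup>2"
    using t square(1) by (intro integral_Markov_inequality_measure[where A = "{}"]) auto
  also have "\<dots> \<le> 2 / t\<^sup>2" using square(2) t by (intro divide_right_mono) auto
  finally have 3: "prob (D \<inter> {x \<in> space M. real L * \<eta> < a x}) \<le> 2 / t\<^sup>2" .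
  show ?thesis using half_split[OF D] 1 2 3 unfolding t_def[symmetric] by linarith
qed

end

section \<open>Strip models from moments\<close>

lemma moments_determine_cdf_bounded:
  assumes "0 < e"
  obtains h \<tau> where "1 \<le> h" "0 < \<tau>" "\<tau> \<le> 1" "\<And>M s. real_distribution M \<Longrightarrow> (\<And>k. k \<le> 2 * h \<Longrightarrow> integrable M (\<lambda>x. x ^ k)) \<Longrightarrow>
    (\<And>k. k \<le> 2 * h \<Longrightarrow> \<bar>(LINT x|M. x ^ k) - gauss_moment k\<bar> \<le> \<tau>) \<Longrightarrow>
    \<bar>measure M {..s} - Phi s\<bar> \<le> e \<and> \<bar>measure M {..<s} - Phi s\<bar> \<le> e"
proof -
  obtain h \<tau> where ht: "0 < \<tau>" "\<And>M. real_distribution M \<Longrightarrow> (\<forall>k\<le>2 * h. integrable M (\<lambda>x. x ^ k)) \<Longrightarrow>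
    (\<forall>k\<le>2 * h. \<bar>(LINT x|M. x ^ k) - gauss_moment k\<bar> \<le> \<tau>) \<Longrightarrow>
    (\<forall>s. \<bar>measure M {..s} - Phi s\<bar> \<le> e \<and> \<bar>measure M {..<s} - Phi s\<bar> \<le> e)"
    using moments_determine_cdf[OF assms] by blast
  show thesis
  proof (rule that[of "max h 1" "min \<tau> 1"])
    fix M s assume M: "real_distribution M" "\<And>k. k \<le> 2 * max h 1 \<Longrightarrow> integrable M (\<lambda>x. x ^ k)"
      "\<And>k. k \<le> 2 * max h 1 \<Longrightarrow> \<bar>(LINT x|M. x ^ k) - gauss_moment k\<bar> \<le> min \<tau> 1"
    have "\<forall>k\<le>2 * h. integrable M (\<lambda>x. x ^ k)" using M(2) by auto
    moreover have "\<forall>k\<le>2 * h. \<bar>(LINT x|M. x ^ k) - gauss_moment k\<bar> \<le> \<tau>"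
    proof (intro allI impI)
      fix k assume "k \<le> 2 * h"
      then have "\<bar>(LINT x|M. x ^ k) - gauss_moment k\<bar> \<le> min \<tau> 1" by (intro M(3)) auto
      then show "\<bar>(LINT x|M. x ^ k) - gauss_moment k\<bar> \<le> \<tau>" by linarith
    qed
    ultimately show "\<bar>measure M {..s} - Phi s\<bar> \<le> e \<and> \<bar>measure M {..<s} - Phi s\<bar> \<le> e" using ht(2)[OF M(1)] by blast
  qed (use ht(1) in auto)
qed

text \<open>The law of b under a normalised weight, to which the determination by moments is applied
  inside a single strip.\<close>

lemma (in prob_space) weighted_distribution:
  fixes w b :: "'a \<Rightarrow> real"
  assumes w: "w \<in> borel_measurable M" "\<And>x. 0 \<le> w x" "integrable M w" and p: "0 < expectation w"
    and b: "b \<in> borel_measurable M"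
  defines "\<nu> \<equiv> distr (density M (\<lambda>x. ennreal (w x / expectation w))) borel b"
  shows "real_distribution \<nu>"
    and "\<And>f :: real \<Rightarrow> real. f \<in> borel_measurable borel \<Longrightarrow> (LINT x|\<nu>. f x) = expectation (\<lambda>x. w x * f (b x)) / expectation w"
    and "\<And>f :: real \<Rightarrow> real. f \<in> borel_measurable borel \<Longrightarrow> integrable M (\<lambda>x. w x * f (b x)) \<Longrightarrow> integrable \<nu> f"
proof -
  define p where "p = expectation w"
  have p0: "0 < p" using p by (simp add: p_def)
  let ?D = "density M (\<lambda>x. ennreal (w x / p))"
  have wp: "(\<lambda>x. w x / p) \<in> borel_measurable M" "AE x in M. 0 \<le> w x / p" using w p0 by auto
  have bD: "b \<in> borel_measurable ?D" using b by simp
  have "emeasure ?D (space ?D) = (\<integral>\<^sup>+x. ennreal (w x / p) \<partial>M)"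
    using wp(1) by (subst emeasure_density) (auto intro!: nn_integral_cong simp: indicator_def)
  also have "\<dots> = ennreal (expectation (\<lambda>x. w x / p))"
    using w p0 by (intro nn_integral_eq_integral) auto
  also have "\<dots> = 1" using p0 by (simp add: p_def)
  finally have "prob_space ?D" by (rule prob_spaceI)
  then have "prob_space (distr ?D borel b)" using bD by (rule prob_space.prob_space_distr)
  then show "real_distribution \<nu>" unfolding \<nu>_def p_def[symmetric]
    by (simp add: real_distribution_def real_distribution_axioms_def)
  fix f :: "real \<Rightarrow> real" assume f: "f \<in> borel_measurable borel"
  have fb: "(\<lambda>x. f (b x)) \<in> borel_measurable M" using f b by measurable
  have "(LINT x|\<nu>. f x) = (LINT x|?D. f (b x))" unfolding \<nu>_def p_def[symmetric]
    using f bD by (intro integral_distr) auto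
  also have "\<dots> = expectation (\<lambda>x. w x / p * f (b x))"
    using integral_density[OF fb wp] by simp
  finally show "(LINT x|\<nu>. f x) = expectation (\<lambda>x. w x * f (b x)) / expectation w" by (simp add: p_def)
  assume i: "integrable M (\<lambda>x. w x * f (b x))"
  have "integrable ?D (\<lambda>x. f (b x))"
    using integrable_density[OF fb wp] i by simp
  then show "integrable \<nu> f" unfolding \<nu>_def p_def[symmetric] using f bD by (simp add: integrable_distr_eq)
qed

text \<open>The tests give errors that are absolute multiples of \<eta>, whereas the model needs
  errors relative to the strip mass. The lower bound \<gamma> on the target, with \<kappa> at most
  half of it, makes every strip mass at least \<eta> \<gamma> / 2, which converts one into the
  other.\<close>

lemma strip_model_of_moments:
  fixes M :: "'a measure"
  assumes "prob_space M" and a: "a \<in> borel_measurable M" and b: "b \<in> borel_measurable M"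
    and \<eta>: "0 < \<eta>" and \<kappa>: "0 < \<kappa>" "\<kappa> \<le> 1" "\<kappa> \<le> \<gamma> / 2"
    and g: "\<And>k. k \<le> L \<Longrightarrow> \<gamma> \<le> g (real k * \<eta>)" "\<And>k. k \<le> L \<Longrightarrow> g (real k * \<eta>) \<le> 1"
    and mass: "\<And>k. k \<le> L \<Longrightarrow> \<bar>(LINT x|M. tent \<eta> (real k * \<eta>) (a x)) - \<eta> * g (real k * \<eta>)\<bar> \<le> \<kappa> * \<eta>"
    and h: "1 \<le> h" and \<tau>: "0 < \<tau>" "\<tau> \<le> 1"
    and determ: "\<And>M s. real_distribution M \<Longrightarrow> (\<And>q. q \<le> 2 * h \<Longrightarrow> integrable M (\<lambda>x. x ^ q)) \<Longrightarrow>
      (\<And>q. q \<le> 2 * h \<Longrightarrow> \<bar>(LINT x|M. x ^ q) - gauss_moment q\<bar> \<le> \<tau>) \<Longrightarrow>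
      \<bar>measure M {..s} - Phi s\<bar> \<le> \<kappa> \<and> \<bar>measure M {..<s} - Phi s\<bar> \<le> \<kappa>"
    and moments: "\<And>k q. k \<le> L \<Longrightarrow> q \<le> 2 * h \<Longrightarrow> integrable M (\<lambda>x. tent \<eta> (real k * \<eta>) (a x) * b x ^ q)"
      "\<And>k q. k \<le> L \<Longrightarrow> q \<le> 2 * h \<Longrightarrow> \<bar>(LINT x|M. tent \<eta> (real k * \<eta>) (a x) * b x ^ q)
         - (LINT x|M. tent \<eta> (real k * \<eta>) (a x)) * gauss_moment q\<bar> \<le> \<tau> * (\<eta> * \<gamma> / 2)"
    and square: "integrable M (\<lambda>x. (b x)\<^sup>2)" "(LINT x|M. (b x)\<^sup>2) \<le> 2"
    and tail: "measure M {x \<in> space M. real L * \<eta> < a x} \<le> \<omega>"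
  shows "strip_model M a b \<eta> L g \<kappa> \<omega>"
proof -
  interpret prob_space M by fact
  have \<gamma>: "0 < \<gamma>" using \<kappa> by linarith
  define W where "W k x = tent \<eta> (real k * \<eta>) (a x)" for k x
  have Wm: "W k \<in> borel_measurable M" for k unfolding W_def by (intro borel_measurable_tent a)
  have Wb: "0 \<le> W k x" "W k x \<le> 1" for k x using \<eta> by (auto simp: W_def tent_nonneg tent_le_1)
  have iW: "integrable M (W k)" for k by (intro integrable_const_bound[where B = 1]) (use Wb Wm in auto)
  define p where "p k = expectation (W k)" for k
  have p_ge: "\<eta> * \<gamma> / 2 \<le> p k" if "k \<le> L" for k
  proof -
    have "\<eta> * \<gamma> \<le> \<eta> * g (real k * \<eta>)" using g(1)[OF that] \<eta> by simp
    moreover have "\<kappa> * \<eta> \<le> \<gamma> / 2 * \<eta>" using \<kappa> \<eta> by (intro mult_right_mono) auto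
    ultimately show ?thesis using mass[OF that] unfolding p_def W_def[abs_def] by (simp add: algebra_simps abs_le_iff)
  qed
  have p_pos: "0 < p k" if "k \<le> L" for k using p_ge[OF that] \<eta> \<gamma> by (meson half_gt_zero less_le_trans mult_pos_pos)
  have mom: "\<bar>expectation (\<lambda>x. W k x * b x ^ q) - p k * gauss_moment q\<bar> \<le> \<tau> * p k" if "k \<le> L" "q \<le> 2 * h" for k q
  proof -
    have "\<tau> * (\<eta> * \<gamma> / 2) \<le> \<tau> * p k" using p_ge[OF that(1)] \<tau> by (intro mult_left_mono) auto
    with moments(2)[OF that] show ?thesis unfolding p_def W_def[abs_def] by linarith
  qed
  have cdf: "\<bar>expectation (\<lambda>x. W k x * indicator A (b x)) - p k * Phi s\<bar> \<le> \<kappa> * p k"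
    if k: "k \<le> L" and A: "A = {..s} \<or> A = {..<s}" for k A s
  proof -
    define \<nu> where "\<nu> = distr (density M (\<lambda>x. ennreal (W k x / expectation (W k)))) borel b"
    have \<nu>: "real_distribution \<nu>" 
      "\<And>f :: real \<Rightarrow> real. f \<in> borel_measurable borel \<Longrightarrow> (LINT x|\<nu>. f x) = expectation (\<lambda>x. W k x * f (b x)) / p k"
      "\<And>f :: real \<Rightarrow> real. f \<in> borel_measurable borel \<Longrightarrow> integrable M (\<lambda>x. W k x * f (b x)) \<Longrightarrow> integrable \<nu> f"
      using weighted_distribution[OF Wm Wb(1) iW _ b, of k] p_pos[OF k] unfolding p_def \<nu>_def by blast+
    interpret V: real_distribution \<nu> by fact
    have "\<bar>measure \<nu> {..s} - Phi s\<bar> \<le> \<kappa> \<and> \<bar>measure \<nu> {..<s} - Phi s\<bar> \<le> \<kappa>"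
    proof (rule determ[OF \<nu>(1)])
      fix q assume q: "q \<le> 2 * h"
      show "integrable \<nu> (\<lambda>x. x ^ q)" using moments(1)[OF k q] by (intro \<nu>(3)) (auto simp: W_def)
      have "(LINT x|\<nu>. x ^ q) - gauss_moment q = (expectation (\<lambda>x. W k x * b x ^ q) - p k * gauss_moment q) / p k"
        using p_pos[OF k] by (subst \<nu>(2)) (auto simp: diff_divide_distrib)
      also have "\<bar>\<dots>\<bar> \<le> \<tau>" using mom[OF k q] p_pos[OF k] by (simp add: abs_divide pos_divide_le_eq)
      finally show "\<bar>(LINT x|\<nu>. x ^ q) - gauss_moment q\<bar> \<le> \<tau>" .
    qed
    then have "\<bar>measure \<nu> A - Phi s\<bar> \<le> \<kappa>" using A by auto
    moreover have m: "measure \<nu> A = expectation (\<lambda>x. W k x * indicator A (b x)) / p k"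
    proof -
      have "measure \<nu> A = (LINT x|\<nu>. indicator A x)" using A by auto
      also have "\<dots> = expectation (\<lambda>x. W k x * indicator A (b x)) / p k" using A by (intro \<nu>(2)) auto
      finally show ?thesis .
    qed
    ultimately have "\<bar>expectation (\<lambda>x. W k x * indicator A (b x)) / p k - Phi s\<bar> \<le> \<kappa>" by (simp only:)
    moreover have "expectation (\<lambda>x. W k x * indicator A (b x)) - p k * Phi s = (expectation (\<lambda>x. W k x * indicator A (b x)) / p k - Phi s) * p k"
      using p_pos[OF k] by (simp add: field_simps)
    ultimately show ?thesis using p_pos[OF k] by (simp add: abs_mult mult_right_mono)
  qed
  show ?thesis
  proof
    fix k s assume k: "k \<le> L"
    show "0 \<le> g (real k * \<eta>)" using g(1)[OF k] \<gamma> by linarith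
    show "\<bar>expectation (\<lambda>x. tent \<eta> (real k * \<eta>) (a x) * indicator {..<s} (b x)) - expectation (\<lambda>x. tent \<eta> (real k * \<eta>) (a x)) * Phi s\<bar> \<le> \<kappa> * expectation (\<lambda>x. tent \<eta> (real k * \<eta>) (a x))"
      using cdf[OF k, of "{..<s}" s] by (simp add: W_def[abs_def] p_def)
    show "\<bar>expectation (\<lambda>x. tent \<eta> (real k * \<eta>) (a x) * indicator {..s} (b x)) - expectation (\<lambda>x. tent \<eta> (real k * \<eta>) (a x)) * Phi s\<bar> \<le> \<kappa> * expectation (\<lambda>x. tent \<eta> (real k * \<eta>) (a x))"
      using cdf[OF k, of "{..s}" s] by (simp add: W_def[abs_def] p_def)
    show "integrable M (\<lambda>x. tent \<eta> (real k * \<eta>) (a x) * (b x)\<^sup>2)" using moments(1)[OF k, of 2] h by simp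
    have "gauss_moment 2 = 1" using gauss_moment_even[of 1] by (simp add: rising_two_def)
    then have "expectation (\<lambda>x. W k x * (b x)\<^sup>2) \<le> p k + \<tau> * p k" using mom[OF k, of 2] h by simp
    also have "\<dots> \<le> 2 * p k" using \<tau> p_pos[OF k] by simp
    finally show "expectation (\<lambda>x. tent \<eta> (real k * \<eta>) (a x) * (b x)\<^sup>2) \<le> 2 * expectation (\<lambda>x. tent \<eta> (real k * \<eta>) (a x))"
      by (simp add: W_def[abs_def] p_def)
  qed (use a b \<eta> \<kappa> g mass square tail in auto)
qed

section \<open>The two-dimensional Gaussian\<close>

abbreviation "gauss_pair \<equiv> std_normal_distribution \<Otimes>\<^sub>M std_normal_distribution"

lemma sigma_finite_normal: "sigma_finite_measure std_normal_distribution"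
  by (rule std_normal.sigma_finite_measure_axioms)

lemma pair_sigma_finite_normal: "pair_sigma_finite std_normal_distribution std_normal_distribution"
  by (intro pair_sigma_finite.intro sigma_finite_normal)

lemma prob_space_gauss_pair: "prob_space gauss_pair"
proof -
  have "prob_space std_normal_distribution" by (rule std_normal.prob_space_axioms)
  then interpret pair_prob_space std_normal_distribution std_normal_distribution
    by (intro pair_prob_space.intro pair_sigma_finite_normal)
  show ?thesis by (rule prob_space_axioms)
qed

lemma measurable_fst_pair: "fst \<in> borel_measurable gauss_pair" and measurable_snd_pair: "snd \<in> borel_measurable gauss_pair"
  using measurable_fst[of std_normal_distribution std_normal_distribution] measurable_snd[of std_normal_distribution std_normal_distribution]
  by (simp_all only: measurable_cong_sets[OF refl sets_density] measurable_cong_sets[OF refl sets_lborel])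

lemma gauss_pair_product:
  fixes f g :: "real \<Rightarrow> real"
  assumes "integrable std_normal_distribution f" "integrable std_normal_distribution g"
  shows "integrable gauss_pair (\<lambda>p. f (fst p) * g (snd p))"
    and "(LINT p|gauss_pair. f (fst p) * g (snd p)) =
      (LINT x|std_normal_distribution. f x) * (LINT x|std_normal_distribution. g x)"
proof -
  have fm: "f \<in> borel_measurable borel" "g \<in> borel_measurable borel"
    using assms[THEN borel_measurable_integrable] by auto
  show i: "integrable gauss_pair (\<lambda>p. f (fst p) * g (snd p))"
  proof (rule pair_sigma_finite.Fubini_integrable[OF pair_sigma_finite_normal])
    show "(\<lambda>p. f (fst p) * g (snd p)) \<in> borel_measurable gauss_pair"
      by (intro borel_measurable_times measurable_compose[OF measurable_fst_pair fm(1)] measurable_compose[OF measurable_snd_pair fm(2)])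
    show "integrable std_normal_distribution (\<lambda>x. LINT y|std_normal_distribution. norm (f (fst (x, y)) * g (snd (x, y))))"
      using assms by (simp add: abs_mult)
  qed (use assms in simp)
  show "(LINT p|gauss_pair. f (fst p) * g (snd p)) =
      (LINT x|std_normal_distribution. f x) * (LINT x|std_normal_distribution. g x)"
    using pair_sigma_finite.integral_fst'[OF pair_sigma_finite_normal i] by simp
qed

lemma integrable_normal_bounded:
  fixes f :: "real \<Rightarrow> real"
  assumes "f \<in> borel_measurable borel" "\<And>x. \<bar>f x\<bar> \<le> 1"
  shows "integrable std_normal_distribution f"
  using assms by (intro std_normal.integrable_const_bound[where B = 1]) auto

lemma normal_tail: "0 < s \<Longrightarrow> measure std_normal_distribution {x. s < \<bar>x\<bar>} \<le> 1 / s\<^sup>2"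
proof -
  assume s: "0 < s"
  have "measure std_normal_distribution {x. s < \<bar>x\<bar>} \<le> measure std_normal_distribution {x \<in> space std_normal_distribution. s\<^sup>2 \<le> x\<^sup>2}"
    using s by (intro std_normal.finite_measure_mono) (auto simp: abs_le_square_iff[symmetric])
  also have "\<dots> \<le> (LINT x|std_normal_distribution. x\<^sup>2) / s\<^sup>2"
    using s integrable_std_normal_distribution_moment[of 2] by (intro integral_Markov_inequality_measure[where A = "{}"]) auto
  also have "(LINT x|std_normal_distribution. x\<^sup>2) = 1"
    using gauss_moment_even[of 1] by (simp add: rising_two_def)
  finally show ?thesis .
qed

text \<open>The Gaussian pair satisfies the same axioms with the same target function, which makes
  it comparable with a dataset. By independence the conditional distribution functions are exact;
  only the strip masses differ from the target.\<close>

lemma strip_model_gauss: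
  assumes \<eta>: "0 < \<eta>" and \<kappa>: "0 < \<kappa>" "\<kappa> \<le> 1" and L: "0 < L"
    and g: "\<And>k. k \<le> L \<Longrightarrow> 0 \<le> g (real k * \<eta>)" "\<And>k. k \<le> L \<Longrightarrow> g (real k * \<eta>) \<le> 1"
    and mass: "\<And>k. k \<le> L \<Longrightarrow> \<bar>(LINT x|std_normal_distribution. tent \<eta> (real k * \<eta>) x) - \<eta> * g (real k * \<eta>)\<bar> \<le> \<kappa> * \<eta>"
    and \<omega>: "1 / (real L * \<eta>)\<^sup>2 \<le> \<omega>"
  shows "strip_model gauss_pair fst snd \<eta> L g \<kappa> \<omega>"
proof -
  interpret prob_space gauss_pair by (rule prob_space_gauss_pair)
  have iW: "integrable std_normal_distribution (tent \<eta> t)" for t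
    using \<eta> by (intro integrable_normal_bounded borel_measurable_tent measurable_ident_sets) (auto simp: tent_nonneg tent_le_1)
  have E: "integrable gauss_pair (\<lambda>p. tent \<eta> t (fst p) * f (snd p))"
    "expectation (\<lambda>p. tent \<eta> t (fst p) * f (snd p)) = (LINT x|std_normal_distribution. tent \<eta> t x) * (LINT x|std_normal_distribution. f x)"
    if "integrable std_normal_distribution f" for f t
    using gauss_pair_product[OF iW that] by auto
  have E1: "expectation (\<lambda>p. tent \<eta> t (fst p)) = (LINT x|std_normal_distribution. tent \<eta> t x)" for t
    using E(2)[of "\<lambda>_. 1" t] std_normal.prob_space by simp
  have p0: "0 \<le> (LINT x|std_normal_distribution. tent \<eta> t x)" for t
    by (intro integral_nonneg_AE) (auto simp: tent_nonneg)
  have ind: "expectation (\<lambda>p. tent \<eta> t (fst p) * indicator A (snd p)) = (LINT x|std_normal_distribution. tent \<eta> t x) * measure std_normal_distribution A"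
    if "A \<in> sets borel" for A t
  proof -
    have "integrable std_normal_distribution (indicator A :: real \<Rightarrow> real)"
      using that by (intro integrable_normal_bounded) (auto simp: indicator_def)
    from E(2)[OF this, of t] show ?thesis using that by simp
  qed
  have lt: "measure std_normal_distribution {..<s} = Phi s" for s
  proof -
    have "emeasure std_normal_distribution {s} = 0"
      by (subst emeasure_density) (auto simp: nn_integral_indicator_singleton)
    then have "measure std_normal_distribution {s} = 0" by (simp add: measure_def)
    moreover have "{..s} = {..<s} \<union> {s}" by auto
    moreover have "measure std_normal_distribution ({..<s} \<union> {s}) = measure std_normal_distribution {..<s} + measure std_normal_distribution {s}"
      by (intro std_normal.finite_measure_Union) auto
    ultimately show ?thesis by simp
  qed
  have m2: "integrable std_normal_distribution (\<lambda>x. x\<^sup>2)" "(LINT x|std_normal_distribution. x\<^sup>2) = 1"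
    using integrable_std_normal_distribution_moment[of 2] gauss_moment_even[of 1] by (auto simp: rising_two_def)
  show ?thesis
  proof
    fix k s assume k: "k \<le> L"
    show "\<bar>expectation (\<lambda>x. tent \<eta> (real k * \<eta>) (fst x)) - \<eta> * g (real k * \<eta>)\<bar> \<le> \<kappa> * \<eta>" using mass[OF k] by (simp add: E1)
    show "\<bar>expectation (\<lambda>x. tent \<eta> (real k * \<eta>) (fst x) * indicator {..<s} (snd x)) - expectation (\<lambda>x. tent \<eta> (real k * \<eta>) (fst x)) * Phi s\<bar> \<le> \<kappa> * expectation (\<lambda>x. tent \<eta> (real k * \<eta>) (fst x))"
      using p0 \<kappa> by (simp add: E1 ind lt)
    show "\<bar>expectation (\<lambda>x. tent \<eta> (real k * \<eta>) (fst x) * indicator {..s} (snd x)) - expectation (\<lambda>x. tent \<eta> (real k * \<eta>) (fst x)) * Phi s\<bar> \<le> \<kappa> * expectation (\<lambda>x. tent \<eta> (real k * \<eta>) (fst x))"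
      using p0 \<kappa> by (simp add: E1 ind)
    show "integrable gauss_pair (\<lambda>x. tent \<eta> (real k * \<eta>) (fst x) * (snd x)\<^sup>2)" by (rule E(1)[OF m2(1)])
    show "expectation (\<lambda>x. tent \<eta> (real k * \<eta>) (fst x) * (snd x)\<^sup>2) \<le> 2 * expectation (\<lambda>x. tent \<eta> (real k * \<eta>) (fst x))"
      using E(2)[OF m2(1)] p0 by (simp add: E1 m2)
  next
    have one: "integrable std_normal_distribution (\<lambda>_. 1 :: real)" by simp
    show "integrable gauss_pair (\<lambda>x. (snd x)\<^sup>2)" "expectation (\<lambda>x. (snd x)\<^sup>2) \<le> 2"
      using gauss_pair_product[OF one m2(1)] std_normal.prob_space by (auto simp: m2)
    have Ls: "0 < real L * \<eta>" using L \<eta> by simp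
    have "prob {x \<in> space gauss_pair. real L * \<eta> < fst x} = expectation (\<lambda>p. indicator {real L * \<eta><..} (fst p))"
    proof -
      have "prob {x \<in> space gauss_pair. real L * \<eta> < fst x} = expectation (indicator {x \<in> space gauss_pair. real L * \<eta> < fst x})"
      proof -
        have "{x \<in> space gauss_pair. real L * \<eta> < fst x} \<inter> space gauss_pair = {x \<in> space gauss_pair. real L * \<eta> < fst x}" by auto
        then show ?thesis by simp
      qed
      also have "\<dots> = expectation (\<lambda>p. indicator {real L * \<eta><..} (fst p))"
        by (intro Bochner_Integration.integral_cong) (auto simp: indicator_def)
      finally show ?thesis .
    qed
    also have "\<dots> = measure std_normal_distribution {real L * \<eta><..}"
    proof -
      have "integrable std_normal_distribution (indicator {real L * \<eta><..} :: real \<Rightarrow> real)"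
        by (intro integrable_normal_bounded) (auto simp: indicator_def)
      from gauss_pair_product(2)[OF this one] show ?thesis using std_normal.prob_space by simp
    qed
    also have "\<dots> \<le> measure std_normal_distribution {x. real L * \<eta> < \<bar>x\<bar>}"
      by (intro std_normal.finite_measure_mono) auto
    also have "\<dots> \<le> \<omega>" using normal_tail[OF Ls] \<omega> by linarith
    finally show "prob {x \<in> space gauss_pair. real L * \<eta> < fst x} \<le> \<omega>" .
  qed (use measurable_fst_pair measurable_snd_pair \<eta> \<kappa> g in auto)
qed

text \<open>The first variable is integrated out after the second has been replaced by
  \<open>- a * s\<close>; the factor \<open>a\<close> is the Jacobian and makes the integrand an
  exact derivative. Up to a factor, the result is the Cauchy density.\<close>

lemma nn_integral_gauss_ray:
  "(\<integral>\<^sup>+a. ennreal a * ennreal (std_normal_density a) * ennreal (std_normal_density (- a * s)) * indicator {0..} a \<partial>lborel)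
    = ennreal (1 / (2 * pi * (1 + s\<^sup>2)))"
proof -
  define q where "q = 1 + s\<^sup>2"
  have q: "0 < q" by (simp add: q_def add_pos_nonneg)
  define F where "F a = - exp (- q * a\<^sup>2 / 2) / (2 * pi * q)" for a :: real
  define f where "f a = a * exp (- q * a\<^sup>2 / 2) / (2 * pi)" for a :: real
  have eq: "a * std_normal_density a * std_normal_density (- a * s) = f a" for a
  proof -
    have "exp (- a\<^sup>2 / 2) * exp (- (- a * s)\<^sup>2 / 2) = exp (- q * a\<^sup>2 / 2)"
      by (simp add: exp_add[symmetric] q_def power_mult_distrib field_simps)
    moreover have "1 / sqrt (2 * pi) * (1 / sqrt (2 * pi)) = 1 / (2 * pi)" by simp
    moreover have "a * std_normal_density a * std_normal_density (- a * s) =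
      a * (1 / sqrt (2 * pi) * (1 / sqrt (2 * pi))) * (exp (- a\<^sup>2 / 2) * exp (- (- a * s)\<^sup>2 / 2))"
      unfolding normal_density_eq by (simp only: mult_ac)
    ultimately show ?thesis unfolding f_def by (simp only:) simp
  qed
  have "(\<integral>\<^sup>+a. ennreal a * ennreal (std_normal_density a) * ennreal (std_normal_density (- a * s)) * indicator {0..} a \<partial>lborel)
     = (\<integral>\<^sup>+a. ennreal (f a) * indicator {0..} a \<partial>lborel)"
  proof (rule nn_integral_cong)
    fix a :: real
    show "ennreal a * ennreal (std_normal_density a) * ennreal (std_normal_density (- a * s)) * indicator {0..} a = ennreal (f a) * indicator {0..} a"
      by (cases "0 \<le> a") (simp_all add: eq[symmetric] ennreal_mult)
  qed
  also have "\<dots> = ennreal (0 - F 0)"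
  proof (rule nn_integral_FTC_atLeast)
    show "f \<in> borel_measurable borel" unfolding f_def by simp
    show "0 \<le> f x" if "0 \<le> x" for x using that by (simp add: f_def)
    show "(F has_real_derivative f x) (at x)" if "0 \<le> x" for x
      unfolding F_def f_def using q by (auto intro!: derivative_eq_intros simp: field_simps)
    have "((\<lambda>a::real. exp (- q * a\<^sup>2 / 2)) \<longlongrightarrow> 0) at_top"
    proof (rule filterlim_compose[OF exp_at_bot])
      have "filterlim (\<lambda>a::real. a\<^sup>2) at_top at_top" by (rule filterlim_pow_at_top) (auto intro: filterlim_ident)
      then have "filterlim (\<lambda>a::real. (q / 2) * a\<^sup>2) at_top at_top"
        using q by (intro filterlim_tendsto_pos_mult_at_top[OF tendsto_const]) auto
      then show "LIM a at_top. - q * a\<^sup>2 / 2 :> at_bot" by (simp add: filterlim_uminus_at_bot)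
    qed
    then have "((\<lambda>a. - exp (- q * a\<^sup>2 / 2) / (2 * pi * q)) \<longlongrightarrow> - 0 / (2 * pi * q)) at_top"
      using q by (intro tendsto_intros) auto
    then show "(F \<longlongrightarrow> 0) at_top" unfolding F_def by simp
  qed
  also have "0 - F 0 = 1 / (2 * pi * q)" by (simp add: F_def)
  finally show ?thesis by (simp add: q_def)
qed

lemma nn_integral_cauchy_tail:
  "(\<integral>\<^sup>+s. ennreal (1 / (2 * pi * (1 + s\<^sup>2))) * indicator {c..} s \<partial>lborel) = ennreal ((pi / 2 - arctan c) / (2 * pi))"
proof -
  have "(\<integral>\<^sup>+s. ennreal (1 / (2 * pi * (1 + s\<^sup>2))) * indicator {c..} s \<partial>lborel) = ennreal (pi / 2 / (2 * pi) - arctan c / (2 * pi))"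
  proof (rule nn_integral_FTC_atLeast)
    show "((\<lambda>s. arctan s / (2 * pi)) has_real_derivative 1 / (2 * pi * (1 + x\<^sup>2))) (at x)" if "c \<le> x" for x
    proof -
      have "inverse a / b = 1 / (b * a)" for a b :: real by (simp add: field_simps)
      from DERIV_cdivide[OF DERIV_arctan[of x], of "2 * pi", unfolded this] show ?thesis .
    qed
    show "((\<lambda>s. arctan s / (2 * pi)) \<longlongrightarrow> pi / 2 / (2 * pi)) at_top"
      by (rule tendsto_divide[OF tendsto_arctan_at_top tendsto_const]) simp
  qed auto
  then show ?thesis by (simp add: diff_divide_distrib)
qed

text \<open>The slope is used as a coordinate in place of polar coordinates: the wedge becomes
  \<open>c \<le> s\<close>, and the Cauchy density integrates to an arctangent.\<close>

lemma gauss_wedge: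
  "measure gauss_pair ({p. snd p \<le> - (c * fst p)} \<inter> {p \<in> space gauss_pair. 0 < fst p}) = (pi / 2 - arctan c) / (2 * pi)"
proof -
  interpret G: prob_space gauss_pair by (rule prob_space_gauss_pair)
  define \<phi> where "\<phi> x = ennreal (std_normal_density x)" for x :: real
  have \<phi>: "\<phi> \<in> borel_measurable borel" unfolding \<phi>_def by simp
  define A where "A = {p. snd p \<le> - (c * fst p)} \<inter> {p \<in> space gauss_pair. 0 < fst p}"
  have meas [measurable]: "fst \<in> borel_measurable gauss_pair" "snd \<in> borel_measurable gauss_pair"
    by (rule measurable_fst_pair, rule measurable_snd_pair)
  have A: "A \<in> sets gauss_pair"
  proof -
    have "A = {p \<in> space gauss_pair. snd p \<le> - (c * fst p) \<and> 0 < fst p}" by (auto simp: A_def)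
    also have "\<dots> \<in> sets gauss_pair" by measurable
    finally show ?thesis .
  qed
  have "emeasure gauss_pair A = (\<integral>\<^sup>+x. \<integral>\<^sup>+y. indicator A (x, y) \<partial>std_normal_distribution \<partial>std_normal_distribution)"
    using A by (subst std_normal.nn_integral_fst) auto
  also have "\<dots> = (\<integral>\<^sup>+x. \<phi> x * (\<integral>\<^sup>+y. \<phi> y * indicator A (x, y) \<partial>lborel) \<partial>lborel)"
  proof -
    have Ax: "(\<lambda>y. indicator A (x, y) :: ennreal) \<in> borel_measurable borel" for x
    proof -
      have "(\<lambda>y. indicator A (x, y) :: ennreal) = (\<lambda>y. indicator {y. y \<le> - (c * x) \<and> 0 < x} y)"
        by (auto simp: A_def indicator_def space_pair_measure fun_eq_iff)
      then show ?thesis by simp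
    qed
    have "(\<integral>\<^sup>+y. indicator A (x, y) \<partial>std_normal_distribution) = (\<integral>\<^sup>+y. \<phi> y * indicator A (x, y) \<partial>lborel)" for x
      unfolding \<phi>_def using Ax by (intro nn_integral_density) auto
    moreover have "(\<lambda>x. \<integral>\<^sup>+y. indicator A (x, y) \<partial>std_normal_distribution) \<in> borel_measurable lborel"
      using std_normal.borel_measurable_nn_integral_fst[of "indicator A" std_normal_distribution] A by simp
    ultimately show ?thesis unfolding \<phi>_def by (subst nn_integral_density) auto
  qed
  also have "\<dots> = (\<integral>\<^sup>+x. \<integral>\<^sup>+s. ennreal x * \<phi> x * \<phi> (- x * s) * indicator {0..} x * indicator {c..} s \<partial>lborel \<partial>lborel)"
  proof (rule nn_integral_cong)
    fix x :: real
    show "\<phi> x * (\<integral>\<^sup>+y. \<phi> y * indicator A (x, y) \<partial>lborel) = (\<integral>\<^sup>+s. ennreal x * \<phi> x * \<phi> (- x * s) * indicator {0..} x * indicator {c..} s \<partial>lborel)"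
    proof (cases "0 < x")
      case True
      have "(\<integral>\<^sup>+y. \<phi> y * indicator A (x, y) \<partial>lborel) = (\<integral>\<^sup>+y. \<phi> y * indicator {..- (c * x)} y \<partial>lborel)"
        using True by (intro nn_integral_cong) (auto simp: A_def indicator_def space_pair_measure)
      also have "\<dots> = ennreal \<bar>- x\<bar> * (\<integral>\<^sup>+s. \<phi> (0 + (- x) * s) * indicator {..- (c * x)} (0 + (- x) * s) \<partial>lborel)"
        using True \<phi> by (intro nn_integral_real_affine) auto
      also have "(\<integral>\<^sup>+s. \<phi> (0 + (- x) * s) * indicator {..- (c * x)} (0 + (- x) * s) \<partial>lborel) = (\<integral>\<^sup>+s. \<phi> (- x * s) * indicator {c..} s \<partial>lborel)"
        using True by (intro nn_integral_cong) (auto simp: indicator_def mult.commute)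
      finally have 1: "(\<integral>\<^sup>+y. \<phi> y * indicator A (x, y) \<partial>lborel) = ennreal x * (\<integral>\<^sup>+s. \<phi> (- x * s) * indicator {c..} s \<partial>lborel)"
        using True by simp
      have "(\<integral>\<^sup>+s. ennreal x * \<phi> x * \<phi> (- x * s) * indicator {0..} x * indicator {c..} s \<partial>lborel)
        = (\<integral>\<^sup>+s. (ennreal x * \<phi> x) * (\<phi> (- x * s) * indicator {c..} s) \<partial>lborel)"
        using True by (intro nn_integral_cong) (auto simp: mult_ac)
      also have "\<dots> = (ennreal x * \<phi> x) * (\<integral>\<^sup>+s. \<phi> (- x * s) * indicator {c..} s \<partial>lborel)"
        using \<phi> by (intro nn_integral_cmult borel_measurable_times_ennreal measurable_compose[OF _ \<phi>]) auto
      finally show ?thesis unfolding 1 by (simp only: mult_ac)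
    next
      case False
      then have "indicator A (x, y) = (0 :: ennreal)" for y by (auto simp: A_def)
      moreover have "ennreal x * \<phi> x * \<phi> (- x * s) * indicator {0..} x * indicator {c..} s = 0" for s
        using False by (auto simp: ennreal_neg)
      ultimately show ?thesis by (simp only: mult_zero_left mult_zero_right nn_integral_const)
    qed
  qed
  also have "\<dots> = (\<integral>\<^sup>+s. \<integral>\<^sup>+x. ennreal x * \<phi> x * \<phi> (- x * s) * indicator {0..} x * indicator {c..} s \<partial>lborel \<partial>lborel)"
  proof (rule lborel_pair.Fubini'[symmetric])
    have f: "(\<lambda>p :: real \<times> real. fst p) \<in> borel_measurable (lborel \<Otimes>\<^sub>M lborel)" "(\<lambda>p :: real \<times> real. snd p) \<in> borel_measurable (lborel \<Otimes>\<^sub>M lborel)"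
      using measurable_fst[of "lborel :: real measure" "lborel :: real measure"]
        measurable_snd[of "lborel :: real measure" "lborel :: real measure"]
      by (simp_all only: measurable_cong_sets[OF refl sets_lborel])
    show "(\<lambda>(x, s). ennreal x * \<phi> x * \<phi> (- x * s) * indicator {0..} x * indicator {c..} s) \<in> borel_measurable (lborel \<Otimes>\<^sub>M lborel)"
      unfolding case_prod_beta'
      by (intro borel_measurable_times_ennreal measurable_compose[OF f(1) measurable_ennreal] measurable_compose[OF f(1) \<phi>]
        measurable_compose[OF _ \<phi>] borel_measurable_times borel_measurable_uminus f
        measurable_compose[OF f(1) borel_measurable_indicator] measurable_compose[OF f(2) borel_measurable_indicator]) auto
  qed
  also have "\<dots> = (\<integral>\<^sup>+s. ennreal (1 / (2 * pi * (1 + s\<^sup>2))) * indicator {c..} s \<partial>lborel)"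
  proof (rule nn_integral_cong)
    fix s :: real
    have "(\<integral>\<^sup>+x. ennreal x * \<phi> x * \<phi> (- x * s) * indicator {0..} x * indicator {c..} s \<partial>lborel)
      = (\<integral>\<^sup>+x. ennreal x * \<phi> x * \<phi> (- x * s) * indicator {0..} x \<partial>lborel) * indicator {c..} s"
      by (intro nn_integral_multc borel_measurable_times_ennreal measurable_compose[OF _ \<phi>]) (use \<phi> in auto)
    then show "(\<integral>\<^sup>+x. ennreal x * \<phi> x * \<phi> (- x * s) * indicator {0..} x * indicator {c..} s \<partial>lborel)
      = ennreal (1 / (2 * pi * (1 + s\<^sup>2))) * indicator {c..} s"
      unfolding \<phi>_def nn_integral_gauss_ray .
  qed
  also have "\<dots> = ennreal ((pi / 2 - arctan c) / (2 * pi))" by (rule nn_integral_cauchy_tail)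
  finally have "emeasure gauss_pair A = ennreal ((pi / 2 - arctan c) / (2 * pi))" .
  moreover have "0 \<le> (pi / 2 - arctan c) / (2 * pi)" using arctan_ubound[of c] by simp
  ultimately show ?thesis unfolding A_def[symmetric] by (simp add: measure_def)
qed

section \<open>Disagreement of a strip model\<close>

text \<open>The second vector is a positive multiple of c v + u, so its inner product with x has the
  sign of \<open>c * a x + b x\<close>. Ties count as positive, as in \<open>hsign\<close>.\<close>

definition disagreement_region :: "('a \<Rightarrow> real) \<Rightarrow> ('a \<Rightarrow> real) \<Rightarrow> real \<Rightarrow> 'a set" where
  "disagreement_region a b c = {x. (0 \<le> a x \<and> b x < - (c * a x)) \<or> (a x < 0 \<and> - (c * a x) \<le> b x)}"

text \<open>The part with positive a, the reflected part with negative a, and the Gaussian wedge all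
  have probability close to \<open>Q c\<close>, and twice the wedge is the claimed value. Points
  with a = 0 lie under the central tent.\<close>

lemma prob_disagreement_region:
  fixes c :: real
  assumes S: "strip_model M a b \<eta> L g \<kappa> \<omega>" "strip_model M (\<lambda>x. - a x) (\<lambda>x. - b x) \<eta> L g \<kappa> \<omega>"
    and G: "strip_model gauss_pair fst snd \<eta> L g \<kappa> \<omega>"
  defines "D \<equiv> space M \<inter> disagreement_region a b c"
  shows "\<bar>measure M D - (pi / 2 - arctan c) / pi\<bar> \<le> 26 * \<eta> + 12 * \<kappa> * (real L * \<eta>) + 4 * \<omega>"
    and "0 < c \<Longrightarrow> 0 < L \<Longrightarrow> \<bar>measure M D - (pi / 2 - arctan c) / pi\<bar> \<le> 106 * \<eta> + 80 * sqrt \<kappa> / c + 8 / (c * (real L * \<eta>))\<^sup>2"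
proof -
  interpret S: strip_model M a b \<eta> L g \<kappa> \<omega> by (rule S(1))
  interpret S': strip_model M "\<lambda>x. - a x" "\<lambda>x. - b x" \<eta> L g \<kappa> \<omega> by (rule S(2))
  interpret G: strip_model gauss_pair fst snd \<eta> L g \<kappa> \<omega> by (rule G)
  define W where "W = {p \<in> space gauss_pair. snd p \<le> - (c * fst p)}"
  have D: "D \<in> sets M" 
  proof -
    have "D = {x \<in> space M. (0 \<le> a x \<and> b x < - (c * a x)) \<or> (a x < 0 \<and> - (c * a x) \<le> b x)}"
      by (auto simp: D_def disagreement_region_def)
    also have "\<dots> \<in> sets M" by measurable
    finally show ?thesis .
  qed
  have Wm: "W \<in> sets gauss_pair" unfolding W_def by measurable
  have h: "S.half_event c D" "S'.half_event c D" "G.half_event c W"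
    unfolding S.half_event_def S'.half_event_def G.half_event_def using D Wm
    by (auto simp: D_def W_def disagreement_region_def)
  have wedge: "measure gauss_pair (W \<inter> {p \<in> space gauss_pair. 0 < fst p}) = (pi / 2 - arctan c) / (2 * pi)"
  proof -
    have "W \<inter> {p \<in> space gauss_pair. 0 < fst p} = {p. snd p \<le> - (c * fst p)} \<inter> {p \<in> space gauss_pair. 0 < fst p}"
      by (auto simp: W_def)
    then show ?thesis by (simp only: gauss_wedge)
  qed
  define P1 where "P1 = measure M (D \<inter> {x \<in> space M. 0 < a x})"
  define P2 where "P2 = measure M (D \<inter> {x \<in> space M. 0 < - a x})"
  define Z where "Z = {x \<in> space M. a x = 0}"
  have Zm: "Z \<in> sets M" unfolding Z_def by measurable
  have Z: "measure M Z \<le> 2 * \<eta>"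
  proof -
    have "measure M Z = S.expectation (indicator Z)" using Zm by simp
    also have "\<dots> \<le> S.expectation (S.W 0)"
    proof (rule integral_mono)
      show "integrable M (indicator Z :: _ \<Rightarrow> real)" using Zm by (simp add: S.emeasure_eq_measure)
      show "indicator Z x \<le> S.W 0 x" for x
        using S.\<eta> S.W_bounds[of 0 x] by (auto simp: Z_def S.W_def tent_def indicator_def)
    qed simp
    also have "\<dots> \<le> 2 * \<eta>" using S.p_bounds(2)[of 0] by (simp add: S.p_def)
    finally show ?thesis .
  qed
  have split: "P1 + P2 \<le> measure M D \<and> measure M D \<le> P1 + P2 + 2 * \<eta>"
  proof -
    have m1: "D \<inter> {x \<in> space M. 0 < a x} \<in> sets M" "D \<inter> {x \<in> space M. 0 < - a x} \<in> sets M" using D by measurable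
    have u: "measure M ((D \<inter> {x \<in> space M. 0 < a x}) \<union> (D \<inter> {x \<in> space M. 0 < - a x})) = P1 + P2"
      unfolding P1_def P2_def by (rule S.finite_measure_Union[OF m1]) auto
    have "P1 + P2 \<le> measure M D" unfolding u[symmetric] using D by (intro S.finite_measure_mono) auto
    moreover have "measure M D \<le> measure M (((D \<inter> {x \<in> space M. 0 < a x}) \<union> (D \<inter> {x \<in> space M. 0 < - a x})) \<union> Z)"
      using m1 Zm by (intro S.finite_measure_mono) (auto simp: Z_def D_def)
    moreover have "\<dots> \<le> P1 + P2 + measure M Z"
      unfolding u[symmetric] using m1 Zm by (intro measure_Un_le) auto
    ultimately show ?thesis using Z by linarith
  qed
  have "x / pi = 2 * (x / (2 * pi))" for x :: real by simp
  note half = this[of "pi / 2 - arctan c"]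
  have half': "(pi / 2 - arctan c) / pi = 2 * measure gauss_pair (W \<inter> {p \<in> space gauss_pair. 0 < fst p})"
    by (simp only: wedge half)
  \<comment> \<open>\<open>4 * e\<close> is one \<open>e\<close> for each half and two for doubling
    the wedge. So the \<open>6\<close>, \<open>3\<close> and \<open>1\<close> of
    \<open>half_error\<close> become \<open>26\<close>, \<open>12\<close> and \<open>4\<close>, and
    the \<open>26\<close>, \<open>20\<close> and \<open>2\<close> of \<open>half_error_steep\<close>
    become \<open>106\<close>, \<open>80\<close> and \<open>8\<close>.\<close>
  have fin: "\<bar>m - y\<bar> \<le> 4 * e + 2 * \<eta>"
    if "\<bar>p1 - q\<bar> \<le> e" "\<bar>p2 - q\<bar> \<le> e" "\<bar>w - q\<bar> \<le> e" "p1 + p2 \<le> m \<and> m \<le> p1 + p2 + 2 * \<eta>" "y = 2 * w"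
    for m y p1 p2 q w e using that by linarith
  show "\<bar>measure M D - (pi / 2 - arctan c) / pi\<bar> \<le> 26 * \<eta> + 12 * \<kappa> * (real L * \<eta>) + 4 * \<omega>"
    using fin[OF S.half_error[OF h(1)] S'.half_error[OF h(2)] G.half_error[OF h(3)] split[unfolded P1_def P2_def] half']
    by (simp add: algebra_simps)
  assume c: "0 < c" "0 < L"
  show "\<bar>measure M D - (pi / 2 - arctan c) / pi\<bar> \<le> 106 * \<eta> + 80 * sqrt \<kappa> / c + 8 / (c * (real L * \<eta>))\<^sup>2"
    using fin[OF S.half_error_steep[OF h(1) c] S'.half_error_steep[OF h(2) c] G.half_error_steep[OF h(3) c]
        split[unfolded P1_def P2_def] half']
    by simp
qed

section \<open>Masses of the strips\<close>

lemma integral_tent: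
  assumes \<eta>: "0 < \<eta>"
  shows "has_bochner_integral lborel (tent \<eta> t) \<eta>"
proof -
  define F where "F x = x + (x - t)\<^sup>2 / (2 * \<eta>)" for x
  define G where "G x = - ((x - t)\<^sup>2 / \<eta>)" for x
  \<comment> \<open>The tent is the rising line on its whole support plus, on the right half, a
    correction of minus twice the slope. Both pieces have polynomial antiderivatives.\<close>
  have 1: "has_bochner_integral lborel (\<lambda>x. (1 + (x - t) / \<eta>) * indicator {t - \<eta>..t + \<eta>} x) (F (t + \<eta>) - F (t - \<eta>))"
  proof (rule has_bochner_integral_FTC_Icc_real)
    show "(F has_real_derivative 1 + (x - t) / \<eta>) (at x)" for x
      unfolding F_def using \<eta> by (auto intro!: derivative_eq_intros simp: field_simps)
    show "isCont (\<lambda>x. 1 + (x - t) / \<eta>) x" for x using \<eta> by (intro continuous_intros) auto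
  qed (use \<eta> in auto)
  have 2: "has_bochner_integral lborel (\<lambda>x. (- 2 * ((x - t) / \<eta>)) * indicator {t..t + \<eta>} x) (G (t + \<eta>) - G t)"
  proof (rule has_bochner_integral_FTC_Icc_real)
    show "(G has_real_derivative - 2 * ((x - t) / \<eta>)) (at x)" for x
      unfolding G_def using \<eta> by (auto intro!: derivative_eq_intros simp: field_simps)
    show "isCont (\<lambda>x. - 2 * ((x - t) / \<eta>)) x" for x using \<eta> by (intro continuous_intros) auto
  qed (use \<eta> in auto)
  have eq: "(1 + (x - t) / \<eta>) * indicator {t - \<eta>..t + \<eta>} x + (- 2 * ((x - t) / \<eta>)) * indicator {t..t + \<eta>} x = tent \<eta> t x" for x
    using \<eta> by (auto simp: tent_def indicator_def max_def abs_if field_simps)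
  have val: "(F (t + \<eta>) - F (t - \<eta>)) + (G (t + \<eta>) - G t) = \<eta>"
    using \<eta> by (simp add: F_def G_def power2_eq_square field_simps)
  show ?thesis using has_bochner_integral_add[OF 1 2] unfolding eq val .
qed

lemma normal_density_lipschitz: "\<bar>std_normal_density x - std_normal_density y\<bar> \<le> \<bar>x - y\<bar>"
proof -
  have d: "(std_normal_density has_real_derivative - z * std_normal_density z) (at z)" for z
    unfolding normal_density_eq by (auto intro!: derivative_eq_intros simp: field_simps)
  have b: "\<bar>- z * std_normal_density z\<bar> \<le> 1" for z
  proof -
    have "1 + (z\<^sup>2 / 2) \<le> exp (z\<^sup>2 / 2)" by (rule exp_ge_add_one_self)
    moreover have "\<bar>z\<bar> \<le> 1 + z\<^sup>2 / 2"
      using zero_le_power2[of "\<bar>z\<bar> - 1"] by (simp add: power2_eq_square algebra_simps)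
    ultimately have "\<bar>z\<bar> \<le> exp (z\<^sup>2 / 2)" by linarith
    then have "\<bar>z\<bar> * exp (- z\<^sup>2 / 2) \<le> 1" by (simp add: exp_minus field_simps)
    moreover have s1: "1 \<le> sqrt (2 * pi)" using pi_gt3 by (intro real_le_rsqrt) auto
    then have "\<bar>z\<bar> * exp (- z\<^sup>2 / 2) / sqrt (2 * pi) \<le> \<bar>z\<bar> * exp (- z\<^sup>2 / 2) / 1"
      by (intro divide_left_mono) auto
    ultimately have "\<bar>z\<bar> * exp (- z\<^sup>2 / 2) / sqrt (2 * pi) \<le> 1" by linarith
    moreover have "\<bar>- z * std_normal_density z\<bar> = \<bar>z\<bar> * exp (- z\<^sup>2 / 2) / sqrt (2 * pi)"
      by (simp add: normal_density_eq abs_mult)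
    ultimately show ?thesis by simp
  qed
  show ?thesis
    using field_differentiable_bound[of UNIV std_normal_density "\<lambda>z. - z * std_normal_density z" 1 x y] d b by auto
qed

text \<open>On the support the density differs from its value at the centre by at most \<eta>, and
  the tent has integral \<eta>.\<close>

lemma integral_tent_normal:
  assumes \<eta>: "0 < \<eta>"
  shows "\<bar>(LINT x|std_normal_distribution. tent \<eta> t x) - \<eta> * std_normal_density t\<bar> \<le> \<eta>\<^sup>2"
proof -
  have T: "integrable lborel (tent \<eta> t)" "(LINT x|lborel. tent \<eta> t x) = \<eta>"
    using integral_tent[OF \<eta>, of t] by (auto simp: has_bochner_integral_iff)
  have m: "tent \<eta> t \<in> borel_measurable borel" by (intro borel_measurable_tent measurable_ident_sets refl)
  have e: "(LINT x|std_normal_distribution. tent \<eta> t x) = (LINT x|lborel. std_normal_density x * tent \<eta> t x)"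
    using m by (subst integral_density) (auto intro: normal_density_nonneg)
  have i: "integrable lborel (\<lambda>x. std_normal_density x * tent \<eta> t x)"
  proof (rule Bochner_Integration.integrable_bound[OF T(1)])
    show "AE x in lborel. norm (std_normal_density x * tent \<eta> t x) \<le> norm (tent \<eta> t x)"
    proof (rule AE_I2)
      fix x
      have "std_normal_density x * tent \<eta> t x \<le> 1 * tent \<eta> t x"
        using std_normal_density_le[of x] tent_nonneg[of \<eta> t x] by (intro mult_right_mono) auto
      then show "norm (std_normal_density x * tent \<eta> t x) \<le> norm (tent \<eta> t x)" by (simp add: tent_nonneg abs_mult)
    qed
  qed (use m in simp)
  have "(LINT x|lborel. std_normal_density x * tent \<eta> t x) - \<eta> * std_normal_density t
     = (LINT x|lborel. std_normal_density x * tent \<eta> t x) - (LINT x|lborel. std_normal_density t * tent \<eta> t x)"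
    using T by simp
  also have "\<dots> = (LINT x|lborel. std_normal_density x * tent \<eta> t x - std_normal_density t * tent \<eta> t x)"
    using i T(1) by (intro Bochner_Integration.integral_diff[symmetric]) auto
  finally have eq: "(LINT x|lborel. std_normal_density x * tent \<eta> t x) - \<eta> * std_normal_density t
     = (LINT x|lborel. (std_normal_density x - std_normal_density t) * tent \<eta> t x)" by (simp add: left_diff_distrib)
  have "\<bar>LINT x|lborel. (std_normal_density x - std_normal_density t) * tent \<eta> t x\<bar> \<le> (LINT x|lborel. \<eta> * tent \<eta> t x)"
  proof (rule integral_abs_bound[THEN order_trans], rule integral_mono)
    show "integrable lborel (\<lambda>x. \<bar>(std_normal_density x - std_normal_density t) * tent \<eta> t x\<bar>)"
      using i T(1) by (intro integrable_abs) (simp add: left_diff_distrib)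
    show "\<bar>(std_normal_density x - std_normal_density t) * tent \<eta> t x\<bar> \<le> \<eta> * tent \<eta> t x" for x
    proof (cases "\<eta> \<le> \<bar>x - t\<bar>")
      case True
      then show ?thesis using tent_eq_0[OF \<eta>, of x t] by simp
    next
      case False
      then have "\<bar>std_normal_density x - std_normal_density t\<bar> \<le> \<eta>" using normal_density_lipschitz[of x t] by linarith
      then show ?thesis unfolding abs_mult using tent_nonneg[of \<eta> t x] by (simp add: mult_right_mono)
    qed
  qed (use T in auto)
  also have "\<dots> = \<eta>\<^sup>2" using T by (simp add: power2_eq_square)
  finally show ?thesis unfolding e eq .
qed

text \<open>The inequalities \<open>z - z\<^sup>2 \<le> ln (1 + z)\<close> and
  \<open>1 + z \<le> exp z\<close> at \<open>z = y / real M\<close>, raised to the power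
  \<open>M\<close>.\<close>

lemma power_le_exp_approx:
  fixes y :: real
  assumes y: "0 \<le> y" "y \<le> real M" and M: "0 < M"
  shows "exp (- y) \<le> 1 / (1 + y / real M) ^ M" and "1 / (1 + y / real M) ^ M \<le> exp (- y) * exp (y\<^sup>2 / real M)"
proof -
  define z where "z = y / real M"
  have z: "0 \<le> z" "z \<le> 1" using assms by (auto simp: z_def)
  have "(1 + z) ^ M \<le> exp z ^ M" using z by (intro power_mono) auto
  also have "\<dots> = exp y" using M by (simp add: z_def exp_of_nat_mult[symmetric])
  finally show "exp (- y) \<le> 1 / (1 + y / real M) ^ M"
    using z unfolding z_def[symmetric] by (simp add: exp_minus inverse_eq_divide divide_left_mono)
  have "exp (z - z\<^sup>2) \<le> 1 + z"
    using ln_one_plus_pos_lower_bound[OF z] z by (metis add_pos_nonneg exp_le_cancel_iff exp_ln zero_less_one)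
  then have "exp (z - z\<^sup>2) ^ M \<le> (1 + z) ^ M" by (intro power_mono) auto
  moreover have "exp (z - z\<^sup>2) ^ M = exp (y - y\<^sup>2 / real M)"
    using M by (simp add: exp_of_nat_mult[symmetric] z_def right_diff_distrib power2_eq_square)
  ultimately have "1 / (1 + z) ^ M \<le> 1 / exp (y - y\<^sup>2 / real M)" using z by (intro divide_left_mono) auto
  also have "\<dots> = exp (- y) * exp (y\<^sup>2 / real M)" by (simp add: exp_diff exp_minus field_simps)
  finally show "1 / (1 + y / real M) ^ M \<le> exp (- y) * exp (y\<^sup>2 / real M)" unfolding z_def .
qed

text \<open>The constant \<open>1 / 4\<close> is a lower bound for the value of the density at the origin.\<close>

lemma mass_target_exists:
  assumes \<kappa>: "0 < \<kappa>" "\<kappa> \<le> 1" and R: "0 \<le> R"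
  shows "\<exists>k M. \<forall>t. \<bar>t\<bar> \<le> R \<longrightarrow> \<bar>std_normal_density t - mass_target k M t\<bar> \<le> \<kappa> / 2 \<and>
    exp (- R\<^sup>2 / 2) / 4 \<le> mass_target k M t \<and> mass_target k M t \<le> 1"
proof -
  define b where "b = 1 / sqrt (2 * pi)"
  have b: "1 / 4 < b" "b \<le> 1 / 2"
  proof -
    have "2 \<le> sqrt (2 * pi)" using pi_gt3 by (intro real_le_rsqrt) auto
    then show "b \<le> 1 / 2" by (simp add: b_def divide_simps)
    have "sqrt (2 * pi) < 4" using pi_less_4 by (intro real_less_lsqrt) auto
    then show "1 / 4 < b" by (simp add: b_def divide_simps)
  qed
  \<comment> \<open>A rational just below the density at the origin: within
    \<open>\<kappa> / 8\<close> for the accuracy, and above \<open>1 / 4\<close> for the lower bound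
    of the target.\<close>
  obtain k0 where k0: "max (1 / 4) (b - \<kappa> / 8) < real_of_rat k0" "real_of_rat k0 < b"
    using of_rat_dense[of "max (1 / 4) (b - \<kappa> / 8)" b] b \<kappa> by auto
  \<comment> \<open>The argument \<open>y\<close> is at most \<open>R\<^sup>2 / 2\<close>, so
    \<open>y\<^sup>2 / M\<close> is at most \<open>R ^ 4 / 4 / M\<close> and one exponent serves all
    \<open>t\<close>. The error \<open>\<kappa> / 4\<close> obtained here and the
    \<open>\<kappa> / 8\<close> of the coefficient stay below \<open>\<kappa> / 2\<close>.\<close>
  have "(\<lambda>n. exp (R ^ 4 / 4 / real (Suc n)) - 1) \<longlonglongrightarrow> exp 0 - 1"
    by (intro tendsto_intros LIMSEQ_Suc[OF lim_const_over_n])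
  then have "\<forall>\<^sub>F n in sequentially. exp (R ^ 4 / 4 / real (Suc n)) - 1 < \<kappa> / 4"
    using \<kappa> by (intro order_tendstoD(2)) auto
  moreover have "\<forall>\<^sub>F n in sequentially. R\<^sup>2 \<le> real n"
    using filterlim_real_sequentially by (simp add: filterlim_at_top)
  ultimately have "\<forall>\<^sub>F n in sequentially. exp (R ^ 4 / 4 / real (Suc n)) - 1 < \<kappa> / 4 \<and> R\<^sup>2 \<le> real n"
    by (rule eventually_conj)
  then obtain n where n: "exp (R ^ 4 / 4 / real (Suc n)) - 1 < \<kappa> / 4" "R\<^sup>2 \<le> real n"
    by (auto simp: eventually_sequentially)
  define M where "M = Suc n"
  have "\<bar>std_normal_density t - mass_target k0 M t\<bar> \<le> \<kappa> / 2 \<and>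
    exp (- R\<^sup>2 / 2) / 4 \<le> mass_target k0 M t \<and> mass_target k0 M t \<le> 1" if t: "\<bar>t\<bar> \<le> R" for t
  proof -
    define y where "y = t\<^sup>2 / 2"
    have tR: "t\<^sup>2 \<le> R\<^sup>2" using t by (simp add: abs_le_square_iff[symmetric])
    have y: "0 \<le> y" "y \<le> real M" "y \<le> R\<^sup>2 / 2" using tR n(2) by (auto simp: y_def M_def)
    define E where "E = 1 / (1 + y / real M) ^ M"
    have E: "exp (- y) \<le> E" "E \<le> exp (- y) * exp (y\<^sup>2 / real M)"
      unfolding E_def using power_le_exp_approx[OF y(1,2)] by (auto simp: M_def)
    have "y\<^sup>2 \<le> (R\<^sup>2 / 2)\<^sup>2" using y by (intro power_mono) auto
    then have "y\<^sup>2 / real M \<le> R ^ 4 / 4 / real M" by (intro divide_right_mono) (auto simp: power2_eq_square power4_eq_xxxx)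
    then have "exp (y\<^sup>2 / real M) \<le> 1 + \<kappa> / 4" using n(1) by (smt (verit) exp_le_cancel_iff M_def)
    moreover have e1: "exp (- y) \<le> 1" "0 < exp (- y)" using y by auto
    ultimately have "exp (- y) * (exp (y\<^sup>2 / real M) - 1) \<le> 1 * (\<kappa> / 4)" using \<kappa> y
      by (intro mult_mono) (auto simp: divide_nonneg_nonneg)
    then have Eu: "E \<le> exp (- y) + \<kappa> / 4" using E(2) by (simp add: right_diff_distrib)
    have T: "mass_target k0 M t = of_rat k0 * E" by (simp add: mass_target_def E_def y_def)
    have N: "std_normal_density t = b * exp (- y)" by (simp add: normal_density_eq b_def y_def)
    have k01: "0 < real_of_rat k0" "real_of_rat k0 \<le> 1" using k0 b by linarith+
    have l: "of_rat k0 * exp (- y) \<le> of_rat k0 * E" using E(1) k01 by (intro mult_left_mono) auto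
    have u: "of_rat k0 * E \<le> of_rat k0 * exp (- y) + \<kappa> / 4"
    proof -
      have "of_rat k0 * E \<le> of_rat k0 * (exp (- y) + \<kappa> / 4)" using Eu k01 by (intro mult_left_mono) auto
      also have "\<dots> \<le> of_rat k0 * exp (- y) + 1 * (\<kappa> / 4)" unfolding distrib_left using k01 \<kappa>
        by (intro add_left_mono mult_right_mono) auto
      finally show ?thesis by simp
    qed
    have kb: "b - of_rat k0 \<le> \<kappa> / 8" "0 \<le> b - of_rat k0" using k0 by linarith+
    have d1: "(b - of_rat k0) * exp (- y) \<le> (\<kappa> / 8) * 1"
      using kb e1 \<kappa> by (intro mult_mono) auto
    have d2: "0 \<le> (b - of_rat k0) * exp (- y)"
      using kb e1 by (intro mult_nonneg_nonneg) auto
    note d = d1 d2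
    have 1: "\<bar>b * exp (- y) - of_rat k0 * E\<bar> \<le> \<kappa> / 2"
      using l u d[unfolded left_diff_distrib] \<kappa> by linarith
    have "exp (- (R\<^sup>2 / 2)) \<le> exp (- y)" using y by simp
    have q: "1 / 4 \<le> real_of_rat k0" "0 \<le> real_of_rat k0" "real_of_rat k0 \<le> 1 / 2" using k0 b by linarith+
    have "1 / 4 * exp (- (R\<^sup>2 / 2)) \<le> of_rat k0 * exp (- y)"
      using \<open>exp (- (R\<^sup>2 / 2)) \<le> exp (- y)\<close> by (rule mult_mono[OF q(1) _ q(2) exp_ge_zero])
    with l have 2: "exp (- R\<^sup>2 / 2) / 4 \<le> of_rat k0 * E" by simp
    have "of_rat k0 * exp (- y) \<le> 1 / 2 * 1"
      by (rule mult_mono[OF q(3) e1(1)]) auto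
    with u \<kappa> have 3: "of_rat k0 * E \<le> 1" by simp
    show ?thesis unfolding T N using 1 2 3 by blast
  qed
  then show ?thesis by blast
qed

section \<open>Uniform deviations\<close>

lemma prob_space_gaussian_dataset: "prob_space (gaussian_dataset d N)"
  unfolding gaussian_dataset_def by (intro prob_space_PiM prob_space_std_gaussian)

lemma measurable_sample: "n < N \<Longrightarrow> (\<lambda>S. S n) \<in> measurable (gaussian_dataset d N) (std_gaussian d)"
  unfolding gaussian_dataset_def by (intro measurable_component_singleton) simp

lemma distr_sample: "n < N \<Longrightarrow> distr (gaussian_dataset d N) (std_gaussian d) (\<lambda>S. S n) = std_gaussian d"
  unfolding gaussian_dataset_def by (intro distr_PiM_component prob_space_std_gaussian) simp

lemma
  fixes f :: "vect \<Rightarrow> real"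
  assumes "n < N" "f \<in> borel_measurable (borel_vect d)"
  shows integral_sample: "(LINT S|gaussian_dataset d N. f (S n)) = (LINT x|std_gaussian d. f x)"
    and integrable_sample: "integrable (gaussian_dataset d N) (\<lambda>S. f (S n)) \<longleftrightarrow> integrable (std_gaussian d) f"
    and measurable_sample_fun: "(\<lambda>S. f (S n)) \<in> borel_measurable (gaussian_dataset d N)"
proof -
  have f: "f \<in> borel_measurable (std_gaussian d)" using assms(2) by (simp only: measurable_std_gaussian)
  show "(LINT S|gaussian_dataset d N. f (S n)) = (LINT x|std_gaussian d. f x)"
    using integral_distr[OF measurable_sample[OF assms(1)] f] unfolding distr_sample[OF assms(1)] by simp
  show "integrable (gaussian_dataset d N) (\<lambda>S. f (S n)) \<longleftrightarrow> integrable (std_gaussian d) f"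
    using integrable_distr_eq[OF measurable_sample[OF assms(1)] f] unfolding distr_sample[OF assms(1)] by simp
  show "(\<lambda>S. f (S n)) \<in> borel_measurable (gaussian_dataset d N)"
    using measurable_compose[OF measurable_sample[OF assms(1)] f] .
qed

lemma measurable_mass:
  "f \<in> borel_measurable (borel_vect d) \<Longrightarrow> (\<lambda>S. mass N S f) \<in> borel_measurable (gaussian_dataset d N)"
  unfolding mass_def by (intro borel_measurable_divide borel_measurable_sum borel_measurable_const measurable_sample_fun) auto

lemma indep_samples:
  assumes "0 < N"
  shows "prob_space.indep_vars (gaussian_dataset d N) (\<lambda>_. std_gaussian d) (\<lambda>n S. S n) {..<N}"
proof -
  interpret prob_space "gaussian_dataset d N" by (rule prob_space_gaussian_dataset)
  have "distr (gaussian_dataset d N) (PiM {..<N} (\<lambda>_. std_gaussian d)) (\<lambda>S. \<lambda>n\<in>{..<N}. S n)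
    = distr (gaussian_dataset d N) (gaussian_dataset d N) (\<lambda>S. S)"
    by (intro distr_cong) (auto simp: gaussian_dataset_def space_PiM PiE_restrict)
  also have "\<dots> = gaussian_dataset d N" by simp
  also have "\<dots> = PiM {..<N} (\<lambda>n. distr (gaussian_dataset d N) (std_gaussian d) (\<lambda>S. S n))"
    unfolding gaussian_dataset_def[of d N]
    by (intro PiM_cong) (auto simp: distr_sample[unfolded gaussian_dataset_def])
  finally show ?thesis
    using assms measurable_sample by (subst indep_vars_iff_distr_eq_PiM') auto
qed

lemma mass_deviation:
  fixes f :: "vect \<Rightarrow> real"
  assumes f: "f \<in> borel_measurable (borel_vect d)" and A: "\<And>x. \<bar>f x\<bar> \<le> A" "0 < A" and N: "0 < N" and s: "0 \<le> s"
  shows "measure (gaussian_dataset d N) {S \<in> space (gaussian_dataset d N). s \<le> \<bar>mass N S f - (LINT x|std_gaussian d. f x)\<bar>}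
    \<le> 2 * exp (- (real N * s\<^sup>2 / (2 * A\<^sup>2)))"
proof -
  interpret prob_space "gaussian_dataset d N" by (rule prob_space_gaussian_dataset)
  have fs: "f \<in> borel_measurable (std_gaussian d)" using f by (simp only: measurable_std_gaussian)
  have i: "indep_vars (\<lambda>_. borel) (\<lambda>n S. f (S n)) {..<N}"
    by (rule indep_vars_compose2[OF indep_samples[OF N] fs])
  interpret H: Hoeffding_ineq "gaussian_dataset d N" "{..<N}" "\<lambda>n S. f (S n)" "\<lambda>_. - A" "\<lambda>_. A"
    "\<Sum>n<N. expectation (\<lambda>S. f (S n))"
  proof unfold_locales
    show "AE S in gaussian_dataset d N. f (S n) \<in> {- A..A}" for n
      using A(1) by (intro AE_I2) (auto simp: abs_le_iff minus_le_iff)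
  qed (use i in auto)
  have E: "(\<Sum>n<N. expectation (\<lambda>S. f (S n))) = real N * (LINT x|std_gaussian d. f x)"
    using f by (simp add: integral_sample)
  have eq: "s \<le> \<bar>mass N S f - (LINT x|std_gaussian d. f x)\<bar> \<longleftrightarrow>
     real N * s \<le> \<bar>(\<Sum>n<N. f (S n)) - real N * (LINT x|std_gaussian d. f x)\<bar>" for S
  proof -
    have "(\<Sum>n<N. f (S n)) - real N * (LINT x|std_gaussian d. f x) = real N * (mass N S f - (LINT x|std_gaussian d. f x))"
      using N by (simp add: mass_def field_simps)
    then have "\<bar>(\<Sum>n<N. f (S n)) - real N * (LINT x|std_gaussian d. f x)\<bar> = real N * \<bar>mass N S f - (LINT x|std_gaussian d. f x)\<bar>"
      by (simp add: abs_mult)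
    then show ?thesis using N by simp
  qed
  have sq: "(\<Sum>n<N. (A - - A)\<^sup>2) = 4 * A\<^sup>2 * real N" by (simp add: power2_eq_square)
  have "prob {S \<in> space (gaussian_dataset d N). real N * s \<le> \<bar>(\<Sum>n<N. f (S n)) - (\<Sum>n<N. expectation (\<lambda>S. f (S n)))\<bar>}
    \<le> 2 * exp (- 2 * (real N * s)\<^sup>2 / (\<Sum>n<N. (A - - A)\<^sup>2))"
    using s N A(2) by (intro H.Hoeffding_ineq_abs_ge) (auto simp: sq)
  also have "- 2 * (real N * s)\<^sup>2 / (\<Sum>n<N. (A - - A)\<^sup>2) = - (real N * s\<^sup>2 / (2 * A\<^sup>2))"
    unfolding sq using N A(2) by (simp add: power2_eq_square field_simps)
  finally show ?thesis unfolding E eq .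
qed

lemma integral_mass:
  assumes "0 < N" "f \<in> borel_measurable (borel_vect d)" "integrable (std_gaussian d) f"
  shows "integrable (gaussian_dataset d N) (\<lambda>S. mass N S f)"
    and "(LINT S|gaussian_dataset d N. mass N S f) = (LINT x|std_gaussian d. f x)"
proof -
  have i: "integrable (gaussian_dataset d N) (\<lambda>S. f (S n))" if "n < N" for n
    using assms that by (simp add: integrable_sample)
  then show "integrable (gaussian_dataset d N) (\<lambda>S. mass N S f)"
    unfolding mass_def by (intro integrable_divide_zero Bochner_Integration.integrable_sum) auto
  have "(LINT S|gaussian_dataset d N. (\<Sum>n<N. f (S n))) = (\<Sum>n<N. LINT S|gaussian_dataset d N. f (S n))"
    using i by (intro Bochner_Integration.integral_sum) auto
  then show "(LINT S|gaussian_dataset d N. mass N S f) = (LINT x|std_gaussian d. f x)"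
    unfolding mass_def using assms by (simp add: integral_sample)
qed

definition truncate :: "nat \<Rightarrow> real \<Rightarrow> (vect \<Rightarrow> real) \<Rightarrow> vect \<Rightarrow> real" where
  "truncate d R f x = (if 1 + dot d x x \<le> R then f x else 0)"

lemma measurable_truncate:
  assumes "f \<in> borel_measurable (borel_vect d)"
  shows "truncate d R f \<in> borel_measurable (borel_vect d)"
proof -
  have "(\<lambda>x. 1 + dot d x x) \<in> borel_measurable (borel_vect d)"
    by (intro borel_measurable_add borel_measurable_const measurable_dot_self measurable_ident_sets refl)
  then have "{x \<in> space (borel_vect d). 1 + dot d x x \<le> R} \<in> sets (borel_vect d)" by measurable
  then show ?thesis unfolding truncate_def using assms by (intro measurable_If) auto
qed

text \<open>Where the function is cut off, \<open>(1 + dot d x x) / R\<close> exceeds one. Inserting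
  this factor trades the cut-off for a factor 1 / R and one more power in
  \<open>growth\<close>.\<close>

lemma truncate_bounds:
  assumes f: "\<And>x. \<bar>f x\<bar> \<le> A * growth d k x" and R: "0 < R" and A: "0 \<le> A"
  shows "\<bar>truncate d R f x\<bar> \<le> A * R ^ k" and "\<bar>f x - truncate d R f x\<bar> \<le> A / R * growth d (Suc k) x"
proof -
  have "A * growth d k x \<le> A * R ^ k" if "1 + dot d x x \<le> R"
    using that A by (intro mult_left_mono) (auto simp: growth_def intro!: power_mono add_nonneg_nonneg)
  then show "\<bar>truncate d R f x\<bar> \<le> A * R ^ k" using f[of x] R A by (auto simp: truncate_def)
  show "\<bar>f x - truncate d R f x\<bar> \<le> A / R * growth d (Suc k) x"
  proof (cases "1 + dot d x x \<le> R")
    case True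
    then show ?thesis using A R order_trans[OF zero_le_one growth_ge_1[of d "Suc k" x]] by (simp add: truncate_def)
  next
    case False
    have "A * growth d k x * 1 \<le> A * growth d k x * ((1 + dot d x x) / R)"
      using False R A growth_ge_1[of d k x] by (intro mult_left_mono) (auto simp: pos_le_divide_eq)
    also have "\<dots> = A / R * growth d (Suc k) x" by (simp add: growth_def)
    finally show ?thesis using f[of x] False by (simp add: truncate_def)
  qed
qed

lemma mass_mono: "(\<And>x. f x \<le> g x) \<Longrightarrow> mass N S f \<le> mass N S g"
  unfolding mass_def by (intro divide_right_mono sum_mono) auto

lemma mass_diff: "mass N S (\<lambda>x. f x - g x) = mass N S f - mass N S g"
  by (simp add: mass_def sum_subtractf diff_divide_distrib)

lemma mass_cmult: "mass N S (\<lambda>x. c * f x) = c * mass N S f"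
  by (simp add: mass_def sum_distrib_left)

lemma abs_mass_le: "\<bar>mass N S f\<bar> \<le> mass N S (\<lambda>x. \<bar>f x\<bar>)"
  unfolding mass_def by (simp add: abs_divide divide_right_mono sum_abs)

text \<open>Hoeffding's inequality needs bounded functions, so it is applied to the truncated ones,
  with a union bound. The truncation errors of all members are controlled by one event, that the
  empirical mean of \<open>growth\<close> is at most \<open>B / \<delta>\<close>; it fails with
  probability at most \<delta> by Markov's inequality. The bound on this mean is kept in the
  conclusion for later use.\<close>

lemma finite_family_deviation:
  fixes F :: "(vect \<Rightarrow> real) set"
  assumes F: "finite F" "\<And>f. f \<in> F \<Longrightarrow> f \<in> borel_measurable (borel_vect d)"
      "\<And>f x. f \<in> F \<Longrightarrow> \<bar>f x\<bar> \<le> A * growth d k x"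
    and pos: "0 < A" "0 < R" "0 < N" "0 \<le> s" "0 < \<delta>" "\<delta> < 1"
  defines "B \<equiv> LINT x|std_gaussian d. growth d (Suc k) x"
  shows "with_prob_at_least (gaussian_dataset d N)
     (1 - (\<delta> + real (card F) * (2 * exp (- (real N * s\<^sup>2 / (2 * (A * R ^ k)\<^sup>2))))))
     (\<lambda>S. mass N S (growth d (Suc k)) \<le> B / \<delta> \<and>
       (\<forall>f\<in>F. \<bar>mass N S f - (LINT x|std_gaussian d. f x)\<bar> \<le> s + 2 * (A / R * (B / \<delta>))))"
proof -
  let ?G = "gaussian_dataset d N"
  interpret prob_space ?G by (rule prob_space_gaussian_dataset)
  interpret \<gamma>: prob_space "std_gaussian d" by (rule prob_space_std_gaussian)
  define H where "H = growth d (Suc k)"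
  have Hm: "H \<in> borel_measurable (borel_vect d)" unfolding H_def by (rule measurable_growth)
  have iH: "integrable (std_gaussian d) H" unfolding H_def by (rule integrable_growth)
  have B1: "1 \<le> B"
  proof -
    have "(LINT x|std_gaussian d. (1::real)) \<le> B" unfolding B_def
      by (intro integral_mono integrable_growth growth_ge_1) simp
    then show ?thesis by (simp add: \<gamma>.prob_space)
  qed
  define bad where "bad f = {S \<in> space ?G. s \<le> \<bar>mass N S (truncate d R f) - (LINT x|std_gaussian d. truncate d R f x)\<bar>}" for f
  define bad0 where "bad0 = {S \<in> space ?G. B / \<delta> \<le> mass N S H}"
  have badm: "bad f \<in> sets ?G" if "f \<in> F" for f
    unfolding bad_def using measurable_mass[OF measurable_truncate[OF F(2)[OF that]], of N R] by measurable
  have bad0m: "bad0 \<in> sets ?G" unfolding bad0_def using measurable_mass[OF Hm, of N] by measurable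
  have p0: "prob bad0 \<le> \<delta>"
  proof -
    have "prob bad0 \<le> expectation (\<lambda>S. mass N S H) / (B / \<delta>)" unfolding bad0_def
    proof (rule integral_Markov_inequality_measure[where A = "{}"])
      have "0 \<le> mass N S H" for S unfolding mass_def H_def
        using order_trans[OF zero_le_one growth_ge_1] by (intro divide_nonneg_nonneg sum_nonneg) auto
      then show "AE S in ?G. 0 \<le> mass N S H" by simp
    qed (use integral_mass[OF pos(3) Hm iH] B1 pos in auto)
    also have "\<dots> = \<delta>" using integral_mass[OF pos(3) Hm iH] B1 pos by (simp add: B_def H_def)
    finally show ?thesis .
  qed
  have p1: "prob (bad f) \<le> 2 * exp (- (real N * s\<^sup>2 / (2 * (A * R ^ k)\<^sup>2)))" if "f \<in> F" for f
    unfolding bad_def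
    by (intro mass_deviation measurable_truncate F(2)[OF that] truncate_bounds(1)[OF F(3)[OF that]]) (use pos in auto)
  define E where "E = space ?G - (bad0 \<union> (\<Union>f\<in>F. bad f))"
  have Um: "bad0 \<union> (\<Union>f\<in>F. bad f) \<in> sets ?G" using bad0m badm F(1) by (intro sets.Un sets.finite_UN) auto
  have "prob (bad0 \<union> (\<Union>f\<in>F. bad f)) \<le> prob bad0 + prob (\<Union>f\<in>F. bad f)"
    using bad0m badm F(1) by (intro measure_Un_le sets.finite_UN) auto
  also have "prob (\<Union>f\<in>F. bad f) \<le> (\<Sum>f\<in>F. prob (bad f))" using badm F(1) by (intro measure_UNION_le) auto
  also have "\<dots> \<le> (\<Sum>f\<in>F. 2 * exp (- (real N * s\<^sup>2 / (2 * (A * R ^ k)\<^sup>2))))" by (intro sum_mono p1)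
  finally have "prob (bad0 \<union> (\<Union>f\<in>F. bad f)) \<le> \<delta> + real (card F) * (2 * exp (- (real N * s\<^sup>2 / (2 * (A * R ^ k)\<^sup>2))))"
    using p0 by simp
  moreover have "prob E = 1 - prob (bad0 \<union> (\<Union>f\<in>F. bad f))" unfolding E_def by (rule prob_compl[OF Um])
  ultimately have pE: "1 - (\<delta> + real (card F) * (2 * exp (- (real N * s\<^sup>2 / (2 * (A * R ^ k)\<^sup>2))))) \<le> prob E" by linarith
  have "mass N S H \<le> B / \<delta> \<and> (\<forall>f\<in>F. \<bar>mass N S f - (LINT x|std_gaussian d. f x)\<bar> \<le> s + 2 * (A / R * (B / \<delta>)))" if S: "S \<in> E" for S
  proof (intro conjI ballI)
    show h: "mass N S H \<le> B / \<delta>" using S unfolding E_def bad0_def by auto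
    fix f assume f: "f \<in> F"
    define t where "t = truncate d R f"
    have 1: "\<bar>mass N S t - (LINT x|std_gaussian d. t x)\<bar> \<le> s" using S f unfolding E_def bad_def t_def by auto
    have d: "\<bar>f x - t x\<bar> \<le> A / R * H x" for x unfolding t_def H_def using truncate_bounds(2)[OF F(3)[OF f]] pos by simp
    have "\<bar>mass N S f - mass N S t\<bar> \<le> mass N S (\<lambda>x. \<bar>f x - t x\<bar>)" unfolding mass_diff[symmetric] by (rule abs_mass_le)
    also have "\<dots> \<le> mass N S (\<lambda>x. A / R * H x)" by (intro mass_mono d)
    also have "\<dots> \<le> A / R * (B / \<delta>)" unfolding mass_cmult using h pos by (intro mult_left_mono) auto
    finally have 2: "\<bar>mass N S f - mass N S t\<bar> \<le> A / R * (B / \<delta>)" .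
    have fi: "integrable (std_gaussian d) f" by (rule integrable_growth_bound[OF F(2)[OF f] F(3)[OF f]])
    have ti: "integrable (std_gaussian d) t" unfolding t_def
      by (rule integrable_growth_bound[OF measurable_truncate[OF F(2)[OF f]], of _ "A * R ^ k" 0])
        (use truncate_bounds(1)[OF F(3)[OF f]] pos in \<open>auto simp: growth_def\<close>)
    have "\<bar>(LINT x|std_gaussian d. f x) - (LINT x|std_gaussian d. t x)\<bar> = \<bar>LINT x|std_gaussian d. f x - t x\<bar>"
      using fi ti by simp
    also have "\<dots> \<le> (LINT x|std_gaussian d. A / R * H x)"
      using fi ti iH d by (intro integral_abs_bound[THEN order_trans] integral_mono) auto
    also have "\<dots> = A / R * B" by (simp add: B_def H_def)
    also have "\<dots> \<le> A / R * (B / \<delta>)" using pos B1 by (intro mult_left_mono) (auto simp: pos_le_divide_eq mult_left_le)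
    finally have 3: "\<bar>(LINT x|std_gaussian d. f x) - (LINT x|std_gaussian d. t x)\<bar> \<le> A / R * (B / \<delta>)" .
    show "\<bar>mass N S f - (LINT x|std_gaussian d. f x)\<bar> \<le> s + 2 * (A / R * (B / \<delta>))" using 1 2 3 by linarith
  qed
  then show ?thesis unfolding with_prob_at_least_def H_def[symmetric]
    using pE Um by (intro bexI[of _ E]) (auto simp: E_def)
qed

text \<open>A grid in the cube, whose points need not be unit vectors. Therefore the estimates for
  \<open>strip_fun\<close> assume only coordinates bounded by one, for which \<open>perp\<close>
  need not be a projection; this is where powers of \<open>real d + 1\<close> come from.\<close>

definition net :: "nat \<Rightarrow> nat \<Rightarrow> vect set" where
  "net d m = PiE {..<d} (\<lambda>_. (\<lambda>i. of_int i / real m) ` {- int m..int m})"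

lemma finite_net: "finite (net d m)"
  unfolding net_def by (intro finite_PiE) auto

lemma card_net_le: "card (net d m) \<le> (2 * m + 1) ^ d"
proof -
  have "card (net d m) = card ((\<lambda>i. of_int i / real m) ` {- int m..int m}) ^ d"
    unfolding net_def by (subst card_PiE) auto
  also have "\<dots> \<le> (2 * m + 1) ^ d"
    using card_image_le[of "{- int m..int m}" "\<lambda>i. of_int i / real m"] by (intro power_mono) (auto simp: nat_add_distrib)
  finally show ?thesis .
qed

lemma net_bounded:
  assumes "v \<in> net d m" "j < d"
  shows "\<bar>v j\<bar> \<le> 1"
proof -
  have "v j \<in> (\<lambda>i. of_int i / real m) ` {- int m..int m}" using assms unfolding net_def by (intro PiE_mem[of v]) auto
  then obtain i where i0: "v j = of_int i / real m" "i \<in> {- int m..int m}" by (rule imageE)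
  then have i: "v j = of_int i / real m" "- int m \<le> i" "i \<le> int m" by auto
  then have "\<bar>real_of_int i\<bar> \<le> real m" by linarith
  then show ?thesis unfolding i(1) by (cases "m = 0") (auto simp: abs_divide)
qed

lemma net_approx:
  assumes v: "\<And>j. j < d \<Longrightarrow> \<bar>v j\<bar> \<le> 1" and m: "0 < m"
  obtains u where "u \<in> net d m" "\<And>j. j < d \<Longrightarrow> \<bar>v j - u j\<bar> \<le> 1 / real m"
proof
  define u where "u = (\<lambda>j\<in>{..<d}. of_int \<lfloor>v j * real m\<rfloor> / real m)"
  show "u \<in> net d m"
    unfolding net_def
  proof (rule PiE_I)
    fix j assume "j \<in> {..<d}"
    then have j: "j < d" by simp
    have "\<bar>v j * real m\<bar> \<le> real m" using mult_right_mono[OF v[OF j], of "real m"] by (simp add: abs_mult)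
    then have "- real m \<le> v j * real m" "v j * real m \<le> real m" by auto
    then have "- int m \<le> \<lfloor>v j * real m\<rfloor>" "\<lfloor>v j * real m\<rfloor> \<le> int m" by (auto simp: le_floor_iff floor_le_iff)
    then show "u j \<in> (\<lambda>i. of_int i / real m) ` {- int m..int m}" using j by (auto simp: u_def)
  qed (simp add: u_def)
  fix j assume j: "j < d"
  have "v j - u j = frac (v j * real m) / real m" using j m by (simp add: u_def frac_def field_simps)
  then show "\<bar>v j - u j\<bar> \<le> 1 / real m" using frac_ge_0[of "v j * real m"] frac_lt_1[of "v j * real m"]
    by (simp add: divide_right_mono)
qed

lemma unit_coordinate_le: "unit_vector d v \<Longrightarrow> j < d \<Longrightarrow> \<bar>v j\<bar> \<le> 1"
  unfolding unit_vector_def using member_le_L2_set[of "{..<d}" j "\<lambda>j. \<bar>v j\<bar>"] by (simp add: L2_set_def)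

lemma unit_vector_dot: "unit_vector d v \<longleftrightarrow> dot d v v = 1"
  by (simp add: unit_vector_def L2_set_def dot_def power2_eq_square)

text \<open>The empirical means of these functions determine every quantity that is checked. For
  \<open>q = 0\<close> the tensor is one and the mean is the mass of the strip.\<close>

definition strip_fun :: "nat \<Rightarrow> real \<Rightarrow> nat \<Rightarrow> nat \<Rightarrow> nat \<Rightarrow> (nat \<Rightarrow> nat) \<Rightarrow> vect \<Rightarrow> vect \<Rightarrow> real" where
  "strip_fun d \<eta> L i q J v x = weight \<eta> L i (dot d x v) * tensor q J (perp d v x)"

lemma weight_bounds: "0 < \<eta> \<Longrightarrow> 0 \<le> weight \<eta> L i x" "0 < \<eta> \<Longrightarrow> weight \<eta> L i x \<le> 1"
  by (auto simp: weight_def tent_nonneg tent_le_1)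

lemma tent_lipschitz:
  assumes "0 < \<eta>"
  shows "\<bar>tent \<eta> t x - tent \<eta> t y\<bar> \<le> \<bar>x - y\<bar> / \<eta>"
proof -
  have "\<bar>\<bar>x - t\<bar> / \<eta> - \<bar>y - t\<bar> / \<eta>\<bar> = \<bar>\<bar>x - t\<bar> - \<bar>y - t\<bar>\<bar> / \<eta>"
    using assms by (simp add: diff_divide_distrib[symmetric] abs_divide)
  also have "\<dots> \<le> \<bar>x - y\<bar> / \<eta>" using assms by (intro divide_right_mono) auto
  finally show ?thesis unfolding tent_def by linarith
qed

lemma weight_lipschitz: "0 < \<eta> \<Longrightarrow> \<bar>weight \<eta> L i x - weight \<eta> L i y\<bar> \<le> \<bar>x - y\<bar> / \<eta>"
  by (auto simp: weight_def tent_lipschitz)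

lemma measurable_weight: "weight \<eta> L i \<in> borel_measurable borel"
  unfolding weight_def by (cases "i < 2 * L + 1") (auto intro!: borel_measurable_tent)

lemma measurable_strip_fun:
  assumes "J \<in> indices d q"
  shows "strip_fun d \<eta> L i q J v \<in> borel_measurable (borel_vect d)"
proof -
  have "(\<lambda>x. weight \<eta> L i (dot d x v)) \<in> borel_measurable (borel_vect d)"
    by (intro measurable_compose[OF measurable_dot measurable_weight] measurable_ident_sets refl)
  moreover have "(\<lambda>x. tensor q J (perp d v x)) \<in> borel_measurable (borel_vect d)"
    by (rule measurable_compose[OF measurable_perp measurable_tensor[OF assms]])
  ultimately show ?thesis unfolding strip_fun_def[abs_def] by (rule borel_measurable_times)
qed

lemma sum_abs_coordinates_le: "(\<Sum>j<d. \<bar>x j\<bar>) \<le> real d * (1 + dot d x x)"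
  using sum_bounded_above[of "{..<d}" "\<lambda>j. \<bar>x j\<bar>" "1 + dot d x x"] abs_coordinate_le[of _ d x] by simp

lemma abs_dot_le:
  assumes "\<And>j. j < d \<Longrightarrow> \<bar>v j\<bar> \<le> \<rho>" "0 \<le> \<rho>"
  shows "\<bar>dot d x v\<bar> \<le> \<rho> * (real d * (1 + dot d x x))"
proof -
  have "\<bar>dot d x v\<bar> \<le> (\<Sum>j<d. \<bar>x j\<bar> * \<bar>v j\<bar>)" unfolding dot_def by (rule order_trans[OF sum_abs]) (simp add: abs_mult)
  also have "\<dots> \<le> (\<Sum>j<d. \<bar>x j\<bar> * \<rho>)" using assms by (intro sum_mono mult_left_mono) auto
  also have "\<dots> = \<rho> * (\<Sum>j<d. \<bar>x j\<bar>)" by (simp add: sum_distrib_left mult.commute)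
  also have "\<dots> \<le> \<rho> * (real d * (1 + dot d x x))" using assms(2) by (intro mult_left_mono sum_abs_coordinates_le)
  finally show ?thesis .
qed

lemma abs_perp_le:
  assumes v: "\<And>j. j < d \<Longrightarrow> \<bar>v j\<bar> \<le> 1" and j: "j < d"
  shows "\<bar>perp d v x j\<bar> \<le> (real d + 1) * (1 + dot d x x)"
proof -
  have "\<bar>dot d x v * v j\<bar> \<le> real d * (1 + dot d x x) * 1"
    unfolding abs_mult using abs_dot_le[of d v 1 x] v j by (intro mult_mono) auto
  then show ?thesis using abs_coordinate_le[OF j, of x] j by (simp add: perp_def algebra_simps abs_le_iff)
qed

lemma abs_perp_diff_le:
  assumes v: "\<And>j. j < d \<Longrightarrow> \<bar>v j\<bar> \<le> 1" and u: "\<And>j. j < d \<Longrightarrow> \<bar>u j\<bar> \<le> 1"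
    and d: "\<And>j. j < d \<Longrightarrow> \<bar>v j - u j\<bar> \<le> \<rho>" "0 \<le> \<rho>" and j: "j < d"
  shows "\<bar>dot d x v - dot d x u\<bar> \<le> \<rho> * (real d * (1 + dot d x x))"
    and "\<bar>perp d v x j - perp d u x j\<bar> \<le> 2 * (\<rho> * (real d * (1 + dot d x x)))"
proof -
  have "dot d x v - dot d x u = dot d x (\<lambda>j. v j - u j)" by (simp add: dot_def sum_subtractf algebra_simps)
  then show 1: "\<bar>dot d x v - dot d x u\<bar> \<le> \<rho> * (real d * (1 + dot d x x))" using abs_dot_le[of d "\<lambda>j. v j - u j" \<rho> x] d by simp
  have "\<bar>(dot d x v - dot d x u) * v j\<bar> \<le> \<rho> * (real d * (1 + dot d x x)) * 1"
    unfolding abs_mult using 1 v[OF j] d by (intro mult_mono) auto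
  then have c1: "\<bar>(dot d x v - dot d x u) * v j\<bar> \<le> \<rho> * (real d * (1 + dot d x x))" by (simp only: mult_1_right)
  have "\<bar>dot d x u * (v j - u j)\<bar> \<le> 1 * (real d * (1 + dot d x x)) * \<rho>"
    unfolding abs_mult using abs_dot_le[of d u 1 x] u d j by (intro mult_mono) auto
  then have c2: "\<bar>dot d x u * (v j - u j)\<bar> \<le> \<rho> * (real d * (1 + dot d x x))"
    by (simp only: mult_1_left mult.commute[of _ \<rho>])
  have "perp d v x j - perp d u x j = - ((dot d x v - dot d x u) * v j) - dot d x u * (v j - u j)"
    using j by (simp add: perp_def algebra_simps)
  then show "\<bar>perp d v x j - perp d u x j\<bar> \<le> 2 * (\<rho> * (real d * (1 + dot d x x)))"
    using c1 c2 by linarith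
qed

lemma abs_prod_diff_le:
  fixes a b :: "nat \<Rightarrow> real"
  assumes "\<And>l. l < q \<Longrightarrow> \<bar>a l\<bar> \<le> Y \<and> \<bar>b l\<bar> \<le> Y \<and> \<bar>a l - b l\<bar> \<le> D" "1 \<le> Y" "0 \<le> D"
  shows "\<bar>(\<Prod>l<q. a l) - (\<Prod>l<q. b l)\<bar> \<le> real q * Y ^ q * D"
  using assms(1)
proof (induction q)
  case (Suc q)
  have IH: "\<bar>(\<Prod>l<q. a l) - (\<Prod>l<q. b l)\<bar> \<le> real q * Y ^ q * D" using Suc by simp
  have pb: "\<bar>\<Prod>l<q. b l\<bar> \<le> Y ^ q"
    using prod_mono[of "{..<q}" "\<lambda>l. \<bar>b l\<bar>" "\<lambda>_. Y"] Suc.prems by (simp add: abs_prod)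
  have "(\<Prod>l<Suc q. a l) - (\<Prod>l<Suc q. b l) = ((\<Prod>l<q. a l) - (\<Prod>l<q. b l)) * a q + (\<Prod>l<q. b l) * (a q - b q)"
    by (simp add: algebra_simps)
  also have "\<bar>\<dots>\<bar> \<le> (real q * Y ^ q * D) * Y + Y ^ q * D"
  proof (rule order_trans[OF abs_triangle_ineq], unfold abs_mult, rule add_mono)
    show "\<bar>(\<Prod>l<q. a l) - (\<Prod>l<q. b l)\<bar> * \<bar>a q\<bar> \<le> (real q * Y ^ q * D) * Y"
      using IH Suc.prems[of q] assms(2,3) by (intro mult_mono) auto
    show "\<bar>\<Prod>l<q. b l\<bar> * \<bar>a q - b q\<bar> \<le> Y ^ q * D"
      using pb Suc.prems[of q] assms(2,3) by (intro mult_mono) auto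
  qed
  also have "Y ^ q * D \<le> Y ^ Suc q * D" using assms(2,3) by (intro mult_right_mono power_increasing) auto
  finally show ?case by (simp add: algebra_simps)
qed simp

lemma abs_tensor_perp_le:
  assumes v: "\<And>j. j < d \<Longrightarrow> \<bar>v j\<bar> \<le> 1" and J: "J \<in> indices d q"
  shows "\<bar>tensor q J (perp d v x)\<bar> \<le> (real d + 1) ^ q * growth d q x"
proof -
  have "\<bar>tensor q J (perp d v x)\<bar> \<le> (\<Prod>l<q. (real d + 1) * (1 + dot d x x))"
    unfolding tensor_def abs_prod using J by (intro prod_mono) (auto intro!: abs_perp_le v)
  then show ?thesis by (simp add: growth_def power_mult_distrib)
qed

lemma strip_fun_bound:
  assumes \<eta>: "0 < \<eta>" and v: "\<And>j. j < d \<Longrightarrow> \<bar>v j\<bar> \<le> 1" and J: "J \<in> indices d q" and q: "q \<le> k"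
  shows "\<bar>strip_fun d \<eta> L i q J v x\<bar> \<le> (real d + 1) ^ k * growth d k x"
proof -
  have "\<bar>strip_fun d \<eta> L i q J v x\<bar> \<le> 1 * \<bar>tensor q J (perp d v x)\<bar>"
    unfolding strip_fun_def abs_mult using weight_bounds[OF \<eta>] by (intro mult_right_mono) auto
  also have "\<dots> \<le> (real d + 1) ^ q * growth d q x" using abs_tensor_perp_le[OF v J] by simp
  also have "\<dots> \<le> (real d + 1) ^ k * growth d k x"
    using q growth_ge_1[of d q x] by (intro mult_mono power_increasing growth_mono) auto
  finally show ?thesis .
qed

text \<open>From the product rule: the slope of the tent gives \<open>1 / \<eta>\<close>, the
  factors of the tensor give \<open>2 * real k\<close>, and the powers of the dimension come from
  bounding inner products and projections coordinatewise.\<close>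

definition lipschitz_factor :: "nat \<Rightarrow> real \<Rightarrow> nat \<Rightarrow> real" where
  "lipschitz_factor d \<eta> k = (1 / \<eta> + 2 * real k) * (real d + 1) ^ Suc k"

lemma strip_fun_lipschitz:
  assumes \<eta>: "0 < \<eta>" and v: "\<And>j. j < d \<Longrightarrow> \<bar>v j\<bar> \<le> 1" and u: "\<And>j. j < d \<Longrightarrow> \<bar>u j\<bar> \<le> 1"
    and d: "\<And>j. j < d \<Longrightarrow> \<bar>v j - u j\<bar> \<le> \<rho>" "0 \<le> \<rho>" "0 < d" and J: "J \<in> indices d q" and q: "q \<le> k"
  shows "\<bar>strip_fun d \<eta> L i q J v x - strip_fun d \<eta> L i q J u x\<bar> \<le> lipschitz_factor d \<eta> k * \<rho> * growth d (Suc k) x"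
proof -
  define G where "G = 1 + dot d x x"
  define Y where "Y = (real d + 1) * G"
  have G1: "1 \<le> G" by (simp add: G_def)
  have "1 * 1 \<le> Y" unfolding Y_def using G1 by (intro mult_mono) auto
  then have Y1: "1 \<le> Y" by simp
  have dY: "real d * G \<le> Y" using G1 by (simp add: Y_def)
  let ?w = "weight \<eta> L i (dot d x v)" and ?w' = "weight \<eta> L i (dot d x u)"
  let ?t = "tensor q J (perp d v x)" and ?t' = "tensor q J (perp d u x)"
  have w: "\<bar>?w - ?w'\<bar> \<le> \<rho> * Y / \<eta>"
  proof -
    have "\<bar>?w - ?w'\<bar> \<le> \<bar>dot d x v - dot d x u\<bar> / \<eta>" by (rule weight_lipschitz[OF \<eta>])
    also have "\<dots> \<le> \<rho> * (real d * G) / \<eta>"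
      unfolding G_def using abs_perp_diff_le(1)[OF v u d(1,2) d(3)] \<eta> by (intro divide_right_mono) auto
    also have "\<dots> \<le> \<rho> * Y / \<eta>" using dY d \<eta> by (intro divide_right_mono mult_left_mono) auto
    finally show ?thesis .
  qed
  have t: "\<bar>?t\<bar> \<le> Y ^ k"
  proof -
    have "\<bar>?t\<bar> \<le> Y ^ q" using abs_tensor_perp_le[OF v J, where x = x] by (simp add: Y_def G_def growth_def power_mult_distrib)
    also have "\<dots> \<le> Y ^ k" using Y1 q by (intro power_increasing)
    finally show ?thesis .
  qed
  have tt: "\<bar>?t - ?t'\<bar> \<le> real k * Y ^ k * (2 * (\<rho> * Y))"
  proof -
    have "\<bar>?t - ?t'\<bar> \<le> real q * Y ^ q * (2 * (\<rho> * Y))"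
      unfolding tensor_def
    proof (rule abs_prod_diff_le)
      fix l assume "l < q"
      then have j: "J l < d" using J by auto
      have "2 * (\<rho> * (real d * G)) \<le> 2 * (\<rho> * Y)" using dY d by (intro mult_left_mono) auto
      then show "\<bar>perp d v x (J l)\<bar> \<le> Y \<and> \<bar>perp d u x (J l)\<bar> \<le> Y \<and> \<bar>perp d v x (J l) - perp d u x (J l)\<bar> \<le> 2 * (\<rho> * Y)"
        using abs_perp_le[where v = v and x = x, OF v j] abs_perp_le[where v = u and x = x, OF u j]
          abs_perp_diff_le(2)[where v = v and u = u and x = x, OF v u d(1,2) j]
        unfolding Y_def G_def by auto
    qed (use Y1 d in auto)
    also have "\<dots> \<le> real k * Y ^ k * (2 * (\<rho> * Y))" using q Y1 d by (intro mult_mono power_increasing) auto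
    finally show ?thesis .
  qed
  have "strip_fun d \<eta> L i q J v x - strip_fun d \<eta> L i q J u x = (?w - ?w') * ?t + ?w' * (?t - ?t')"
    by (simp add: strip_fun_def algebra_simps)
  also have "\<bar>\<dots>\<bar> \<le> \<rho> * Y / \<eta> * Y ^ k + 1 * (real k * Y ^ k * (2 * (\<rho> * Y)))"
  proof (rule order_trans[OF abs_triangle_ineq], unfold abs_mult, rule add_mono)
    show "\<bar>?w - ?w'\<bar> * \<bar>?t\<bar> \<le> \<rho> * Y / \<eta> * Y ^ k" using w t Y1 d \<eta> by (intro mult_mono) auto
    show "\<bar>?w'\<bar> * \<bar>?t - ?t'\<bar> \<le> 1 * (real k * Y ^ k * (2 * (\<rho> * Y)))"
      using tt weight_bounds[OF \<eta>] by (intro mult_mono) auto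
  qed
  also have "\<dots> = (1 / \<eta> + 2 * real k) * Y ^ Suc k * \<rho>" by (simp add: algebra_simps)
  also have "Y ^ Suc k = (real d + 1) ^ Suc k * growth d (Suc k) x" by (simp only: Y_def G_def growth_def power_mult_distrib)
  finally show ?thesis by (simp only: lipschitz_factor_def mult_ac)
qed

text \<open>Moving v to the nearest net point changes a function by at most a Lipschitz constant
  times \<open>growth\<close>. Its empirical mean is bounded on the event of
  \<open>finite_family_deviation\<close> and its expectation is \<open>B\<close>, so both sides of
  the comparison move by a controlled amount. \<open>C\<close> bounds the number of net points,
  strips and tensors together.\<close>

lemma uniform_deviation:
  fixes k L :: nat
  assumes \<eta>: "0 < \<eta>" and pos: "0 < d" "0 < N" "0 < m" "0 < R" "0 \<le> s" "0 < \<delta>" "\<delta> < 1"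
  defines "B \<equiv> LINT x|std_gaussian d. growth d (Suc k) x"
    and "A \<equiv> (real d + 1) ^ k"
    and "C \<equiv> real ((2 * m + 1) ^ d) * (2 * real L + 2) * ((real k + 1) * (real d + 1) ^ k)"
  shows "with_prob_at_least (gaussian_dataset d N)
     (1 - (\<delta> + C * (2 * exp (- (real N * s\<^sup>2 / (2 * (A * R ^ k)\<^sup>2))))))
     (\<lambda>S. \<forall>v. unit_vector d v \<longrightarrow> (\<forall>i<2 * L + 2. \<forall>q\<le>k. \<forall>J\<in>indices d q.
       \<bar>mass N S (strip_fun d \<eta> L i q J v) - (LINT x|std_gaussian d. strip_fun d \<eta> L i q J v x)\<bar>
         \<le> s + 2 * (A / R * (B / \<delta>)) + 2 * (lipschitz_factor d \<eta> k * (1 / real m) * (B / \<delta>))))"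
proof -
  define T where "T = (SIGMA q:{..k}. indices d q)"
  define f where "f = (\<lambda>(v, i, q, J). strip_fun d \<eta> L i q J v)"
  define F where "F = f ` (net d m \<times> {..<2 * L + 2} \<times> T)"
  have fT: "finite T" unfolding T_def by (intro finite_SigmaI finite_PiE) auto
  have cT: "real (card T) \<le> (real k + 1) * (real d + 1) ^ k"
  proof -
    have "card T = (\<Sum>q\<le>k. d ^ q)" unfolding T_def by (subst card_SigmaI) (auto simp: card_PiE intro: finite_PiE)
    also have "real \<dots> \<le> (\<Sum>q\<le>k. (real d + 1) ^ k)"
      unfolding of_nat_sum of_nat_power
      by (intro sum_mono order_trans[OF power_mono[of "real d" "real d + 1"] power_increasing]) auto
    finally show ?thesis by (simp add: add.commute)
  qed
  have fin: "finite (net d m \<times> {..<2 * L + 2} \<times> T)" using finite_net fT by auto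
  have cF: "real (card F) \<le> C"
  proof -
    have "card F \<le> card (net d m) * ((2 * L + 2) * card T)"
      unfolding F_def using card_image_le[OF fin, of f] by (simp add: card_cartesian_product)
    then have "real (card F) \<le> real (card (net d m) * ((2 * L + 2) * card T))" by (simp only: of_nat_le_iff)
    also have "\<dots> = real (card (net d m)) * ((2 * real L + 2) * real (card T))" by (simp add: distrib_right)
    also have "\<dots> \<le> real ((2 * m + 1) ^ d) * ((2 * real L + 2) * ((real k + 1) * (real d + 1) ^ k))"
      using card_net_le[of d m] cT by (intro mult_mono) (simp_all only: of_nat_le_iff, auto)
    finally show ?thesis unfolding C_def by (simp only: mult.assoc)
  qed
  define e where "e = 2 * exp (- (real N * s\<^sup>2 / (2 * (A * R ^ k)\<^sup>2)))"
  have "with_prob_at_least (gaussian_dataset d N) (1 - (\<delta> + real (card F) * e))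
     (\<lambda>S. mass N S (growth d (Suc k)) \<le> B / \<delta> \<and>
       (\<forall>f\<in>F. \<bar>mass N S f - (LINT x|std_gaussian d. f x)\<bar> \<le> s + 2 * (A / R * (B / \<delta>))))"
    unfolding B_def e_def
  proof (rule finite_family_deviation)
    show "finite F" unfolding F_def using fin by simp
    show "f \<in> borel_measurable (borel_vect d)" if "f \<in> F" for f
      using that unfolding F_def f_def T_def by (auto intro: measurable_strip_fun)
    show "\<bar>f x\<bar> \<le> A * growth d k x" if "f \<in> F" for f x
      using that unfolding F_def f_def T_def A_def by (auto intro!: strip_fun_bound[OF \<eta>] net_bounded)
    show "0 < A" by (simp add: A_def)
  qed (use pos in auto)
  then obtain E where E: "E \<in> sets (gaussian_dataset d N)"
    "\<And>S. S \<in> E \<Longrightarrow> mass N S (growth d (Suc k)) \<le> B / \<delta>"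
    "\<And>S f. S \<in> E \<Longrightarrow> f \<in> F \<Longrightarrow> \<bar>mass N S f - (LINT x|std_gaussian d. f x)\<bar> \<le> s + 2 * (A / R * (B / \<delta>))"
    "1 - (\<delta> + real (card F) * e) \<le> measure (gaussian_dataset d N) E"
    unfolding with_prob_at_least_def by blast
  have "real (card F) * e \<le> C * e" using cF by (intro mult_right_mono) (auto simp: e_def)
  with E(4) have pE: "1 - (\<delta> + C * e) \<le> measure (gaussian_dataset d N) E" by linarith
  have B0: "0 \<le> B" unfolding B_def by (intro integral_nonneg_AE) (use order_trans[OF zero_le_one growth_ge_1] in auto)
  define \<Lambda> where "\<Lambda> = lipschitz_factor d \<eta> k * (1 / real m)"
  have \<Lambda>0: "0 \<le> \<Lambda>" using \<eta> by (auto simp: \<Lambda>_def lipschitz_factor_def)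
  have "\<bar>mass N S (strip_fun d \<eta> L i q J v) - (LINT x|std_gaussian d. strip_fun d \<eta> L i q J v x)\<bar>
         \<le> s + 2 * (A / R * (B / \<delta>)) + 2 * (\<Lambda> * (B / \<delta>))"
    if S: "S \<in> E" and v: "unit_vector d v" and i: "i < 2 * L + 2" and q: "q \<le> k" and J: "J \<in> indices d q" for S v i q J
  proof -
    have v1: "\<bar>v j\<bar> \<le> 1" if "j < d" for j using unit_coordinate_le[OF v that] .
    obtain u where u: "u \<in> net d m" "\<And>j. j < d \<Longrightarrow> \<bar>v j - u j\<bar> \<le> 1 / real m" using net_approx[of d v m, OF v1 pos(3)] by blast
    have u1: "\<bar>u j\<bar> \<le> 1" if "j < d" for j using net_bounded[OF u(1) that] .
    define a where "a = strip_fun d \<eta> L i q J v"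
    define b where "b = strip_fun d \<eta> L i q J u"
    have diff: "\<bar>a x - b x\<bar> \<le> \<Lambda> * growth d (Suc k) x" for x
      unfolding a_def b_def \<Lambda>_def by (rule strip_fun_lipschitz[OF \<eta> v1 u1 u(2)]) (use pos J q in auto)
    have "b \<in> F" unfolding F_def f_def T_def b_def using u(1) i q J by (intro image_eqI[of _ _ "(u, i, q, J)"]) auto
    then have 1: "\<bar>mass N S b - (LINT x|std_gaussian d. b x)\<bar> \<le> s + 2 * (A / R * (B / \<delta>))" by (rule E(3)[OF S])
    have "\<bar>mass N S a - mass N S b\<bar> \<le> mass N S (\<lambda>x. \<bar>a x - b x\<bar>)" unfolding mass_diff[symmetric] by (rule abs_mass_le)
    also have "\<dots> \<le> mass N S (\<lambda>x. \<Lambda> * growth d (Suc k) x)" by (intro mass_mono diff)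
    also have "\<dots> \<le> \<Lambda> * (B / \<delta>)" unfolding mass_cmult using E(2)[OF S] \<Lambda>0 by (intro mult_left_mono) auto
    finally have 2: "\<bar>mass N S a - mass N S b\<bar> \<le> \<Lambda> * (B / \<delta>)" .
    have ia: "integrable (std_gaussian d) a" unfolding a_def
      by (rule integrable_growth_bound[OF measurable_strip_fun[OF J] strip_fun_bound[OF \<eta> v1 J q]])
    have ib: "integrable (std_gaussian d) b" unfolding b_def
      by (rule integrable_growth_bound[OF measurable_strip_fun[OF J] strip_fun_bound[OF \<eta> u1 J q]])
    have "\<bar>(LINT x|std_gaussian d. a x) - (LINT x|std_gaussian d. b x)\<bar> = \<bar>LINT x|std_gaussian d. a x - b x\<bar>"
      using ia ib by simp
    also have "\<dots> \<le> (LINT x|std_gaussian d. \<Lambda> * growth d (Suc k) x)"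
      using ia ib integrable_growth[of d "Suc k"] diff by (intro integral_abs_bound[THEN order_trans] integral_mono) auto
    also have "\<dots> = \<Lambda> * B" by (simp add: B_def)
    also have "\<dots> \<le> \<Lambda> * (B / \<delta>)" using pos B0 \<Lambda>0 by (intro mult_left_mono) (auto simp: pos_le_divide_eq mult_left_le)
    finally have 3: "\<bar>(LINT x|std_gaussian d. a x) - (LINT x|std_gaussian d. b x)\<bar> \<le> \<Lambda> * (B / \<delta>)" .
    show ?thesis using 1 2 3 unfolding a_def[symmetric] by linarith
  qed
  then show ?thesis unfolding with_prob_at_least_def e_def[symmetric] \<Lambda>_def[symmetric]
    using pE E(1) by (intro bexI[of _ E]) auto
qed

section \<open>The moment defect\<close>

definition perp_moment :: "nat \<Rightarrow> vect \<Rightarrow> nat \<Rightarrow> (nat \<Rightarrow> nat) \<Rightarrow> real" where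
  "perp_moment d v q J = (LINT z|std_gaussian d. tensor q J (perp d v z))"

lemma dot_perp_self: "dot d v v = 1 \<Longrightarrow> dot d (perp d v x) v = 0"
  by (simp add: dot_perp_left)

lemma integrable_tensor_perp:
  assumes "dot d v v = 1" "J \<in> indices d q"
  shows "integrable (std_gaussian d) (\<lambda>z. tensor q J (perp d v z))"
proof (rule integrable_growth_bound)
  show "(\<lambda>z. tensor q J (perp d v z)) \<in> borel_measurable (borel_vect d)"
    by (rule measurable_compose[OF measurable_perp measurable_tensor[OF assms(2)]])
  show "\<bar>tensor q J (perp d v x)\<bar> \<le> 1 * growth d q x" for x
    using order_trans[OF abs_tensor_le[OF assms(2)] growth_perp_le[OF assms(1)]] by simp
qed

lemma sum_tensor_perp_moment:
  assumes v: "dot d v v = 1"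
  shows "(\<Sum>J\<in>indices d q. tensor q J u * perp_moment d v q J) = (LINT z|std_gaussian d. dot d u (perp d v z) ^ q)"
proof -
  have "(\<Sum>J\<in>indices d q. tensor q J u * perp_moment d v q J)
    = (\<Sum>J\<in>indices d q. LINT z|std_gaussian d. tensor q J u * tensor q J (perp d v z))"
    unfolding perp_moment_def by simp
  also have "\<dots> = (LINT z|std_gaussian d. (\<Sum>J\<in>indices d q. tensor q J u * tensor q J (perp d v z)))"
    by (intro Bochner_Integration.integral_sum[symmetric] integrable_mult_right integrable_tensor_perp[OF v])
  finally show ?thesis by (simp only: dot_power_eq_tensor)
qed

text \<open>For u orthogonal to v, projecting z does not change its inner product with u. So the
  contraction is an ordinary Gaussian moment in direction u.\<close>

lemma sum_tensor_perp_moment_orthogonal: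
  assumes v: "dot d v v = 1" and u: "dot d u v = 0"
  shows "(\<Sum>J\<in>indices d q. tensor q J u * perp_moment d v q J) = sqrt (dot d u u) ^ q * gauss_moment q"
proof -
  have "dot d u (perp d v z) = dot d z u" for z
    by (subst dot_commute) (simp add: dot_perp_left dot_commute[of d v u] u)
  then show ?thesis unfolding sum_tensor_perp_moment[OF v] by (simp only: integral_dot_power(2))
qed

lemma sum_even_moments:
  "(\<Sum>q<2 * h + 1. f q * gauss_moment q) = (\<Sum>m<h + 1. f (2 * m) * rising_two 1 m)"
proof (induction h)
  case 0
  show ?case using std_normal.prob_space by (simp add: rising_two_def)
next
  case (Suc h)
  have odd: "gauss_moment (2 * h + 1) = 0" by (rule integral_std_normal_distribution_moment_odd) simp
  have e: "2 * Suc h + 1 = Suc (Suc (2 * h + 1))" "Suc (2 * h + 1) = 2 * Suc h" by simp_all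
  have "(\<Sum>q<2 * Suc h + 1. f q * gauss_moment q) = (\<Sum>q<2 * h + 1. f q * gauss_moment q)
      + f (2 * h + 1) * gauss_moment (2 * h + 1) + f (Suc (2 * h + 1)) * gauss_moment (Suc (2 * h + 1))"
    unfolding e(1) sum.lessThan_Suc ..
  also have "\<dots> = (\<Sum>m<h + 1. f (2 * m) * rising_two 1 m) + 0 + f (2 * Suc h) * rising_two 1 (Suc h)"
    unfolding Suc.IH odd e(2) gauss_moment_even by (simp only: mult_zero_right)
  also have "\<dots> = (\<Sum>m<Suc h + 1. f (2 * m) * rising_two 1 m)" by simp
  finally show ?case .
qed

text \<open>\<open>perp d v x\<close> is orthogonal to v, so contracting with it leaves normal
  moments scaled by its length. The odd ones vanish; only even powers of the length remain, which
  need no square root.\<close>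

lemma cross_kernel_eq:
  assumes v: "dot d v v = 1"
  shows "(\<Sum>q<2 * h + 1. \<Sum>J\<in>indices d q. tensor q J (perp d v x) * perp_moment d v q J)
    = cross_kernel h (dot d x x - (dot d x v)\<^sup>2)"
proof -
  have "(\<Sum>q<2 * h + 1. \<Sum>J\<in>indices d q. tensor q J (perp d v x) * perp_moment d v q J)
    = (\<Sum>q<2 * h + 1. sqrt (dot d (perp d v x) (perp d v x)) ^ q * gauss_moment q)"
    by (simp only: sum_tensor_perp_moment_orthogonal[OF v dot_perp_self[OF v]])
  also have "\<dots> = (\<Sum>m<h + 1. sqrt (dot d (perp d v x) (perp d v x)) ^ (2 * m) * rising_two 1 m)"
    by (rule sum_even_moments)
  also have "\<dots> = cross_kernel h (dot d (perp d v x) (perp d v x))"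
    unfolding cross_kernel_def power_mult by (simp only: real_sqrt_pow2 dot_self_nonneg mult.commute)
  finally show ?thesis using v by (simp add: dot_perp_perp power2_eq_square)
qed

text \<open>One of the two factors of the square is opened as an integral over z. The contraction
  then applies to \<open>perp d v z\<close>, and its norm has the moments of dimension
  \<open>d - 1\<close>.\<close>

lemma gauss_kernel_eq:
  assumes v: "dot d v v = 1"
  shows "(\<Sum>q<2 * h + 1. \<Sum>J\<in>indices d q. (perp_moment d v q J)\<^sup>2) = gauss_kernel h (real d - 1)"
proof -
  have sq: "(\<Sum>J\<in>indices d q. (perp_moment d v q J)\<^sup>2)
      = (LINT z|std_gaussian d. sqrt (dot d (perp d v z) (perp d v z)) ^ q) * gauss_moment q" for q
  proof -
    have "(\<Sum>J\<in>indices d q. (perp_moment d v q J)\<^sup>2)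
      = (\<Sum>J\<in>indices d q. LINT z|std_gaussian d. tensor q J (perp d v z) * perp_moment d v q J)"
      by (simp add: power2_eq_square perp_moment_def)
    also have "\<dots> = (LINT z|std_gaussian d. (\<Sum>J\<in>indices d q. tensor q J (perp d v z) * perp_moment d v q J))"
      by (intro Bochner_Integration.integral_sum[symmetric] integrable_mult_left integrable_tensor_perp[OF v])
    also have "\<dots> = (LINT z|std_gaussian d. sqrt (dot d (perp d v z) (perp d v z)) ^ q * gauss_moment q)"
      by (simp only: sum_tensor_perp_moment_orthogonal[OF v dot_perp_self[OF v]])
    finally show ?thesis by simp
  qed
  have "(\<Sum>q<2 * h + 1. \<Sum>J\<in>indices d q. (perp_moment d v q J)\<^sup>2)
    = (\<Sum>m<h + 1. (LINT z|std_gaussian d. sqrt (dot d (perp d v z) (perp d v z)) ^ (2 * m)) * rising_two 1 m)"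
    unfolding sq by (rule sum_even_moments)
  also have "\<dots> = (\<Sum>m<h + 1. rising_two (real d - 1) m * rising_two 1 m)"
    unfolding power_mult by (simp only: real_sqrt_pow2 dot_self_nonneg integral_perp_norm_power[OF v])
  finally show ?thesis unfolding gauss_kernel_def by (simp only: mult.commute)
qed

definition tensor_defect :: "nat \<Rightarrow> nat \<Rightarrow> dataset \<Rightarrow> vect \<Rightarrow> (vect \<Rightarrow> real) \<Rightarrow> nat \<Rightarrow> (nat \<Rightarrow> nat) \<Rightarrow> real" where
  "tensor_defect d N S v w q J =
     mass N S (\<lambda>x. w x * tensor q J (perp d v x)) - mass N S w * perp_moment d v q J"

lemma sum_swap_dependent:
  "(\<Sum>q\<in>A. \<Sum>J\<in>B q. \<Sum>n\<in>C. f q J n) = (\<Sum>n\<in>C. \<Sum>q\<in>A. \<Sum>J\<in>B q. f q J n)"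
proof -
  have "(\<Sum>q\<in>A. \<Sum>J\<in>B q. \<Sum>n\<in>C. f q J n) = (\<Sum>q\<in>A. \<Sum>n\<in>C. \<Sum>J\<in>B q. f q J n)"
    by (intro sum.cong refl sum.swap)
  also have "\<dots> = (\<Sum>n\<in>C. \<Sum>q\<in>A. \<Sum>J\<in>B q. f q J n)" by (rule sum.swap)
  finally show ?thesis .
qed

text \<open>Each square of an empirical moment minus mass times Gaussian moment is expanded, and the
  three sums over tensors are evaluated by the three kernels. In particular the defect is
  nonnegative and bounds each of its terms.\<close>

lemma moment_defect_eq:
  assumes v: "dot d v v = 1"
  shows "moment_defect h d N S v w = (\<Sum>q<2 * h + 1. \<Sum>J\<in>indices d q. (tensor_defect d N S v w q J)\<^sup>2)"
proof -
  define t where "t q J n = tensor q J (perp d v (S n))" for q J n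
  define c where "c q J = perp_moment d v q J" for q J
  define p where "p = mass N S w"
  define a where "a q J = (\<Sum>n<N. w (S n) * t q J n) / real N" for q J
  have T: "tensor_defect d N S v w q J = a q J - p * c q J" for q J
    by (simp add: tensor_defect_def mass_def a_def t_def p_def c_def)
  have 1: "(\<Sum>q<2 * h + 1. \<Sum>J\<in>indices d q. (a q J)\<^sup>2) =
    (\<Sum>n<N. \<Sum>m<N. w (S n) * w (S m) * power_kernel h (dot d (S n) (S m) - dot d (S n) v * dot d (S m) v)) / (real N)\<^sup>2"
  proof -
    have "(a q J)\<^sup>2 = (\<Sum>n<N. \<Sum>m<N. w (S n) * w (S m) * (t q J n * t q J m)) / (real N)\<^sup>2" for q J
    proof -
      have "(\<Sum>n<N. w (S n) * t q J n)\<^sup>2 = (\<Sum>n<N. \<Sum>m<N. w (S n) * w (S m) * (t q J n * t q J m))"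
        unfolding power2_eq_square sum_product by (intro sum.cong refl) (simp add: mult_ac)
      then show ?thesis by (simp only: a_def power_divide)
    qed
    then have "(\<Sum>q<2 * h + 1. \<Sum>J\<in>indices d q. (a q J)\<^sup>2)
      = (\<Sum>q<2 * h + 1. \<Sum>J\<in>indices d q. (\<Sum>n<N. \<Sum>m<N. w (S n) * w (S m) * (t q J n * t q J m))) / (real N)\<^sup>2"
      by (simp only: sum_divide_distrib)
    also have "(\<Sum>q<2 * h + 1. \<Sum>J\<in>indices d q. (\<Sum>n<N. \<Sum>m<N. w (S n) * w (S m) * (t q J n * t q J m)))
      = (\<Sum>n<N. \<Sum>m<N. w (S n) * w (S m) * (\<Sum>q<2 * h + 1. \<Sum>J\<in>indices d q. t q J n * t q J m))"
      unfolding sum_distrib_left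
      by (rule trans[OF sum_swap_dependent], rule sum.cong[OF refl], rule sum_swap_dependent)
    finally have "(\<Sum>q<2 * h + 1. \<Sum>J\<in>indices d q. (a q J)\<^sup>2)
      = (\<Sum>n<N. \<Sum>m<N. w (S n) * w (S m) * (\<Sum>q<2 * h + 1. \<Sum>J\<in>indices d q. t q J n * t q J m)) / (real N)\<^sup>2" .
    moreover have "(\<Sum>q<2 * h + 1. \<Sum>J\<in>indices d q. t q J n * t q J m)
      = power_kernel h (dot d (S n) (S m) - dot d (S n) v * dot d (S m) v)" for n m
      unfolding t_def power_kernel_def dot_power_eq_tensor[symmetric] dot_perp_perp[OF v] ..
    ultimately show ?thesis by (simp only:)
  qed
  have 2: "(\<Sum>q<2 * h + 1. \<Sum>J\<in>indices d q. a q J * c q J) =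
    (\<Sum>n<N. w (S n) * cross_kernel h (dot d (S n) (S n) - (dot d (S n) v)\<^sup>2)) / real N"
  proof -
    have "a q J * c q J = (\<Sum>n<N. w (S n) * (t q J n * c q J)) / real N" for q J
      by (simp add: a_def sum_distrib_right mult.assoc)
    then have "(\<Sum>q<2 * h + 1. \<Sum>J\<in>indices d q. a q J * c q J)
      = (\<Sum>q<2 * h + 1. \<Sum>J\<in>indices d q. \<Sum>n<N. w (S n) * (t q J n * c q J)) / real N"
      by (simp only: sum_divide_distrib)
    also have "(\<Sum>q<2 * h + 1. \<Sum>J\<in>indices d q. \<Sum>n<N. w (S n) * (t q J n * c q J))
      = (\<Sum>n<N. w (S n) * (\<Sum>q<2 * h + 1. \<Sum>J\<in>indices d q. t q J n * c q J))"
      unfolding sum_distrib_left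
      by (rule sum_swap_dependent)
    finally have "(\<Sum>q<2 * h + 1. \<Sum>J\<in>indices d q. a q J * c q J)
      = (\<Sum>n<N. w (S n) * (\<Sum>q<2 * h + 1. \<Sum>J\<in>indices d q. t q J n * c q J)) / real N" .
    moreover have "(\<Sum>q<2 * h + 1. \<Sum>J\<in>indices d q. t q J n * c q J)
      = cross_kernel h (dot d (S n) (S n) - (dot d (S n) v)\<^sup>2)" for n
      unfolding t_def c_def by (rule cross_kernel_eq[OF v])
    ultimately show ?thesis by (simp only:)
  qed
  have "(a q J - p * c q J)\<^sup>2 = (a q J)\<^sup>2 - 2 * p * (a q J * c q J) + p\<^sup>2 * (c q J)\<^sup>2" for q J
    by (simp add: power2_eq_square algebra_simps)
  then have "(\<Sum>q<2 * h + 1. \<Sum>J\<in>indices d q. (tensor_defect d N S v w q J)\<^sup>2)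
    = (\<Sum>q<2 * h + 1. \<Sum>J\<in>indices d q. (a q J)\<^sup>2) - 2 * p * (\<Sum>q<2 * h + 1. \<Sum>J\<in>indices d q. a q J * c q J)
      + p\<^sup>2 * (\<Sum>q<2 * h + 1. \<Sum>J\<in>indices d q. (c q J)\<^sup>2)"
    by (simp only: T sum.distrib sum_subtractf sum_distrib_left)
  moreover have "(\<Sum>q<2 * h + 1. \<Sum>J\<in>indices d q. (c q J)\<^sup>2) = gauss_kernel h (real d - 1)"
    unfolding c_def by (rule gauss_kernel_eq[OF v])
  ultimately show ?thesis by (simp only: 1 2 moment_defect_def p_def)
qed

text \<open>The error of the moment in direction u is the inner product of the tensor of defects
  with the q-th tensor power of u, whose squared norm is \<open>dot d u u ^ q = 1\<close>.
  Cauchy-Schwarz thus covers all directions orthogonal to v by one number.\<close>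

lemma directional_defect_le:
  assumes v: "dot d v v = 1" and u: "dot d u u = 1" "dot d u v = 0" and q: "q \<le> 2 * h"
  shows "(mass N S (\<lambda>x. w x * dot d x u ^ q) - mass N S w * gauss_moment q)\<^sup>2 \<le> moment_defect h d N S v w"
proof -
  have xu: "dot d (perp d v x) u = dot d x u" for x using u(2) by (simp add: dot_perp_left dot_commute[of d v u])
  have e1: "mass N S (\<lambda>x. w x * dot d x u ^ q) = (\<Sum>J\<in>indices d q. mass N S (\<lambda>x. w x * tensor q J (perp d v x)) * tensor q J u)"
  proof -
    have "w x * dot d x u ^ q = (\<Sum>J\<in>indices d q. w x * tensor q J (perp d v x) * tensor q J u)" for x
      unfolding mult.assoc sum_distrib_left[symmetric] dot_power_eq_tensor[symmetric] xu ..
    then have "mass N S (\<lambda>x. w x * dot d x u ^ q) = mass N S (\<lambda>x. \<Sum>J\<in>indices d q. w x * tensor q J (perp d v x) * tensor q J u)"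
      by (simp only:)
    also have "\<dots> = (\<Sum>J\<in>indices d q. mass N S (\<lambda>x. w x * tensor q J (perp d v x) * tensor q J u))"
      unfolding mass_def sum_divide_distrib[symmetric] by (subst sum.swap) (rule refl)
    also have "\<dots> = (\<Sum>J\<in>indices d q. mass N S (\<lambda>x. w x * tensor q J (perp d v x)) * tensor q J u)"
      by (simp add: mass_def sum_distrib_right)
    finally show ?thesis .
  qed
  have e2: "gauss_moment q = (\<Sum>J\<in>indices d q. tensor q J u * perp_moment d v q J)"
    using sum_tensor_perp_moment_orthogonal[OF v u(2), of q] u(1) by simp
  have e3: "(\<Sum>J\<in>indices d q. tensor_defect d N S v w q J * tensor q J u)
    = (\<Sum>J\<in>indices d q. mass N S (\<lambda>x. w x * tensor q J (perp d v x)) * tensor q J u)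
      - mass N S w * (\<Sum>J\<in>indices d q. tensor q J u * perp_moment d v q J)"
    unfolding tensor_defect_def left_diff_distrib sum_subtractf sum_distrib_left by (simp only: mult_ac)
  have "mass N S (\<lambda>x. w x * dot d x u ^ q) - mass N S w * gauss_moment q
    = (\<Sum>J\<in>indices d q. tensor_defect d N S v w q J * tensor q J u)"
    unfolding e1 e2 e3 ..
  then have "(mass N S (\<lambda>x. w x * dot d x u ^ q) - mass N S w * gauss_moment q)\<^sup>2
    \<le> (\<Sum>J\<in>indices d q. (tensor_defect d N S v w q J)\<^sup>2) * (\<Sum>J\<in>indices d q. (tensor q J u)\<^sup>2)"
    by (simp only: Cauchy_Schwarz_ineq_sum)
  also have "(\<Sum>J\<in>indices d q. (tensor q J u)\<^sup>2) = 1"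
    using dot_power_eq_tensor[of d u u q] u(1) by (simp add: power2_eq_square)
  also have "(\<Sum>J\<in>indices d q. (tensor_defect d N S v w q J)\<^sup>2) * 1 \<le> moment_defect h d N S v w"
    unfolding moment_defect_eq[OF v] mult_1_right
    by (rule member_le_sum[of q "{..<2 * h + 1}" "\<lambda>q. \<Sum>J\<in>indices d q. (tensor_defect d N S v w q J)\<^sup>2"])
      (use q in \<open>auto intro: sum_nonneg\<close>)
  finally show ?thesis .
qed

section \<open>Soundness\<close>

text \<open>\<gamma> is a lower bound for the target density on the strips, \<kappa> the accuracy of
  masses and distribution functions, \<tau> the accuracy of moments that guarantees it. The range
  exceeds \<open>rad q\<close> by one because the last centre may overshoot by less than a
  strip.\<close>

locale calibrated =
  fixes q :: parameters and \<kappa> \<tau> \<gamma> :: real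
  assumes kappa: "0 < \<kappa>" "\<kappa> \<le> 1" "\<kappa> \<le> \<gamma> / 2"
    and mass_tol: "0 < mass_tol q" "of_rat (mass_tol q) \<le> \<kappa>"
    and defect_tol: "0 < defect_tol q" "sqrt (of_rat (defect_tol q)) \<le> \<tau> * (\<gamma> / 2)"
    and width: "0 < width q" "(of_rat (width q) :: real) \<le> of_rat (mass_tol q) / 4"
    and deg: "1 \<le> deg q" and rad: "3 \<le> rad q" and tau: "0 < \<tau>" "\<tau> \<le> 1"
    and determ: "\<And>M s. real_distribution M \<Longrightarrow> (\<And>i. i \<le> 2 * deg q \<Longrightarrow> integrable M (\<lambda>x. x ^ i)) \<Longrightarrow>
      (\<And>i. i \<le> 2 * deg q \<Longrightarrow> \<bar>(LINT x|M. x ^ i) - gauss_moment i\<bar> \<le> \<tau>) \<Longrightarrow>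
      \<bar>measure M {..s} - Phi s\<bar> \<le> \<kappa> \<and> \<bar>measure M {..<s} - Phi s\<bar> \<le> \<kappa>"
    and target: "\<And>t. \<bar>t\<bar> \<le> real (rad q) + 1 \<Longrightarrow>
      \<bar>std_normal_density t - mass_target (coef q) (expo q) t\<bar> \<le> of_rat (mass_tol q) / 2"
      "\<And>t. \<bar>t\<bar> \<le> real (rad q) + 1 \<Longrightarrow> \<gamma> \<le> mass_target (coef q) (expo q) t"
      "\<And>t. \<bar>t\<bar> \<le> real (rad q) + 1 \<Longrightarrow> mass_target (coef q) (expo q) t \<le> 1"
begin

definition strip :: "real \<Rightarrow> real" where "strip \<epsilon> = \<epsilon> * of_rat (width q)"

definition strip_count :: "real \<Rightarrow> nat" where "strip_count \<epsilon> = half_width (rad q) (strip \<epsilon>)"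

abbreviation "target \<equiv> mass_target (coef q) (expo q)"

lemma mass_tol_pos: "0 < (of_rat (mass_tol q) :: real)"
  using mass_tol(1) by simp

lemma width_le: "0 < (of_rat (width q) :: real)" "(of_rat (width q) :: real) \<le> 1 / 4"
  using width mass_tol(2) kappa(2) by auto

lemma strip_bounds:
  assumes "0 < \<epsilon>" "\<epsilon> < 1"
  shows "0 < strip \<epsilon>" "strip \<epsilon> \<le> \<epsilon> / 4" "strip \<epsilon> \<le> of_rat (mass_tol q) / 4"
proof -
  show "0 < strip \<epsilon>" using width_le assms by (simp add: strip_def)
  show "strip \<epsilon> \<le> \<epsilon> / 4" using mult_left_mono[OF width_le(2), of \<epsilon>] assms by (simp add: strip_def)
  have "strip \<epsilon> \<le> of_rat (width q)" using mult_right_mono[of \<epsilon> 1 "of_rat (width q)"] assms width_le(1) by (simp add: strip_def)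
  then show "strip \<epsilon> \<le> of_rat (mass_tol q) / 4" using width(2) by linarith
qed

lemma strip_count_bounds:
  assumes e: "0 < \<epsilon>" "\<epsilon> < 1"
  shows "real (rad q) \<le> real (strip_count \<epsilon>) * strip \<epsilon>" "real (strip_count \<epsilon>) * strip \<epsilon> \<le> real (rad q) + 1" "1 < strip_count \<epsilon>"
proof -
  note s = strip_bounds[OF e]
  show r: "real (rad q) \<le> real (strip_count \<epsilon>) * strip \<epsilon>"
    using less_half_width[OF s(1), of "strip_count \<epsilon>" "rad q"] by (simp add: strip_count_def)
  have "real (strip_count \<epsilon>) * strip \<epsilon> \<le> (real (rad q) / strip \<epsilon> + 1) * strip \<epsilon>"
    unfolding strip_count_def using s(1) by (intro mult_right_mono half_width_le) auto
  also have "\<dots> = real (rad q) + strip \<epsilon>" using s(1) by (simp add: distrib_right)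
  finally show "real (strip_count \<epsilon>) * strip \<epsilon> \<le> real (rad q) + 1" using s(2) e by linarith
  show "1 < strip_count \<epsilon>"
  proof (rule ccontr)
    assume "\<not> 1 < strip_count \<epsilon>"
    then have "real (strip_count \<epsilon>) * strip \<epsilon> \<le> 1 * strip \<epsilon>" using s(1) by (intro mult_right_mono) auto
    then show False using r rad s(2) e by linarith
  qed
qed

lemma centre_le:
  assumes e: "0 < \<epsilon>" "\<epsilon> < 1" and k: "\<bar>k\<bar> \<le> int (strip_count \<epsilon>)"
  shows "\<bar>of_int k * strip \<epsilon>\<bar> \<le> real (rad q) + 1"
proof -
  have "\<bar>of_int k\<bar> \<le> real (strip_count \<epsilon>)" using k by linarith
  then have "\<bar>of_int k\<bar> * strip \<epsilon> \<le> real (strip_count \<epsilon>) * strip \<epsilon>"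
    using strip_bounds(1)[OF e] by (intro mult_right_mono) auto
  moreover have "\<bar>of_int k * strip \<epsilon>\<bar> = \<bar>of_int k\<bar> * strip \<epsilon>" using strip_bounds(1)[OF e] by (simp add: abs_mult)
  ultimately show ?thesis using strip_count_bounds(2)[OF e] by linarith
qed

text \<open>Half of the tolerance is spent on the rational substitute of the density and a quarter
  on the width of the strip. The last quarter is reserved for the sampling error in the completeness
  proof.\<close>

lemma normal_mass:
  assumes e: "0 < \<epsilon>" "\<epsilon> < 1" and t: "\<bar>t\<bar> \<le> real (rad q) + 1"
  shows "\<bar>(LINT x|std_normal_distribution. tent (strip \<epsilon>) t x) - strip \<epsilon> * target t\<bar>
    \<le> 3 / 4 * of_rat (mass_tol q) * strip \<epsilon>"
proof -
  note s = strip_bounds[OF e]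
  have "\<bar>strip \<epsilon> * (std_normal_density t - target t)\<bar> \<le> strip \<epsilon> * (of_rat (mass_tol q) / 2)"
    unfolding abs_mult using s(1) target(1)[OF t] by (simp add: mult_left_mono)
  moreover have "(strip \<epsilon>)\<^sup>2 \<le> strip \<epsilon> * (of_rat (mass_tol q) / 4)"
    unfolding power2_eq_square using s by (intro mult_left_mono) auto
  moreover have "strip \<epsilon> * (std_normal_density t - target t) = strip \<epsilon> * std_normal_density t - strip \<epsilon> * target t"
    by (rule right_diff_distrib)
  moreover have "strip \<epsilon> * (of_rat (mass_tol q) / 2) = of_rat (mass_tol q) * strip \<epsilon> / 2"
    "strip \<epsilon> * (of_rat (mass_tol q) / 4) = of_rat (mass_tol q) * strip \<epsilon> / 4"
    "3 / 4 * of_rat (mass_tol q) * strip \<epsilon> = 3 / 4 * (of_rat (mass_tol q) * strip \<epsilon>)" by simp_all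
  ultimately show ?thesis using integral_tent_normal[OF s(1), of t] unfolding abs_le_iff by linarith
qed

lemma gauss_pair_model:
  assumes e: "0 < \<epsilon>" "\<epsilon> < 1" and \<omega>: "1 / (real (rad q))\<^sup>2 \<le> \<omega>"
  shows "strip_model gauss_pair fst snd (strip \<epsilon>) (strip_count \<epsilon>) target \<kappa> \<omega>"
proof (rule strip_model_gauss)
  note s = strip_bounds[OF e] and S = strip_count_bounds[OF e]
  have c: "\<bar>real k * strip \<epsilon>\<bar> \<le> real (rad q) + 1" if "k \<le> strip_count \<epsilon>" for k
    using centre_le[OF e, of "int k"] that by simp
  have \<gamma>: "0 < \<gamma>" using kappa by linarith
  show "0 < strip \<epsilon>" "0 < \<kappa>" "\<kappa> \<le> 1" "0 < strip_count \<epsilon>" using s S kappa by auto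
  show "0 \<le> target (real k * strip \<epsilon>)" "target (real k * strip \<epsilon>) \<le> 1" if "k \<le> strip_count \<epsilon>" for k
    using target(2,3)[OF c[OF that]] \<gamma> by linarith+
  show "\<bar>(LINT x|std_normal_distribution. tent (strip \<epsilon>) (real k * strip \<epsilon>) x) - strip \<epsilon> * target (real k * strip \<epsilon>)\<bar> \<le> \<kappa> * strip \<epsilon>"
    if "k \<le> strip_count \<epsilon>" for k
  proof -
    have "3 / 4 * of_rat (mass_tol q) * strip \<epsilon> \<le> \<kappa> * strip \<epsilon>"
      using mass_tol(2) mass_tol_pos s(1) by (intro mult_right_mono) linarith+
    then show ?thesis using normal_mass[OF e c[OF that]] by linarith
  qed
  have "1 / (real (strip_count \<epsilon>) * strip \<epsilon>)\<^sup>2 \<le> 1 / (real (rad q))\<^sup>2"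
    using S(1,3) s(1) rad by (intro divide_left_mono power_mono mult_pos_pos zero_less_power) auto
  then show "1 / (real (strip_count \<epsilon>) * strip \<epsilon>)\<^sup>2 \<le> \<omega>" using \<omega> by linarith
qed

end

lemma mass_eq_integral:
  fixes f :: "vect \<Rightarrow> real"
  assumes "0 < N"
  shows "integrable (measure_pmf (uniform_on_dataset N S)) f"
    and "(LINT x|measure_pmf (uniform_on_dataset N S). f x) = mass N S f"
proof -
  have ne: "{..<N} \<noteq> {}" using assms by auto
  have "finite (set_pmf (uniform_on_dataset N S))" using ne by (simp add: uniform_on_dataset_def)
  then show "integrable (measure_pmf (uniform_on_dataset N S)) f" by (rule integrable_measure_pmf_finite)
  show "(LINT x|measure_pmf (uniform_on_dataset N S). f x) = mass N S f"
    using ne by (simp add: uniform_on_dataset_def mass_def integral_pmf_of_set)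
qed

lemma mass_const: "0 < N \<Longrightarrow> mass N S (\<lambda>_. c) = c"
  by (simp add: mass_def)

lemma mass_sum: "mass N S (\<lambda>x. \<Sum>k\<in>I. f k x) = (\<Sum>k\<in>I. mass N S (f k))"
  unfolding mass_def sum_divide_distrib[symmetric] by (subst sum.swap) (rule refl)

lemma mass_add: "mass N S (\<lambda>x. f x + g x) = mass N S f + mass N S g"
  by (simp add: mass_def sum.distrib add_divide_distrib)

lemma prob_eq_mass:
  assumes "0 < N"
  shows "measure (measure_pmf (uniform_on_dataset N S)) A = mass N S (indicator A)"
  using mass_eq_integral(2)[OF assms, of S "indicator A"] by simp

locale accepted_dataset = calibrated +
  fixes d N :: nat and S :: dataset and v :: vect and \<epsilon> :: real
  assumes N: "0 < N" and e: "0 < \<epsilon>" "\<epsilon> < 1" and v: "dot d v v = 1"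
    and passes: "\<And>i. i < 2 * strip_count \<epsilon> + 2 \<Longrightarrow> passes q d N S v \<epsilon> i"
begin

abbreviation "\<eta> \<equiv> strip \<epsilon>"
abbreviation "L \<equiv> strip_count \<epsilon>"

lemma weight_centre: "\<bar>k\<bar> \<le> int L \<Longrightarrow> weight \<eta> L (nat (k + int L)) x = tent \<eta> (of_int k * \<eta>) x"
proof -
  assume "\<bar>k\<bar> \<le> int L"
  then have "nat (k + int L) < 2 * L + 1" "real (nat (k + int L)) - real L = of_int k" by linarith+
  then show ?thesis by (simp add: weight_def)
qed

lemma tent_mass:
  assumes k: "\<bar>k\<bar> \<le> int L"
  shows "\<bar>mass N S (\<lambda>x. tent \<eta> (of_int k * \<eta>) (dot d x v)) - \<eta> * target (of_int k * \<eta>)\<bar> \<le> of_rat (mass_tol q) * \<eta>"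
proof -
  have i: "nat (k + int L) < 2 * L + 1" "real (nat (k + int L)) - real L = of_int k" using k by linarith+
  then have "mass_ok q d N S v \<epsilon> (nat (k + int L))"
    using passes[of "nat (k + int L)"] by (simp add: passes_def strip_count_def strip_def)
  then show ?thesis
    unfolding mass_ok_def Let_def strip_def[symmetric] strip_count_def[symmetric] i(2) weight_centre[OF k] .
qed

lemma directional_moment:
  assumes i: "i < 2 * L + 2" and u: "dot d u u = 1" "dot d u v = 0" and p: "p \<le> 2 * deg q"
  defines "w \<equiv> \<lambda>x. weight \<eta> L i (dot d x v)"
  shows "\<bar>mass N S (\<lambda>x. w x * dot d x u ^ p) - mass N S w * gauss_moment p\<bar> \<le> \<tau> * (\<eta> * \<gamma> / 2)"
proof -
  have "(mass N S (\<lambda>x. w x * dot d x u ^ p) - mass N S w * gauss_moment p)\<^sup>2 \<le> of_rat (defect_tol q) * \<eta>\<^sup>2"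
    using directional_defect_le[OF v u p, of N S w] passes[OF i]
    by (simp add: passes_def defect_ok_def w_def strip_def strip_count_def Let_def)
  then have "\<bar>mass N S (\<lambda>x. w x * dot d x u ^ p) - mass N S w * gauss_moment p\<bar> \<le> sqrt (of_rat (defect_tol q) * \<eta>\<^sup>2)"
    using real_le_rsqrt by fastforce
  also have "\<dots> = sqrt (of_rat (defect_tol q)) * \<eta>"
    using strip_bounds(1)[OF e] by (simp add: real_sqrt_mult)
  also have "\<dots> \<le> \<tau> * (\<gamma> / 2) * \<eta>"
    using strip_bounds(1)[OF e] defect_tol by (intro mult_right_mono) auto
  finally show ?thesis by (simp add: algebra_simps)
qed

text \<open>The first term is Chebyshev's bound for a normal variable beyond
  \<open>rad q - 1\<close>, a distance that the inner centres reach. In the second, each of at most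
  \<open>2 * L\<close> strips contributes an error of \<open>2 * \<kappa> * \<eta>\<close>, and
  \<open>L * \<eta>\<close> is at most \<open>rad q + 1\<close>.\<close>

definition tail_mass :: real where
  "tail_mass = 1 / (real (rad q) - 1)\<^sup>2 + 4 * \<kappa> * (real (rad q) + 1)"

text \<open>A point beyond the last centre is missed by all tents but the outermost ones, and the masses of the
  others nearly add up to one because they are close to the Gaussian masses.\<close>

lemma tail:
  assumes \<sigma>: "\<sigma> = 1 \<or> \<sigma> = -1"
  shows "measure (measure_pmf (uniform_on_dataset N S)) {x. real L * \<eta> < \<sigma> * dot d x v} \<le> tail_mass"
proof -
  note s = strip_bounds[OF e] and SB = strip_count_bounds[OF e]
  \<comment> \<open>The two outermost tents are left out, since their supports reach beyond the last
    centre.\<close>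
  define I where "I = {- (int L - 1) .. int L - 1}"
  define T where "T k = (LINT x|std_normal_distribution. tent \<eta> (of_int k * \<eta>) x)" for k
  define m where "m k = mass N S (\<lambda>x. tent \<eta> (of_int k * \<eta>) (dot d x v))" for k
  have I: "\<bar>k\<bar> \<le> int L" "\<bar>k\<bar> \<le> int L - 1" if "k \<in> I" for k using that by (auto simp: I_def)
  have c: "T k - 2 * \<kappa> * \<eta> \<le> m k" if "k \<in> I" for k
  proof -
    have "3 / 4 * of_rat (mass_tol q) * \<eta> \<le> \<kappa> * \<eta>" "of_rat (mass_tol q) * \<eta> \<le> \<kappa> * \<eta>"
      using mass_tol(2) mass_tol_pos s(1) by (intro mult_right_mono; linarith)+
    then show ?thesis
      using normal_mass[OF e centre_le[OF e I(1)[OF that]]] tent_mass[OF I(1)[OF that]]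
      unfolding T_def m_def by linarith
  qed
  have card: "real (card I) * \<eta> \<le> 2 * (real (rad q) + 1)"
  proof -
    have "real (card I) \<le> 2 * real L" using SB(3) by (simp add: I_def)
    then have "real (card I) * \<eta> \<le> 2 * real L * \<eta>" using s(1) by (intro mult_right_mono) auto
    then have "real (card I) * \<eta> \<le> 2 * (real L * \<eta>)" by (simp only: mult.assoc)
    also have "\<dots> \<le> 2 * (real (rad q) + 1)" by (rule mult_left_mono[OF SB(2)]) simp
    finally show ?thesis .
  qed
  define R where "R = real (rad q) - 1"
  have R: "0 < R" using rad by (simp add: R_def)
  have i: "integrable std_normal_distribution (tent \<eta> t)" for t
    using s(1) by (intro integrable_normal_bounded borel_measurable_tent measurable_ident_sets) (auto simp: tent_nonneg tent_le_1)
  have "1 - 1 / R\<^sup>2 \<le> 1 - measure std_normal_distribution {x. R < \<bar>x\<bar>}" using normal_tail[OF R] by simp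
  also have "\<dots> = (LINT x|std_normal_distribution. 1 - indicator {x. R < \<bar>x\<bar>} x)"
  proof -
    have "{x. R < \<bar>x\<bar>} \<in> sets std_normal_distribution" by simp
    then show ?thesis using std_normal.prob_space
      by (subst Bochner_Integration.integral_diff) (auto simp: std_normal.emeasure_eq_measure)
  qed
  also have "\<dots> \<le> (LINT x|std_normal_distribution. (\<Sum>k\<in>I. tent \<eta> (of_int k * \<eta>) x))"
  proof (rule integral_mono)
    show "1 - indicator {x. R < \<bar>x\<bar>} x \<le> (\<Sum>k\<in>I. tent \<eta> (of_int k * \<eta>) x)" for x
    proof (cases "R < \<bar>x\<bar>")
      case True
      then show ?thesis using sum_nonneg[of I "\<lambda>k. tent \<eta> (of_int k * \<eta>) x"] tent_nonneg by simp
    next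
      case False
      have "R \<le> (real L - 1) * \<eta>" using SB(1) s(2) e by (simp add: R_def left_diff_distrib)
      then have "\<bar>x\<bar> \<le> (real L - 1) * \<eta>" using False by linarith
      then have x: "of_int (- (int L - 1)) * \<eta> \<le> x" "x \<le> of_int (int L - 1) * \<eta>" by (auto simp: abs_le_iff algebra_simps)
      show ?thesis using False sum_tents_eq_1[OF s(1) x] by (simp add: I_def)
    qed
    show "integrable std_normal_distribution (\<lambda>x. \<Sum>k\<in>I. tent \<eta> (of_int k * \<eta>) x)"
      by (intro Bochner_Integration.integrable_sum i)
    show "integrable std_normal_distribution (\<lambda>x. 1 - indicator {x. R < \<bar>x\<bar>} x :: real)"
      by (intro integrable_normal_bounded) (auto simp: indicator_def)
  qed
  also have "\<dots> = (\<Sum>k\<in>I. T k)" unfolding T_def by (intro Bochner_Integration.integral_sum i)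
  also have "\<dots> \<le> (\<Sum>k\<in>I. m k + 2 * \<kappa> * \<eta>)" using c by (intro sum_mono) (simp add: algebra_simps)
  also have "\<dots> = (\<Sum>k\<in>I. m k) + 2 * \<kappa> * (real (card I) * \<eta>)" by (simp add: sum.distrib)
  also have "\<dots> \<le> (\<Sum>k\<in>I. m k) + 2 * \<kappa> * (2 * (real (rad q) + 1))"
    using card kappa by (intro add_left_mono mult_left_mono) auto
  finally have 1: "1 - tail_mass \<le> (\<Sum>k\<in>I. m k)" by (simp add: tail_mass_def R_def algebra_simps)
  have "mass N S (\<lambda>x. indicator {x. real L * \<eta> < \<sigma> * dot d x v} x + (\<Sum>k\<in>I. tent \<eta> (of_int k * \<eta>) (dot d x v)))
    \<le> mass N S (\<lambda>_. 1)"
  proof (rule mass_mono)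
    fix x
    show "indicator {x. real L * \<eta> < \<sigma> * dot d x v} x + (\<Sum>k\<in>I. tent \<eta> (of_int k * \<eta>) (dot d x v)) \<le> 1"
    proof (cases "real L * \<eta> < \<sigma> * dot d x v")
      case True
      have "tent \<eta> (of_int k * \<eta>) (dot d x v) = 0" if "k \<in> I" for k
      proof (rule tent_eq_0[OF s(1)])
        have "\<bar>of_int k\<bar> \<le> real L - 1" using I(2)[OF that] by linarith
        then have "\<bar>of_int k\<bar> * \<eta> \<le> (real L - 1) * \<eta>" using s(1) by (intro mult_right_mono) auto
        moreover have "\<sigma> * dot d x v \<le> \<bar>dot d x v\<bar>" using \<sigma> by auto
        moreover have "\<bar>of_int k * \<eta>\<bar> = \<bar>of_int k\<bar> * \<eta>" using s(1) by (simp add: abs_mult)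
        ultimately have "\<eta> \<le> \<bar>dot d x v\<bar> - \<bar>of_int k * \<eta>\<bar>" using True by (simp add: left_diff_distrib)
        also have "\<dots> \<le> \<bar>dot d x v - of_int k * \<eta>\<bar>" by (rule abs_triangle_ineq2)
        finally show "\<eta> \<le> \<bar>dot d x v - of_int k * \<eta>\<bar>" .
      qed
      then show ?thesis using True by simp
    next
      case False
      then show ?thesis using sum_tents_le_1[OF s(1), of I "dot d x v"] by (simp add: I_def)
    qed
  qed
  then have "mass N S (indicator {x. real L * \<eta> < \<sigma> * dot d x v}) + (\<Sum>k\<in>I. m k) \<le> 1"
    unfolding mass_add mass_sum m_def mass_const[OF N] .
  then show ?thesis unfolding prob_eq_mass[OF N] using 1 by linarith
qed

text \<open>The case \<open>\<sigma> = -1\<close> is the reflection that handles points on the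
  negative side of v. The tests are symmetric under it: centres are mirrored, the target is even,
  and the sign of odd moments does not matter because the normal ones vanish.\<close>

lemma dataset_model:
  assumes u: "dot d u u = 1" "dot d u v = 0" and \<sigma>: "\<sigma> = 1 \<or> \<sigma> = -1"
  shows "strip_model (measure_pmf (uniform_on_dataset N S)) (\<lambda>x. \<sigma> * dot d x v) (\<lambda>x. \<sigma> * dot d x u) \<eta> L target \<kappa> tail_mass"
proof (rule strip_model_of_moments[where \<gamma> = \<gamma> and h = "deg q" and \<tau> = \<tau>])
  note s = strip_bounds[OF e] and SB = strip_count_bounds[OF e]
  have c: "\<bar>real k * \<eta>\<bar> \<le> real (rad q) + 1" if "k \<le> L" for k
    using centre_le[OF e, of "int k"] that by simp
  \<comment> \<open>The tent at a centre for \<open>- dot d x v\<close> is the tent at the mirrored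
    centre for \<open>dot d x v\<close>.\<close>
  define z where "z k = (if \<sigma> = 1 then int k else - int k)" for k
  have z: "\<bar>z k\<bar> \<le> int L" if "k \<le> L" for k using that by (simp add: z_def)
  have zi: "nat (z k + int L) < 2 * L + 2" if "k \<le> L" for k using z[OF that] by linarith
  have tz: "tent \<eta> (real k * \<eta>) (\<sigma> * y) = tent \<eta> (of_int (z k) * \<eta>) y" for k y
    using \<sigma> tent_neg[of \<eta> "- (real k * \<eta>)" y] by (auto simp: z_def)
  have gz: "target (of_int (z k) * \<eta>) = target (real k * \<eta>)" for k by (simp add: z_def mass_target_def)
  show "prob_space (measure_pmf (uniform_on_dataset N S))" by (rule measure_pmf.prob_space_axioms)
  show "0 < \<eta>" "0 < \<kappa>" "\<kappa> \<le> 1" "\<kappa> \<le> \<gamma> / 2" "1 \<le> deg q" "0 < \<tau>" "\<tau> \<le> 1" using s kappa deg tau by auto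
  show "\<gamma> \<le> target (real k * \<eta>)" "target (real k * \<eta>) \<le> 1" if "k \<le> L" for k
    using target(2,3)[OF c[OF that]] by auto
  show "\<bar>(LINT x|measure_pmf (uniform_on_dataset N S). tent \<eta> (real k * \<eta>) (\<sigma> * dot d x v)) - \<eta> * target (real k * \<eta>)\<bar> \<le> \<kappa> * \<eta>"
    if "k \<le> L" for k
  proof -
    have "of_rat (mass_tol q) * \<eta> \<le> \<kappa> * \<eta>" using mass_tol s(1) by (intro mult_right_mono) auto
    then show ?thesis using tent_mass[OF z[OF that]] unfolding mass_eq_integral(2)[OF N] tz gz by linarith
  qed
  show "\<bar>measure M {..s} - Phi s\<bar> \<le> \<kappa> \<and> \<bar>measure M {..<s} - Phi s\<bar> \<le> \<kappa>"
    if "real_distribution M" "\<And>i. i \<le> 2 * deg q \<Longrightarrow> integrable M (\<lambda>x. x ^ i)"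
      "\<And>i. i \<le> 2 * deg q \<Longrightarrow> \<bar>(LINT x|M. x ^ i) - gauss_moment i\<bar> \<le> \<tau>" for M s
    using that by (rule determ)
  show "\<bar>(LINT x|measure_pmf (uniform_on_dataset N S). tent \<eta> (real k * \<eta>) (\<sigma> * dot d x v) * (\<sigma> * dot d x u) ^ p)
      - (LINT x|measure_pmf (uniform_on_dataset N S). tent \<eta> (real k * \<eta>) (\<sigma> * dot d x v)) * gauss_moment p\<bar> \<le> \<tau> * (\<eta> * \<gamma> / 2)"
    if "k \<le> L" "p \<le> 2 * deg q" for k p
  proof -
    have \<sigma>p: "\<bar>\<sigma> ^ p\<bar> = 1" using \<sigma> by (auto simp: power_abs)
    have \<sigma>g: "\<sigma> ^ p * gauss_moment p = gauss_moment p"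
    proof (cases "odd p")
      case True
      then show ?thesis using integral_std_normal_distribution_moment_odd[OF True] by simp
    next
      case False
      then show ?thesis using \<sigma> by auto
    qed
    define w where "w x = tent \<eta> (of_int (z k) * \<eta>) (dot d x v)" for x
    have "\<bar>mass N S (\<lambda>x. w x * dot d x u ^ p) - mass N S w * gauss_moment p\<bar> \<le> \<tau> * (\<eta> * \<gamma> / 2)"
      using directional_moment[OF zi[OF that(1)] u that(2)] unfolding weight_centre[OF z[OF that(1)]] w_def .
    moreover have "mass N S (\<lambda>x. w x * (\<sigma> * dot d x u) ^ p) = \<sigma> ^ p * mass N S (\<lambda>x. w x * dot d x u ^ p)"
      by (simp add: mass_def sum_distrib_left power_mult_distrib mult_ac)
    then have "mass N S (\<lambda>x. w x * (\<sigma> * dot d x u) ^ p) - mass N S w * gauss_moment p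
      = \<sigma> ^ p * (mass N S (\<lambda>x. w x * dot d x u ^ p) - mass N S w * gauss_moment p)"
      using \<sigma>g by (simp add: algebra_simps)
    ultimately show ?thesis unfolding mass_eq_integral(2)[OF N] tz w_def[symmetric] by (simp add: abs_mult \<sigma>p)
  qed
  \<comment> \<open>Index \<open>2 * L + 1\<close> is the constant weight, so this is the second
    moment over the whole dataset. It is off by at most one from the normal value one, hence at most
    two.\<close>
  have "\<bar>mass N S (\<lambda>x. 1 * dot d x u ^ 2) - mass N S (\<lambda>_. 1) * gauss_moment 2\<bar> \<le> \<tau> * (\<eta> * \<gamma> / 2)"
    using directional_moment[of "2 * L + 1", OF _ u, of 2] deg unfolding weight_def by simp
  moreover have "\<tau> * (\<eta> * \<gamma> / 2) \<le> 1"
  proof -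
    have "\<gamma> \<le> 1" using target(2,3)[of 0] rad by simp
    moreover have "0 \<le> \<gamma>" using kappa by linarith
    ultimately have "\<eta> * \<gamma> \<le> 1" using s(1,2) e by (intro mult_le_one) auto
    then show ?thesis using tau s(1) \<open>0 \<le> \<gamma>\<close> by (intro mult_le_one) auto
  qed
  moreover have "gauss_moment 2 = 1" using gauss_moment_even[of 1] by (simp add: rising_two_def)
  moreover have "(\<sigma> * y)\<^sup>2 = y\<^sup>2" for y using \<sigma> by auto
  ultimately have "\<bar>mass N S (\<lambda>x. (\<sigma> * dot d x u)\<^sup>2) - 1\<bar> \<le> 1"
    by (simp only: mass_const[OF N] mult_1_left mult_1_right)
  then show "(LINT x|measure_pmf (uniform_on_dataset N S). (\<sigma> * dot d x u)\<^sup>2) \<le> 2"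
    unfolding mass_eq_integral(2)[OF N] by linarith
  show "measure (measure_pmf (uniform_on_dataset N S)) {x \<in> space (measure_pmf (uniform_on_dataset N S)). real L * \<eta> < \<sigma> * dot d x v} \<le> tail_mass"
    using tail[OF \<sigma>] by simp
qed (simp_all add: mass_eq_integral(1)[OF N])

text \<open>\<open>c0\<close> is the cosine of the angle and \<open>c\<close> its cotangent, so
  \<open>pi / 2 - arctan c\<close> is the angle itself. With u the normalised part of w orthogonal
  to v, w acts in inner products as s (c v + u), where s is the sine.\<close>

lemma disagreement_model:
  assumes w: "dot d w w = 1" and c0: "c0 = dot d w v" "c0\<^sup>2 < 1"
  defines "c \<equiv> c0 / sqrt (1 - c0\<^sup>2)"
  shows "\<bar>disagreement d N S v w - (pi / 2 - arctan c) / pi\<bar> \<le> 26 * \<eta> + 12 * \<kappa> * (real L * \<eta>) + 4 * tail_mass" (is ?A)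
    and "0 < c \<Longrightarrow> \<bar>disagreement d N S v w - (pi / 2 - arctan c) / pi\<bar> \<le> 106 * \<eta> + 80 * sqrt \<kappa> / c + 8 / (c * (real L * \<eta>))\<^sup>2"
proof -
  define s where "s = sqrt (1 - c0\<^sup>2)"
  have s: "0 < s" "s\<^sup>2 = 1 - c0\<^sup>2" using c0(2) by (simp_all add: s_def)
  have cs: "c * s = c0" using s(1) by (simp add: c_def s_def[symmetric])
  define u where "u j = perp d v w j / s" for j
  have du: "dot d x u = dot d x (perp d v w) / s" for x by (simp add: dot_def u_def sum_divide_distrib)
  have pw: "dot d (perp d v w) (perp d v w) = s\<^sup>2" unfolding s(2) dot_perp_perp[OF v] w c0(1) by (simp add: power2_eq_square)
  have u: "dot d u u = 1" "dot d u v = 0"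
  proof -
    have "dot d u u = dot d (perp d v w) u / s" by (simp add: dot_commute[of d u] du)
    then show "dot d u u = 1" using s(1) by (simp add: du pw power2_eq_square)
    have "dot d u v = dot d v (perp d v w) / s" by (simp add: dot_commute[of d u] du)
    then show "dot d u v = 0" by (simp add: dot_commute[of d v "perp d v w"] dot_perp_self[OF v])
  qed
  have split: "dot d x w = s * (c * dot d x v + dot d x u)" for x
  proof -
    have "s * dot d x u = dot d x w - c0 * dot d x v"
      using s(1) unfolding du by (simp add: dot_commute[of d x "perp d v w"] dot_perp_left c0(1) dot_commute[of d w x] dot_commute[of d v x])
    then have "dot d x w = c * s * dot d x v + s * dot d x u" unfolding cs by simp
    then show ?thesis by (simp add: algebra_simps)
  qed
  have "hsign (dot d x v) \<noteq> hsign (dot d x w) \<longleftrightarrow> x \<in> disagreement_region (\<lambda>x. dot d x v) (\<lambda>x. dot d x u) c" for x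
    using s(1) by (auto simp: hsign_def disagreement_region_def split zero_le_mult_iff)
  then have D: "disagreement d N S v w = measure (measure_pmf (uniform_on_dataset N S))
      (space (measure_pmf (uniform_on_dataset N S)) \<inter> disagreement_region (\<lambda>x. dot d x v) (\<lambda>x. dot d x u) c)"
    by (simp add: disagreement_def)
  have "1 / (real (rad q))\<^sup>2 \<le> 1 / (real (rad q) - 1)\<^sup>2"
    using rad by (intro divide_left_mono power_mono mult_pos_pos zero_less_power) auto
  moreover have "0 \<le> 4 * \<kappa> * (real (rad q) + 1)" using kappa by simp
  ultimately have "1 / (real (rad q))\<^sup>2 \<le> tail_mass" unfolding tail_mass_def by linarith
  note G = gauss_pair_model[OF e this]
  have S: "strip_model (measure_pmf (uniform_on_dataset N S)) (\<lambda>x. dot d x v) (\<lambda>x. dot d x u) \<eta> L target \<kappa> tail_mass"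
    "strip_model (measure_pmf (uniform_on_dataset N S)) (\<lambda>x. - dot d x v) (\<lambda>x. - dot d x u) \<eta> L target \<kappa> tail_mass"
    using dataset_model[OF u, of 1] dataset_model[OF u, of "-1"] by simp_all
  show ?A unfolding D by (rule prob_disagreement_region(1)[OF S G])
  show "\<bar>disagreement d N S v w - (pi / 2 - arctan c) / pi\<bar> \<le> 106 * \<eta> + 80 * sqrt \<kappa> / c + 8 / (c * (real L * \<eta>))\<^sup>2" if "0 < c"
    unfolding D by (rule prob_disagreement_region(2)[OF S G that]) (use strip_count_bounds(3)[OF e] in simp)
qed

text \<open>Opposite vectors agree only where \<open>dot d x v = 0\<close>, because both signs are
  then positive. Such points lie at the peak of the central tent, whose mass is at most
  \<open>2 * \<eta>\<close>.\<close>

lemma disagreement_opposite: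
  assumes "\<And>x. dot d x w = - dot d x v"
  shows "1 - \<epsilon> \<le> disagreement d N S v w"
proof -
  have "mass N S (\<lambda>_. 1) \<le> mass N S (\<lambda>x. indicator {x. hsign (dot d x v) \<noteq> hsign (dot d x w)} x + tent \<eta> (of_int 0 * \<eta>) (dot d x v))"
    by (intro mass_mono) (auto simp: indicator_def hsign_def assms tent_def)
  then have "1 \<le> disagreement d N S v w + mass N S (\<lambda>x. tent \<eta> (of_int 0 * \<eta>) (dot d x v))"
    unfolding mass_add mass_const[OF N] disagreement_def prob_eq_mass[OF N] .
  moreover have "mass N S (\<lambda>x. tent \<eta> (of_int 0 * \<eta>) (dot d x v)) \<le> \<eta> * target (of_int 0 * \<eta>) + of_rat (mass_tol q) * \<eta>"
    using tent_mass[of 0] by linarith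
  moreover have "\<eta> * target (of_int 0 * \<eta>) \<le> \<eta>"
    using target(3)[of 0] strip_bounds(1)[OF e] by (simp add: mult_left_le)
  moreover have "of_rat (mass_tol q) * \<eta> \<le> 1 * \<eta>"
    using mass_tol(2) kappa(2) strip_bounds(1)[OF e] by (intro mult_right_mono) linarith+
  ultimately show ?thesis using strip_bounds(2)[OF e] e by linarith
qed

end

text \<open>The derivative of arctan is at least one half on the unit interval. This makes the
  tangent of an angle up to a quarter of pi at most twice the angle.\<close>

lemma arctan_ge_half: "0 \<le> x \<Longrightarrow> x \<le> 1 \<Longrightarrow> x / 2 \<le> arctan x"
proof -
  assume x: "0 \<le> x" "x \<le> 1"
  have "arctan 0 - 0 / 2 \<le> arctan x - x / 2"
  proof (rule DERIV_nonneg_imp_nondecreasing[OF x(1)])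
    fix t assume "0 \<le> t" "t \<le> x"
    then have "t\<^sup>2 \<le> 1" using x by (simp add: power_le_one)
    then have "0 \<le> inverse (1 + t\<^sup>2) - 1 / 2" by (simp add: field_simps add_pos_nonneg)
    moreover have "((\<lambda>t. arctan t - t / 2) has_real_derivative (inverse (1 + t\<^sup>2) - 1 / 2)) (at t)"
      by (intro DERIV_diff DERIV_arctan DERIV_cdivide DERIV_ident)
    ultimately show "\<exists>y. ((\<lambda>t. arctan t - t / 2) has_real_derivative y) (at t) \<and> 0 \<le> y" by blast
  qed
  then show ?thesis by simp
qed

text \<open>For an angle of at most a quarter of pi the steep estimate applies and every error
  carries a factor 1 / c, the tangent, at most twice the angle. For larger angles a constant
  additive error is already a multiple of the angle. Parallel and opposite vectors have no
  orthogonal direction u and are treated apart.\<close>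

lemma (in accepted_dataset) disagreement_bound:
  assumes w: "dot d w w = 1" and \<mu>: "0 < \<mu>" "\<mu> < 1"
    and par: "160 * sqrt \<kappa> + 16 / (real (rad q))\<^sup>2 \<le> \<mu> / 4" "12 * \<kappa> * (real (rad q) + 1) + 4 * tail_mass \<le> \<mu> / 4"
  shows "\<bar>disagreement d N S v w - arccos (dot d w v) / pi\<bar> \<le> \<mu> * (arccos (dot d w v) / pi) + 110 * \<epsilon>"
proof -
  note s = strip_bounds[OF e] and SB = strip_count_bounds[OF e]
  define c0 where "c0 = dot d w v"
  have perp_sq: "dot d (perp d v w) (perp d v w) = 1 - c0\<^sup>2"
    using w by (simp add: dot_perp_perp[OF v] c0_def power2_eq_square)
  then have "c0\<^sup>2 \<le> 1" using dot_self_nonneg[of d "perp d v w"] by linarith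
  then have c01: "\<bar>c0\<bar> \<le> 1" by (simp add: abs_square_le_1)
  show ?thesis
  proof (cases "c0\<^sup>2 < 1")
    case True
    define c where "c = c0 / sqrt (1 - c0\<^sup>2)"
    define \<theta> where "\<theta> = pi / 2 - arctan c"
    have "\<bar>c0\<bar> < 1" using True by (simp add: abs_square_less_1)
    then have \<theta>: "arccos c0 = \<theta>"
      using arcsin_arctan[of c0] arccos_arcsin_eq[of c0] by (simp add: \<theta>_def c_def)
    have \<theta>0: "0 < \<theta>" using arctan_ubound[of c] by (simp add: \<theta>_def)
    have main: "\<bar>disagreement d N S v w - \<theta> / pi\<bar> \<le> \<mu> * (\<theta> / pi) + 110 * \<epsilon>"
    proof (cases "1 \<le> c")
      case True
      have "arctan (1 / c) = \<theta>" using arctan_inverse[of c] True by (simp add: \<theta>_def inverse_eq_divide)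
      then have c\<theta>: "1 / c \<le> 2 * \<theta>" using arctan_ge_half[of "1 / c"] True by simp
      \<comment> \<open>For \<open>c\<close> at least one, \<open>c \<le> c\<^sup>2\<close> weakens
        the quadratic decay of the tail to \<open>1 / c\<close>, the common form of both
        errors.\<close>
      have "(real (rad q))\<^sup>2 * c \<le> (c * (real L * \<eta>))\<^sup>2"
      proof -
        have "(real (rad q))\<^sup>2 \<le> (real L * \<eta>)\<^sup>2" using SB(1) by (intro power_mono) auto
        moreover have "c \<le> c\<^sup>2" using True by (simp add: power2_eq_square)
        ultimately have "(real (rad q))\<^sup>2 * c \<le> (real L * \<eta>)\<^sup>2 * c\<^sup>2" using True by (intro mult_mono) auto
        then show ?thesis by (simp add: power_mult_distrib mult.commute)
      qed
      then have "8 / (c * (real L * \<eta>))\<^sup>2 \<le> 8 / ((real (rad q))\<^sup>2 * c)"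
        using True rad s(1) SB(3) by (intro divide_left_mono mult_pos_pos zero_less_power) auto
      then have "80 * sqrt \<kappa> / c + 8 / (c * (real L * \<eta>))\<^sup>2 \<le> (80 * sqrt \<kappa> + 8 / (real (rad q))\<^sup>2) * (1 / c)"
        by (simp add: add_divide_distrib)
      also have "\<dots> \<le> (80 * sqrt \<kappa> + 8 / (real (rad q))\<^sup>2) * (2 * \<theta>)"
        using c\<theta> kappa by (intro mult_left_mono) auto
      also have "\<dots> = (160 * sqrt \<kappa> + 16 / (real (rad q))\<^sup>2) * \<theta>" by (simp add: algebra_simps)
      also have "\<dots> \<le> \<mu> / 4 * \<theta>" using par \<theta>0 by (intro mult_right_mono) auto
      also have "\<dots> = \<mu> * (\<theta> / 4)" by simp
      also have "\<dots> \<le> \<mu> * (\<theta> / pi)" using \<theta>0 \<mu> pi_less_4 by (intro mult_left_mono divide_left_mono) auto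
      finally show ?thesis
        using disagreement_model(2)[OF w c0_def \<open>c0\<^sup>2 < 1\<close>] True s(2) e unfolding c_def[symmetric] \<theta>_def[symmetric] by linarith
    next
      case False
      have "arctan c < arctan 1" using False by (subst arctan_less_iff) simp
      \<comment> \<open>The angle is at least a quarter of pi here, so the budget
        \<open>\<mu> / 4\<close> is at most \<open>\<mu>\<close> times the angle over pi.\<close>
      then have "pi / 4 \<le> \<theta>" by (simp add: \<theta>_def arctan_one)
      then have "1 / 4 \<le> \<theta> / pi" by (simp add: field_simps)
      then have "\<mu> * (1 / 4) \<le> \<mu> * (\<theta> / pi)" using \<mu> by (intro mult_left_mono) auto
      moreover have "12 * \<kappa> * (real L * \<eta>) \<le> 12 * \<kappa> * (real (rad q) + 1)"
        using SB(2) kappa by (intro mult_left_mono) auto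
      ultimately show ?thesis
        using disagreement_model(1)[OF w c0_def \<open>c0\<^sup>2 < 1\<close>] par(2) s(2) e unfolding c_def[symmetric] \<theta>_def[symmetric] by linarith
    qed
    then show ?thesis by (simp only: c0_def[symmetric] \<theta>)
  next
    case False
    then have one: "c0\<^sup>2 = 1" using \<open>c0\<^sup>2 \<le> 1\<close> by simp
    have p0: "perp d v w j = 0" if "j < d" for j
    proof -
      have "(\<Sum>j<d. (perp d v w j)\<^sup>2) = 0" using perp_sq one by (simp add: dot_def power2_eq_square)
      then show ?thesis using that by (simp add: sum_nonneg_eq_0_iff)
    qed
    have wv: "dot d x w = c0 * dot d x v" for x
    proof -
      have "w j = c0 * v j" if "j < d" for j using p0[OF that] that by (simp add: perp_def c0_def)
      then have "dot d x w = (\<Sum>j<d. x j * (c0 * v j))" unfolding dot_def by (intro sum.cong refl) simp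
      then show ?thesis by (simp add: dot_def sum_distrib_left mult_ac)
    qed
    from one have "c0 = 1 \<or> c0 = -1" by (simp add: power2_eq_1_iff)
    then show ?thesis
    proof
      assume c: "c0 = 1"
      have "disagreement d N S v w = 0" unfolding disagreement_def by (simp add: wv c)
      then show ?thesis using c e by (simp add: c0_def[symmetric])
    next
      assume c: "c0 = -1"
      have "disagreement d N S v w \<le> 1" unfolding disagreement_def by simp
      moreover have "1 - \<epsilon> \<le> disagreement d N S v w" by (rule disagreement_opposite) (simp add: wv c)
      ultimately have "\<bar>disagreement d N S v w - 1\<bar> \<le> \<mu> + 110 * \<epsilon>" using e \<mu> by linarith
      then show ?thesis using c by (simp add: c0_def[symmetric])
    qed
  qed
qed

section \<open>Completeness\<close>

text \<open>Stable under sums, products, powers and rounding up, so that the required sample size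
  can be assembled from its parts without computing an exponent.\<close>

definition poly_bounded :: "(nat \<Rightarrow> real \<Rightarrow> real \<Rightarrow> real) \<Rightarrow> bool" where
  "poly_bounded f \<longleftrightarrow> (\<exists>c e. \<forall>d \<epsilon> \<delta>. 0 < d \<longrightarrow> 0 < \<epsilon> \<longrightarrow> \<epsilon> < 1 \<longrightarrow> 0 < \<delta> \<longrightarrow> \<delta> < 1 \<longrightarrow>
     0 \<le> f d \<epsilon> \<delta> \<and> f d \<epsilon> \<delta> \<le> c * (real d / (\<epsilon> * \<delta>)) ^ e)"

lemma poly_boundedD:
  assumes "poly_bounded f"
  obtains c e where "\<And>d \<epsilon> \<delta>. 0 < d \<Longrightarrow> 0 < \<epsilon> \<Longrightarrow> \<epsilon> < 1 \<Longrightarrow> 0 < \<delta> \<Longrightarrow> \<delta> < 1 \<Longrightarrow>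
     0 \<le> f d \<epsilon> \<delta> \<and> f d \<epsilon> \<delta> \<le> c * (real d / (\<epsilon> * \<delta>)) ^ e"
  using assms unfolding poly_bounded_def by metis

lemma size_ratio_bounds:
  assumes "0 < d" "0 < \<epsilon>" "\<epsilon> < 1" "0 < \<delta>" "\<delta> < 1"
  shows "1 \<le> real d / (\<epsilon> * \<delta>)" "real d \<le> real d / (\<epsilon> * \<delta>)" "1 / \<epsilon> \<le> real d / (\<epsilon> * \<delta>)" "1 / \<delta> \<le> real d / (\<epsilon> * \<delta>)"
proof -
  have ed: "\<epsilon> * \<delta> \<le> 1" "0 < \<epsilon> * \<delta>" "\<epsilon> * \<delta> \<le> \<epsilon>" "\<epsilon> * \<delta> \<le> \<delta>"
    using assms by (auto intro: mult_le_one mult_left_le mult_left_le_one_le)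
  have d: "1 \<le> real d" using assms by simp
  show "1 / \<epsilon> \<le> real d / (\<epsilon> * \<delta>)" "1 / \<delta> \<le> real d / (\<epsilon> * \<delta>)" using ed assms d by (auto intro!: frac_le)
  show "1 \<le> real d / (\<epsilon> * \<delta>)" using frac_le[of "real d" 1 "\<epsilon> * \<delta>" 1] ed d by simp
  show "real d \<le> real d / (\<epsilon> * \<delta>)" using frac_le[of "real d" "real d" "\<epsilon> * \<delta>" 1] ed d by simp
qed

lemma poly_bounded_mono:
  assumes "poly_bounded g"
    and "\<And>d \<epsilon> \<delta>. 0 < d \<Longrightarrow> 0 < \<epsilon> \<Longrightarrow> \<epsilon> < 1 \<Longrightarrow> 0 < \<delta> \<Longrightarrow> \<delta> < 1 \<Longrightarrow> 0 \<le> f d \<epsilon> \<delta> \<and> f d \<epsilon> \<delta> \<le> g d \<epsilon> \<delta>"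
  shows "poly_bounded f"
proof -
  obtain c e where c: "\<And>d \<epsilon> \<delta>. 0 < d \<Longrightarrow> 0 < \<epsilon> \<Longrightarrow> \<epsilon> < 1 \<Longrightarrow> 0 < \<delta> \<Longrightarrow> \<delta> < 1 \<Longrightarrow>
     0 \<le> g d \<epsilon> \<delta> \<and> g d \<epsilon> \<delta> \<le> c * (real d / (\<epsilon> * \<delta>)) ^ e"
    using poly_boundedD[OF assms(1)] by blast
  show ?thesis unfolding poly_bounded_def
  proof (intro exI allI impI)
    fix d :: nat and \<epsilon> \<delta> :: real
    assume h: "0 < d" "0 < \<epsilon>" "\<epsilon> < 1" "0 < \<delta>" "\<delta> < 1"
    show "0 \<le> f d \<epsilon> \<delta> \<and> f d \<epsilon> \<delta> \<le> c * (real d / (\<epsilon> * \<delta>)) ^ e" using c[OF h] assms(2)[OF h] by linarith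
  qed
qed

lemma poly_bounded_ratio: "poly_bounded (\<lambda>d \<epsilon> \<delta>. real d / (\<epsilon> * \<delta>))"
  unfolding poly_bounded_def by (rule exI[of _ 1], rule exI[of _ 1]) auto

lemma poly_bounded_dim: "poly_bounded (\<lambda>d \<epsilon> \<delta>. real d)"
  by (rule poly_bounded_mono[OF poly_bounded_ratio]) (auto intro: size_ratio_bounds)

lemma poly_bounded_inverse1: "poly_bounded (\<lambda>d \<epsilon> \<delta>. 1 / \<epsilon>)"
  by (rule poly_bounded_mono[OF poly_bounded_ratio]) (auto intro: size_ratio_bounds)

lemma poly_bounded_inverse2: "poly_bounded (\<lambda>d \<epsilon> \<delta>. 1 / \<delta>)"
  by (rule poly_bounded_mono[OF poly_bounded_ratio]) (auto intro: size_ratio_bounds)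

lemma poly_bounded_const: "0 \<le> a \<Longrightarrow> poly_bounded (\<lambda>_ _ _. a)"
  unfolding poly_bounded_def by (rule exI[of _ a], rule exI[of _ 0]) auto

lemma poly_bounded_add:
  assumes "poly_bounded f" "poly_bounded g"
  shows "poly_bounded (\<lambda>d \<epsilon> \<delta>. f d \<epsilon> \<delta> + g d \<epsilon> \<delta>)"
proof -
  obtain c e where c: "\<And>d \<epsilon> \<delta>. 0 < d \<Longrightarrow> 0 < \<epsilon> \<Longrightarrow> \<epsilon> < 1 \<Longrightarrow> 0 < \<delta> \<Longrightarrow> \<delta> < 1 \<Longrightarrow>
     0 \<le> f d \<epsilon> \<delta> \<and> f d \<epsilon> \<delta> \<le> c * (real d / (\<epsilon> * \<delta>)) ^ e"
    using poly_boundedD[OF assms(1)] by blast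
  obtain c' e' where c': "\<And>d \<epsilon> \<delta>. 0 < d \<Longrightarrow> 0 < \<epsilon> \<Longrightarrow> \<epsilon> < 1 \<Longrightarrow> 0 < \<delta> \<Longrightarrow> \<delta> < 1 \<Longrightarrow>
     0 \<le> g d \<epsilon> \<delta> \<and> g d \<epsilon> \<delta> \<le> c' * (real d / (\<epsilon> * \<delta>)) ^ e'"
    using poly_boundedD[OF assms(2)] by blast
  show ?thesis unfolding poly_bounded_def
  proof (intro exI allI impI)
    fix d :: nat and \<epsilon> \<delta> :: real
    assume h: "0 < d" "0 < \<epsilon>" "\<epsilon> < 1" "0 < \<delta>" "\<delta> < 1"
    define X where "X = real d / (\<epsilon> * \<delta>)"
    have X: "1 \<le> X" using size_ratio_bounds(1)[OF h] by (simp add: X_def)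
    have "c * X ^ e \<le> \<bar>c\<bar> * X ^ (e + e')" using X by (intro mult_mono power_increasing) auto
    moreover have "c' * X ^ e' \<le> \<bar>c'\<bar> * X ^ (e + e')" using X by (intro mult_mono power_increasing) auto
    ultimately show "0 \<le> f d \<epsilon> \<delta> + g d \<epsilon> \<delta> \<and> f d \<epsilon> \<delta> + g d \<epsilon> \<delta> \<le> (\<bar>c\<bar> + \<bar>c'\<bar>) * (real d / (\<epsilon> * \<delta>)) ^ (e + e')"
      using c[OF h] c'[OF h] unfolding X_def[symmetric] distrib_right by linarith
  qed
qed

lemma poly_bounded_mult:
  assumes "poly_bounded f" "poly_bounded g"
  shows "poly_bounded (\<lambda>d \<epsilon> \<delta>. f d \<epsilon> \<delta> * g d \<epsilon> \<delta>)"
proof -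
  obtain c e where c: "\<And>d \<epsilon> \<delta>. 0 < d \<Longrightarrow> 0 < \<epsilon> \<Longrightarrow> \<epsilon> < 1 \<Longrightarrow> 0 < \<delta> \<Longrightarrow> \<delta> < 1 \<Longrightarrow>
     0 \<le> f d \<epsilon> \<delta> \<and> f d \<epsilon> \<delta> \<le> c * (real d / (\<epsilon> * \<delta>)) ^ e"
    using poly_boundedD[OF assms(1)] by blast
  obtain c' e' where c': "\<And>d \<epsilon> \<delta>. 0 < d \<Longrightarrow> 0 < \<epsilon> \<Longrightarrow> \<epsilon> < 1 \<Longrightarrow> 0 < \<delta> \<Longrightarrow> \<delta> < 1 \<Longrightarrow>
     0 \<le> g d \<epsilon> \<delta> \<and> g d \<epsilon> \<delta> \<le> c' * (real d / (\<epsilon> * \<delta>)) ^ e'"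
    using poly_boundedD[OF assms(2)] by blast
  show ?thesis unfolding poly_bounded_def
  proof (intro exI allI impI)
    fix d :: nat and \<epsilon> \<delta> :: real
    assume h: "0 < d" "0 < \<epsilon>" "\<epsilon> < 1" "0 < \<delta>" "\<delta> < 1"
    define X where "X = real d / (\<epsilon> * \<delta>)"
    note a = c[OF h, folded X_def] and b = c'[OF h, folded X_def]
    have "f d \<epsilon> \<delta> * g d \<epsilon> \<delta> \<le> c * X ^ e * (c' * X ^ e')" using a b by (intro mult_mono) linarith+
    also have "\<dots> = c * c' * X ^ (e + e')" by (simp add: power_add)
    finally show "0 \<le> f d \<epsilon> \<delta> * g d \<epsilon> \<delta> \<and> f d \<epsilon> \<delta> * g d \<epsilon> \<delta> \<le> (c * c') * (real d / (\<epsilon> * \<delta>)) ^ (e + e')"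
      using a b by (simp add: X_def)
  qed
qed

lemma poly_bounded_power: "poly_bounded f \<Longrightarrow> poly_bounded (\<lambda>d \<epsilon> \<delta>. f d \<epsilon> \<delta> ^ n)"
  by (induction n) (simp_all add: poly_bounded_const poly_bounded_mult)

lemma poly_bounded_ceiling:
  assumes "poly_bounded f"
  shows "poly_bounded (\<lambda>d \<epsilon> \<delta>. real (nat \<lceil>f d \<epsilon> \<delta>\<rceil>))"
proof (rule poly_bounded_mono[OF poly_bounded_add[OF assms poly_bounded_const[of 1]]])
  fix d :: nat and \<epsilon> \<delta> :: real
  assume h: "0 < d" "0 < \<epsilon>" "\<epsilon> < 1" "0 < \<delta>" "\<delta> < 1"
  have "0 \<le> f d \<epsilon> \<delta>" using assms h unfolding poly_bounded_def by blast
  then show "0 \<le> real (nat \<lceil>f d \<epsilon> \<delta>\<rceil>) \<and> real (nat \<lceil>f d \<epsilon> \<delta>\<rceil>) \<le> f d \<epsilon> \<delta> + 1" by (simp add: of_nat_nat)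
qed simp

lemma integral_growth_ge_1: "1 \<le> (LINT x|std_gaussian d. growth d k x)"
proof -
  interpret prob_space "std_gaussian d" by (rule prob_space_std_gaussian)
  have "expectation (\<lambda>_. 1) \<le> expectation (growth d k)"
    by (intro integral_mono integrable_growth growth_ge_1) auto
  then show ?thesis using prob_space by simp
qed

lemma poly_bounded_growth: "poly_bounded (\<lambda>d \<epsilon> \<delta>. LINT x|std_gaussian d. growth d k x)"
proof (rule poly_bounded_mono)
  have "0 \<le> gauss_moment (2 * k)" unfolding power_mult by (intro Bochner_Integration.integral_nonneg) simp
  then show "poly_bounded (\<lambda>d \<epsilon> \<delta>. (real d + 1) ^ k * (1 + real d * gauss_moment (2 * k)))"
    by (intro poly_bounded_mult poly_bounded_power poly_bounded_add poly_bounded_dim poly_bounded_const) auto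
  show "0 \<le> (LINT x|std_gaussian d. growth d k x) \<and>
      (LINT x|std_gaussian d. growth d k x) \<le> (real d + 1) ^ k * (1 + real d * gauss_moment (2 * k))" for d
    using integral_growth_ge_1[of d k] integral_growth_le[of d k] by simp
qed

lemma poly_bounded_large_enough:
  assumes "poly_bounded f"
  obtains C where "1 \<le> C" "\<And>d N \<epsilon> \<delta>. 0 < d \<Longrightarrow> 0 < \<epsilon> \<Longrightarrow> \<epsilon> < 1 \<Longrightarrow> 0 < \<delta> \<Longrightarrow> \<delta> < 1 \<Longrightarrow>
    large_enough C d N \<epsilon> \<delta> \<Longrightarrow> f d \<epsilon> \<delta> \<le> real N"
proof -
  obtain c e where c: "\<And>d \<epsilon> \<delta>. 0 < d \<Longrightarrow> 0 < \<epsilon> \<Longrightarrow> \<epsilon> < 1 \<Longrightarrow> 0 < \<delta> \<Longrightarrow> \<delta> < 1 \<Longrightarrow>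
     0 \<le> f d \<epsilon> \<delta> \<and> f d \<epsilon> \<delta> \<le> c * (real d / (\<epsilon> * \<delta>)) ^ e"
    using poly_boundedD[OF assms] by blast
  \<comment> \<open>\<open>C\<close> is both the factor and the exponent in
    \<open>large_enough\<close>. Of the \<open>Suc e\<close> factors \<open>C * X\<close>, one
    absorbs the coefficient \<open>c\<close> and the others the power of \<open>X\<close>.\<close>
  define C where "C = max c (real (Suc e))"
  have C: "1 \<le> C" "c \<le> C" "real (Suc e) \<le> C" by (auto simp: C_def)
  show thesis
  proof (rule that[OF C(1)])
    fix d N :: nat and \<epsilon> \<delta> :: real
    assume h: "0 < d" "0 < \<epsilon>" "\<epsilon> < 1" "0 < \<delta>" "\<delta> < 1" and l: "large_enough C d N \<epsilon> \<delta>"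
    define X where "X = real d / (\<epsilon> * \<delta>)"
    have X: "1 \<le> X" using size_ratio_bounds(1)[OF h] by (simp add: X_def)
    have CX: "X \<le> C * X" using C(1) X by simp
    then have CX1: "1 \<le> C * X" using X by linarith
    have "f d \<epsilon> \<delta> \<le> c * X ^ e" using c[OF h] by (simp add: X_def)
    also have "\<dots> \<le> (C * X) * (C * X) ^ e"
    proof -
      have "c * X ^ e \<le> C * X ^ e" using C X by (intro mult_right_mono) auto
      also have "\<dots> \<le> (C * X) * (C * X) ^ e" using C X CX by (intro mult_mono power_mono) auto
      finally show ?thesis .
    qed
    also have "\<dots> = (C * X) powr real (Suc e)" using C(1) X by (subst powr_realpow) auto
    also have "\<dots> \<le> (C * X) powr C" using C CX1 by (intro powr_mono) auto
    also have "\<dots> \<le> real N" using l by (simp add: large_enough_def X_def)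
    finally show "f d \<epsilon> \<delta> \<le> real N" .
  qed
qed

section \<open>From small deviations to acceptance\<close>

lemma with_prob_at_least_mono:
  assumes "with_prob_at_least M p P" "\<And>x. P x \<Longrightarrow> Q x" "p' \<le> p"
  shows "with_prob_at_least M p' Q"
proof -
  from assms(1) obtain A where "A \<in> sets M" "\<forall>x\<in>A. P x" "p \<le> measure M A"
    unfolding with_prob_at_least_def by blast
  then show ?thesis unfolding with_prob_at_least_def using assms(2,3) by (intro bexI[of _ A]) auto
qed

lemma integral_strip_fun:
  assumes \<eta>: "0 < \<eta>" and v: "dot d v v = 1" and J: "J \<in> indices d p"
  shows "(LINT x|std_gaussian d. strip_fun d \<eta> L i p J v x)
    = (LINT z|std_normal_distribution. weight \<eta> L i z) * perp_moment d v p J"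
  unfolding strip_fun_def perp_moment_def
proof (rule integral_rotate(2)[OF v])
  show "integrable std_normal_distribution (weight \<eta> L i)"
    using weight_bounds[OF \<eta>] by (intro integrable_normal_bounded measurable_weight) (simp add: abs_le_iff order_trans[of _ 0])
  show "tensor p J \<in> borel_measurable (borel_vect d)" by (rule measurable_tensor[OF J])
  show "integrable (std_gaussian d) (\<lambda>x. tensor p J (perp d v x))" by (rule integrable_tensor_perp[OF v J])
qed

lemma abs_perp_moment_le:
  assumes v: "dot d v v = 1" and J: "J \<in> indices d p" and k: "p \<le> k"
  shows "\<bar>perp_moment d v p J\<bar> \<le> (LINT x|std_gaussian d. growth d k x)"
proof -
  have "\<bar>perp_moment d v p J\<bar> \<le> (LINT x|std_gaussian d. \<bar>tensor p J (perp d v x)\<bar>)"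
    unfolding perp_moment_def by (rule integral_abs_bound)
  also have "\<dots> \<le> (LINT x|std_gaussian d. growth d k x)"
  proof (intro integral_mono integrable_abs integrable_tensor_perp[OF v J] integrable_growth)
    show "\<bar>tensor p J (perp d v x)\<bar> \<le> growth d k x" for x
      using abs_tensor_le[OF J, of "perp d v x"] growth_perp_le[OF v, of p x] growth_mono[OF k, of d x] by linarith
  qed
  finally show ?thesis .
qed

context calibrated
begin

abbreviation "moment_bound d \<equiv> LINT x|std_gaussian d. growth d (Suc (2 * deg q)) x"

text \<open>An upper bound for the number of squares summed in
  \<open>moment_defect_eq\<close>.\<close>

definition tensor_count :: "nat \<Rightarrow> real" where
  "tensor_count d = (2 * real (deg q) + 1) * (real d + 1) ^ (2 * deg q)"

lemma tensor_count_ge: "1 \<le> tensor_count d"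
proof -
  have "1 * 1 \<le> (2 * real (deg q) + 1) * (real d + 1) ^ (2 * deg q)"
    by (intro mult_mono one_le_power) auto
  then show ?thesis by (simp add: tensor_count_def)
qed

text \<open>A tensor defect refers to the empirical mass, so its error is that of the tensor mean
  plus that of the mass times a Gaussian moment; this explains the factor
  \<open>1 + moment_bound d\<close>. Then each defect is at most t \<eta> / T with T =
  \<open>tensor_count d\<close>, and the sum of at most T such squares is below the
  tolerance.\<close>

lemma passes_of_small_deviation:
  assumes e: "0 < \<epsilon>" "\<epsilon> < 1" and N: "0 < N" and v: "dot d v v = 1"
    and t: "0 < t" "t \<le> of_rat (mass_tol q) / 4" "t\<^sup>2 \<le> of_rat (defect_tol q)"
    and dev: "\<And>p J. p \<le> 2 * deg q \<Longrightarrow> J \<in> indices d p \<Longrightarrow>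
      \<bar>mass N S (strip_fun d (strip \<epsilon>) (strip_count \<epsilon>) i p J v) - (LINT x|std_gaussian d. strip_fun d (strip \<epsilon>) (strip_count \<epsilon>) i p J v x)\<bar>
        \<le> t * strip \<epsilon> / (tensor_count d * (1 + moment_bound d))"
    and i: "i < 2 * strip_count \<epsilon> + 2"
  shows "passes q d N S v \<epsilon> i"
proof -
  note s = strip_bounds[OF e]
  define \<eta> where "\<eta> = strip \<epsilon>"
  define L where "L = strip_count \<epsilon>"
  define B where "B = moment_bound d"
  define T where "T = tensor_count d"
  define t' where "t' = t * \<eta> / (T * (1 + B))"
  define P where "P = (LINT z|std_normal_distribution. weight \<eta> L i z)"
  define w where "w x = weight \<eta> L i (dot d x v)" for x
  have W: "\<epsilon> * of_rat (width q) = \<eta>" "half_width (rad q) \<eta> = L"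
    by (simp_all add: \<eta>_def L_def strip_def strip_count_def)
  have \<eta>: "0 < \<eta>" using s by (simp add: \<eta>_def)
  have B: "1 \<le> B" unfolding B_def by (rule integral_growth_ge_1)
  have T: "1 \<le> T" unfolding T_def by (rule tensor_count_ge)
  have TB: "1 \<le> T * (1 + B)" using mult_mono[of 1 T 1 "1 + B"] T B by simp
  have t'0: "0 \<le> t'" using t \<eta> TB by (simp add: t'_def)
  have t'1: "t' \<le> t * \<eta>" using divide_left_mono[of 1 "T * (1 + B)" "t * \<eta>"] t \<eta> TB by (simp add: t'_def)
  have t'2: "t' * (1 + B) = t * \<eta> / T" using B T by (simp add: t'_def)
  have dev': "\<bar>mass N S (\<lambda>x. w x * tensor p J (perp d v x)) - P * perp_moment d v p J\<bar> \<le> t'"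
    if "p \<le> 2 * deg q" "J \<in> indices d p" for p J
    using dev[OF that] unfolding integral_strip_fun[OF s(1) v that(2)]
    by (simp add: t'_def \<eta>_def L_def B_def T_def w_def P_def strip_fun_def[abs_def])
  have massdev: "\<bar>mass N S w - P\<bar> \<le> t'"
  proof -
    \<comment> \<open>The only index sequence of length zero. Its tensor is constantly one, so the
      deviation of degree zero is that of the strip mass.\<close>
    have "(\<lambda>_. undefined) \<in> indices d 0" by simp
    moreover have "perp_moment d v 0 J = 1" for J
      using prob_space.prob_space[OF prob_space_std_gaussian] by (simp add: perp_moment_def tensor_def)
    ultimately show ?thesis using dev'[of 0 "\<lambda>_. undefined"] by (simp add: tensor_def)
  qed
  have "mass_ok q d N S v \<epsilon> i" if i': "i < 2 * L + 1"
  proof -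
    define k where "k = int i - int L"
    have k: "\<bar>k\<bar> \<le> int (strip_count \<epsilon>)" "real i - real L = of_int k" using i' by (auto simp: k_def L_def)
    have "P = (LINT z|std_normal_distribution. tent \<eta> (of_int k * \<eta>) z)"
      using i' by (simp add: P_def weight_def k(2))
    then have "\<bar>P - \<eta> * target (of_int k * \<eta>)\<bar> \<le> 3 / 4 * of_rat (mass_tol q) * \<eta>"
      using normal_mass[OF e centre_le[OF e k(1)]] by (simp add: \<eta>_def)
    moreover have "t * \<eta> \<le> of_rat (mass_tol q) / 4 * \<eta>" using t \<eta> by (intro mult_right_mono) linarith+
    ultimately have "\<bar>mass N S w - \<eta> * target (of_int k * \<eta>)\<bar> \<le> of_rat (mass_tol q) * \<eta>"
      using massdev t'1 unfolding abs_le_iff by linarith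
    then show ?thesis
      unfolding mass_ok_def Let_def W k(2) w_def .
  qed
  moreover have "defect_ok q d N S v \<epsilon> i"
  proof -
    have td: "(tensor_defect d N S v w p J)\<^sup>2 \<le> (t * \<eta> / T)\<^sup>2" if p: "p \<le> 2 * deg q" and J: "J \<in> indices d p" for p J
    proof -
      have pm: "\<bar>perp_moment d v p J\<bar> \<le> B" unfolding B_def by (rule abs_perp_moment_le[OF v J]) (use p in simp)
      have "\<bar>(mass N S w - P) * perp_moment d v p J\<bar> \<le> t' * B"
        unfolding abs_mult using massdev pm t'0 by (intro mult_mono) auto
      moreover have "tensor_defect d N S v w p J = (mass N S (\<lambda>x. w x * tensor p J (perp d v x)) - P * perp_moment d v p J)
          - (mass N S w - P) * perp_moment d v p J"
        by (simp add: tensor_defect_def algebra_simps)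
      ultimately have "\<bar>tensor_defect d N S v w p J\<bar> \<le> t' + t' * B"
        using dev'[OF p J] by linarith
      also have "\<dots> = t * \<eta> / T" using t'2 by (simp add: algebra_simps)
      finally show ?thesis by (metis abs_ge_zero power2_abs power_mono)
    qed
    have "moment_defect (deg q) d N S v w \<le> (\<Sum>p<2 * deg q + 1. \<Sum>J\<in>indices d p. (t * \<eta> / T)\<^sup>2)"
      unfolding moment_defect_eq[OF v] using td by (intro sum_mono) auto
    also have "\<dots> = (\<Sum>p<2 * deg q + 1. real d ^ p * (t * \<eta> / T)\<^sup>2)" by (simp add: card_PiE)
    also have "\<dots> \<le> (\<Sum>p<2 * deg q + 1. (real d + 1) ^ (2 * deg q) * (t * \<eta> / T)\<^sup>2)"
    proof (intro sum_mono mult_right_mono)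
      fix p assume "p \<in> {..<2 * deg q + 1}"
      then have "real d ^ p \<le> (real d + 1) ^ p" "(real d + 1) ^ p \<le> (real d + 1) ^ (2 * deg q)"
        by (auto intro!: power_mono power_increasing)
      then show "real d ^ p \<le> (real d + 1) ^ (2 * deg q)" by linarith
    qed simp
    also have "\<dots> = T * (t * \<eta> / T)\<^sup>2" by (simp add: T_def tensor_count_def)
    also have "\<dots> = (t * \<eta>)\<^sup>2 / T" using T by (simp add: power2_eq_square)
    also have "\<dots> \<le> (t * \<eta>)\<^sup>2" using divide_left_mono[of 1 T "(t * \<eta>)\<^sup>2"] T by simp
    also have "\<dots> \<le> of_rat (defect_tol q) * \<eta>\<^sup>2"
      unfolding power_mult_distrib using t(3) by (intro mult_right_mono) auto
    finally show ?thesis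
      unfolding defect_ok_def Let_def W w_def .
  qed
  ultimately show ?thesis by (simp add: passes_def L_def strip_count_def strip_def)
qed

text \<open>One \<delta> is lost to Markov's inequality for the empirical mean of
  \<open>growth\<close>, the other to the union bound. The net is exponentially large, but its
  logarithm is polynomial, while the exponent in Hoeffding's inequality is linear in N.\<close>

lemma completeness:
  obtains C where "1 \<le> C" "\<And>d N \<epsilon> \<delta>. 0 < d \<Longrightarrow> 0 < N \<Longrightarrow> 0 < \<epsilon> \<Longrightarrow> \<epsilon> < 1 \<Longrightarrow> 0 < \<delta> \<Longrightarrow> \<delta> < 1 \<Longrightarrow> large_enough C d N \<epsilon> \<delta> \<Longrightarrow>
    with_prob_at_least (gaussian_dataset d N) (1 - 2 * \<delta>)
      (\<lambda>S. \<forall>v. unit_vector d v \<longrightarrow> accepts (tester q) d N S v \<epsilon> \<delta> \<mu>)"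
proof -
  define w :: real where "w = of_rat (width q)"
  define k where "k = 2 * deg q"
  define t where "t = min (of_rat (mass_tol q) / 4) (min 1 (of_rat (defect_tol q) :: real))"
  have w: "0 < w" using width_le by (simp add: w_def)
  have dt: "0 < (of_rat (defect_tol q) :: real)" using defect_tol(1) by simp
  have t: "0 < t" "t \<le> of_rat (mass_tol q) / 4" "t \<le> 1" "t \<le> of_rat (defect_tol q)"
    using mass_tol_pos dt unfolding t_def by (auto simp del: of_rat_less_0_iff zero_less_of_rat_iff)
  have "t\<^sup>2 \<le> t * 1" unfolding power2_eq_square using t by (intro mult_left_mono) auto
  then have t2: "t\<^sup>2 \<le> of_rat (defect_tol q)" using t(4) by linarith
  define A where "A d = (real d + 1) ^ k" for d :: nat
  define B where "B d = moment_bound d" for d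
  define T where "T d = tensor_count d" for d
  \<comment> \<open>\<open>1 / \<sigma> d \<epsilon>\<close> is the deviation that
    \<open>passes_of_small_deviation\<close> allows. Sampling error, truncation and net each get a
    third of it; this determines \<open>R\<close> and \<open>m\<close>.\<close>
  define \<sigma> where "\<sigma> d \<epsilon> = T d * (1 + B d) * (1 / (t * w)) * (1 / \<epsilon>)" for d \<epsilon>
  define R where "R d \<epsilon> \<delta> = 6 * A d * B d * (1 / \<delta>) * \<sigma> d \<epsilon>" for d \<epsilon> \<delta>
  define \<Lambda> where "\<Lambda> d \<epsilon> = (1 / w * (1 / \<epsilon>) + 2 * real k) * (real d + 1) ^ Suc k" for d :: nat and \<epsilon>
  define m where "m d \<epsilon> \<delta> = nat \<lceil>6 * \<Lambda> d \<epsilon> * B d * (1 / \<delta>) * \<sigma> d \<epsilon>\<rceil>" for d \<epsilon> \<delta>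
  \<comment> \<open>Bounds the logarithm of the number of events times \<open>2 / \<delta>\<close>,
    by \<open>1 + x \<le> exp x\<close> for the net and \<open>x \<le> exp x\<close> for the other
    factors.\<close>
  define l where "l d \<epsilon> \<delta> = real d * (2 * real (m d \<epsilon> \<delta>)) + (2 * (real (rad q) * (1 / w) * (1 / \<epsilon>) + 1) + 2)
    + (real k + 1) * (real d + 1) ^ k + 2 * (1 / \<delta>)" for d :: nat and \<epsilon> \<delta>
  \<comment> \<open>The number of samples for which the exponent in Hoeffding's inequality reaches
    \<open>l\<close>. \<open>18\<close> is the \<open>2\<close> of that inequality times the square
    of the \<open>3\<close> in \<open>s\<close>.\<close>
  define f where "f d \<epsilon> \<delta> = 18 * (\<sigma> d \<epsilon>)\<^sup>2 * (A d * R d \<epsilon> \<delta> ^ k)\<^sup>2 * l d \<epsilon> \<delta>" for d \<epsilon> \<delta>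
  note pb = poly_bounded_mult poly_bounded_add poly_bounded_power poly_bounded_const poly_bounded_dim
    poly_bounded_inverse1 poly_bounded_inverse2 poly_bounded_growth poly_bounded_ceiling
  have pA: "poly_bounded (\<lambda>d \<epsilon> \<delta>. A d)" unfolding A_def by (intro pb) simp
  have pB: "poly_bounded (\<lambda>d \<epsilon> \<delta>. B d)" unfolding B_def by (rule pb)
  have pT: "poly_bounded (\<lambda>d \<epsilon> \<delta>. T d)" unfolding T_def tensor_count_def by (intro pb) simp_all
  have p\<sigma>: "poly_bounded (\<lambda>d \<epsilon> \<delta>. \<sigma> d \<epsilon>)" unfolding \<sigma>_def by (intro pb pT pB) (use t w in simp_all)
  have pR: "poly_bounded R" unfolding R_def[abs_def] by (intro pb pA pB p\<sigma>) simp
  have p\<Lambda>: "poly_bounded (\<lambda>d \<epsilon> \<delta>. \<Lambda> d \<epsilon>)" unfolding \<Lambda>_def by (intro pb) (use w in simp_all)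
  have pm: "poly_bounded (\<lambda>d \<epsilon> \<delta>. real (m d \<epsilon> \<delta>))" unfolding m_def by (intro pb p\<Lambda> pB p\<sigma>) simp
  have pl: "poly_bounded l" unfolding l_def[abs_def] by (intro pb pm) (use w in simp_all)
  have "poly_bounded f" unfolding f_def[abs_def] by (intro pb p\<sigma> pA pR pl) simp
  then obtain C where C: "1 \<le> C" "\<And>d N \<epsilon> \<delta>. 0 < d \<Longrightarrow> 0 < \<epsilon> \<Longrightarrow> \<epsilon> < 1 \<Longrightarrow> 0 < \<delta> \<Longrightarrow> \<delta> < 1 \<Longrightarrow>
    large_enough C d N \<epsilon> \<delta> \<Longrightarrow> f d \<epsilon> \<delta> \<le> real N"
    using poly_bounded_large_enough by blast
  show thesis
  proof (rule that[OF C(1)])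
    fix d N :: nat and \<epsilon> \<delta> :: real
    assume d: "0 < d" and N: "0 < N" and e: "0 < \<epsilon>" "\<epsilon> < 1" and \<delta>: "0 < \<delta>" "\<delta> < 1" and le: "large_enough C d N \<epsilon> \<delta>"
    have fN: "f d \<epsilon> \<delta> \<le> real N" using C(2)[OF d e \<delta> le] .
    define \<eta> where "\<eta> = strip \<epsilon>"
    define L where "L = strip_count \<epsilon>"
    have \<eta>: "0 < \<eta>" "\<eta> = \<epsilon> * w" using strip_bounds[OF e] by (auto simp: \<eta>_def strip_def w_def)
    have A0: "1 \<le> A d" by (simp add: A_def one_le_power)
    have B0: "1 \<le> B d" unfolding B_def by (rule integral_growth_ge_1)
    have T0: "1 \<le> T d" unfolding T_def by (rule tensor_count_ge)
    have \<sigma>0: "0 < \<sigma> d \<epsilon>" using T0 B0 t w e by (simp add: \<sigma>_def)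
    have \<Lambda>0: "0 < \<Lambda> d \<epsilon>" unfolding \<Lambda>_def by (intro mult_pos_pos add_pos_nonneg zero_less_power) (use w e d in auto)
    have R0: "0 < R d \<epsilon> \<delta>" using A0 B0 \<sigma>0 \<delta> by (simp add: R_def)
    have m': "6 * \<Lambda> d \<epsilon> * B d * (1 / \<delta>) * \<sigma> d \<epsilon> \<le> real (m d \<epsilon> \<delta>)" unfolding m_def by (rule real_nat_ceiling_ge)
    have mpos: "0 < 6 * \<Lambda> d \<epsilon> * B d * (1 / \<delta>) * \<sigma> d \<epsilon>" using \<Lambda>0 B0 \<sigma>0 \<delta> by simp
    have m0: "0 < m d \<epsilon> \<delta>" using m' mpos by (cases "m d \<epsilon> \<delta>") auto
    have lip: "lipschitz_factor d \<eta> k = \<Lambda> d \<epsilon>" using \<eta> by (simp add: lipschitz_factor_def \<Lambda>_def mult.commute)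
    define s where "s = 1 / (3 * \<sigma> d \<epsilon>)"
    have s0: "0 \<le> s" using \<sigma>0 by (simp add: s_def)
    define K where "K = real ((2 * m d \<epsilon> \<delta> + 1) ^ d) * (2 * real L + 2) * ((real k + 1) * (real d + 1) ^ k)"
    define E where "E = real N * s\<^sup>2 / (2 * (A d * R d \<epsilon> \<delta> ^ k)\<^sup>2)"
    have wp: "with_prob_at_least (gaussian_dataset d N) (1 - (\<delta> + K * (2 * exp (- E))))
     (\<lambda>S. \<forall>v. unit_vector d v \<longrightarrow> (\<forall>i<2 * L + 2. \<forall>p\<le>k. \<forall>J\<in>indices d p.
       \<bar>mass N S (strip_fun d \<eta> L i p J v) - (LINT x|std_gaussian d. strip_fun d \<eta> L i p J v x)\<bar>
         \<le> s + 2 * (A d / R d \<epsilon> \<delta> * (B d / \<delta>)) + 2 * (\<Lambda> d \<epsilon> * (1 / real (m d \<epsilon> \<delta>)) * (B d / \<delta>))))"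
      using uniform_deviation[where L = L and k = k, OF \<eta>(1) d N m0 R0 s0 \<delta>]
      unfolding lip[symmetric] K_def E_def A_def B_def k_def .
    have prob: "1 - 2 * \<delta> \<le> 1 - (\<delta> + K * (2 * exp (- E)))"
    proof -
      have L: "real L \<le> real (rad q) * (1 / w) * (1 / \<epsilon>) + 1"
        using half_width_le[OF \<eta>(1), of "rad q"] \<eta> unfolding L_def strip_count_def \<eta>_def by (simp add: \<eta>(2)[unfolded \<eta>_def] mult.commute)
      have S: "0 < (A d * R d \<epsilon> \<delta> ^ k)\<^sup>2" using A0 R0 by simp
      have "l d \<epsilon> \<delta> = f d \<epsilon> \<delta> * s\<^sup>2 / (2 * (A d * R d \<epsilon> \<delta> ^ k)\<^sup>2)"
        using A0 R0 \<sigma>0 by (simp add: f_def s_def power_divide power_mult_distrib)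
      also have "\<dots> \<le> E" unfolding E_def using fN S by (intro divide_right_mono mult_right_mono) auto
      finally have lE: "l d \<epsilon> \<delta> \<le> E" .
      have "K * (2 / \<delta>) \<le> (exp (2 * real (m d \<epsilon> \<delta>)) ^ d * exp (2 * real L + 2) * exp ((real k + 1) * (real d + 1) ^ k)) * exp (2 / \<delta>)"
      proof -
        have "real ((2 * m d \<epsilon> \<delta> + 1) ^ d) \<le> exp (2 * real (m d \<epsilon> \<delta>)) ^ d"
          using exp_ge_add_one_self[of "2 * real (m d \<epsilon> \<delta>)"] by (simp add: add.commute power_mono)
        moreover have "x \<le> exp x" for x :: real using exp_ge_add_one_self[of x] by linarith
        ultimately show ?thesis unfolding K_def using \<delta> by (intro mult_mono) auto
      qed
      also have "\<dots> = exp (real d * (2 * real (m d \<epsilon> \<delta>)) + (2 * real L + 2) + (real k + 1) * (real d + 1) ^ k + 2 / \<delta>)"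
        by (simp add: exp_add exp_of_nat_mult)
      also have "\<dots> \<le> exp E" using lE L unfolding l_def by simp
      finally have "K * (2 / \<delta>) * exp (- E) \<le> exp E * exp (- E)" by (intro mult_right_mono) auto
      then have "K * (2 * exp (- E)) / \<delta> \<le> 1" by (simp add: exp_minus)
      then show ?thesis using \<delta> by (simp add: pos_divide_le_eq)
    qed
    have acc: "accepts (tester q) d N S v \<epsilon> \<delta> \<mu>"
      if dev: "\<forall>v. unit_vector d v \<longrightarrow> (\<forall>i<2 * L + 2. \<forall>p\<le>k. \<forall>J\<in>indices d p.
       \<bar>mass N S (strip_fun d \<eta> L i p J v) - (LINT x|std_gaussian d. strip_fun d \<eta> L i p J v x)\<bar>
         \<le> s + 2 * (A d / R d \<epsilon> \<delta> * (B d / \<delta>)) + 2 * (\<Lambda> d \<epsilon> * (1 / real (m d \<epsilon> \<delta>)) * (B d / \<delta>)))"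
        and v: "unit_vector d v" for S v
    proof -
      have 1: "2 * (A d / R d \<epsilon> \<delta> * (B d / \<delta>)) = s"
        using A0 B0 \<sigma>0 \<delta> by (simp add: R_def s_def field_simps)
      have "\<Lambda> d \<epsilon> * (1 / real (m d \<epsilon> \<delta>)) * (B d / \<delta>) = (\<Lambda> d \<epsilon> * B d / \<delta>) / real (m d \<epsilon> \<delta>)" by simp
      also have "\<dots> \<le> (\<Lambda> d \<epsilon> * B d / \<delta>) / (6 * \<Lambda> d \<epsilon> * B d * (1 / \<delta>) * \<sigma> d \<epsilon>)"
        using \<Lambda>0 B0 \<sigma>0 \<delta> m' m0 by (intro divide_left_mono mult_pos_pos) auto
      also have "\<dots> = s / 2" using \<Lambda>0 B0 \<delta> \<sigma>0 by (simp add: s_def field_simps)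
      finally have 2: "2 * (\<Lambda> d \<epsilon> * (1 / real (m d \<epsilon> \<delta>)) * (B d / \<delta>)) \<le> s" by linarith
      have 3: "3 * s = t * \<eta> / (T d * (1 + B d))" using \<sigma>0 e w t by (simp add: s_def \<sigma>_def \<eta>(2))
      have "passes q d N S v \<epsilon> i" if i: "i < 2 * strip_count \<epsilon> + 2" for i
      proof (rule passes_of_small_deviation[OF e N _ t(1,2) t2 _ i])
        show "dot d v v = 1" using v by (simp add: unit_vector_dot)
        show "\<bar>mass N S (strip_fun d (strip \<epsilon>) (strip_count \<epsilon>) i p J v) - (LINT x|std_gaussian d. strip_fun d (strip \<epsilon>) (strip_count \<epsilon>) i p J v x)\<bar>
            \<le> t * strip \<epsilon> / (tensor_count d * (1 + moment_bound d))"
          if "p \<le> 2 * deg q" "J \<in> indices d p" for p J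
        proof -
          have "\<bar>mass N S (strip_fun d \<eta> L i p J v) - (LINT x|std_gaussian d. strip_fun d \<eta> L i p J v x)\<bar>
              \<le> s + 2 * (A d / R d \<epsilon> \<delta> * (B d / \<delta>)) + 2 * (\<Lambda> d \<epsilon> * (1 / real (m d \<epsilon> \<delta>)) * (B d / \<delta>))"
            using dev v i that by (simp add: L_def k_def)
          also have "\<dots> \<le> s + s + s" unfolding 1 by (rule add_left_mono[OF 2])
          also have "\<dots> = t * \<eta> / (T d * (1 + B d))" unfolding 3[symmetric] by simp
          finally show ?thesis by (simp only: \<eta>_def L_def T_def B_def)
        qed
      qed
      then show ?thesis unfolding accepts_tester[OF width(1) e(1)] by (simp add: strip_count_def strip_def)
    qed
    show "with_prob_at_least (gaussian_dataset d N) (1 - 2 * \<delta>)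
      (\<lambda>S. \<forall>v. unit_vector d v \<longrightarrow> accepts (tester q) d N S v \<epsilon> \<delta> \<mu>)"
      by (rule with_prob_at_least_mono[OF wp _ prob]) (use acc in blast)
  qed
qed

end

section \<open>Choice of the constants\<close>

lemma rat_between: "x < y \<Longrightarrow> \<exists>r. x < of_rat r \<and> of_rat r < (y :: real)"
  using Rats_dense_in_real[of x y] by (auto simp: Rats_def)

lemma small_rat: "0 < y \<Longrightarrow> \<exists>r > 0. of_rat r \<le> (y :: real)"
  using rat_between[of 0 y] by (auto intro: less_imp_le)

text \<open>The order of choice avoids circularity: the radius from \<mu>, then \<gamma> from the
  radius, \<kappa> from both and \<mu>, the mass tolerance and the target from \<kappa>, degree and
  \<tau> from \<kappa>, and finally the defect tolerance from \<tau> and \<gamma>.\<close>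

lemma calibrated_exists:
  assumes \<mu>: "0 < \<mu>" "\<mu> < 1"
  obtains q \<kappa> \<tau> \<gamma> where "calibrated q \<kappa> \<tau> \<gamma>"
    "160 * sqrt \<kappa> + 16 / (real (rad q))\<^sup>2 \<le> \<mu> / 4"
    "12 * \<kappa> * (real (rad q) + 1) + 4 * (1 / (real (rad q) - 1)\<^sup>2 + 4 * \<kappa> * (real (rad q) + 1)) \<le> \<mu> / 4"
proof -
  \<comment> \<open>Both inverse squares of the radius, with and without the shift by one, must be
    at most \<open>\<mu> / 128\<close>.\<close>
  define r where "r = nat \<lceil>128 / \<mu>\<rceil> + 3"
  have r: "3 \<le> r" "128 / \<mu> \<le> real r - 1"
    using real_nat_ceiling_ge[of "128 / \<mu>"] by (auto simp: r_def)
  define \<gamma> :: real where "\<gamma> = exp (- (real r + 1)\<^sup>2 / 2) / 4"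
  have \<gamma>: "0 < \<gamma>" "\<gamma> \<le> 1"
    unfolding \<gamma>_def by (simp_all add: order_trans[of _ 1])
  \<comment> \<open>\<open>1280\<close> makes \<open>160 * sqrt \<kappa>\<close> at most
    \<open>\<mu> / 8\<close>. \<open>224\<close> is \<open>8 * 28\<close>, where
    \<open>28 = 12 + 4 * 4\<close> is the total coefficient of
    \<open>\<kappa> * (real r + 1)\<close> in the second inequality. The bound
    \<open>\<gamma> / 2\<close> keeps strip masses away from zero.\<close>
  define \<kappa> where "\<kappa> = min (\<gamma> / 2) (min ((\<mu> / 1280)\<^sup>2) (\<mu> / (224 * (real r + 1))))"
  have \<kappa>: "0 < \<kappa>" "\<kappa> \<le> \<gamma> / 2" "\<kappa> \<le> (\<mu> / 1280)\<^sup>2" "\<kappa> \<le> \<mu> / (224 * (real r + 1))"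
  proof -
    show "0 < \<kappa>" using \<mu> \<gamma> by (simp add: \<kappa>_def)
  qed (unfold \<kappa>_def, linarith+)
  have \<kappa>1: "\<kappa> \<le> 1" using \<kappa>(2) \<gamma> by linarith
  obtain k1 where k1: "0 < k1" "of_rat k1 \<le> \<kappa>" using small_rat[OF \<kappa>(1)] by blast
  then have k1': "0 < (of_rat k1 :: real)" "(of_rat k1 :: real) \<le> 1" using \<kappa>1 by (simp, linarith)
  obtain k M where M: "\<And>t. \<bar>t\<bar> \<le> real r + 1 \<Longrightarrow> \<bar>std_normal_density t - mass_target k M t\<bar> \<le> of_rat k1 / 2 \<and>
    \<gamma> \<le> mass_target k M t \<and> mass_target k M t \<le> 1"
    using mass_target_exists[OF k1', of "real r + 1"] unfolding \<gamma>_def by auto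
  obtain h \<tau> where h: "1 \<le> h" "0 < \<tau>" "\<tau> \<le> 1" and
    determ: "\<And>M s. real_distribution M \<Longrightarrow> (\<And>k. k \<le> 2 * h \<Longrightarrow> integrable M (\<lambda>x. x ^ k)) \<Longrightarrow>
    (\<And>k. k \<le> 2 * h \<Longrightarrow> \<bar>(LINT x|M. x ^ k) - gauss_moment k\<bar> \<le> \<tau>) \<Longrightarrow>
    \<bar>measure M {..s} - Phi s\<bar> \<le> \<kappa> \<and> \<bar>measure M {..<s} - Phi s\<bar> \<le> \<kappa>"
    by (rule moments_determine_cdf_bounded[OF \<kappa>(1)]) blast
  have "0 < (\<tau> * (\<gamma> / 2))\<^sup>2" using h \<gamma> by simp
  then obtain k2 where k2: "0 < k2" "of_rat k2 \<le> (\<tau> * (\<gamma> / 2))\<^sup>2" using small_rat by blast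
  define q where "q = \<lparr>deg = h, expo = M, rad = r, coef = k, mass_tol = k1, defect_tol = k2, width = k1 / 4\<rparr>"
  have sq: "sqrt (of_rat k2) \<le> \<tau> * (\<gamma> / 2)" using k2(2) h \<gamma> by (intro real_le_lsqrt) auto
  have "calibrated q \<kappa> \<tau> \<gamma>"
  proof
    show "\<bar>measure M {..s} - Phi s\<bar> \<le> \<kappa> \<and> \<bar>measure M {..<s} - Phi s\<bar> \<le> \<kappa>"
      if "real_distribution M" "\<And>i. i \<le> 2 * deg q \<Longrightarrow> integrable M (\<lambda>x. x ^ i)"
        "\<And>i. i \<le> 2 * deg q \<Longrightarrow> \<bar>(LINT x|M. x ^ i) - gauss_moment i\<bar> \<le> \<tau>" for M s
      using that by (intro determ) (simp_all add: q_def)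
  qed (use \<kappa> \<kappa>1 k1 k2 sq h r M in \<open>simp_all add: q_def of_rat_divide\<close>)
  moreover have "160 * sqrt \<kappa> + 16 / (real (rad q))\<^sup>2 \<le> \<mu> / 4"
    "12 * \<kappa> * (real (rad q) + 1) + 4 * (1 / (real (rad q) - 1)\<^sup>2 + 4 * \<kappa> * (real (rad q) + 1)) \<le> \<mu> / 4"
  proof -
    have sq: "sqrt \<kappa> \<le> \<mu> / 1280" using \<kappa>(3) \<mu> by (intro real_le_lsqrt) auto
    have inv: "1 / x\<^sup>2 \<le> \<mu> / 128" if "128 / \<mu> \<le> x" for x
    proof -
      have "1 \<le> 128 / \<mu>" using \<mu> by simp
      then have "x \<le> x\<^sup>2" using that by (simp add: power2_eq_square)
      then have "128 / \<mu> \<le> x\<^sup>2" using that by linarith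
      then have "1 / x\<^sup>2 \<le> 1 / (128 / \<mu>)" using \<mu> by (intro divide_left_mono mult_pos_pos) (auto intro: order_less_le_trans[of 0 "128 / \<mu>"])
      then show ?thesis by simp
    qed
    show "160 * sqrt \<kappa> + 16 / (real (rad q))\<^sup>2 \<le> \<mu> / 4"
    proof -
      have "1 / (real r)\<^sup>2 \<le> \<mu> / 128" using r(2) by (intro inv) linarith
      then have "16 / (real r)\<^sup>2 \<le> \<mu> / 8" by simp
      then show ?thesis using sq by (simp add: q_def)
    qed
    have "\<kappa> * (real r + 1) \<le> \<mu> / (224 * (real r + 1)) * (real r + 1)" using \<kappa>(4) by (intro mult_right_mono) auto
    also have "\<dots> = \<mu> / 224" by (simp add: divide_simps)
    finally have "\<kappa> * (real r + 1) \<le> \<mu> / 224" .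
    moreover have "28 * y + 4 * z \<le> \<mu> / 4" if "y \<le> \<mu> / 224" "z \<le> \<mu> / 128" for y z
      using that \<mu> by linarith
    ultimately have "28 * (\<kappa> * (real r + 1)) + 4 * (1 / (real r - 1)\<^sup>2) \<le> \<mu> / 4"
      using inv[OF r(2)] by blast
    moreover have "12 * \<kappa> * (real r + 1) + 4 * (1 / (real r - 1)\<^sup>2 + 4 * \<kappa> * (real r + 1))
      = 28 * (\<kappa> * (real r + 1)) + 4 * (1 / (real r - 1)\<^sup>2)" by (simp add: distrib_left)
    moreover have "rad q = r" by (simp add: q_def)
    ultimately show "12 * \<kappa> * (real (rad q) + 1) + 4 * (1 / (real (rad q) - 1)\<^sup>2 + 4 * \<kappa> * (real (rad q) + 1)) \<le> \<mu> / 4"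
      by (simp only:)
  qed
  ultimately show thesis by (rule that)
qed

theorem theoremB1:
  fixes \<mu> :: real
  assumes "0 < \<mu>" and "\<mu> < 1"
  shows "\<exists>(T :: prog) (C :: real) (p :: real poly) (K\<^sub>1 :: real) (K\<^sub>2 :: real).
    C > 0 \<and> K\<^sub>1 > 0 \<and> K\<^sub>2 > 0 \<and>
    (\<forall>(d :: nat) (N :: nat) (\<epsilon> :: real) (\<delta> :: real).
       0 < d \<longrightarrow> 0 < N \<longrightarrow> 0 < \<epsilon> \<longrightarrow> \<epsilon> < 1 \<longrightarrow> 0 < \<delta> \<longrightarrow> \<delta> < 1 \<longrightarrow>
       \<comment> \<open>running time\<close>
       (large_enough C d N \<epsilon> \<delta> \<longrightarrow>
         (\<forall>(S :: dataset) (v :: vect). unit_vector d v \<longrightarrow>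
            halts_within T (poly p (real d * real N / (\<epsilon> * \<delta>))) d N S v \<epsilon> \<delta> \<mu>)) \<and>
       \<comment> \<open>completeness\<close>
       (large_enough C d N \<epsilon> \<delta> \<longrightarrow>
         with_prob_at_least (gaussian_dataset d N) (1 - K\<^sub>1 * \<delta>)
           (\<lambda>S. \<forall>v. unit_vector d v \<longrightarrow> accepts T d N S v \<epsilon> \<delta> \<mu>)) \<and>
       \<comment> \<open>soundness\<close>
       (\<forall>(S :: dataset) (v :: vect). unit_vector d v \<longrightarrow> accepts T d N S v \<epsilon> \<delta> \<mu> \<longrightarrow>
         (\<forall>w :: vect. unit_vector d w \<longrightarrow>
            (1 - \<mu>) * (angle d v w / pi) - K\<^sub>2 * \<epsilon> \<le> disagreement d N S v w \<and>
            disagreement d N S v w \<le> (1 + \<mu>) * (angle d v w / pi) + K\<^sub>2 * \<epsilon>)))"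
proof -
  obtain q \<kappa> \<tau> \<gamma> where cal: "calibrated q \<kappa> \<tau> \<gamma>"
    and par: "160 * sqrt \<kappa> + 16 / (real (rad q))\<^sup>2 \<le> \<mu> / 4"
      "12 * \<kappa> * (real (rad q) + 1) + 4 * (1 / (real (rad q) - 1)\<^sup>2 + 4 * \<kappa> * (real (rad q) + 1)) \<le> \<mu> / 4"
    using calibrated_exists[OF assms] by blast
  interpret calibrated q \<kappa> \<tau> \<gamma> by (rule cal)
  obtain p where p: "\<And>d N S v \<epsilon> \<delta> \<mu>. 0 < d \<Longrightarrow> 0 < N \<Longrightarrow> 0 < \<epsilon> \<Longrightarrow> \<epsilon> < 1 \<Longrightarrow> 0 < \<delta> \<Longrightarrow> \<delta> < 1 \<Longrightarrow>
    halts_within (tester q) (poly p (real d * real N / (\<epsilon> * \<delta>))) d N S v \<epsilon> \<delta> \<mu>"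
    using halts_tester[OF width(1)] by metis
  obtain C where C: "1 \<le> C" "\<And>d N \<epsilon> \<delta>. 0 < d \<Longrightarrow> 0 < N \<Longrightarrow> 0 < \<epsilon> \<Longrightarrow> \<epsilon> < 1 \<Longrightarrow> 0 < \<delta> \<Longrightarrow> \<delta> < 1 \<Longrightarrow> large_enough C d N \<epsilon> \<delta> \<Longrightarrow>
    with_prob_at_least (gaussian_dataset d N) (1 - 2 * \<delta>)
      (\<lambda>S. \<forall>v. unit_vector d v \<longrightarrow> accepts (tester q) d N S v \<epsilon> \<delta> \<mu>)"
    by (rule completeness[of \<mu>]) blast
  have sound: "(1 - \<mu>) * (angle d v w / pi) - 110 * \<epsilon> \<le> disagreement d N S v w \<and>
      disagreement d N S v w \<le> (1 + \<mu>) * (angle d v w / pi) + 110 * \<epsilon>"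
    if h: "0 < N" "0 < \<epsilon>" "\<epsilon> < 1" "unit_vector d v" "unit_vector d w" "accepts (tester q) d N S v \<epsilon> \<delta> \<mu>"
    for d N S v w \<epsilon> \<delta>
  proof -
    interpret accepted_dataset q \<kappa> \<tau> \<gamma> d N S v \<epsilon>
    proof
      show "passes q d N S v \<epsilon> i" if "i < 2 * strip_count \<epsilon> + 2" for i
        using h(6) that unfolding accepts_tester[OF width(1) h(2)] by (simp add: strip_count_def strip_def)
    qed (use h in \<open>simp_all add: unit_vector_dot\<close>)
    have "angle d v w = arccos (dot d w v)"
      using h(4,5) by (simp add: angle_def unit_vector_def dot_commute)
    then have "\<bar>disagreement d N S v w - angle d v w / pi\<bar> \<le> \<mu> * (angle d v w / pi) + 110 * \<epsilon>"
      using disagreement_bound[of w \<mu>] h(5) assms par by (simp only: unit_vector_dot tail_mass_def)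
    then show ?thesis by (simp only: abs_le_iff left_diff_distrib distrib_right) linarith
  qed
  show ?thesis
    by (rule exI[of _ "tester q"], rule exI[of _ C], rule exI[of _ p], rule exI[of _ 2], rule exI[of _ 110])
      (use C p sound in auto)
qed

end
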